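(* Let $d\ge 3$ and let $V:\mathbb Z^d\to\mathbb C$ be a potential with $V\in\ell^p(\mathbb Z^d)$, where $1\le p<\frac65$ if $d=3$ and $1\le p<\frac43$ if $d\ge4$. Then the modified determinant $D$ is analytic in the unit disc $\mathbb D$, is Hölder up to the boundary, and satisfies $$\|D\|_{\mathscr H_\infty(\mathbb D)}\le e^{C_*^2\|V\|_p^2/2}.$$ It has $N\le\infty$ zeros $\{z_j\}_{j=1}^N$ in $\mathbb D$, such that $$0<r_0=\inf|z_j|=|z_1|\le|z_2|\le\dots\le|z_j|\le|z_{j+1}|\le|z_{j+2}|\le\dots,$$ $$\sum_{j=1}^N\Big[(1-|z_j|)+|\operatorname{Im}\lambda_j|+|\operatorname{Re}\varkappa(\lambda_j)|\Big]<\infty,\qquad \lambda_j=\lambda(z_j).$$ Moreover, the function $\psi(z)=\log D(z)$ is analytic in $\{|z|<r_0\}$ and has the Taylor series $$\psi(z)=-\psi_2z^2-\psi_3z^3-\psi_4z^4-\cdots,\qquad |z|<r_0,$$ where, with $a=\frac2d$, $$\psi_2=\frac{a^2}{2}\operatorname{Tr}V^2,\qquad \psi_3=\frac{a^3}{3}\operatorname{Tr}V^3,\qquad \psi_4=\frac{a^4}{4}\operatorname{Tr}\big(V^4+2VH_0VH_0+4V^2H_0^2\big)-\psi_2,\ \dots$$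
   Context: The discrete Laplacian on $\ell^2(\mathbb Z^d)$ is $(\Delta f)(n)=\frac12\sum_{|n-m|=1}f_m$; its spectrum is $[-d,d]$. $V$ acts as multiplication, $(Vf)(n)=V_nf_n$; $H=\Delta+V$ and $H_0=\Delta$. $\|V\|_p$ is the $\ell^p(\mathbb Z^d)$ norm. Let $\Lambda=\mathbb C\setminus[-d,d]$, $\mathbb D=\{|z|<1\}$. The map $\lambda(z)=\frac d2\left(z+\frac1z\right)$ is a conformal mapping of $\mathbb D$ onto $\Lambda$ (with $0\mapsto\infty$). Let $\varkappa(\lambda)=\sqrt{\lambda^2-d^2}$ for $\lambda\in\Lambda$, with the branch $\varkappa=\lambda-\frac{d^2}{2\lambda}+O(\lambda^{-3})$ as $|\lambda|\to\infty$. With $R_0(\lambda)=(\Delta-\lambda)^{-1}$, set $\mathcal D(\lambda)=\det\big[(I+VR_0(\lambda))e^{-VR_0(\lambda)}\big]$ for $\lambda\in\Lambda$ (regularized determinant), and let the modified determinant be $D(z)=\mathcal D(\lambda(z))$ for $z\in\mathbb D$; here $D(0)=1$ and the branch of $\log D$ is fixed by $\log D(0)=0$. Zeros are counted with multiplicity. $\|F\|_{\mathscr H_\infty(\mathbb D)}=\sup_{z\in\mathbb D}|F(z)|$ for $F$ analytic in $\mathbb D$. The constant $C_*$ is $C_*=C_{p,d}+C_d^0\,\Gamma(p,d)$, where $C_{1,d}=1$, $C_{p,d}=p^{\frac{d(p-1)}{2p}}$, $\Gamma(p,d)=(3+2\kappa)^{\frac{d(p-1)}{p}}$; $C_d^0=16$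 if $d=3$, $C_d^0=4$ if $d=4$, $C_d^0=\frac{14\cdot2^{d/4}}{d-4}$ if $d\ge5$; and $\kappa=\frac{6(p-1)}{6-5p}$ if $d=3$, $\kappa=\left(\frac{5p-1}{4-3p}\right)^{\frac{5p-4}{4(p-1)}}$ if $d=4$, $\kappa=\frac{3d(p-1)}{3d-(2d+1)p}$ if $d\ge5$.
   Formalization: The formula for ψ_4 ends in −2ψ_2 instead of the printed −ψ_2; the printed coefficient is false whenever Tr V² ≠ 0 (for example V = vδ_0), and the two formulas agree when Tr V² = 0. *)

theory Defs
  imports "HOL-Complex_Analysis.Complex_Analysis" "HOL-Combinatorics.Permutations"
begin

section \<open>The Hilbert space of square-summable functions\<close>

typedef 'a ell2 = "{f :: 'a \<Rightarrow> complex. (\<lambda>x. (cmod (f x))\<^sup>2) summable_on UNIV}"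
  morphisms coord Abs_ell2
  by (rule exI[of _ "\<lambda>_. 0"]) simp

lemma coord_summable: "(\<lambda>x. (cmod (coord f x))\<^sup>2) summable_on UNIV"
  using coord[of f] by simp

lemma ell2_eqI: "(\<And>x. coord f x = coord g x) \<Longrightarrow> f = g"
  by (metis coord_inject ext)

lemma ell2_criterion:
  assumes "\<And>F. finite F \<Longrightarrow> L2_set (\<lambda>x. cmod (f x)) F \<le> b"
  shows "(\<lambda>x. (cmod (f x))\<^sup>2) summable_on UNIV"
    and "sqrt (\<Sum>\<^sub>\<infinity>x. (cmod (f x))\<^sup>2) \<le> b"
proof -
  have b0: "0 \<le> b" using assms[of "{}"] by simp
  have fin: "(\<Sum>x\<in>F. (cmod (f x))\<^sup>2) \<le> b\<^sup>2" if "finite F" for F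
    using assms[OF that] by (simp add: L2_set_def real_sqrt_le_iff sqrt_le_D)
  show s: "(\<lambda>x. (cmod (f x))\<^sup>2) summable_on UNIV"
    by (rule nonneg_bdd_above_summable_on) (auto intro!: bdd_aboveI[of _ "b\<^sup>2"] fin)
  have "(\<Sum>\<^sub>\<infinity>x. (cmod (f x))\<^sup>2) \<le> b\<^sup>2"
    by (rule infsum_le_finite_sums[OF s]) (use fin in auto)
  then show "sqrt (\<Sum>\<^sub>\<infinity>x. (cmod (f x))\<^sup>2) \<le> b"
    using b0 real_le_lsqrt by blast
qed

lemma L2_set_le_ell2_norm:
  assumes "(\<lambda>x. (cmod (f x))\<^sup>2) summable_on UNIV" "finite F"
  shows "L2_set (\<lambda>x. cmod (f x)) F \<le> sqrt (\<Sum>\<^sub>\<infinity>x. (cmod (f x))\<^sup>2)"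
  unfolding L2_set_def real_sqrt_le_iff
  by (rule finite_sum_le_infsum[OF assms]) auto

lemma ell2_add_bound:
  assumes "(\<lambda>x. (cmod (f x))\<^sup>2) summable_on UNIV" "(\<lambda>x. (cmod (g x))\<^sup>2) summable_on UNIV" "finite F"
  shows "L2_set (\<lambda>x. cmod (f x + g x)) F
    \<le> sqrt (\<Sum>\<^sub>\<infinity>x. (cmod (f x))\<^sup>2) + sqrt (\<Sum>\<^sub>\<infinity>x. (cmod (g x))\<^sup>2)"
proof -
  have "L2_set (\<lambda>x. cmod (f x + g x)) F \<le> L2_set (\<lambda>x. cmod (f x) + cmod (g x)) F"
    by (rule L2_set_mono) (auto intro: norm_triangle_ineq)
  also have "\<dots> \<le> L2_set (\<lambda>x. cmod (f x)) F + L2_set (\<lambda>x. cmod (g x)) F"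
    by (rule L2_set_triangle_ineq)
  finally show ?thesis
    using L2_set_le_ell2_norm[OF assms(1,3)] L2_set_le_ell2_norm[OF assms(2,3)] by linarith
qed

lemma ell2_scale_bound:
  assumes "(\<lambda>x. (cmod (f x))\<^sup>2) summable_on UNIV" "\<And>x. cmod (c x) \<le> b" "finite F"
  shows "L2_set (\<lambda>x. cmod (c x * f x)) F \<le> b * sqrt (\<Sum>\<^sub>\<infinity>x. (cmod (f x))\<^sup>2)"
proof -
  have b0: "0 \<le> b" using assms(2) norm_ge_zero order_trans by blast
  have "L2_set (\<lambda>x. cmod (c x * f x)) F \<le> L2_set (\<lambda>x. b * cmod (f x)) F"
    by (rule L2_set_mono) (auto simp: norm_mult intro!: mult_right_mono assms(2))
  also have "\<dots> = b * L2_set (\<lambda>x. cmod (f x)) F"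
    using b0 by (simp add: L2_set_right_distrib)
  finally show ?thesis
    using mult_left_mono[OF L2_set_le_ell2_norm[OF assms(1,3)] b0] by linarith
qed

instantiation ell2 :: (type) real_normed_vector
begin

definition zero_ell2 :: "'a ell2" where "0 = Abs_ell2 (\<lambda>_. 0)"
definition plus_ell2 :: "'a ell2 \<Rightarrow> 'a ell2 \<Rightarrow> 'a ell2"
  where "f + g = Abs_ell2 (\<lambda>x. coord f x + coord g x)"
definition scaleR_ell2 :: "real \<Rightarrow> 'a ell2 \<Rightarrow> 'a ell2"
  where "c *\<^sub>R f = Abs_ell2 (\<lambda>x. of_real c * coord f x)"
definition uminus_ell2 :: "'a ell2 \<Rightarrow> 'a ell2"
  where "- f = Abs_ell2 (\<lambda>x. - coord f x)"
definition minus_ell2 :: "'a ell2 \<Rightarrow> 'a ell2 \<Rightarrow> 'a ell2"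
  where "f - g = Abs_ell2 (\<lambda>x. coord f x - coord g x)"
definition norm_ell2 :: "'a ell2 \<Rightarrow> real"
  where "norm f = sqrt (\<Sum>\<^sub>\<infinity>x. (cmod (coord f x))\<^sup>2)"
definition dist_ell2 :: "'a ell2 \<Rightarrow> 'a ell2 \<Rightarrow> real"
  where "dist_ell2 f g = norm (f - g)"
definition sgn_ell2 :: "'a ell2 \<Rightarrow> 'a ell2"
  where "sgn_ell2 f = inverse (norm f) *\<^sub>R f"
definition uniformity_ell2 :: "('a ell2 \<times> 'a ell2) filter"
  where "uniformity_ell2 = (INF e\<in>{0 <..}. principal {(f, g). dist f g < e})"
definition open_ell2 :: "'a ell2 set \<Rightarrow> bool"
  where "open_ell2 U \<longleftrightarrow> (\<forall>f\<in>U. eventually (\<lambda>(f', g). f' = f \<longrightarrow> g \<in> U) uniformity)"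

lemma coord_zero: "coord (0::'a ell2) x = 0"
  by (simp add: zero_ell2_def Abs_ell2_inverse)

lemma coord_plus: "coord (f + g :: 'a ell2) x = coord f x + coord g x"
  unfolding plus_ell2_def
  by (subst Abs_ell2_inverse)
     (auto intro!: ell2_criterion(1) ell2_add_bound coord_summable)

lemma coord_scaleR: "coord (c *\<^sub>R f :: 'a ell2) x = of_real c * coord f x"
  unfolding scaleR_ell2_def
  by (subst Abs_ell2_inverse)
     (auto intro!: ell2_criterion(1) ell2_scale_bound[where b = "\<bar>c\<bar>"] coord_summable)

lemma coord_uminus: "coord (- f :: 'a ell2) x = - coord f x"
  unfolding uminus_ell2_def
  by (subst Abs_ell2_inverse) (auto intro!: coord_summable)

lemma coord_minus: "coord (f - g :: 'a ell2) x = coord f x - coord g x"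
proof -
  have "(\<lambda>x. coord f x - coord g x) = coord (f + (- g))"
    by (auto simp: coord_plus coord_uminus)
  then show ?thesis by (simp add: minus_ell2_def coord_inverse coord_plus coord_uminus)
qed

instance
proof
  fix f g h :: "'a ell2" and a b :: real
  show "f + g + h = f + (g + h)" by (rule ell2_eqI) (simp add: coord_plus)
  show "f + g = g + f" by (rule ell2_eqI) (simp add: coord_plus)
  show "0 + f = f" by (rule ell2_eqI) (simp add: coord_plus coord_zero)
  show "- f + f = 0" by (rule ell2_eqI) (simp add: coord_plus coord_uminus coord_zero)
  show "f - g = f + - g" by (rule ell2_eqI) (simp add: coord_plus coord_uminus coord_minus)
  show "a *\<^sub>R (f + g) = a *\<^sub>R f + a *\<^sub>R g"
    by (rule ell2_eqI) (simp add: coord_plus coord_scaleR algebra_simps)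
  show "(a + b) *\<^sub>R f = a *\<^sub>R f + b *\<^sub>R f"
    by (rule ell2_eqI) (simp add: coord_plus coord_scaleR algebra_simps)
  show "a *\<^sub>R b *\<^sub>R f = (a * b) *\<^sub>R f"
    by (rule ell2_eqI) (simp add: coord_scaleR)
  show "1 *\<^sub>R f = f" by (rule ell2_eqI) (simp add: coord_scaleR)
  show "dist f g = norm (f - g)" by (rule dist_ell2_def)
  show "sgn f = inverse (norm f) *\<^sub>R f" by (rule sgn_ell2_def)
  show "(uniformity :: ('a ell2 \<times> 'a ell2) filter) = (INF e\<in>{0 <..}. principal {(f, g). dist f g < e})"
    by (rule uniformity_ell2_def)
  show "open U \<longleftrightarrow> (\<forall>f\<in>U. eventually (\<lambda>(f', g). f' = f \<longrightarrow> g \<in> U) uniformity)"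
    for U :: "'a ell2 set"
    by (rule open_ell2_def)
  show "norm f = 0 \<longleftrightarrow> f = 0"
  proof
    assume "norm f = 0"
    then have "(\<Sum>\<^sub>\<infinity>x. (cmod (coord f x))\<^sup>2) = 0" by (simp add: norm_ell2_def)
    then have "coord f x = 0" for x
      using finite_sum_le_infsum[OF coord_summable[of f], of "{x}"] by simp
    then show "f = 0" by (intro ell2_eqI) (simp add: coord_zero)
  qed (simp add: norm_ell2_def coord_zero)
  show "norm (f + g) \<le> norm f + norm g"
    unfolding norm_ell2_def coord_plus
    by (rule ell2_criterion(2)) (intro ell2_add_bound coord_summable)
  show "norm (a *\<^sub>R f) = \<bar>a\<bar> * norm f"
    unfolding norm_ell2_def coord_scaleR
    by (simp add: norm_mult power_mult_distrib infsum_cmult_right' real_sqrt_mult)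
qed

end

lemma norm_coord_le: "cmod (coord f x) \<le> norm f"
  using L2_set_le_ell2_norm[OF coord_summable[of f], of "{x}"]
  by (simp add: norm_ell2_def)

instance ell2 :: (type) banach
proof
  fix X :: "nat \<Rightarrow> 'a ell2"
  assume X: "Cauchy X"
  have "Cauchy (\<lambda>n. coord (X n) x)" for x
  proof (rule metric_CauchyI)
    fix e :: real assume "0 < e"
    then obtain M where M: "\<And>m n. m \<ge> M \<Longrightarrow> n \<ge> M \<Longrightarrow> dist (X m) (X n) < e"
      using metric_CauchyD[OF X] by blast
    have "dist (coord (X m) x) (coord (X n) x) \<le> dist (X m) (X n)" for m n
      using norm_coord_le[of "X m - X n" x] by (simp add: dist_norm coord_minus)
    then show "\<exists>M. \<forall>m\<ge>M. \<forall>n\<ge>M. dist (coord (X m) x) (coord (X n) x) < e"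
      using M by (meson le_less_trans)
  qed
  then have "\<forall>x. \<exists>l. (\<lambda>n. coord (X n) x) \<longlonglongrightarrow> l"
    using Cauchy_convergent convergent_def by blast
  then obtain l where l: "\<And>x. (\<lambda>n. coord (X n) x) \<longlonglongrightarrow> l x" by metis
  have bound: "L2_set (\<lambda>x. cmod (coord (X m) x - l x)) F \<le> e"
    if M: "\<And>n. n \<ge> m \<Longrightarrow> dist (X m) (X n) \<le> e" and F: "finite F" for m e F
  proof -
    have "(\<lambda>n. L2_set (\<lambda>x. cmod (coord (X m) x - coord (X n) x)) F)
        \<longlonglongrightarrow> L2_set (\<lambda>x. cmod (coord (X m) x - l x)) F"
      unfolding L2_set_def by (intro tendsto_intros l)
    moreover have "\<forall>n\<ge>m. L2_set (\<lambda>x. cmod (coord (X m) x - coord (X n) x)) F \<le> e"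
    proof (intro allI impI)
      fix n assume "n \<ge> m"
      have "L2_set (\<lambda>x. cmod (coord (X m - X n) x)) F \<le> norm (X m - X n)"
        unfolding norm_ell2_def by (rule L2_set_le_ell2_norm[OF coord_summable F])
      then show "L2_set (\<lambda>x. cmod (coord (X m) x - coord (X n) x)) F \<le> e"
        using M[OF \<open>n \<ge> m\<close>] by (simp add: coord_minus dist_norm)
    qed
    ultimately show ?thesis using LIMSEQ_le_const2 by blast
  qed
  obtain M where M: "\<And>m n. m \<ge> M \<Longrightarrow> n \<ge> M \<Longrightarrow> dist (X m) (X n) < 1"
    using metric_CauchyD[OF X, of 1] by auto
  have "(\<lambda>x. (cmod (coord (X M) x - l x))\<^sup>2) summable_on UNIV"
    by (rule ell2_criterion(1)[of _ 1]) (rule bound, use M in \<open>auto intro: less_imp_le\<close>)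
  then have d: "coord (Abs_ell2 (\<lambda>x. coord (X M) x - l x)) x = coord (X M) x - l x" for x
    by (simp add: Abs_ell2_inverse)
  define L where "L = X M - Abs_ell2 (\<lambda>x. coord (X M) x - l x)"
  have L: "coord L x = l x" for x by (simp add: L_def coord_minus d)
  have "X \<longlonglongrightarrow> L"
  proof (rule metric_LIMSEQ_I)
    fix e :: real assume e: "0 < e"
    then obtain K where K: "\<And>m n. m \<ge> K \<Longrightarrow> n \<ge> K \<Longrightarrow> dist (X m) (X n) < e/2"
      using metric_CauchyD[OF X, of "e/2"] by auto
    have "dist (X m) L < e" if "m \<ge> K" for m
    proof -
      have "norm (X m - L) \<le> e/2"
        unfolding norm_ell2_def coord_minus L
        by (rule ell2_criterion(2)) (rule bound, use K that in \<open>auto intro: less_imp_le\<close>)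
      then show ?thesis using e by (simp add: dist_norm)
    qed
    then show "\<exists>no. \<forall>n\<ge>no. dist (X n) L < e" by blast
  qed
  then show "convergent X" by (auto simp: convergent_def)
qed

section \<open>Operators on the sequence space, traces and determinants\<close>

type_synonym 'a ell2_op = "'a ell2 \<Rightarrow>\<^sub>L 'a ell2"

definition delta :: "'a \<Rightarrow> 'a ell2" where
  "delta y = Abs_ell2 (\<lambda>x. if x = y then 1 else 0)"

definition entry :: "'a ell2_op \<Rightarrow> 'a \<Rightarrow> 'a \<Rightarrow> complex" where
  "entry A x y = coord (blinfun_apply A (delta y)) x"

definition op_pow :: "'a ell2_op \<Rightarrow> nat \<Rightarrow> 'a ell2_op" where
  "op_pow A k = (((o\<^sub>L) A) ^^ k) id_blinfun"

definition op_exp :: "'a ell2_op \<Rightarrow> 'a ell2_op" where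
  "op_exp A = (\<Sum>k. (1 / fact k) *\<^sub>R op_pow A k)"

definition op_inverse :: "'a ell2_op \<Rightarrow> 'a ell2_op" where
  "op_inverse A = (THE B. A o\<^sub>L B = id_blinfun \<and> B o\<^sub>L A = id_blinfun)"

definition op_trace :: "'a ell2_op \<Rightarrow> complex" where
  "op_trace A = (\<Sum>\<^sub>\<infinity>x. entry A x x)"

definition principal_minor :: "'a ell2_op \<Rightarrow> 'a set \<Rightarrow> complex" where
  "principal_minor T S = (\<Sum>\<pi> | \<pi> permutes S. of_int (sign \<pi>) * (\<Prod>x\<in>S. entry T x (\<pi> x)))"

text \<open>The Fredholm determinant of \<open>I + T\<close> with \<open>T\<close> of trace class is the sum over \<open>k\<close> of the
  traces of the exterior powers \<open>\<Lambda>\<^sup>k T\<close>.  Computed in the orthonormal basis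
  \<open>\<delta>\<^sub>x\<^sub>1 \<and> \<dots> \<and> \<delta>\<^sub>x\<^sub>k\<close>, the trace of \<open>\<Lambda>\<^sup>k T\<close> is the sum of the principal minors of \<open>T\<close> over the
  index sets with \<open>k\<close> elements, which gives Fredholm's series.  It converges absolutely.\<close>

definition fredholm_det :: "'a ell2_op \<Rightarrow> complex" where
  "fredholm_det B = (\<Sum>\<^sub>\<infinity>S\<in>{S. finite S}. principal_minor (B - id_blinfun) S)"

text \<open>Regularized determinant \<open>det((I + A) e\<^sup>-\<^sup>A)\<close>, for Hilbert-Schmidt \<open>A\<close>.\<close>

definition det2 :: "'a ell2_op \<Rightarrow> complex" where
  "det2 A = fredholm_det ((id_blinfun + A) o\<^sub>L op_exp (- A))"

definition mult_op :: "('a \<Rightarrow> complex) \<Rightarrow> 'a ell2_op" where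
  "mult_op v = Blinfun (\<lambda>f. Abs_ell2 (\<lambda>x. v x * coord f x))"

lemma mult_op_apply:
  assumes "bounded (range v)"
  shows "coord (blinfun_apply (mult_op v) f) x = v x * coord f x"
proof -
  obtain b where b: "\<And>x. cmod (v x) \<le> b" using assms by (auto simp: bounded_iff)
  define M where "M = (\<lambda>f. Abs_ell2 (\<lambda>x. v x * coord f x))"
  have c: "coord (M f) x = v x * coord f x" for f x
    unfolding M_def
    by (subst Abs_ell2_inverse)
       (auto intro!: ell2_criterion(1) ell2_scale_bound[OF coord_summable b])
  have "bounded_linear M"
  proof (rule bounded_linear_intro[where K = b])
    show "M (f + g) = M f + M g" for f g
      by (rule ell2_eqI) (simp only: c coord_plus distrib_left)
    show "M (r *\<^sub>R f) = r *\<^sub>R M f" for r f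
      by (rule ell2_eqI) (simp only: c coord_scaleR mult.left_commute)
    show "norm (M f) \<le> norm f * b" for f
    proof -
      have "norm (M f) \<le> b * norm f"
        unfolding norm_ell2_def c
        by (rule ell2_criterion(2)) (rule ell2_scale_bound[OF coord_summable b])
      then show ?thesis by (simp only: mult.commute)
    qed
  qed
  then show ?thesis by (simp add: mult_op_def M_def[symmetric] bounded_linear_Blinfun_apply c)
qed

section \<open>The discrete Laplacian on the cubic lattice\<close>

text \<open>The lattice of dimension \<open>d = CARD('n)\<close> is the type \<open>int ^ 'n\<close>; \<open>|n - m|\<close> is the Euclidean
  length.\<close>

definition lat_norm :: "int ^ 'n::finite \<Rightarrow> real" where
  "lat_norm n = norm (\<chi> i. real_of_int (n $ i) :: real ^ 'n)"

definition lattice_laplacian :: "(int ^ 'n::finite \<Rightarrow> complex) \<Rightarrow> int ^ 'n \<Rightarrow> complex" where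
  "lattice_laplacian f n = 1/2 * (\<Sum>m | lat_norm (n - m) = 1. f m)"

definition H0 :: "(int ^ 'n::finite) ell2_op" where
  "H0 = Blinfun (\<lambda>f. Abs_ell2 (lattice_laplacian (coord f)))"

lemma finite_lat_sphere: "finite {v :: int ^ 'n::finite. lat_norm v = 1}"
proof -
  have "{v :: int ^ 'n. lat_norm v = 1} \<subseteq> vec_lambda ` (PiE UNIV (\<lambda>_. {-1..1}))"
  proof
    fix v :: "int ^ 'n" assume "v \<in> {v. lat_norm v = 1}"
    then have "\<bar>real_of_int (v $ i)\<bar> \<le> 1" for i
      using component_le_norm_cart[of "\<chi> i. real_of_int (v $ i) :: real ^ 'n" i]
      by (simp add: lat_norm_def)
    then have "v $ i \<in> {-1..1}" for i by (simp add: abs_le_iff) (smt (verit) of_int_le_1_iff of_int_minus)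
    then have "vec_nth v \<in> PiE UNIV (\<lambda>_. {-1..1})" by auto
    then show "v \<in> vec_lambda ` (PiE UNIV (\<lambda>_. {-1..1}))"
      by (metis (no_types) image_eqI vec_nth_inverse)
  qed
  then show ?thesis by (rule finite_subset) (intro finite_imageI finite_PiE; simp)
qed

lemma H0_apply: "coord (blinfun_apply H0 f) n = lattice_laplacian (coord f) n"
proof -
  let ?U = "{v :: int ^ 'a. lat_norm v = 1}"
  define S where "S = (\<lambda>v f. Abs_ell2 (\<lambda>n. coord f (n - v :: int ^ 'a)))"
  have r: "bij_betw (\<lambda>n. n - v) UNIV (UNIV :: (int ^ 'a) set)" for v
    by (rule bij_betwI[where g = "\<lambda>n. n + v"]) auto
  have c: "coord (S v f) n = coord f (n - v)" for v n f
    unfolding S_def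
    by (subst Abs_ell2_inverse)
       (auto simp: summable_on_reindex_bij_betw[OF r, of "\<lambda>n. (cmod (coord f n))\<^sup>2"] coord_summable)
  have bl: "bounded_linear (S v)" for v
  proof (rule bounded_linear_intro[where K = 1])
    show "S v (f + g) = S v f + S v g" for f g by (rule ell2_eqI) (simp only: c coord_plus)
    show "S v (s *\<^sub>R f) = s *\<^sub>R S v f" for s f by (rule ell2_eqI) (simp only: c coord_scaleR)
    show "norm (S v f) \<le> norm f * 1" for f
      unfolding norm_ell2_def c
      by (simp add: infsum_reindex_bij_betw[OF r, of "\<lambda>n. (cmod (coord f n))\<^sup>2"])
  qed
  let ?L = "\<lambda>f. (1/2) *\<^sub>R (\<Sum>v\<in>?U. S v f)"
  have L: "bounded_linear ?L"
    by (intro bounded_linear_intros bl)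
  have cs: "coord (sum g A) n = (\<Sum>v\<in>A. coord (g v) n)" for g :: "int ^ 'a \<Rightarrow> (int ^ 'a) ell2" and A n
    by (induction A rule: infinite_finite_induct) (auto simp: coord_zero coord_plus)
  have Lc: "coord (?L f) n = lattice_laplacian (coord f) n" for f n
  proof -
    have "(\<Sum>v\<in>?U. coord f (n - v)) = (\<Sum>m | lat_norm (n - m) = 1. coord f m)"
      by (rule sum.reindex_bij_witness[where i = "\<lambda>m. n - m" and j = "\<lambda>v. n - v"]) auto
    then show ?thesis by (simp add: coord_scaleR cs c lattice_laplacian_def)
  qed
  have "(\<lambda>f. Abs_ell2 (lattice_laplacian (coord f))) = ?L"
  proof
    fix f :: "(int ^ 'a) ell2"
    have "lattice_laplacian (coord f) = coord (?L f)" using Lc by (intro ext) metis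
    then show "Abs_ell2 (lattice_laplacian (coord f)) = ?L f" by (simp add: coord_inverse)
  qed
  then show ?thesis by (simp add: H0_def bounded_linear_Blinfun_apply[OF L] Lc)
qed

definition R0 :: "complex \<Rightarrow> (int ^ 'n::finite) ell2_op" where
  "R0 \<mu> = op_inverse (H0 - mult_op (\<lambda>_. \<mu>))"

section \<open>The potential and the modified determinant\<close>

definition in_lp :: "real \<Rightarrow> ('a \<Rightarrow> complex) \<Rightarrow> bool" where
  "in_lp p v \<longleftrightarrow> (\<lambda>x. cmod (v x) powr p) summable_on UNIV"

definition lp_norm :: "real \<Rightarrow> ('a \<Rightarrow> complex) \<Rightarrow> real" where
  "lp_norm p v = (\<Sum>\<^sub>\<infinity>x. cmod (v x) powr p) powr (1/p)"

definition Lam :: "nat \<Rightarrow> complex set" where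
  "Lam d = UNIV - of_real ` {- real d .. real d}"

definition joukowski :: "nat \<Rightarrow> complex \<Rightarrow> complex" where
  "joukowski d z = of_nat d / 2 * (z + 1 / z)"

text \<open>The branch of \<open>sqrt (\<mu>\<^sup>2 - d\<^sup>2)\<close> on \<open>Lam d\<close> that is asymptotic to \<open>\<mu>\<close> at infinity.
  It is analytic because \<open>1 - d\<^sup>2/\<mu>\<^sup>2\<close> meets the cut of the principal square root only for real
  \<open>\<mu>\<close> in \<open>[-d, d]\<close>.\<close>

definition varkappa :: "nat \<Rightarrow> complex \<Rightarrow> complex" where
  "varkappa d \<mu> = \<mu> * csqrt (1 - (of_nat d)\<^sup>2 / \<mu>\<^sup>2)"

lemma Lam_nonzero: "\<mu> \<in> Lam d \<Longrightarrow> \<mu> \<noteq> 0"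
proof
  assume "\<mu> \<in> Lam d" "\<mu> = 0"
  moreover have "(0::complex) = of_real 0" "(0::real) \<in> {- real d .. real d}" by auto
  ultimately show False unfolding Lam_def by blast
qed

lemma varkappa_square: "\<mu> \<in> Lam d \<Longrightarrow> (varkappa d \<mu>)\<^sup>2 = \<mu>\<^sup>2 - (of_nat d)\<^sup>2"
  by (simp add: varkappa_def power_mult_distrib Lam_nonzero field_simps)

lemma varkappa_holomorphic: "varkappa d holomorphic_on Lam d"
proof -
  have "1 - (of_nat d)\<^sup>2 / \<mu>\<^sup>2 \<notin> \<real>\<^sub>\<le>\<^sub>0" if L: "\<mu> \<in> Lam d" for \<mu> :: complex
  proof
    assume "1 - (of_nat d)\<^sup>2 / \<mu>\<^sup>2 \<in> \<real>\<^sub>\<le>\<^sub>0"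
    then obtain r where r: "1 - (of_nat d)\<^sup>2 / \<mu>\<^sup>2 = complex_of_real r" "r \<le> 0"
      by (auto elim: nonpos_Reals_cases)
    define s where "s = real d / sqrt (1 - r)"
    have "(of_nat d)\<^sup>2 = \<mu>\<^sup>2 * of_real (1 - r)"
      using r(1) Lam_nonzero[OF L] by (simp add: field_simps)
    moreover have "(complex_of_real s)\<^sup>2 = (of_nat d)\<^sup>2 / of_real (1 - r)"
      using r(2) by (simp add: s_def power_divide flip: of_real_power)
    moreover have "complex_of_real (1 - r) \<noteq> 0"
      using r(2) by (metis less_irrefl of_real_eq_0_iff diff_gt_0_iff_gt less_le_trans zero_less_one le_less_trans)
    ultimately have "\<mu>\<^sup>2 = (complex_of_real s)\<^sup>2" by simp
    then have "\<mu> = of_real s \<or> \<mu> = of_real (- s)"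
      by (simp add: power2_eq_iff)
    moreover have "1 \<le> sqrt (1 - r)" using r(2) by simp
    then have "0 \<le> s" "s \<le> real d" unfolding s_def
      using mult_left_mono[of 1 "sqrt (1 - r)" "real d"] r(2) by (auto simp: divide_le_eq)
    ultimately show False using L unfolding Lam_def by force
  qed
  then show ?thesis unfolding varkappa_def
    by (intro holomorphic_intros) (auto simp: Lam_nonzero)
qed

lemma varkappa_asymp:
  "(\<lambda>\<mu>. varkappa d \<mu> - \<mu> + (of_nat d)\<^sup>2 / (2 * \<mu>)) \<in> O[at_infinity](\<lambda>\<mu>. 1 / \<mu> ^ 3)"
proof (rule bigoI)
  have "cmod (varkappa d \<mu> - \<mu> + (of_nat d)\<^sup>2 / (2 * \<mu>)) \<le> (real d ^ 4 / 2) * cmod (1 / \<mu> ^ 3)"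
    if "\<mu> \<noteq> 0" for \<mu> :: complex
  proof -
    define w where "w = (of_nat d)\<^sup>2 / \<mu>\<^sup>2"
    define s where "s = csqrt (1 - w)"
    have s2: "s\<^sup>2 = 1 - w" by (simp add: s_def)
    have "1 \<le> Re (1 + s)" using csqrt_principal[of "1 - w"] by (auto simp: s_def simp del: csqrt.sel)
    then have n: "1 \<le> cmod (1 + s)" using complex_Re_le_cmod order_trans by blast
    then have nz: "1 + s \<noteq> 0" by auto
    have w: "w = (1 - s) * (1 + s)" using s2 by (simp add: algebra_simps power2_eq_square)
    have "s - 1 + w / 2 = - (w\<^sup>2 / (2 * (1 + s)\<^sup>2))"
    proof -
      have "w\<^sup>2 / (2 * (1 + s)\<^sup>2) = (1 - s)\<^sup>2 / 2"
        using nz by (simp add: w power_mult_distrib)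
      then show ?thesis by (simp add: w field_simps power2_eq_square)
    qed
    moreover have "(of_nat d)\<^sup>2 / (2 * \<mu>) = \<mu> * (w / 2)"
      using that by (simp add: w_def field_simps power2_eq_square)
    ultimately have e: "varkappa d \<mu> - \<mu> + (of_nat d)\<^sup>2 / (2 * \<mu>) = - (\<mu> * w\<^sup>2) / (2 * (1 + s)\<^sup>2)"
      unfolding varkappa_def w_def[symmetric] s_def[symmetric]
      by (metis (no_types, opaque_lifting) distrib_left minus_divide_left mult.right_neutral
          mult_minus_right right_diff_distrib times_divide_eq_right)
    have "\<mu> * w\<^sup>2 = of_nat d ^ 4 * (1 / \<mu> ^ 3)"
      using that by (simp add: w_def field_simps power2_eq_square power3_eq_cube eval_nat_numeral)
    then have "cmod (\<mu> * w\<^sup>2) = real d ^ 4 * cmod (1 / \<mu> ^ 3)"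
      by (simp add: norm_mult norm_power norm_divide)
    moreover have "1 \<le> (cmod (1 + s))\<^sup>2" using n by simp
    then have "cmod (\<mu> * w\<^sup>2) / (2 * (cmod (1 + s))\<^sup>2) \<le> cmod (\<mu> * w\<^sup>2) / 2"
      by (intro divide_left_mono) auto
    ultimately show ?thesis unfolding e by (simp add: norm_divide norm_mult norm_power)
  qed
  then have "\<forall>\<mu>. 1 \<le> norm \<mu> \<longrightarrow> norm (varkappa d \<mu> - \<mu> + (of_nat d)\<^sup>2 / (2 * \<mu>))
      \<le> (real d ^ 4 / 2) * norm (1 / \<mu> ^ 3)"
    by (metis norm_zero not_one_le_zero)
  then show "\<forall>\<^sub>F \<mu> in at_infinity. norm (varkappa d \<mu> - \<mu> + (of_nat d)\<^sup>2 / (2 * \<mu>))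
      \<le> (real d ^ 4 / 2) * norm (1 / \<mu> ^ 3)"
    unfolding eventually_at_infinity by blast
qed

definition calD :: "(int ^ 'n::finite \<Rightarrow> complex) \<Rightarrow> complex \<Rightarrow> complex" where
  "calD V \<mu> = det2 (mult_op V o\<^sub>L R0 \<mu>)"

text \<open>The point \<open>z = 0\<close> corresponds to \<open>\<mu> = \<infinity>\<close>, where the determinant takes the value 1.\<close>

definition modD :: "(int ^ 'n::finite \<Rightarrow> complex) \<Rightarrow> complex \<Rightarrow> complex" where
  "modD V z = (if z = 0 then 1 else calD V (joukowski CARD('n) z))"

text \<open>With \<open>a = 2/d\<close> one has \<open>1 / joukowski d z = a z / (1 + z\<^sup>2)\<close>, whose square is
  \<open>a\<^sup>2 z\<^sup>2 (1 - 2 z\<^sup>2 + \<dots>)\<close>.  The term \<open>- Tr V\<^sup>2 / (2 \<mu>\<^sup>2)\<close> of \<open>log calD\<close> therefore adds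
  \<open>a\<^sup>2 Tr V\<^sup>2\<close> to the coefficient of \<open>z\<^sup>4\<close>.  In the expansion \<open>log D = - \<Sum>k. \<psi>\<^sub>k z\<^sup>k\<close> this is
  the summand \<open>- 2 \<psi>\<^sub>2\<close> of \<open>\<psi>\<^sub>4\<close>; the source prints \<open>- \<psi>\<^sub>2\<close> there, which fails
  whenever \<open>Tr V\<^sup>2\<close> is not zero.\<close>

definition Hinf_norm :: "(complex \<Rightarrow> complex) \<Rightarrow> ereal" where
  "Hinf_norm F = (SUP z\<in>ball 0 1. ereal (cmod (F z)))"

definition holder_up_to_boundary :: "(complex \<Rightarrow> complex) \<Rightarrow> bool" where
  "holder_up_to_boundary F \<longleftrightarrow>
     (\<exists>G \<alpha> C. (\<forall>z\<in>ball 0 1. G z = F z) \<and> 0 < \<alpha> \<and> \<alpha> \<le> 1 \<and>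
        (\<forall>z\<in>cball 0 1. \<forall>w\<in>cball 0 1. cmod (G z - G w) \<le> C * cmod (z - w) powr \<alpha>))"

definition indices :: "enat \<Rightarrow> nat set" where
  "indices N = {j. 1 \<le> j \<and> enat j \<le> N}"

definition zeros_in_disc :: "(complex \<Rightarrow> complex) \<Rightarrow> enat \<Rightarrow> (nat \<Rightarrow> complex) \<Rightarrow> bool" where
  "zeros_in_disc F N \<zeta> \<longleftrightarrow>
     (\<forall>j\<in>indices N. \<zeta> j \<in> ball 0 1 \<and> F (\<zeta> j) = 0) \<and>
     (\<forall>w\<in>ball 0 1. F w = 0 \<longrightarrow>
        finite {j\<in>indices N. \<zeta> j = w} \<and> int (card {j\<in>indices N. \<zeta> j = w}) = zorder F w)"

section \<open>The constants\<close>

definition kap :: "real \<Rightarrow> nat \<Rightarrow> real" where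
  "kap p d =
     (if d = 3 then 6 * (p - 1) / (6 - 5 * p)
      else if d = 4 then ((5 * p - 1) / (4 - 3 * p)) powr ((5 * p - 4) / (4 * (p - 1)))
      else 3 * real d * (p - 1) / (3 * real d - (2 * real d + 1) * p))"

text \<open>For \<open>p = 1\<close> the outer exponent is 0, so that \<open>Gam 1 d = 1\<close>.  This includes \<open>d = 4\<close>, where the
  formula for \<open>kap\<close> has no meaning at \<open>p = 1\<close>.\<close>

definition Gam :: "real \<Rightarrow> nat \<Rightarrow> real" where
  "Gam p d = (3 + 2 * kap p d) powr (real d * (p - 1) / p)"

definition Cpd :: "real \<Rightarrow> nat \<Rightarrow> real" where
  "Cpd p d = (if p = 1 then 1 else p powr (real d * (p - 1) / (2 * p)))"

definition Cd0 :: "nat \<Rightarrow> real" where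
  "Cd0 d = (if d = 3 then 16 else if d = 4 then 4 else 14 * 2 powr (real d / 4) / (real d - 4))"

definition Cstar :: "real \<Rightarrow> nat \<Rightarrow> real" where
  "Cstar p d = Cpd p d + Cd0 d * Gam p d"

end

theory Submission
  imports Defs
begin

text \<open>The kernel of \<open>e\<^sup>-\<^sup>i\<^sup>t\<^sup>\<Delta>\<close> is a product of Bessel functions, and the resolvent is its Laplace
  transform.  The bound \<open>|J\<^sub>n(t)| \<le> 5/4 t\<^sup>-\<^sup>1\<^sup>/\<^sup>3\<close>, the weighted integrals of \<open>|J\<^sub>n|\<^sup>3\<close> and the sums of
  \<open>J\<^sub>n\<^sup>4\<close> bound the resolvent kernel in \<open>l\<^sup>q\<close> with \<open>1/q = 1 - 1/p\<close>, uniformly up to the cut, and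
  bound its differences in the same way.  By Young's inequality the symmetrised operator
  \<open>|V|\<^sup>1\<^sup>/\<^sup>2 R |V|\<^sup>1\<^sup>/\<^sup>2\<close> is Hilbert-Schmidt with norm at most \<open>C * lp_norm p V\<close>.  Hadamard's inequality
  gives \<open>|det2| \<le> exp (norm\<^sup>2 / 2)\<close> on boxes, and analyticity and Hoelder continuity pass to the limit.
  A Blaschke product controls the zeros, and the conformal map turns \<open>1 - |z|\<close> into the other two
  terms of the sum.  The coefficients come from the traces of the first powers of \<open>V R\<close> on boxes.\<close>

section \<open>Bessel functions\<close>

text \<open>The ranges of p come from the decay of J_n, here \<open>bes n\<close>. In dimension 3
  the integral of |J_n|^3 over t is at most of order |n|^(-1/2); spread over three coordinates it
  leaves |n_i|^(-1/6) in each, which is in l^q exactly for q > 6, that is p < 6/5. In higher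
  dimension the sum over n of J_n^4 is at most of order (log t)/t, so the evolution kernel has l^4
  norm at most of order ((log t)/t)^(d/4). This is integrable for d > 4 and yields every q >= 4;
  dimension 4 is the borderline, where q > 4, that is p < 4/3, is reached by interpolation with the
  t^(-1/3) bound. The explicit constants are rational roundings that still fit below C_*. The
  determinant is given by Fredholm's series for (1 + A) exp(-A) - 1 with A = V R, a sum over all
  finite sets of lattice points, while the estimates concern finite matrices. Everything is
  therefore proved for V truncated to a box with constants independent of the box, and carried over
  at each fixed z by dominated convergence of the principal minors.\<close>

definition bes :: "int => real => real" where "bes n t = integral {0..pi} (%th. cos (of_int n*th - t * sin th))/pi"

lemma bes_integrable: "(%th. cos (a*th - t * sin th)) integrable_on {u..v::real}" by (intro integrable_continuous_real continuous_intros)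

lemma bes_deriv_integral: "(bes n has_real_derivative
   integral {0..pi} (%th. sin th * sin (of_int n*th - t * sin th))/pi) (at t)"
proof -
 have "((%t. integral (cbox 0 pi) (%th. cos (of_int n*th - t * sin th))) has_field_derivative
   integral (cbox 0 pi) (%th. sin th * sin (of_int n*th - t * sin th))) (at t within UNIV)" by (rule leibniz_rule_field_derivative)
   (auto intro!: derivative_eq_intros continuous_intros integrable_continuous_real
      simp: case_prod_unfold)
 from DERIV_cdivide[OF this, of pi] show ?thesis by (simp add: bes_def[abs_def])
qed

lemma bes_deriv: "(bes n has_real_derivative (bes (n - 1) t - bes (n + 1) t)/2) (at t)"
proof -
 have "integral {0..pi} (%th. sin th * sin (of_int n*th - t * sin th)) =
  integral {0..pi} (%th. (cos (of_int (n - 1)*th - t * sin th) - cos (of_int (n + 1)*th - t * sin th))/2)"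
 proof (rule integral_cong)
  fix th :: real
  let ?a = "of_int n*th - t * sin th"
  have "of_int (n - 1)*th - t * sin th = ?a - th" "of_int (n + 1)*th - t * sin th = ?a + th" by (auto simp: algebra_simps)
  thus "sin th * sin ?a = (cos (of_int (n - 1)*th - t * sin th) - cos (of_int (n + 1)*th - t * sin th))/2"
   by (simp only: cos_add cos_diff) (simp add: field_simps)
 qed
 also have "... = (integral {0..pi} (%th. cos (of_int (n - 1)*th - t * sin th)) - integral {0..pi} (%th. cos (of_int (n + 1)*th - t * sin th)))/2"
  by (subst integral_divide, subst integral_diff) (auto intro: bes_integrable)
 finally show ?thesis using bes_deriv_integral[of n t] by (simp add: bes_def diff_divide_distrib mult.commute)
qed

lemma bes_continuous: "continuous_on S (bes n)" by (rule continuous_at_imp_continuous_on) (blast intro: DERIV_isCont[OF bes_deriv])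

text \<open>The phase takes multiples of pi at 0 and pi, so the integral of the derivative in
  \<theta> of sin (n \<theta> - t sin \<theta>) vanishes; product formulas for cosines turn this
  into the recurrence.\<close>

lemma bes_rec: "t*(bes (n - 1) t + bes (n + 1) t) = 2 * of_int n*bes n t"
proof -
 have "((%th. cos (of_int n*th - t * sin th)*(of_int n - t * cos th)) has_integral
   sin (of_int n*pi - t * sin pi) - sin (of_int n*0 - t * sin 0)) {0..pi}" by (rule fundamental_theorem_of_calculus)
   (auto intro!: derivative_eq_intros simp: has_real_derivative_iff_has_vector_derivative[symmetric])
 moreover have "sin (of_int n*pi) = 0" by (simp add: sin_zero_iff_int2)
 ultimately have "integral {0..pi} (%th. cos (of_int n*th - t * sin th)*(of_int n - t * cos th)) = 0" by (simp add: integral_unique)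
 moreover have "cos (of_int n*th - t * sin th)*(of_int n - t * cos th) = of_int n * cos (of_int n*th - t * sin th) - t/2 *
   (cos (of_int (n - 1)*th - t * sin th) + cos (of_int (n + 1)*th - t * sin th))" for th :: real
 proof -
  let ?a = "of_int n*th - t * sin th"
  have "of_int (n - 1)*th - t * sin th = ?a - th" "of_int (n + 1)*th - t * sin th = ?a + th" by (auto simp: algebra_simps)
  thus ?thesis by (simp only: cos_add cos_diff) (simp add: field_simps)
 qed
 ultimately have "0 = integral {0..pi} (%th. of_int n * cos (of_int n*th - t * sin th) - t/2 *
   (cos (of_int (n - 1)*th - t * sin th) + cos (of_int (n + 1)*th - t * sin th)))" by simp
 also have "... = of_int n*(pi*bes n t) - t/2*(pi*bes (n - 1) t + pi*bes (n + 1) t)"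
  by (subst integral_diff, (intro integrable_on_cmult_left integrable_on_mult_right integrable_add bes_integrable)+,
    subst integral_mult_right, subst integral_mult_right, subst integral_add) (auto intro: bes_integrable simp: bes_def)
 finally have "pi*(t*(bes (n - 1) t + bes (n + 1) t)) = pi*(2 * of_int n*bes n t)" by (simp add: algebra_simps)
 thus ?thesis by simp
qed

lemma abs_bes_le_1: "\<bar>bes n t\<bar> <= 1"
proof -
 have "norm (integral {0..pi} (%th. cos (of_int n*th - t * sin th))) <= integral {0..pi} (%_. 1)"
  by (rule integral_norm_bound_integral) (auto intro: bes_integrable)
 thus ?thesis by (simp add: bes_def)
qed

lemma integral_reflect_pi:
 fixes f :: "real => real"
 assumes "continuous_on {0..pi} f" shows "integral {0..pi} (%x. f (pi - x)) = integral {0..pi} f"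
proof -
 have "(f has_integral integral {0..pi} f) (cbox 0 pi)" using assms integrable_continuous_real integrable_integral by fastforce
 from has_integral_affinity[OF this, of "-1" pi]
 have "((%x. f (pi - x)) has_integral integral {0..pi} f) ((%x. pi - x) ` {0..pi})" by simp
 moreover have "(%x. pi - x) ` {0..pi} = {0..pi}" by (auto simp: image_iff intro!: bexI[of _ "pi - x" for x])
 ultimately show ?thesis by (simp add: integral_unique)
qed

lemma bes_neg: "bes (- n) t = cos (of_int n*pi)*bes n t"
proof -
 let ?f = "%th. cos (of_int (- n)*th - t * sin th)"
 have "integral {0..pi} ?f = integral {0..pi} (%th. ?f (pi - th))" by (rule integral_reflect_pi[symmetric]) (intro continuous_intros)
 also have "... = integral {0..pi} (%th. cos (of_int n*pi) * cos (of_int n*th - t * sin th))"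
 proof (rule integral_cong)
  fix th :: real
  have "of_int (- n)*(pi - th) - t * sin (pi - th) = (of_int n*th - t * sin th) - of_int n*pi" by (simp add: algebra_simps)
  moreover have "sin (of_int n*pi) = 0" by (simp add: sin_zero_iff_int2)
  ultimately show "?f (pi - th) = cos (of_int n*pi) * cos (of_int n*th - t * sin th)" by (simp only: cos_diff) simp
 qed
 finally show ?thesis by (simp add: bes_def)
qed

lemma abs_bes_minus: "\<bar>bes (- n) t\<bar> = \<bar>bes n t\<bar>"
proof -
 have "\<bar>cos (of_int n*pi)\<bar> = 1"
 proof -
  have "sin (of_int n*pi) = 0" by (simp add: sin_zero_iff_int2)
  hence "(cos (of_int n*pi))^2 = 1" using sin_cos_squared_add[of "of_int n*pi"] by simp
  thus ?thesis by (simp add: power2_eq_1_iff) auto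
 qed
 thus ?thesis by (simp add: bes_neg abs_mult)
qed

lemma abs_bes_abs: "\<bar>bes \<bar>n\<bar> t\<bar> = \<bar>bes n t\<bar>" by (cases "n >= 0") (auto simp: abs_bes_minus)

text \<open>Equals \<open>t\<close> times the derivative of \<open>bes n\<close>.\<close>

definition besd :: "int => real => real" where "besd n t = of_int n*bes n t - t*bes (n + 1) t"

lemma bes_deriv': "t ~= 0 ==> (bes n has_real_derivative besd n t/t) (at t)" using bes_deriv[of n t] bes_rec[of t n]
 by (auto simp: besd_def field_simps elim!: back_subst[of "%d. (bes n has_real_derivative d) (at t)"])

lemma besd_alt: "besd n t = t*bes (n - 1) t - of_int n*bes n t" using bes_rec[of t n] by (simp add: besd_def algebra_simps)

text \<open>Bessel's equation in the form (t d/dt)^2 J_n = (n^2 - t^2) J_n. It follows from the two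
  first order relations, one through the order above and one (\<open>besd_alt\<close>) through the
  order below.\<close>

lemma besd_deriv:
 assumes "t ~= 0" shows "(besd n has_real_derivative ((of_int n)^2 - t^2)/t*bes n t) (at t)"
proof -
 have "(besd n has_real_derivative of_int n*(besd n t/t) - (bes (n+1) t + t*(besd (n+1) t/t))) (at t)" unfolding besd_def[of n, abs_def]
  by (rule derivative_eq_intros bes_deriv'[OF assms] refl)+ (simp add: besd_def)
 moreover have "of_int n*(besd n t/t) - (bes (n+1) t + t*(besd (n+1) t/t)) = ((of_int n)^2 - t^2)/t*bes n t"
  unfolding besd_alt[of "n+1"] unfolding besd_def using assms by (simp add: field_simps power2_eq_square)
 ultimately show ?thesis by simp
qed

section \<open>Numerical bounds for J_0 and J_1 at 1\<close>

lemma bes_even_sin_powers: shows "((%th. sin th^2) has_integral pi/2) {0..pi}" and "((%th. sin th^4) has_integral 3*pi/8) {0..pi}"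
proof -
 have "((%th. sin th^2) has_integral (pi/2 - sin pi * cos pi/2) - (0/2 - sin 0 * cos 0/2)) {0..pi}" by (rule fundamental_theorem_of_calculus)
   (auto intro!: derivative_eq_intros simp: has_real_derivative_iff_has_vector_derivative[symmetric]
    cos_squared_eq power2_eq_square[symmetric] field_simps)
 thus "((%th. sin th^2) has_integral pi/2) {0..pi}" by simp
 have "((%th. sin th^4) has_integral (3/8*pi - 3/8*(sin pi * cos pi) - 1/4*(sin pi^3 * cos pi))
   - (3/8*0 - 3/8*(sin 0 * cos 0) - 1/4*(sin 0^3 * cos 0))) {0..pi}"
 proof (rule fundamental_theorem_of_calculus)
  fix x :: real
  have c: "cos x * cos x = 1 - sin x * sin x" using sin_cos_squared_add[of x] by (simp add: power2_eq_square)
  have "((%x. 3/8*x - 3/8*(sin x * cos x) - 1/4*(sin x^3 * cos x)) has_real_derivative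
    3/8 - 3*(cos x * cos x - sin x * sin x)/8 - (3 * sin x^2*(cos x * cos x) - sin x^3 * sin x)/4) (at x within {0..pi})"
   by (auto intro!: derivative_eq_intros simp: field_simps power2_eq_square)
  moreover have "3/8 - 3*(cos x * cos x - sin x * sin x)/8 - (3 * sin x^2*(cos x * cos x) - sin x^3 * sin x)/4 = sin x^4"
   unfolding c by (simp add: field_simps power2_eq_square power3_eq_cube power4_eq_xxxx)
  ultimately show "((%x. 3/8*x - 3/8*(sin x * cos x) - 1/4*(sin x^3 * cos x))
    has_vector_derivative sin x^4) (at x within {0..pi})" by (simp add: has_real_derivative_iff_has_vector_derivative)
 qed simp
 thus "((%th. sin th^4) has_integral 3*pi/8) {0..pi}" by simp
qed

lemma cos_ge_quadratic: "1 - x^2/2 <= cos (x::real)"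
proof -
 have "(sin (x/2))^2 <= (x/2)^2" using abs_sin_x_le_abs_x[of "x/2"] by (simp only: abs_le_square_iff)
 moreover have "cos x = 1 - 2*(sin (x/2))^2" using cos_double_sin[of "x/2"] by simp
 ultimately show ?thesis by (simp add: power_divide)
qed

lemma cos_le_quartic: "cos (x::real) <= 1 - x^2/2 + x^4/24"
proof -
 obtain t where "cos x = (\<Sum>m<4. cos_coeff m*x^m) + cos (t + 1/2*real 4*pi)/fact 4*x^4" using Maclaurin_cos_expansion[of x 4] by blast
 moreover have "cos (t + 2*pi)/24*x^4 <= 1/24*x^4" by (intro mult_right_mono) auto
 moreover have "{..<4::nat} = {0, 1, 2, 3}" by auto
 ultimately show ?thesis by (simp add: cos_coeff_def fact_numeral)
qed

lemma sin_ge_cubic: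
 assumes "0 <= x" shows "x - x^3/6 <= sin (x::real)"
proof -
 obtain t where "sin x = (\<Sum>m<3. sin_coeff m*x^m) + sin (t + 1/2*real 3*pi)/fact 3*x^3" using Maclaurin_sin_expansion[of x 3] by blast
 moreover have "(-1)/6*x^3 <= sin (t + 1/2*real 3*pi)/6*x^3" using assms by (intro mult_right_mono) auto
 moreover have "{..<3::nat} = {0, 1, 2}" by auto
 ultimately show ?thesis by (simp add: sin_coeff_def fact_numeral)
qed

lemma bes_0_1_bounds: "3/4 <= bes 0 1" "bes 0 1 <= 49/64"
proof -
 have 1: "((%th. 1 - sin th^2/2) has_integral pi - (pi/2)/2) {0..pi}"
  using has_integral_diff[OF has_integral_const_real[of 1 0 pi] has_integral_divide[OF bes_even_sin_powers(1), of 2]] by simp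
 have 2: "((%th. 1 - sin th^2/2 + sin th^4/24) has_integral pi - (pi/2)/2 + (3*pi/8)/24) {0..pi}"
  by (rule has_integral_add[OF 1 has_integral_divide[OF bes_even_sin_powers(2)]])
 have J: "((%th. cos (of_int 0*th - 1 * sin th)) has_integral pi*bes 0 1) {0..pi}"
  using integrable_integral[OF bes_integrable[of 0 1 0 pi]] by (simp add: bes_def)
 have "pi - (pi/2)/2 <= pi*bes 0 1" by (rule has_integral_le[OF 1 J]) (use cos_ge_quadratic in auto)
 hence "pi*(3/4) <= pi*bes 0 1" by (simp add: algebra_simps)
 thus "3/4 <= bes 0 1" using pi_gt_zero by (rule mult_left_le_imp_le)
 have "pi*bes 0 1 <= pi - (pi/2)/2 + (3*pi/8)/24" by (rule has_integral_le[OF J 2]) (use cos_le_quartic in auto)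
 hence "pi*bes 0 1 <= pi*(49/64)" by (simp add: algebra_simps)
 thus "bes 0 1 <= 49/64" using pi_gt_zero by (rule mult_left_le_imp_le)
qed

lemma bes_m1: "bes (- 1) t = - bes 1 t" using bes_neg[of 1 t] by simp

lemma bes_1_1_bounds: "7/16 <= bes 1 1" "bes 1 1 <= 1/2"
proof -
 \<comment> \<open>J_1 = - J_0', differentiated under the integral sign, leaves sin \<theta> sin
   (sin \<theta>), whose Taylor bounds involve only even powers of the sine.\<close>
 have "(bes 0 has_real_derivative - bes 1 1) (at 1)" using bes_deriv[of 0 1] by (simp add: bes_m1)
 from DERIV_unique[OF bes_deriv_integral[of 0 1] this]
 have eq: "pi*bes 1 1 = integral {0..pi} (%th. sin th * sin (sin th))" by (simp add: field_simps)
 have J: "((%th. sin th * sin (sin th)) has_integral pi*bes 1 1) {0..pi}"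
  unfolding eq by (intro integrable_integral integrable_continuous_real continuous_intros)
 have 1: "((%th. sin th^2 - sin th^4/6) has_integral pi/2 - (3*pi/8)/6) {0..pi}"
  by (rule has_integral_diff[OF bes_even_sin_powers(1) has_integral_divide[OF bes_even_sin_powers(2)]])
 have "pi/2 - (3*pi/8)/6 <= pi*bes 1 1"
 proof (rule has_integral_le[OF 1 J])
  fix th assume "th \<in> {0..pi}"
  hence "0 <= sin th" by (simp add: sin_ge_zero)
  hence "sin th*(sin th - sin th^3/6) <= sin th * sin (sin th)" by (intro mult_left_mono sin_ge_cubic)
  thus "sin th^2 - sin th^4/6 <= sin th * sin (sin th)" by (simp add: algebra_simps power2_eq_square power3_eq_cube power4_eq_xxxx)
 qed
 hence "pi*(7/16) <= pi*bes 1 1" by (simp add: algebra_simps)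
 thus "7/16 <= bes 1 1" using pi_gt_zero by (rule mult_left_le_imp_le)
 have "pi*bes 1 1 <= pi/2"
 proof (rule has_integral_le[OF J bes_even_sin_powers(1)])
  fix th assume "th \<in> {0..pi}"
  hence "0 <= sin th" by (simp add: sin_ge_zero)
  thus "sin th * sin (sin th) <= sin th^2" unfolding power2_eq_square by (intro mult_left_mono sin_x_le_x)
 qed
 hence "pi*bes 1 1 <= pi*(1/2)" by simp
 thus "bes 1 1 <= 1/2" using pi_gt_zero by (rule mult_left_le_imp_le)
qed

text \<open>The squared amplitude at infinity: it tends to 2/pi for every order. Only an asymptotic
  upper bound is derived, and 3/4 is a rational above 2/pi that can be reached from the values at t
  = 1.\<close>

definition bamp :: "int => real => real" where "bamp n t = t*((bes n t)^2 + (bes (n + 1) t)^2)"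

text \<open>Sonin's function for \<open>sqrt t * bes 0 t\<close>, whose frequency \<open>1 + 1/(4 t\<^sup>2)\<close> decreases.\<close>

lemma bamp_0_le:
 assumes "1 <= t" shows "bamp 0 t <= 3/4 + \<bar>bes 0 t\<bar>"
proof -
 \<comment> \<open>This is u'^2 + (1 + 1/(4 t^2)) u^2 for u = sqrt t J_0, written out with J_0' = -
   J_1.\<close>
 define E where "E = (%t. t*((bes 0 t)^2 + (bes 1 t)^2) - bes 0 t*bes 1 t + (bes 0 t)^2/(2*t))"
 have d0: "(bes 0 has_real_derivative - bes 1 t) (at t)" for t using bes_deriv[of 0 t] by (simp add: bes_m1)
 have d1: "(bes 1 has_real_derivative bes 0 t - bes 1 t/t) (at t)" if "t ~= 0" for t
  using bes_deriv'[OF that, of 1] that by (simp add: besd_alt diff_divide_distrib)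
 have "E t <= E 1"
 proof (rule DERIV_nonpos_imp_nonincreasing[OF assms], intro exI conjI)
  fix s :: real assume "1 <= s"
  hence s: "s ~= 0" by auto
  let ?a = "bes 0 s" and ?b = "bes 1 s"
  have "(E has_real_derivative (?a*?a + ?b*?b) + s*(2*?a*(- ?b) + 2*?b*(?a - ?b / s))
    - ((- ?b)*?b + ?a*(?a - ?b / s)) + (2*?a*(- ?b)*(2 * s) - ?a*?a*2)/(2 * s*(2 * s))) (at s)" unfolding E_def power2_eq_square
   by (rule DERIV_cong, (rule DERIV_add DERIV_diff DERIV_mult DERIV_divide DERIV_ident DERIV_const d0 d1 s | simp add: s)+) (simp add: algebra_simps)
  moreover have "(?a*?a + ?b*?b) + s*(2*?a*(- ?b) + 2*?b*(?a - ?b / s))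
    - ((- ?b)*?b + ?a*(?a - ?b / s)) + (2*?a*(- ?b)*(2 * s) - ?a*?a*2)/(2 * s*(2 * s)) = - (?a^2)/(2 * s^2)"
   using s by (simp add: field_simps power2_eq_square)
  ultimately show "(E has_real_derivative - ((bes 0 s)^2)/(2 * s^2)) (at s)" by simp
  show "- ((bes 0 s)^2)/(2 * s^2) <= 0" by simp
 qed
 also have "E 1 <= 3/4"
 proof -
  let ?a = "bes 0 1" and ?b = "bes 1 1"
  \<comment> \<open>The first product replaces b by its upper bound 1/2, the second replaces a by
    49/64; the value at this corner is just below 3/4.\<close>
  have "(?b - 1/2)*(?b + 1/2 - ?a) <= 0" using bes_0_1_bounds bes_1_1_bounds by (intro mult_nonpos_nonneg) auto
  moreover have "?a*(3*?a - 1) <= 49/64*(3*(49/64) - 1)" using bes_0_1_bounds by (intro mult_mono) auto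
  moreover have "(?b - 1/2)*(?b + 1/2 - ?a) = ?b*?b - ?a*?b - 1/4 + ?a/2" by (simp add: algebra_simps)
  moreover have "?a*(3*?a - 1) = 3*(?a*?a) - ?a" by (simp add: algebra_simps)
  moreover have "E 1 = ?a*?a + ?b*?b - ?a*?b + ?a*?a/2" by (simp add: E_def power2_eq_square)
  ultimately show ?thesis by simp
 qed
 finally have "E t <= 3/4" .
 moreover have "bes 0 t*bes 1 t <= \<bar>bes 0 t\<bar>*1"
 proof -
  have "bes 0 t*bes 1 t <= \<bar>bes 0 t\<bar>*\<bar>bes 1 t\<bar>" by (simp add: abs_mult[symmetric])
  also have "... <= \<bar>bes 0 t\<bar>*1" using abs_bes_le_1[of 1 t] by (intro mult_left_mono) auto
  finally show ?thesis .
 qed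
 moreover have "0 <= (bes 0 t)^2/(2*t)" using assms by simp
 ultimately show ?thesis by (simp add: E_def bamp_def)
qed

lemma bes_tendsto_0_if_bamp:
 assumes "\<forall>\<^sub>F t in at_top. bamp n t <= c" shows "(bes n \<longlongrightarrow> 0) at_top" "(bes (n + 1) \<longlongrightarrow> 0) at_top"
proof -
 have ev: "\<forall>\<^sub>F t in at_top. (bes n t)^2 + (bes (n + 1) t)^2 <= c*inverse t" using assms eventually_gt_at_top[of 0]
  by eventually_elim (simp add: bamp_def field_simps)
 have lim: "((%t. c*inverse t) \<longlongrightarrow> 0) at_top" by (intro tendsto_mult_right_zero tendsto_inverse_0_at_top filterlim_ident)
 have ev1: "\<forall>\<^sub>F t in at_top. (bes n t)^2 <= c*inverse t"
  using ev by eventually_elim (metis add_increasing2 order_trans order_refl zero_le_power2)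
 have ev2: "\<forall>\<^sub>F t in at_top. (bes (n + 1) t)^2 <= c*inverse t"
  using ev by eventually_elim (metis add_increasing order_trans order_refl zero_le_power2)
 have "((%t. (bes n t)^2) \<longlongrightarrow> 0) at_top" by (rule tendsto_sandwich[OF _ ev1 tendsto_const lim]) simp
 moreover have "((%t. (bes (n + 1) t)^2) \<longlongrightarrow> 0) at_top" by (rule tendsto_sandwich[OF _ ev2 tendsto_const lim]) simp
 ultimately have "((%t. sqrt ((bes n t)^2)) \<longlongrightarrow> sqrt 0) at_top" "((%t. sqrt ((bes (n + 1) t)^2)) \<longlongrightarrow> sqrt 0) at_top"
  using tendsto_real_sqrt by (blast, blast)
 thus "(bes n \<longlongrightarrow> 0) at_top" "(bes (n + 1) \<longlongrightarrow> 0) at_top" by (simp_all add: tendsto_rabs_zero_iff)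
qed

lemma bamp_diff: "bamp (n + 1) t - bamp n t = 2 * of_int (n + 1)*bes (n + 1) t*(bes (n + 2) t - bes n t)"
proof -
 have "bamp (n + 1) t - bamp n t = (t*(bes n t + bes (n + 2) t))*(bes (n + 2) t - bes n t)" by (simp add: bamp_def power2_eq_square algebra_simps)
 also have "t*(bes n t + bes (n + 2) t) = 2 * of_int (n + 1)*bes (n + 1) t" using bes_rec[of t "n + 1"] by (simp add: add.commute)
 finally show ?thesis .
qed

text \<open>Induction on the order: by \<open>bamp_diff\<close> consecutive amplitudes differ by a
  term with the factor J_{n+1}, which tends to 0 once the amplitude of order n is bounded.\<close>

lemma bamp_eventually:
 assumes "0 < e" shows "\<forall>\<^sub>F t in at_top. bamp (int n) t <= 3/4 + e" using assms
proof (induction n arbitrary: e)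
 case 0
 have "\<forall>\<^sub>F t in at_top. bamp 0 t <= 3/4 + 1" using eventually_ge_at_top[of 1]
 proof eventually_elim
  case (elim t)
  show ?case using bamp_0_le[OF elim] abs_bes_le_1[of 0 t] by linarith
 qed
 from bes_tendsto_0_if_bamp(1)[OF this]
 have "\<forall>\<^sub>F t in at_top. \<bar>bes 0 t\<bar> < e" using 0 by (auto simp: tendsto_iff dist_real_def)
 thus ?case using eventually_ge_at_top[of 1]
 proof eventually_elim
  case (elim t)
  show ?case using bamp_0_le[OF elim(2)] elim(1) by simp
 qed
next
 case (Suc n)
 have "((%t. 2 * of_int (int n + 1)*bes (int n + 1) t*2) \<longlongrightarrow> 2 * of_int (int n + 1)*0*2) at_top"
  by (intro tendsto_intros bes_tendsto_0_if_bamp(2)[OF Suc.IH[of 1]]) auto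
 from tendstoD[OF this, of "e/2"]
 have "\<forall>\<^sub>F t in at_top. \<bar>2 * of_int (int n + 1)*bes (int n + 1) t*2\<bar> < e/2" using Suc.prems by (simp add: dist_real_def)
 thus ?case using Suc.IH[of "e/2", simplified, OF Suc.prems]
 proof eventually_elim
  case (elim t)
  have "bamp (int n + 1) t - bamp (int n) t <= \<bar>2 * of_int (int n + 1)*bes (int n + 1) t*(bes (int n + 2) t - bes (int n) t)\<bar>"
   unfolding bamp_diff by simp
  also have "... <= \<bar>2 * of_int (int n + 1)*bes (int n + 1) t\<bar>*2" unfolding abs_mult[of _ "_ - _"]
   using abs_bes_le_1[of "int n + 2" t] abs_bes_le_1[of "int n" t] by (intro mult_left_mono) auto
  also have "... < e/2" using elim(1) by (simp add: abs_mult)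
  finally show ?case using elim(2) by (simp add: add.commute)
 qed
qed

text \<open>This and the next lemma are the field arithmetic behind the derivatives of
  \<open>w\<close> and \<open>S\<close> in \<open>bes_oscillatory\<close>, with J, B and q (or Q^2)
  for \<open>bes n\<close>, \<open>besd n\<close> and t^2 - x^2.\<close>

lemma sonin_alg1:
 fixes q r x J B :: real
 assumes "q ~= 0" "r ~= 0" "x^2 = r^2 - q" shows "(x^2 - r^2)/r*J + ((2*r*J + r^2*(B/r))*(2*q) - r^2*J*(2*(2*r)))/((2*q)*(2*q))
  = r/(2*q)*(B + r^2*J/(2*q)) - q/r*(1 + (r^4/4 + x^2*r^2)/q^3)*J"
proof -
 have "(x^2 - r^2)/r*J = - q/r*J" using assms by simp
 moreover have "((2*r*J + r^2*(B/r))*(2*q) - r^2*J*(2*(2*r)))/((2*q)*(2*q)) = r*J/q + r*B/(2*q) - r^3*J/q^2"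
  using assms by (simp add: field_simps power2_eq_square power3_eq_cube)
 moreover have "r/(2*q)*(B + r^2*J/(2*q)) = r*B/(2*q) + r^3*J/(4*q^2)" using assms by (simp add: field_simps power2_eq_square power3_eq_cube)
 moreover have "q/r*(1 + (r^4/4 + x^2*r^2)/q^3)*J = q/r*J + (r^3/4 + x^2*r)/q^2*J"
  using assms by (simp add: field_simps power2_eq_square power3_eq_cube power4_eq_xxxx)
 moreover have "(r^3/4 + x^2*r)/q^2*J = r^3*J/(4*q^2) + r^3*J/q^2 - r*J/q"
  unfolding assms(3) using assms by (simp add: field_simps power2_eq_square power3_eq_cube)
 ultimately show ?thesis by simp
qed

lemma sonin_alg2:
 fixes Q r J w g g' :: real
 assumes "Q ~= 0" "r ~= 0" "g ~= 0" shows "(r/Q)*J^2 + Q*(2*J*((w - r^2*J/(2*(Q*Q)))/r))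
    + (2*w*(r/(2*(Q*Q))*w - Q*Q/r*g*J)*(Q*g) - w^2*(r/Q*g + Q*g'))/((Q*g)*(Q*g)) = w^2*(- g')/(Q*g^2)"
proof -
 have "Q*(2*J*((w - r^2*J/(2*(Q*Q)))/r)) = 2*Q*J*w/r - r*J^2/Q" using assms by (simp add: field_simps power2_eq_square)
 moreover have "2*w*(r/(2*(Q*Q))*w - Q*Q/r*g*J)*(Q*g) = w^2*(r/Q*g) - (2*Q*J*w/r)*((Q*g)*(Q*g))"
  using assms by (simp add: field_simps power2_eq_square)
 moreover have "(w^2*(r/Q*g) - (2*Q*J*w/r)*((Q*g)*(Q*g)) - w^2*(r/Q*g + Q*g'))/((Q*g)*(Q*g)) = - (2*Q*J*w/r) - w^2*(Q*g')/((Q*g)*(Q*g))"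
  using assms by (simp add: distrib_left diff_divide_distrib)
 moreover have "w^2*(Q*g')/((Q*g)*(Q*g)) = w^2*g'/(Q*g^2)" using assms by (simp add: power2_eq_square mult_ac)
 ultimately show ?thesis by simp
qed
text \<open>In the variable \<open>s\<close> with \<open>ds = sqrt (t\<^sup>2 - x\<^sup>2) dt / t\<close> the function
  \<open>u = (t\<^sup>2 - x\<^sup>2)\<^sup>1\<^sup>/\<^sup>4 * bes n t\<close> solves \<open>u'' + g u = 0\<close> with \<open>g\<close> decreasing to 1.
  Hence \<open>u\<^sup>2 + u'\<^sup>2 / g\<close> increases to the squared amplitude at infinity.\<close>

lemma bes_oscillatory:
 fixes n :: nat and t :: real
 assumes "real n < t" shows "sqrt (t^2 - (real n)^2)*(bes n t)^2 <= 3/4"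
proof -
 define x where "x = real n"
 have x0: "0 <= x" by (simp add: x_def)
 define q where "q = (%t. t^2 - x^2)"
 define g where "g = (%t. 1 + (t^4/4 + x^2*t^2)/(q t)^3)"
 \<comment> \<open>In the variable s one has u' = (t^2 - x^2)^(-1/4) \<open>w\<close>, hence
   \<open>S\<close> is u^2 + u'^2 / g.\<close>
 define w where "w = (%t. besd n t + t^2*bes n t/(2*q t))"
 define S where "S = (%t. sqrt (q t)*(bes n t)^2 + (w t)^2/(sqrt (q t)*g t))"
 have qpos: "0 < q s" if "x < s" for s using that x0 unfolding q_def by (simp add: power_strict_mono)
 have g1: "1 <= g s" if "x < s" for s using qpos[OF that] unfolding g_def by simp
 have mono: "S s <= S t'" if "x < s" "s <= t'" for s t'
 proof (rule DERIV_nonneg_imp_nondecreasing[OF \<open>s <= t'\<close>], intro exI conjI)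
  fix r assume "s <= r"
  hence xr: "x < r" using that by simp
  have r0: "r > 0" using xr x0 by simp
  have q0: "0 < q r" by (rule qpos[OF xr])
  define Q where "Q = sqrt (q r)"
  have Q0: "Q > 0" and QQ: "Q*Q = q r" using q0 by (auto simp: Q_def)
  define g' where "g' = - r*(r^4/2 + 5*x^2*r^2 + 2*x^4)/(q r)^4"
  have dq: "(q has_real_derivative 2*r) (at r)" unfolding q_def by (auto intro!: derivative_eq_intros)
  have dQ: "((%t. sqrt (q t)) has_real_derivative r/Q) (at r)" using DERIV_chain2[OF DERIV_real_sqrt[OF q0] dq] by (simp add: Q_def field_simps)
  have dg: "(g has_real_derivative g') (at r)"
  proof -
   have "(g has_real_derivative ((r^3 + 2*x^2*r)*(q r)^3 - (r^4/4 + x^2*r^2)*(3*(q r)^2*(2*r))) / ((q r)^3*(q r)^3)) (at r)" unfolding g_def using q0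
    by (auto intro!: derivative_eq_intros dq simp: power2_eq_square power3_eq_cube)
   moreover have "((r^3 + 2*x^2*r)*(q r)^3 - (r^4/4 + x^2*r^2)*(3*(q r)^2*(2*r)))
     / ((q r)^3*(q r)^3) = ((r^3 + 2*x^2*r)*q r - (r^4/4 + x^2*r^2)*(6*r))/(q r)^4"
    using q0 by (simp add: field_simps power2_eq_square power3_eq_cube power4_eq_xxxx)
   moreover have "(r^3 + 2*x^2*r)*q r - (r^4/4 + x^2*r^2)*(6*r) = - r*(r^4/2 + 5*x^2*r^2 + 2*x^4)"
    by (simp add: q_def field_simps power2_eq_square power3_eq_cube power4_eq_xxxx)
   ultimately show ?thesis by (simp add: g'_def)
  qed
  define J where "J = bes n r"
  define w' where "w' = r/(2*q r)*w r - q r/r*g r*J"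
  have dw: "(w has_real_derivative w') (at r)"
  proof -
   have "(w has_real_derivative (x^2 - r^2)/r*J + ((2*r*J + r^2*(besd n r/r))*(2*q r) - r^2*J*(2*(2*r))) / ((2*q r)*(2*q r))) (at r)"
    unfolding w_def J_def x_def using q0 r0 by (auto intro!: derivative_eq_intros dq[unfolded x_def] bes_deriv' besd_deriv simp: x_def)
   moreover have "(x^2 - r^2)/r*J + ((2*r*J + r^2*(besd n r/r))*(2*q r) - r^2*J*(2*(2*r))) / ((2*q r)*(2*q r)) = w'"
   proof -
    have e: "x^2 = r^2 - q r" by (simp add: q_def)
    show ?thesis unfolding w'_def w_def g_def J_def[symmetric] by (rule sonin_alg1[OF _ _ e]) (use q0 r0 in auto)
   qed
   ultimately show ?thesis by simp
  qed
  have g0: "g r > 0" using g1[OF xr] by simp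
  have dS: "(S has_real_derivative (r/Q)*J^2 + Q*(2*J*(besd n r/r)) + (2*w r*w'*(Q*g r) - (w r)^2*(r/Q*g r + Q*g'))/((Q*g r)*(Q*g r))) (at r)"
  proof -
   define R where "R = (%t. sqrt (q t))"
   have dR: "(R has_real_derivative r/Q) (at r)" and RQ: "R r = Q" using dQ by (auto simp: R_def Q_def)
   have SR: "S = (%t. R t*(bes n t)^2 + (w t)^2/(R t*g t))" by (simp add: S_def R_def)
   show ?thesis unfolding SR J_def using Q0 g0 r0 by (auto intro!: derivative_eq_intros dR dw dg bes_deriv' simp: RQ mult_ac)
  qed
  have eq: "(r/Q)*J^2 + Q*(2*J*(besd n r/r)) + (2*w r*w'*(Q*g r) - (w r)^2*(r/Q*g r + Q*g'))/((Q*g r)*(Q*g r)) = (w r)^2*(- g')/(Q*(g r)^2)"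
  proof -
   have b: "besd n r = w r - r^2*J/(2*(Q*Q))" unfolding QQ by (simp add: w_def J_def)
   show ?thesis unfolding b w'_def QQ[symmetric] by (rule sonin_alg2) (use Q0 g0 r0 in auto)
  qed
  have "0 <= r^4/2 + 5*x^2*r^2 + 2*x^4" by simp
  hence "0 <= - g'" unfolding g'_def using r0 q0 by simp
  thus "0 <= (w r)^2*(- g')/(Q*(g r)^2)" by (intro divide_nonneg_nonneg mult_nonneg_nonneg) (use Q0 in auto)
  show "(S has_real_derivative (w r)^2*(- g')/(Q*(g r)^2)) (at r)" using dS unfolding eq .
 qed
 \<comment> \<open>Since \<open>S\<close> increases, S t <= S s for every large s. There S s exceeds
   \<open>bamp n s\<close> at most by terms with a factor J_n(s), which tends to 0, and by the
   factor s/(s - x), which tends to 1.\<close>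
 have lim: "S t <= 3/4 + e" if "0 < e" for e
 proof -
  have amp: "\<forall>\<^sub>F s in at_top. bamp n s <= 3/4 + e/2" using bamp_eventually[of "e/2" n] that by simp
  note J0 = bes_tendsto_0_if_bamp[OF amp]
  have "((%s. 2*(x + 1)*\<bar>bes n s\<bar> + (x + 1)^2*\<bar>bes n s\<bar>) \<longlongrightarrow> 2*(x + 1)*\<bar>0\<bar> + (x + 1)^2*\<bar>0\<bar>) at_top"
   by (intro tendsto_intros J0)
  from tendstoD[OF this, of "e/2"]
  have small: "\<forall>\<^sub>F s in at_top. 2*(x + 1)*\<bar>bes n s\<bar> + (x + 1)^2*\<bar>bes n s\<bar> < e/2"
   using that x0 by (simp add: dist_real_def)
  have "\<forall>\<^sub>F s in at_top. S t <= s/(s - x)*(3/4 + e)" using amp small eventually_ge_at_top[of "max t (2*x + 1)"]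
  proof eventually_elim
   case (elim s)
   have xs: "x < s" and s1: "1 <= s" and ts: "t <= s" and s2: "2*x <= s" using elim(3) x0 by auto
   define J where "J = bes n s"
   define K where "K = bes (n + 1) s"
   define m where "m = x + s^2/(2*q s)"
   have q0: "0 < q s" by (rule qpos[OF xs])
   have "4*x^2 <= s^2" using power_mono[OF s2, of 2] x0 by (simp add: power_mult_distrib)
   hence "s^2 <= 2*q s" unfolding q_def by (smt (verit) zero_le_power2)
   hence m: "0 <= m" "m <= x + 1" using q0 x0 by (auto simp: m_def)
   have w: "w s = m*J - s*K" using q0 by (simp add: w_def besd_def m_def J_def K_def x_def algebra_simps)
   have JK: "\<bar>J\<bar> <= 1" "\<bar>K\<bar> <= 1" unfolding J_def K_def by (rule abs_bes_le_1)+
   have "(w s)^2 / s = s*K^2 - 2*m*(J*K) + m^2*J^2 / s" unfolding w using s1 by (simp add: field_simps power2_eq_square)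
   moreover have "- (2*m*(J*K)) <= 2*(x + 1)*\<bar>J\<bar>"
   proof -
    have "- (2*m*(J*K)) <= \<bar>2*m*(J*K)\<bar>" by simp
    also have "... = 2*m*(\<bar>J\<bar>*\<bar>K\<bar>)" using m by (simp add: abs_mult)
    also have "... <= 2*(x + 1)*(\<bar>J\<bar>*1)" using m JK by (intro mult_mono) auto
    finally show ?thesis by simp
   qed
   moreover have "m^2*J^2 / s <= (x + 1)^2*\<bar>J\<bar>"
   proof -
    have "m^2*J^2 / s <= m^2*J^2/1" using s1 by (intro divide_left_mono) auto
    also have "... <= (x + 1)^2*(\<bar>J\<bar>*\<bar>J\<bar>)" using m by (simp add: power2_eq_square mult_mono)
    also have "... <= (x + 1)^2*(\<bar>J\<bar>*1)" using JK by (intro mult_left_mono) auto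
    finally show ?thesis by simp
   qed
   ultimately have ws: "s*J^2 + (w s)^2 / s <= 3/4 + e" using elim(1,2) by (simp add: bamp_def J_def K_def algebra_simps)
   define Q where "Q = sqrt (q s)"
   have Q0: "0 < Q" using q0 by (simp add: Q_def)
   have Qs: "Q <= s" unfolding Q_def q_def using s1 by (intro real_le_lsqrt) auto
   have sQ: "s - x <= Q"
   proof -
    have "(s - x)^2 = (s - x)*(s - x)" by (rule power2_eq_square)
    also have "... <= (s - x)*(s + x)" using xs x0 by (intro mult_left_mono) auto
    also have "... = q s" by (simp add: q_def power2_eq_square algebra_simps)
    finally show ?thesis unfolding Q_def by (rule real_le_rsqrt)
   qed
   have "S t <= S s" using mono[OF _ ts] assms by (simp add: x_def)
   also have "S s = Q*J^2 + (w s)^2/(Q*g s)" by (simp add: S_def Q_def J_def)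
   also have "... <= s/Q*(s*J^2) + s/Q*((w s)^2 / s)"
   proof (rule add_mono)
    have "Q*Q <= s * s" using Q0 Qs by (intro mult_mono) auto
    hence "Q <= s * s/Q" using Q0 by (simp add: field_simps)
    thus "Q*J^2 <= s/Q*(s*J^2)" using mult_right_mono[of Q "s * s/Q" "J^2"] by simp
    have "(w s)^2/(Q*g s) <= (w s)^2/(Q*1)" using Q0 g1[OF xs] by (intro divide_left_mono mult_left_mono) (auto intro!: mult_pos_pos)
    thus "(w s)^2/(Q*g s) <= s/Q*((w s)^2 / s)" using s1 by simp
   qed
   also have "... = s/Q*(s*J^2 + (w s)^2 / s)" by (simp add: distrib_left)
   also have "... <= s/(s - x)*(3/4 + e)" using ws s1 xs sQ Q0 that by (intro mult_mono divide_left_mono) (auto intro!: add_nonneg_nonneg)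
   finally show ?case .
  qed
  moreover have "((%s. s/(s - x)*(3/4 + e)) \<longlongrightarrow> 1*(3/4 + e)) at_top"
  proof (intro tendsto_intros)
   have "((%s. 1 + x*inverse (s - x)) \<longlongrightarrow> 1 + x*0) at_top" by (intro tendsto_intros tendsto_inverse_0_at_top)
     (auto intro!: filterlim_tendsto_add_at_top[of "%_. - x", unfolded add.commute[of "- x"], simplified]
      tendsto_const filterlim_ident)
   hence "((%s. 1 + x*inverse (s - x)) \<longlongrightarrow> 1) at_top" by simp
   thus "((%s. s/(s - x)) \<longlongrightarrow> 1) at_top"
   proof (rule Lim_transform_eventually)
    show "\<forall>\<^sub>F s in at_top. 1 + x*inverse (s - x) = s/(s - x)"
     using eventually_gt_at_top[of x] by eventually_elim (simp add: field_simps)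
   qed
  qed
  ultimately show ?thesis using tendsto_lowerbound[of "%s. s/(s - x)*(3/4 + e)"] by fastforce
 qed
 have "sqrt (q t)*(bes n t)^2 <= S t" using qpos[of t] g1[of t] assms unfolding S_def x_def by (simp add: order_trans[OF zero_le_one])
 also have "... <= 3/4" using lim field_le_epsilon by blast
 finally show ?thesis by (simp add: q_def x_def)
qed

text \<open>Van der Corput: on \<open>[L, pi]\<close> the phase has the monotone derivative \<open>x - t cos \<theta> \<ge> m\<close>.\<close>

lemma bes_van_der_corput:
 fixes n :: nat
 assumes L: "0 <= L" "L <= pi" and t: "0 <= t" and m: "0 < m" "m <= real n - t * cos L" shows "pi*\<bar>bes n t\<bar> <= L + 2/m"
proof -
 let ?p = "%th. real n*th - t * sin th"
 let ?d = "%th. real n - t * cos th"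
 have d: "m <= ?d th" if "th \<in> {L..pi}" for th
 proof -
  have "cos th <= cos L" using that L by (intro cos_monotone_0_pi_le) auto
  hence "t * cos th <= t * cos L" using t by (rule mult_left_mono)
  thus ?thesis using m by simp
 qed
 have d0: "?d th ~= 0" if "th \<in> {L..pi}" for th using d[OF that] m by auto
 have 1: "((%th. t * sin th/(?d th)^2) has_integral (- 1/?d pi) - (- 1/?d L)) {L..pi}" by (rule fundamental_theorem_of_calculus[OF L(2)])
   (use d0 in \<open>auto intro!: derivative_eq_intros simp: power2_eq_square has_real_derivative_iff_has_vector_derivative[symmetric]\<close>)
 \<comment> \<open>The derivative of sin(phase)/phase'. The integration by parts leaves boundary
   terms and the variation of 1/phase', which telescopes because phase' is increasing on
   [0, pi].\<close>
 have 2: "((%th. cos (?p th) - sin (?p th)*(t * sin th)/(?d th)^2) has_integral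
   sin (?p pi)/?d pi - sin (?p L)/?d L) {L..pi}" by (rule fundamental_theorem_of_calculus[OF L(2)])
   (use d0 in \<open>auto intro!: derivative_eq_intros simp: power2_eq_square has_real_derivative_iff_has_vector_derivative[symmetric]
    diff_divide_distrib mult.commute[of t "cos _"] mult.commute[of t "sin _"]\<close>)
 have 3: "(%th. sin (?p th)*(t * sin th)/(?d th)^2) integrable_on {L..pi}" by (intro integrable_continuous_real continuous_intros) (use d0 in auto)
 have "norm (integral {L..pi} (%th. sin (?p th)*(t * sin th)/(?d th)^2)) <= integral {L..pi} (%th. t * sin th/(?d th)^2)"
 proof (rule integral_norm_bound_integral[OF 3 has_integral_integrable[OF 1]])
  fix th assume th: "th \<in> {L..pi}"
  hence "0 <= t * sin th" using L t by (auto intro!: mult_nonneg_nonneg sin_ge_zero)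
  moreover have "\<bar>sin (?p th)\<bar>*(t * sin th) <= 1*(t * sin th)" using calculation by (intro mult_right_mono) auto
  ultimately show "norm (sin (?p th)*(t * sin th)/(?d th)^2) <= t * sin th/(?d th)^2"
   by (simp only: real_norm_def abs_divide abs_mult[of _ "t * sin th"]) (simp add: divide_right_mono)
 qed
 hence 4: "\<bar>integral {L..pi} (%th. sin (?p th)*(t * sin th)/(?d th)^2)\<bar> <= 1/?d L - 1/?d pi" using integral_unique[OF 1] by simp
 have "integral {L..pi} (%th. cos (?p th)) =
   integral {L..pi} (%th. cos (?p th) - sin (?p th)*(t * sin th)/(?d th)^2) + integral {L..pi} (%th. sin (?p th)*(t * sin th)/(?d th)^2)"
  by (subst integral_add[symmetric]) (use 2 3 in \<open>auto intro: has_integral_integrable\<close>)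
 also have "integral {L..pi} (%th. cos (?p th) - sin (?p th)*(t * sin th)/(?d th)^2)
   = sin (?p pi)/?d pi - sin (?p L)/?d L" by (rule integral_unique[OF 2])
 finally have "\<bar>integral {L..pi} (%th. cos (?p th))\<bar> <= \<bar>sin (?p pi)/?d pi\<bar> + \<bar>sin (?p L)/?d L\<bar> + (1/?d L - 1/?d pi)"
  using 4 by linarith
 also have "... <= 1/?d pi + 1/?d L + (1/?d L - 1/?d pi)"
  using d[of pi] d[of L] L m by (intro add_mono order_refl) (auto simp: abs_divide intro!: divide_right_mono)
 also have "... = 2/?d L" by simp
 also have "... <= 2/m" using d[of L] L m by (intro divide_left_mono) auto
 finally have b: "\<bar>integral {L..pi} (%th. cos (?p th))\<bar> <= 2/m" .
 have "norm (integral {0..L} (%th. cos (?p th))) <= integral {0..L} (%_. 1)" by (rule integral_norm_bound_integral) (auto intro: bes_integrable)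
 hence a: "\<bar>integral {0..L} (%th. cos (?p th))\<bar> <= L" using L by simp
 have "pi*bes n t = integral {0..pi} (%th. cos (?p th))" by (simp add: bes_def)
 also have "... = integral {0..L} (%th. cos (?p th)) + integral {L..pi} (%th. cos (?p th))"
  by (rule Henstock_Kurzweil_Integration.integral_combine[symmetric]) (use L bes_integrable in auto)
 finally have "\<bar>pi*bes n t\<bar> <= L + 2/m" using a b by linarith
 thus ?thesis by (simp add: abs_mult)
qed

section \<open>The uniform bound of order t^(-1/3)\<close>

lemma one_minus_cos_ge:
 assumes "0 <= L" "L <= 2" shows "L^2/3 <= 1 - cos (L::real)"
proof -
 have "L^4 = L^2*L^2" by (simp add: power4_eq_xxxx power2_eq_square)
 also have "... <= L^2*4" using power_mono[OF assms(2,1), of 2] by (intro mult_left_mono) auto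
 finally show ?thesis using cos_le_quartic[of L] by simp
qed

lemma cube_root_powers:
 assumes "0 < (t::real)" shows "0 < t powr (1/3)" "(t powr (1/3))^3 = t" "t powr (-1/3) = 1/t powr (1/3)"
proof -
 show "0 < t powr (1/3)" using assms by simp
 show "(t powr (1/3))^3 = t" using assms by (simp add: powr_realpow[symmetric] powr_powr)
 show "t powr (-1/3) = 1/t powr (1/3)" using powr_minus_divide[of t "1/3"] by simp
qed

text \<open>Van der Corput with L = 2 n^(-1/3), which balances L against 2/m for m of order n L^2.
  The outcome is 7/(2 pi) n^(-1/3), and 9/8 is a rational above 7/(2 pi).\<close>

lemma bes_turning_point:
 assumes "1 <= n" shows "\<bar>bes (int n) (real n)\<bar> <= 9/8*real n powr (-1/3)"
proof -
 define c where "c = real n powr (1/3)"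
 have n0: "0 < real n" using assms by simp
 have c: "0 < c" "c^3 = real n" "real n powr (-1/3) = 1 / c" using cube_root_powers[OF n0] by (auto simp: c_def)
 have c1: "1 <= c" unfolding c_def using assms by (intro ge_one_powr_ge_zero) auto
 have L: "0 <= 2 / c" "2 / c <= 2" using c c1 by (auto simp: divide_le_eq)
 have "real n*((2 / c)^2/3) <= real n*(1 - cos (2 / c))" by (intro mult_left_mono one_minus_cos_ge L) auto
 moreover have "real n*((2 / c)^2/3) = 4/3 * c" using c(1) unfolding c(2)[symmetric] by (simp add: field_simps power2_eq_square power3_eq_cube)
 ultimately have "4/3 * c <= real n - real n * cos (2 / c)" by (simp add: algebra_simps)
 hence "pi*\<bar>bes (int n) (real n)\<bar> <= 2 / c + 2/(4/3 * c)" using c L pi_gt3 by (intro bes_van_der_corput) auto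
 also have "... = 7/2 / c" using c by (simp add: field_simps)
 also have "... <= pi*(9/8) / c" using c pi_approx by (intro divide_right_mono) auto
 finally have "pi*\<bar>bes (int n) (real n)\<bar> <= pi*(9/8 / c)" by simp
 hence "\<bar>bes (int n) (real n)\<bar> <= 9/8 / c" using pi_gt_zero by (rule mult_left_le_imp_le)
 thus ?thesis unfolding c(3) by simp
qed

text \<open>The threshold t^2 - n^2 = t^(4/3)/4 separates the range near and before the turning
  point, where van der Corput gives 50/(13 pi), from the oscillatory range, where the amplitude
  bound gives sqrt (3/2). Both are just below 5/4. For t <= 1 the trivial bound is better.\<close>

lemma bes_nat_bound:
 assumes t: "0 < t" shows "\<bar>bes (int n) t\<bar> <= 5/4*t powr (-1/3)"
proof -
 define c where "c = t powr (1/3)"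
 have c: "0 < c" "c^3 = t" "t powr (-1/3) = 1 / c" using cube_root_powers[OF t] by (auto simp: c_def)
 have "\<bar>bes (int n) t\<bar> <= 5/4 / c"
 proof (cases "c <= 1")
  case True
  hence "1 <= 5/4 / c" using c by (simp add: field_simps)
  thus ?thesis using abs_bes_le_1[of n t] by linarith
 next
  case False
  hence c1: "1 <= c" by simp
  have t4: "c^4 = t * c" using c(2) by (simp add: power4_eq_xxxx power3_eq_cube)
  show ?thesis
  proof (cases "t^2 - (real n)^2 <= c^4/4")
   case True
   have L: "0 <= 2 / c" "2 / c <= 2" using c c1 by (auto simp: divide_le_eq)
   have "t*((2 / c)^2/3) <= t*(1 - cos (2 / c))" using t by (intro mult_left_mono one_minus_cos_ge L) auto
   moreover have "t*((2 / c)^2/3) = 4/3 * c" using c(1) unfolding c(2)[symmetric] by (simp add: field_simps power2_eq_square power3_eq_cube)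
   moreover have "t - real n <= c/4"
   proof (cases "t <= real n")
    case True thus ?thesis using c by simp
   next
    case False
    have "(t - real n)*t <= (t - real n)*(t + real n)" using False by (intro mult_left_mono) auto
    also have "... = t^2 - (real n)^2" by (simp add: power2_eq_square algebra_simps)
    also have "... <= c/4*t" using True t4 by (simp add: mult.commute)
    finally show ?thesis using t by (rule mult_right_le_imp_le)
   qed
   ultimately have "13/12 * c <= real n - t * cos (2 / c)" by (simp add: algebra_simps)
   hence "pi*\<bar>bes (int n) t\<bar> <= 2 / c + 2/(13/12 * c)" using c L t pi_gt3 by (intro bes_van_der_corput) auto
   also have "... = 50/13 / c" using c by (simp add: field_simps)
   also have "... <= pi*(5/4) / c" using c pi_approx by (intro divide_right_mono) auto
   finally have "pi*\<bar>bes (int n) t\<bar> <= pi*(5/4 / c)" by simp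
   thus "\<bar>bes (int n) t\<bar> <= 5/4 / c" using pi_gt_zero by (rule mult_left_le_imp_le)
  next
   case False
   have "(c^2/2)^2 <= t^2 - (real n)^2" using False by (simp add: power_divide flip: power_mult)
   hence 1: "c^2/2 <= sqrt (t^2 - (real n)^2)" by (rule real_le_rsqrt)
   have "0 < c^4" using c by simp
   hence "(real n)^2 < t^2" using False by linarith
   hence "real n < t" using t by (simp add: power2_less_imp_less)
   from bes_oscillatory[OF this] have "sqrt (t^2 - (real n)^2)*(bes n t)^2 <= 3/4" .
   hence "c^2/2*(bes n t)^2 <= 3/4" using mult_right_mono[OF 1, of "(bes n t)^2"] by simp
   hence "(c*\<bar>bes n t\<bar>)^2 <= (5/4)^2" by (simp add: power_mult_distrib power_divide)
   hence "c*\<bar>bes n t\<bar> <= 5/4" by (rule power2_le_imp_le) simp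
   thus ?thesis using c by (simp add: field_simps)
  qed
 qed
 thus ?thesis unfolding c(3) by simp
qed

lemma bes_uniform_bound: "0 < t ==> \<bar>bes n t\<bar> <= 5/4*t powr (-1/3)"
 using bes_nat_bound[of t "nat \<bar>n\<bar>"] abs_bes_abs[of n t] by simp

section \<open>Fourier series in the angle and sums of fourth powers over the order\<close>

lemma integral_reflect_at:
 fixes f :: "real => real"
 assumes "continuous_on {c - b..c - a} f" shows "integral {a..b} (%x. f (c - x)) = integral {c - b..c - a} f"
proof -
 have "(f has_integral integral {c - b..c - a} f) (cbox (c - b) (c - a))" using assms integrable_continuous_real integrable_integral by fastforce
 from has_integral_affinity[OF this, of "-1" c]
 have "((%x. f (c - x)) has_integral integral {c - b..c - a} f) ((%x. c - x) ` {c - b..c - a})" by simp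
 moreover have "(%x. c - x) ` {c - b..c - a} = {a..b}" by (auto simp: image_iff intro!: bexI[of _ "c - x" for x])
 ultimately show ?thesis by (simp add: integral_unique)
qed

text \<open>With an antiderivative G on a large interval, G (r + 2 pi) - G r has derivative f (r + 2
  pi) - f r = 0 in r, hence does not depend on r.\<close>

lemma integral_periodic_shift:
 fixes f :: "real => real"
 assumes c: "continuous_on UNIV f" and per: "!!x. f (x + 2*pi) = f x" shows "integral {0..2*pi} (%x. f (x + s)) = integral {0..2*pi} f"
proof -
 define B where "B = \<bar>s\<bar> + 2*pi + 1"
 have "continuous_on {-B..B} f" using c continuous_on_subset by blast
 then obtain G where G: "!!x. x \<in> {-B..B} ==> (G has_vector_derivative f x) (at x within {-B..B})" using antiderivative_continuous by blast
 have G': "(G has_real_derivative f x) (at x)" if "x \<in> {-B<..<B}" for x using G[of x] that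
  by (simp add: has_real_derivative_iff_has_vector_derivative at_within_interior[of x "{-B..B}"])
 have I: "integral {0..2*pi} (%x. f (x + r)) = G (r + 2*pi) - G r" if "\<bar>r\<bar> <= \<bar>s\<bar>" for r
 proof (rule integral_unique)
  have "((%x. f (x + r)) has_integral G (2*pi + r) - G (0 + r)) {0..2*pi}"
  proof (rule fundamental_theorem_of_calculus)
   fix x assume x: "x \<in> {0..2*pi}"
   have "x + r \<in> {-B<..<B}" using that x abs_ge_self[of r] abs_ge_minus_self[of r] by (auto simp: B_def)
   hence "((%x. G (x + r)) has_real_derivative f (x + r)) (at x)" using DERIV_shift[of G "f (x + r)" x r] G'[of "x + r"] by auto
   thus "((%x. G (x + r)) has_vector_derivative f (x + r)) (at x within {0..2*pi})"
    by (simp add: has_real_derivative_iff_has_vector_derivative has_vector_derivative_at_within)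
  qed simp
  thus "((%x. f (x + r)) has_integral G (r + 2*pi) - G r) {0..2*pi}" by (simp add: add.commute)
 qed
 have "\<exists>c. \<forall>r\<in>{-\<bar>s\<bar>..\<bar>s\<bar>}. G (r + 2*pi) - G r = c"
 proof (rule has_derivative_zero_constant)
  fix r assume r: "r \<in> {-\<bar>s\<bar>..\<bar>s\<bar>}"
  have "-\<bar>s\<bar> <= r" "r <= \<bar>s\<bar>" using r by auto
  hence "r + 2*pi \<in> {-B<..<B}" "r \<in> {-B<..<B}" unfolding B_def greaterThanLessThan_iff using pi_gt_zero by (intro conjI; linarith)+
  hence "((%r. G (r + 2*pi) - G r) has_real_derivative f (r + 2*pi) - f r) (at r)"
   using DERIV_shift[of G "f (r + 2*pi)" r "2*pi"] by (intro DERIV_diff) (auto intro: G')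
  thus "((%r. G (r + 2*pi) - G r) has_derivative (%h. 0)) (at r within {-\<bar>s\<bar>..\<bar>s\<bar>})"
   by (simp add: per has_field_derivative_def has_derivative_at_withinI lambda_zero)
 qed auto
 hence "G (s + 2*pi) - G s = G (0 + 2*pi) - G 0" by (metis abs_ge_self abs_ge_minus_self abs_ge_zero atLeastAtMost_iff minus_le_iff neg_le_0_iff_le)
 thus ?thesis using I[of s] I[of 0] by simp
qed

lemma bes_full_period: shows "integral {0..2*pi} (%th. cos (of_int n*th - t * sin th)) = 2*pi*bes n t"
  and "integral {0..2*pi} (%th. sin (of_int n*th - t * sin th)) = 0"
proof -
 let ?a = "%th. of_int n*th - t * sin th"
 have e: "?a (2*pi - th) = 2*pi * of_int n - ?a th" for th by (simp add: algebra_simps sin_diff)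
 have "cos (2*pi * of_int n - x) = cos x" "sin (2*pi * of_int n - x) = - sin x" for x by (simp_all add: cos_diff sin_diff)
 hence r: "cos (?a (2*pi - th)) = cos (?a th)" "sin (?a (2*pi - th)) = - sin (?a th)" for th unfolding e by simp_all
 have "integral {0..pi} (%th. cos (?a (2*pi - th))) = integral {2*pi - pi..2*pi - 0} (%th. cos (?a th))"
  by (rule integral_reflect_at) (intro continuous_intros)
 moreover have "integral {0..pi} (%th. cos (?a th)) + integral {pi..2*pi} (%th. cos (?a th)) = integral {0..2*pi} (%th. cos (?a th))"
  by (rule Henstock_Kurzweil_Integration.integral_combine) (auto intro: bes_integrable)
 ultimately show "integral {0..2*pi} (%th. cos (?a th)) = 2*pi*bes n t" unfolding r by (simp add: bes_def)
 have "integral {0..pi} (%th. sin (?a (2*pi - th))) = integral {2*pi - pi..2*pi - 0} (%th. sin (?a th))"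
  by (rule integral_reflect_at) (intro continuous_intros)
 moreover have "integral {0..pi} (%th. sin (?a th)) + integral {pi..2*pi} (%th. sin (?a th)) = integral {0..2*pi} (%th. sin (?a th))"
  by (rule Henstock_Kurzweil_Integration.integral_combine) (auto intro!: integrable_continuous_real continuous_intros)
 ultimately show "integral {0..2*pi} (%th. sin (?a th)) = 0" unfolding r by simp
qed

lemma integral_cos_phase_cos: "integral {0..2*pi} (%ph. cos (a - x * cos (ph + s))) = 2*pi * cos a*bes 0 x"
proof -
 have c: "continuous_on UNIV (%ph. cos (a - x * sin ph))" by (intro continuous_intros)
 have "integral {0..2*pi} (%ph. cos (a - x * cos (ph + s))) = integral {0..2*pi} (%ph. cos (a - x * sin (ph + (s + pi/2))))"
  by (intro integral_cong) (simp add: sin_add cos_add)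
 also have "... = integral {0..2*pi} (%ph. cos (a - x * sin ph))" by (rule integral_periodic_shift[OF c]) simp
 also have "... = integral {0..2*pi} (%ph. cos a * cos (of_int 0*ph - x * sin ph) - sin a * sin (of_int 0*ph - x * sin ph))"
  by (intro integral_cong) (simp add: cos_diff)
 also have "... = cos a*integral {0..2*pi} (%ph. cos (of_int 0*ph - x * sin ph)) - sin a*integral {0..2*pi} (%ph. sin (of_int 0*ph - x * sin ph))"
  by (subst integral_diff) (auto intro!: integrable_continuous_real continuous_intros)
 also have "... = 2*pi * cos a*bes 0 x" unfolding bes_full_period by simp
 finally show ?thesis .
qed

text \<open>Write J_n(t)^2 as a double integral over two angles and pass to their difference \<psi>.
  The difference of the sines is 2 sin (\<psi>/2) times a cosine of the remaining angle, whose
  integration produces J_0.\<close>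

lemma bes_squared_fourier: "integral {0..2*pi} (%ps. cos (of_int n*ps)*bes 0 (2*t * sin (ps/2))) = 2*pi*(bes n t)^2"
proof -
 let ?a = "%th. of_int n*th - t * sin th"
 have int: "(%th. cos (?a th)) integrable_on {0..2*pi}" "(%th. sin (?a th)) integrable_on {0..2*pi}"
  by (auto intro!: integrable_continuous_real continuous_intros)
 have "(2*pi*bes n t)*(2*pi*bes n t) =
   integral {0..2*pi} (%ph. cos (?a ph)*(2*pi*bes n t))"
  using integral_mult_left[of "{0..2*pi}" "%th. cos (?a th)" "2*pi*bes n t"] by (simp add: bes_full_period)
 also have "... = integral {0..2*pi} (%ph. integral {0..2*pi} (%ps. cos (?a (ps + ph) - ?a ph)))"
 proof (rule integral_cong)
  fix ph :: real
  have c: "continuous_on UNIV (%th. cos (?a th - ?a ph))" by (intro continuous_intros)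
  have per: "cos (?a (th + 2*pi) - ?a ph) = cos (?a th - ?a ph)" for th
  proof -
   have "?a (th + 2*pi) - ?a ph = (?a th - ?a ph) + 2*pi * of_int n" unfolding sin_periodic by (simp add: algebra_simps)
   thus ?thesis by (simp only: cos_add) simp
  qed
  have "integral {0..2*pi} (%ps. cos (?a (ps + ph) - ?a ph)) = integral {0..2*pi} (%th. cos (?a th - ?a ph))"
   by (rule integral_periodic_shift[OF c per])
  also have "... = integral {0..2*pi} (%th. cos (?a ph) * cos (?a th) + sin (?a ph) * sin (?a th))"
   by (intro integral_cong) (simp only: cos_diff, simp add: mult.commute)
  also have "... = cos (?a ph)*(2*pi*bes n t)"
   by (subst integral_add) (auto simp: bes_full_period intro!: integrable_continuous_real continuous_intros)
  finally show "cos (?a ph)*(2*pi*bes n t) = integral {0..2*pi} (%ps. cos (?a (ps + ph) - ?a ph))" by simp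
 qed
 also have "... = integral {0..2*pi} (%ps. integral {0..2*pi} (%ph. cos (?a (ps + ph) - ?a ph)))"
 proof -
  have "continuous_on (cbox (0, 0) (2*pi, 2*pi)) (%(ph, ps). cos (?a (ps + ph) - ?a ph))" by (auto intro!: continuous_intros simp: case_prod_unfold)
  from integral_swap_continuous[OF this] show ?thesis by simp
 qed
 also have "... = integral {0..2*pi} (%ps. 2*pi*(cos (of_int n*ps)*bes 0 (2*t * sin (ps/2))))"
 proof (rule integral_cong)
  fix ps :: real
  have "?a (ps + ph) - ?a ph = of_int n*ps - 2*t * sin (ps/2) * cos (ph + ps/2)" for ph
  proof -
   have "sin (ps + ph) - sin ph = 2 * sin (ps/2) * cos (ph + ps/2)"
    using sin_diff_sin[of "ps + ph" ph] by (simp add: add_divide_distrib algebra_simps)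
   hence "t * sin (ps + ph) - t * sin ph = 2*t * sin (ps/2) * cos (ph + ps/2)"
    by (metis (no_types, opaque_lifting) mult.assoc mult.left_commute right_diff_distrib)
   thus ?thesis by (simp add: algebra_simps)
  qed
  thus "integral {0..2*pi} (%ph. cos (?a (ps + ph) - ?a ph)) = 2*pi*(cos (of_int n*ps)*bes 0 (2*t * sin (ps/2)))"
   by (simp only: integral_cos_phase_cos; simp?)
 qed
 finally have "(2*pi)*(2*pi*(bes n t)^2) = (2*pi)*integral {0..2*pi} (%ps. cos (of_int n*ps)*bes 0 (2*t * sin (ps/2)))"
  by (simp add: power2_eq_square mult_ac)
 thus ?thesis by simp
qed

lemma integral_cos_period: "integral {0..2*pi} (%ps. cos (of_int k*ps)) = (if k = 0 then 2*pi else 0)"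
proof (cases "k = 0")
 case False
 have "((%ps. cos (of_int k*ps)) has_integral sin (of_int k*(2*pi)) / of_int k - sin (of_int k*0) / of_int k) {0..2*pi}"
  by (rule fundamental_theorem_of_calculus)
   (use False in \<open>auto intro!: derivative_eq_intros simp: has_real_derivative_iff_has_vector_derivative[symmetric]\<close>)
 moreover have "sin (of_int k*(2*pi)) = 0" by (metis Ints_of_int mult.commute sin_integer_2pi)
 ultimately show ?thesis using False by (simp add: integral_unique)
qed simp

lemma integral_cos_cos: "integral {0..2*pi} (%ps. cos (of_int n*ps) * cos (of_int m*ps)) = pi*((if n = m then 1 else 0) + (if n = - m then 1 else 0))"
proof -
 have "integral {0..2*pi} (%ps. cos (of_int n*ps) * cos (of_int m*ps))
  = integral {0..2*pi} (%ps. (cos (of_int (n - m)*ps) + cos (of_int (n + m)*ps))/2)"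
  by (intro integral_cong) (simp only: cos_times_cos of_int_diff of_int_add left_diff_distrib distrib_right)
 also have "... = (integral {0..2*pi} (%ps. cos (of_int (n - m)*ps)) + integral {0..2*pi} (%ps. cos (of_int (n + m)*ps)))/2"
  by (subst integral_divide, subst integral_add) (auto intro!: integrable_continuous_real continuous_intros)
 finally show ?thesis unfolding integral_cos_period by (auto simp: eq_neg_iff_add_eq_0)
qed

text \<open>Bessel's inequality for the Fourier coefficients \<open>(bes n t)\<^sup>2\<close> of \<open>bes 0 (2 t sin (\<psi>/2))\<close>.\<close>

lemma sum_bes_power4_le_integral: "2*pi*(\<Sum>n\<in>{-int N..int N}. bes n t^4) <= integral {0..2*pi} (%ps. (bes 0 (2*t * sin (ps/2)))^2)"
proof -
 let ?I = "{-int N..int N}"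
 define a where "a = (%n. (bes n t)^2)"
 have aneg: "a (- n) = a n" for n unfolding a_def by (metis abs_bes_minus power2_abs)
 define s where "s = (%ps. \<Sum>n\<in>?I. a n * cos (of_int n*ps))"
 define g where "g = (%ps. bes 0 (2*t * sin (ps/2)))"
 have cg: "continuous_on S g" for S unfolding g_def by (rule continuous_on_compose2[OF bes_continuous[of UNIV]]) (auto intro!: continuous_intros)
 have cs: "continuous_on S s" for S unfolding s_def by (intro continuous_intros)
 have "integral {0..2*pi} (%ps. s ps*g ps) = (\<Sum>n\<in>?I. a n*integral {0..2*pi} (%ps. cos (of_int n*ps)*g ps))"
  unfolding s_def sum_distrib_right mult.assoc by (subst integral_sum) (auto intro!: integrable_continuous_real continuous_intros cg)
 also have "... = 2*pi*(\<Sum>n\<in>?I. bes n t^4)" unfolding g_def bes_squared_fourier sum_distrib_left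
  by (intro sum.cong) (auto simp: a_def power4_eq_xxxx power2_eq_square)
 finally have sg: "integral {0..2*pi} (%ps. s ps*g ps) = 2*pi*(\<Sum>n\<in>?I. bes n t^4)" .
 have "integral {0..2*pi} (%ps. s ps * s ps) =
   integral {0..2*pi} (%ps. \<Sum>n\<in>?I. \<Sum>m\<in>?I. a n*a m*(cos (of_int n*ps) * cos (of_int m*ps)))"
  unfolding s_def sum_product by (intro integral_cong sum.cong) auto
 also have "... = (\<Sum>n\<in>?I. \<Sum>m\<in>?I. a n*a m*(pi*((if n = m then 1 else 0) + (if n = - m then 1 else 0))))"
 proof -
  have "integral {0..2*pi} (%ps. \<Sum>n\<in>?I. \<Sum>m\<in>?I. a n*a m*(cos (of_int n*ps) * cos (of_int m*ps)))
   = (\<Sum>n\<in>?I. integral {0..2*pi} (%ps. \<Sum>m\<in>?I. a n*a m*(cos (of_int n*ps) * cos (of_int m*ps))))"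
   by (rule integral_sum) (auto intro!: integrable_continuous_real continuous_intros)
  also have "... = (\<Sum>n\<in>?I. \<Sum>m\<in>?I. integral {0..2*pi} (%ps. a n*a m*(cos (of_int n*ps) * cos (of_int m*ps))))"
   by (intro sum.cong refl integral_sum) (auto intro!: integrable_continuous_real continuous_intros)
  finally show ?thesis by (simp add: integral_cos_cos)
 qed
 also have "... = (\<Sum>n\<in>?I. 2*pi*(a n)^2)"
 proof (rule sum.cong[OF refl])
  fix n assume n: "n \<in> ?I"
  have "(\<Sum>m\<in>?I. a n*a m*(pi*((if n = m then 1 else 0) + (if n = - m then 1 else 0))))
   = (\<Sum>m\<in>?I. if n = m then pi*(a n*a m) else 0) + (\<Sum>m\<in>?I. if m = - n then pi*(a n*a m) else 0)"
   unfolding sum.distrib[symmetric] by (intro sum.cong) (auto simp: algebra_simps)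
  also have "... = pi*(a n*a n) + pi*(a n*a (- n))" using n by (simp add: sum.delta sum.delta')
  finally show "(\<Sum>m\<in>?I. a n*a m*(pi*((if n = m then 1 else 0) + (if n = - m then 1 else 0)))) = 2*pi*(a n)^2"
   by (simp add: aneg power2_eq_square)
 qed
 also have "... = 2*pi*(\<Sum>n\<in>?I. bes n t^4)" by (simp add: a_def sum_distrib_left flip: power_mult)
 finally have ss: "integral {0..2*pi} (%ps. s ps * s ps) = 2*pi*(\<Sum>n\<in>?I. bes n t^4)" .
 have "integral {0..2*pi} (%ps. s ps*g ps) <= integral {0..2*pi} (%ps. (s ps * s ps + (g ps)^2)/2)"
 proof (rule integral_le)
  show "s x*g x <= (s x * s x + (g x)^2)/2" for x using sum_squares_bound[of "s x" "g x"] by (simp add: power2_eq_square)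
 qed (auto intro!: integrable_continuous_real continuous_intros cg cs)
 also have "... = (integral {0..2*pi} (%ps. s ps * s ps) + integral {0..2*pi} (%ps. (g ps)^2))/2"
  by (subst integral_divide, subst integral_add) (auto intro!: integrable_continuous_real continuous_intros cg cs)
 finally show ?thesis unfolding sg ss by (simp add: g_def)
qed

lemma bes_0_squared_le: "0 < x ==> (bes 0 x)^2 <= 3/4/x" using bes_oscillatory[of 0 x] by (simp add: field_simps)

text \<open>A bound for the mean of J_0(2 t sin (\<psi>/2))^2 over [0, pi], which by Bessel's
  inequality dominates the sum over n of J_n(t)^4: the trivial bound 1 for small t, and otherwise
  the result of a decay like 1/(t \<psi>), whose integral brings in the logarithm.\<close>

definition bmaj :: "real => real" where "bmaj t = (if t <= 1/2 then 1 else (1 + ln (2*t))/(2*t))"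

lemma sum_bes_power4_le:
 assumes t: "0 < t" shows "(\<Sum>n\<in>{-int N..int N}. bes n t^4) <= bmaj t"
proof -
 define h where "h = (%ps. (bes 0 (2*t * sin (ps/2)))^2)"
 have ch: "continuous_on S h" for S unfolding h_def
  by (intro continuous_intros, rule continuous_on_compose2[OF bes_continuous[of UNIV]]) (auto intro!: continuous_intros)
 have h1: "h ps <= 1" for ps unfolding h_def using abs_bes_le_1 by (simp add: abs_square_le_1)
 have "integral {0..pi} (%ps. h (2*pi - ps)) = integral {2*pi - pi..2*pi - 0} h" by (rule integral_reflect_at) (rule ch)
 moreover have "h (2*pi - ps) = h ps" for ps
 proof -
  have "sin ((2*pi - ps)/2) = sin (pi - ps/2)" by (simp add: diff_divide_distrib)
  thus ?thesis unfolding h_def by (simp only: sin_pi_minus)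
 qed
 moreover have "integral {0..pi} h + integral {pi..2*pi} h = integral {0..2*pi} h"
  by (rule Henstock_Kurzweil_Integration.integral_combine) (auto intro!: integrable_continuous_real ch)
 ultimately have half: "integral {0..2*pi} h = 2*integral {0..pi} h" by simp
 have "integral {0..pi} h <= pi*bmaj t"
 proof (cases "t <= 1/2")
  case True
  have "integral {0..pi} h <= integral {0..pi} (%_. 1)" by (rule integral_le) (auto intro!: integrable_continuous_real ch h1)
  thus ?thesis using True by (simp add: bmaj_def)
 next
  case False
  \<comment> \<open>The point at which the two bounds 1 and a/\<psi> of the integrand meet.\<close>
  define a where "a = pi/(2*t)"
  have a: "0 < a" "a <= pi" using False by (auto simp: a_def field_simps)
  have "integral {0..a} h <= integral {0..a} (%_. 1)" by (rule integral_le) (auto intro!: integrable_continuous_real ch h1)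
  hence 1: "integral {0..a} h <= a" using a by simp
  have i: "((%ps. a/ps) has_integral a*ln pi - a*ln a) {a..pi}" by (rule fundamental_theorem_of_calculus)
    (use a in \<open>auto intro!: derivative_eq_intros simp: has_real_derivative_iff_has_vector_derivative[symmetric]\<close>)
  have "integral {a..pi} h <= integral {a..pi} (%ps. a/ps)"
  proof (rule integral_le)
   fix ps assume ps: "ps \<in> {a..pi}"
   hence p: "0 < ps" using a by auto
   have "ps/pi <= sin (ps/2)"
   proof -
    have "concave_on {0..pi} sin" by (rule f''_le0_imp_concave[where f' = cos and f'' = "%x. - sin x"])
      (auto intro!: derivative_eq_intros sin_ge_zero)
    from concave_onD[OF this, of "ps/pi" 0 "pi/2"] show ?thesis using ps p by (simp add: field_simps)
   qed
   hence "2*t*(ps/pi) <= 2*t * sin (ps/2)" using t by (intro mult_left_mono) auto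
   moreover have "2*t*(ps/pi) = ps/a" using t by (simp add: a_def field_simps)
   ultimately have s: "ps/a <= 2*t * sin (ps/2)" by simp
   have pa: "0 < ps/a" using p a by simp
   have "h ps <= 3/4/(2*t * sin (ps/2))" unfolding h_def by (rule bes_0_squared_le) (use s pa in linarith)
   also have "... <= 3/4/(ps/a)"
   proof (rule divide_left_mono[OF s])
    have "0 < 2*t * sin (ps/2)" using s pa by linarith
    thus "0 < 2*t * sin (ps/2)*(ps/a)" by (rule mult_pos_pos[OF _ pa])
   qed simp
   also have "... <= 1/(ps/a)" using pa by (intro divide_right_mono) auto
   finally show "h ps <= a/ps" by simp
  next
   show "h integrable_on {a..pi}" by (intro integrable_continuous_real ch)
   show "(%ps. a/ps) integrable_on {a..pi}" by (rule has_integral_integrable[OF i])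
  qed
  also have "... = a*ln pi - a*ln a" by (rule integral_unique[OF i])
  also have "... = a*ln (2*t)" using t by (simp add: a_def ln_div algebra_simps)
  finally have 2: "integral {a..pi} h <= a*ln (2*t)" .
  have "integral {0..a} h + integral {a..pi} h = integral {0..pi} h"
   by (rule Henstock_Kurzweil_Integration.integral_combine) (use a in \<open>auto intro!: integrable_continuous_real ch\<close>)
  hence "integral {0..pi} h <= a*(1 + ln (2*t))" using 1 2 by (simp add: distrib_left)
  thus ?thesis using False by (simp add: bmaj_def a_def)
 qed
 hence "pi*(\<Sum>n\<in>{-int N..int N}. bes n t^4) <= pi*bmaj t" using sum_bes_power4_le_integral[where N=N and t=t] half unfolding h_def by linarith
 thus ?thesis using pi_gt_zero by (rule mult_left_le_imp_le)
qed

text \<open>Both \<open>(t J')\<^sup>2 - (n\<^sup>2 - t\<^sup>2) J\<^sup>2\<close> and \<open>t J J'\<close> increase from 0.\<close>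

lemma bes_below_turning_point:
 fixes n :: nat
 assumes n: "1 <= n" and t: "0 < t" "t <= real n" shows "sqrt ((real n)^2 - t^2)*(bes n t)^2 <= bes n t*besd n t"
proof -
 have z: "bes n 0 = 0" using bes_rec[of 0 "int n"] n by simp
 hence dz: "besd n 0 = 0" by (simp add: besd_def)
 have cb: "continuous_on S (besd n)" for S unfolding besd_def[abs_def] by (intro continuous_intros bes_continuous)
 define P where "P = (%t. (besd n t)^2 - ((real n)^2 - t^2)*(bes n t)^2)"
 define M where "M = (%t. bes n t*besd n t)"
 have "P 0 <= P t"
 proof (rule DERIV_nonneg_imp_increasing_open[of 0 t])
  fix s assume "0 < s" "s < t"
  hence s: "s ~= 0" by simp
  have "(P has_real_derivative 2*besd n s*(((of_int (int n))^2 - s^2) / s*bes n s)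
    - (((real n)^2 - s^2)*(2*bes n s*(besd n s / s)) + (- (2 * s))*(bes n s)^2)) (at s)"
   unfolding P_def using s by (auto intro!: derivative_eq_intros bes_deriv' besd_deriv)
  moreover have "2*besd n s*(((of_int (int n))^2 - s^2) / s*bes n s)
    - (((real n)^2 - s^2)*(2*bes n s*(besd n s / s)) + (- (2 * s))*(bes n s)^2) = 2 * s*(bes n s)^2" using s by (simp add: field_simps)
  ultimately show "\<exists>y. (P has_real_derivative y) (at s) \<and> 0 <= y" using \<open>0 < s\<close> by auto
 qed (use t cb bes_continuous in \<open>auto simp: P_def intro!: continuous_intros\<close>)
 hence P: "0 <= P t" by (simp add: P_def z dz)
 have "M 0 <= M t"
 proof (rule DERIV_nonneg_imp_increasing_open[of 0 t])
  fix s assume s: "0 < s" "s < t"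
  hence s0: "s ~= 0" by simp
  have "(M has_real_derivative (besd n s / s)*besd n s + bes n s*(((of_int (int n))^2 - s^2) / s*bes n s)) (at s)"
   unfolding M_def using s0 by (auto intro!: derivative_eq_intros bes_deriv' besd_deriv)
  moreover have "0 <= (besd n s / s)*besd n s" using s by simp
  moreover have "0 <= bes n s*(((of_int (int n))^2 - s^2) / s*bes n s)"
  proof -
   have "s^2 <= (real n)^2" using s t by (intro power_mono) auto
   hence "0 <= ((real n)^2 - s^2) / s" using s by (intro divide_nonneg_pos) auto
   hence "0 <= ((real n)^2 - s^2) / s*(bes n s*bes n s)" by (rule mult_nonneg_nonneg[OF _ zero_le_square])
   thus ?thesis by (simp add: mult_ac)
  qed
  ultimately show "\<exists>y. (M has_real_derivative y) (at s) \<and> 0 <= y" by fastforce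
 qed (use t cb bes_continuous in \<open>auto simp: M_def intro!: continuous_intros\<close>)
 hence M: "0 <= M t" by (simp add: M_def z)
 have "t^2 <= (real n)^2" using t by (intro power_mono) auto
 hence sq: "(sqrt ((real n)^2 - t^2))^2 = (real n)^2 - t^2" by simp
 have "(sqrt ((real n)^2 - t^2)*(bes n t)^2)^2 = ((real n)^2 - t^2)*(bes n t)^2*(bes n t)^2"
  unfolding power_mult_distrib sq by (simp add: power2_eq_square)
 also have "... <= (besd n t)^2*(bes n t)^2" using P by (intro mult_right_mono) (auto simp: P_def)
 also have "... = (M t)^2" by (simp add: M_def power_mult_distrib)
 finally show ?thesis using M unfolding M_def by (rule power2_le_imp_le)
qed

section \<open>Weighted integrals of |J_n|^3 over t\<close>

abbreviation nni :: "(real => real) => real set => ennreal"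
 where "nni f A \<equiv> (\<integral>\<^sup>+t. ennreal (f t)*indicator A t \<partial>lborel)"

lemma power_powr: "0 < x ==> (x^n) powr s = x powr (real n * s)" for x :: real by (simp add: powr_realpow[symmetric] powr_powr)

lemma powr_three_quarters:
 fixes y a :: real
 assumes "0 <= y" "y^4 <= a" shows "y^3 <= a powr (3/4)"
proof (cases "y = 0")
 case False
 hence y: "0 < y" using assms by simp
 have "y^3 = (y^4) powr (3/4)" using y by (simp add: power_powr)
 also have "... <= a powr (3/4)" using assms y by (intro powr_mono2) auto
 finally show ?thesis .
qed simp

lemma bes_cont_measurable [measurable]: "bes n \<in> borel_measurable borel" by (rule borel_measurable_continuous_onI) (rule bes_continuous)

lemma bes_fourth_power_le:
 fixes n :: nat
 assumes "real n < t" shows "\<bar>bes n t\<bar>^4 <= 9/16/(t^2 - (real n)^2)"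
proof -
 have q: "0 < t^2 - (real n)^2" using assms by (simp add: power_strict_mono)
 have "(sqrt (t^2 - (real n)^2)*(bes n t)^2)^2 <= (3/4)^2" using bes_oscillatory[OF assms] q by (intro power_mono) auto
 hence "(t^2 - (real n)^2)*\<bar>bes n t\<bar>^4 <= 9/16" using q by (simp add: power_mult_distrib power_divide flip: power_mult)
 thus ?thesis using q by (simp add: field_simps)
qed

lemma nn_integral_le_const_interval:
 fixes f :: "real => real"
 assumes "!!t. t \<in> {a..b} ==> f t <= c" "a <= b" "0 <= c" shows "nni (%t. f t) {a..b} <= ennreal (c*(b - a))"
proof -
 have "nni (%t. f t) {a..b} <= (\<integral>\<^sup>+t. ennreal c*indicator {a..b} t \<partial>lborel)"
  by (intro nn_integral_mono) (auto simp: indicator_def intro!: ennreal_leI assms)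
 also have "... = ennreal (c*(b - a))" using assms by (simp add: nn_integral_cmult_indicator ennreal_mult'[symmetric])
 finally show ?thesis .
qed

lemma nni_split:
 assumes le: "!!t. t \<in> A ==> t ~= a ==> t \<in> B \<and> f t <= g t \<or> t \<in> C \<and> f t <= h t"
  and [measurable]: "g \<in> borel_measurable borel" "h \<in> borel_measurable borel" "B \<in> sets borel" "C \<in> sets borel"
  and b: "nni g B <= ennreal b" "nni h C <= ennreal c" "0 <= b" "0 <= c" shows "nni f A <= ennreal (b + c)"
proof -
 have "nni f A <= (\<integral>\<^sup>+t. ennreal (g t)*indicator B t + ennreal (h t)*indicator C t \<partial>lborel)"
 proof (rule nn_integral_mono_AE)
  have "AE t in lborel. t ~= a" by (rule AE_lborel_singleton)
  thus "AE t in lborel. ennreal (f t)*indicator A t <= ennreal (g t)*indicator B t + ennreal (h t)*indicator C t"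
   by eventually_elim (use le in \<open>force simp: indicator_def intro: add_increasing add_increasing2 ennreal_leI\<close>)
 qed
 also have "... = nni g B + nni h C" by (rule nn_integral_add) measurable
 also have "... <= ennreal (b + c)" using b by (auto intro: add_mono)
 finally show ?thesis .
qed

lemma powr_numeric_bounds: "(9/32::real) powr (3/4) <= 387/1000" "(3/4::real) powr (3/4) <= 81/100"
proof -
 have "((9/32::real)^3) powr (1/4) <= ((387/1000)^4) powr (1/4)" by (intro powr_mono2) (auto simp: power_divide)
 thus "(9/32::real) powr (3/4) <= 387/1000" using power_powr[of "9/32" 3 "1/4"] power_powr[of "387/1000" 4 "1/4"] by simp
 have "((3/4::real)^3) powr (1/4) <= ((81/100)^4) powr (1/4)" by (intro powr_mono2) (auto simp: power_divide)
 thus "(3/4::real) powr (3/4) <= 81/100" using power_powr[of "3/4" 3 "1/4"] power_powr[of "81/100" 4 "1/4"] by simp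
qed

lemma bes_cube_far:
 fixes n :: nat
 assumes t: "1 <= t" "2*real n <= t" shows "t powr al*\<bar>bes n t\<bar>^3 <= 81/100*t powr (al - 3/2)"
proof -
 have "(2*real n)^2 <= t^2" using t by (intro power_mono) auto
 hence n: "4*(real n)^2 <= t^2" by (simp add: power_mult_distrib)
 moreover have "0 < t^2" using t by simp
 ultimately have "(real n)^2 < t^2" by linarith
 hence "9/16/(t^2 - (real n)^2) <= 9/16/(3/4*t^2)" using t n by (intro divide_left_mono mult_pos_pos) auto
 hence "\<bar>bes n t\<bar>^4 <= 3/4*(1/t^2)" using bes_fourth_power_le[of n t] t by simp
 hence "\<bar>bes n t\<bar>^3 <= (3/4*(1/t^2)) powr (3/4)" by (intro powr_three_quarters) auto
 also have "... = (3/4) powr (3/4)*t powr (-3/2)"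
 proof -
  have "(1/t^2) powr (3/4) = t powr (-3/2)" using t power_powr[of t 2 "3/4"] powr_minus_divide[of t "3/2"] by (simp add: powr_divide)
  thus ?thesis by (simp only: powr_mult)
 qed
 also have "... <= 81/100*t powr (-3/2)" by (intro mult_right_mono powr_numeric_bounds) auto
 finally have "t powr al*\<bar>bes n t\<bar>^3 <= t powr al*(81/100*t powr (-3/2))" by (intro mult_left_mono) auto
 also have "... = 81/100*t powr (al + - 3/2)" unfolding powr_add by simp
 finally show ?thesis by simp
qed

text \<open>On [0, n] the modulus of J_n increases to its value X at the turning point. Up to b the
  square is at most c/1.4 times its own derivative (\<open>grow\<close>), so the integral is at most
  X (c/1.4) X^2; the rest has length c/4 and contributes X^3 c/4. With X <= 9/(8 c) this is of order
  c^(-2) = n^(-2/3).\<close>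

lemma bes_cube_integral_left:
 fixes n :: nat
 assumes n: "1 <= n" shows "nni (%t. \<bar>bes n t\<bar>^3) {0..real n} <= ennreal (1.4*real n powr (-1/2))"
proof -
 define c where "c = real n powr (1/3)"
 have n0: "0 < real n" using n by simp
 have c: "0 < c" "c^3 = real n" "real n powr (-1/3) = 1 / c" using cube_root_powers[OF n0] by (auto simp: c_def)
 have c1: "1 <= c" unfolding c_def using n by (intro ge_one_powr_ge_zero) auto
 \<comment> \<open>At distance c/4 from the turning point sqrt (n^2 - t^2) is already at least 0.7
   t/c, which is what the growth rate 1.4/c requires.\<close>
 define b where "b = real n - c/4"
 have "c <= c^3" using c1 power_increasing[of 1 3 c] by simp
 hence b: "0 <= b" "b <= real n" using c by (auto simp: b_def)
 define D where "D = (%t. 2*bes n t*((bes (int n - 1) t - bes (int n + 1) t)/2))"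
 have dJ: "((%t. (bes n t)^2) has_real_derivative D t) (at t)" for t unfolding D_def by (auto intro!: derivative_eq_intros bes_deriv)
 have z: "bes n 0 = 0" using bes_rec[of 0 "int n"] n by simp
 have De: "D t = 2*(bes n t*besd n t)/t" if "0 < t" for t
 proof -
  have "(bes n has_real_derivative besd n t/t) (at t)" using that by (intro bes_deriv') auto
  from DERIV_unique[OF this bes_deriv] show ?thesis unfolding D_def by (simp only: mult.assoc flip: times_divide_eq_right)
 qed
 have M: "sqrt ((real n)^2 - t^2)*(bes n t)^2 <= bes n t*besd n t" if "0 < t" "t <= real n" for t by (rule bes_below_turning_point[OF n that])
 have D0: "0 <= D t" if "0 <= t" "t <= real n" for t
 proof (cases "t = 0")
  case True thus ?thesis by (simp add: D_def z)
 next
  case False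
  hence t: "0 < t" using that by simp
  have "t^2 <= (real n)^2" using that by (intro power_mono) auto
  hence "0 <= sqrt ((real n)^2 - t^2)*(bes n t)^2" by simp
  thus ?thesis using M[OF t that(2)] t by (simp add: De)
 qed
 have mono: "(bes n s)^2 <= (bes n t)^2" if "0 <= s" "s <= t" "t <= real n" for s t
  by (rule DERIV_nonneg_imp_nondecreasing[OF that(2)]) (use dJ D0 that in \<open>meson order_trans\<close>)
 have absmono: "\<bar>bes n t\<bar> <= \<bar>bes n (real n)\<bar>" if "0 <= t" "t <= real n" for t
  using mono[OF that order_refl] by (simp add: abs_le_square_iff)
 have grow: "(bes n t)^2 <= c/1.4*D t" if "0 <= t" "t <= b" for t
 proof (cases "t = 0")
  case True thus ?thesis by (simp add: z D_def)
 next
  case False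
  hence t: "0 < t" and tn: "t <= real n" using that b by auto
  have "t*t <= t*real n" using t tn by (intro mult_left_mono) auto
  have "(0.7*t / c)^2 <= (real n)^2 - t^2"
  proof -
   have "(0.7*t / c)^2 = 0.49 / c^2*(t*t)" using c by (simp add: power2_eq_square)
   also have "... <= 0.49 / c^2*(t*real n)" by (rule mult_left_mono[OF \<open>t*t <= t*real n\<close>]) (use c in auto)
   also have "... = 0.49 * c*t" unfolding c(2)[symmetric] using c(1) by (simp add: field_simps power2_eq_square power3_eq_cube)
   also have "... <= c/4*(2*t)" using c t by simp
   also have "... <= (real n - t)*(real n + t)" using that t tn c unfolding b_def by (intro mult_mono) auto
   finally show ?thesis by (simp add: power2_eq_square algebra_simps)
  qed
  hence k: "0.7*t / c <= sqrt ((real n)^2 - t^2)" by (rule real_le_rsqrt)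
  have "0.7*t / c*(bes n t)^2 <= bes n t*besd n t" using mult_right_mono[OF k, of "(bes n t)^2"] M[OF t tn] by simp
  thus ?thesis using t c by (simp add: De field_simps)
 qed
 define X where "X = \<bar>bes n (real n)\<bar>"
 have X: "0 <= X" "X <= 9/8 / c" using bes_turning_point[OF n] unfolding X_def c(3) by simp_all
 have "(nni (%t. \<bar>bes n t\<bar>^3) {0..b}) <= (\<integral>\<^sup>+t. ennreal (X*(c/1.4))*(ennreal (D t)*indicator {0..b} t) \<partial>lborel)"
 proof (intro nn_integral_mono)
  fix t :: real
  show "ennreal (\<bar>bes n t\<bar>^3)*indicator {0..b} t <= ennreal (X*(c/1.4))*(ennreal (D t)*indicator {0..b} t)"
  proof (cases "t \<in> {0..b}")
   case True
   have "\<bar>bes n t\<bar>^3 = \<bar>bes n t\<bar>*(bes n t)^2" by (simp add: power3_eq_cube power2_eq_square)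
   also have "... <= X*(c/1.4*D t)" using True b X absmono[of t] grow[of t] unfolding X_def by (intro mult_mono) auto
   finally show ?thesis using True X c by (simp add: ennreal_mult'[symmetric] mult.assoc ennreal_leI)
  qed simp
 qed
 also have "... = ennreal (X*(c/1.4))*(nni (%t. D t) {0..b})" unfolding D_def by (rule nn_integral_cmult) measurable
 also have "nni (%t. D t) {0..b} = ennreal ((bes n b)^2 - (bes n 0)^2)"
  by (rule nn_integral_FTC_Icc) (use b D0 dJ in \<open>auto simp: D_def intro!: borel_measurable_times\<close>)
 also have "ennreal (X*(c/1.4))*... <= ennreal (X*(c/1.4))*ennreal (X^2)"
  using mono[OF b(1) b(2) order_refl] by (intro mult_left_mono ennreal_leI) (auto simp: X_def z)
 finally have 1: "nni (%t. \<bar>bes n t\<bar>^3) {0..b} <= ennreal (X^3*(c/1.4))"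
  using X c by (simp add: ennreal_mult'[symmetric] power3_eq_cube power2_eq_square mult_ac)
 have 2: "nni (%t. \<bar>bes n t\<bar>^3) {b..real n} <= ennreal (X^3*(real n - b))"
  by (rule nn_integral_le_const_interval) (use b absmono in \<open>auto simp: X_def intro!: power_mono\<close>)
 have "nni (%t. \<bar>bes n t\<bar>^3) {0..real n} <= ennreal (X^3*(c/1.4) + X^3*(real n - b))"
  by (rule nni_split[OF _ _ _ _ _ 1 2]) (use X c b in auto)
 also have "... = ennreal (X^3*(c/1.4 + c/4))" by (simp add: b_def algebra_simps)
 also have "... <= ennreal (1.4*real n powr (-1/2))"
 proof (rule ennreal_leI)
  have "X^3 <= (9/8 / c)^3" using X by (intro power_mono) auto
  hence "X^3*(c/1.4 + c/4) <= (9/8 / c)^3*(c/1.4 + c/4)" using c by (intro mult_right_mono) auto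
  also have "... = 19683/14336*(c / c^3)" by (simp add: power_divide)
  also have "c / c^3 = 1 / c^2" using c(1) by (simp add: power2_eq_square power3_eq_cube)
  also have "19683/14336*(1 / c^2) <= 1.4 / c^2" using divide_right_mono[of "19683/14336" "1.4" "c^2"] by simp
  also have "... = 1.4*real n powr (-2/3)"
  proof -
   have "real n powr (-2/3) = 1 / c^2" using n0 powr_minus_divide[of "real n" "2/3"] by (simp add: c_def powr_power)
   thus ?thesis by simp
  qed
  \<comment> \<open>The better power -2/3 is given up to match the order n^(-1/2) of the part to the
    right of n.\<close>
  also have "... <= 1.4*real n powr (-1/2)" using n by (intro mult_left_mono powr_mono) auto
  finally show "X^3*(c/1.4 + c/4) <= 1.4*real n powr (-1/2)" .
 qed
 finally show ?thesis .
qed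

lemma nn_integral_powr_tail:
 assumes "0 < a" "s < -1" "0 <= C" shows "nni (%t. C*t powr s) {a..} = ennreal (C*a powr (s + 1)/(- s - 1))"
proof -
 have "nni (%t. C*t powr s) {a..} = ennreal (0 - C*a powr (s + 1)/(s + 1))"
 proof (rule nn_integral_FTC_atLeast)
  fix x assume "a <= x"
  thus "((%t. C*t powr (s + 1)/(s + 1)) has_real_derivative C*x powr s) (at x)" using assms by (auto intro!: derivative_eq_intros)
  show "0 <= C*x powr s" using assms by simp
 next
  have "((%t. C*t powr (s + 1)/(s + 1)) \<longlongrightarrow> C*0/(s + 1)) at_top"
   using assms by (intro tendsto_intros tendsto_neg_powr filterlim_ident) auto
  thus "((%t. C*t powr (s + 1)/(s + 1)) \<longlongrightarrow> 0) at_top" by simp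
 qed measurable
 also have "0 - C*a powr (s + 1)/(s + 1) = C*a powr (s + 1)/(- s - 1)" using assms by (simp add: field_simps)
 finally show ?thesis .
qed

lemma nn_integral_singular_left:
 assumes "0 <= a" "0 <= b" shows "nni (%t. b*(t - a) powr (-3/4)) {a..2*a} = ennreal (4*b*a powr (1/4))"
proof -
 have "((%t. b*(t - a) powr (-3/4)) has_integral 4*b*(2*a - a) powr (1/4) - 4*b*(a - a) powr (1/4)) {a..2*a}"
 proof (rule fundamental_theorem_of_calculus_interior)
  show "continuous_on {a..2*a} (%t. 4*b*(t - a) powr (1/4))" by (intro continuous_intros continuous_on_powr') auto
  fix x assume x: "x \<in> {a<..<2*a}"
  hence "((%t. 4*b*(t - a) powr (1/4)) has_real_derivative 4*b*(1/4*(x - a) powr (1/4 - 1))) (at x)" by (auto intro!: derivative_eq_intros)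
  thus "((%t. 4*b*(t - a) powr (1/4)) has_vector_derivative b*(x - a) powr (-3/4)) (at x)"
   by (simp add: has_real_derivative_iff_has_vector_derivative)
 qed (use assms in auto)
 hence "((%t. b*(t - a) powr (-3/4)) has_integral 4*b*a powr (1/4)) {a..2*a}" by simp
 from nn_integral_has_integral_lebesgue[OF _ this]
 show ?thesis using assms by (simp add: ennreal_mult'' mult.commute ennreal_indicator[symmetric] del: ennreal_indicator)
qed

text \<open>The oscillatory bound for J_n^4 raised to the power 3/4 has the integrable singularity
  (t - n)^(-3/4) at the turning point and the tail t^(-3/2) beyond 2 n. The restriction on
  \<open>al\<close> keeps the weighted tail integrable with a margin of 1/4.\<close>

lemma bes_cube_integral_right:
 fixes n :: nat
 assumes n: "1 <= n" and al: "0 <= al" "al <= 1/4" shows "(nni (%t. t powr al*\<bar>bes n t\<bar>^3) {real n..})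
  <= ennreal ((155/100 + 58/100/(1/2 - al))*2 powr al*real n powr (al - 1/2))"
proof -
 define x where "x = real n"
 have x: "0 < x" "1 <= x" using n by (auto simp: x_def)
 define b where "b = (2*x) powr al*(387/1000*x powr (-3/4))"
 have near: "t powr al*\<bar>bes n t\<bar>^3 <= b*(t - x) powr (-3/4)" if t: "x < t" "t <= 2*x" for t
 proof -
  have "\<bar>bes n t\<bar>^4 <= 9/16/(t^2 - x^2)" using bes_fourth_power_le[of n t] t by (simp add: x_def)
  also have "... <= 9/16/(2*x*(t - x))"
  proof (rule divide_left_mono)
   have "2*x*(t - x) <= (t + x)*(t - x)" using t by (intro mult_right_mono) auto
   thus "2*x*(t - x) <= t^2 - x^2" by (simp add: power2_eq_square algebra_simps)
   hence "0 < t^2 - x^2" using t x by (smt (verit) mult_pos_pos)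
   thus "0 < (t^2 - x^2)*(2*x*(t - x))" using t x by simp
  qed simp
  also have "... = 9/32*(1/x)*(1/(t - x))" by simp
  finally have "\<bar>bes n t\<bar>^3 <= (9/32*(1/x)*(1/(t - x))) powr (3/4)" by (intro powr_three_quarters) auto
  also have "... = (9/32) powr (3/4)*(x powr (-3/4)*(t - x) powr (-3/4))"
  proof -
   have "(1/y) powr (3/4) = y powr (-3/4)" if "0 < y" for y :: real using that powr_minus_divide[of y "3/4"] by (simp add: powr_divide)
   thus ?thesis using x t by (simp only: powr_mult; simp?)
  qed
  also have "... <= 387/1000*(x powr (-3/4)*(t - x) powr (-3/4))" by (intro mult_right_mono powr_numeric_bounds) auto
  finally have 1: "\<bar>bes n t\<bar>^3 <= 387/1000*(x powr (-3/4)*(t - x) powr (-3/4))" .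
  have "t powr al*\<bar>bes n t\<bar>^3 <= (2*x) powr al*(387/1000*(x powr (-3/4)*(t - x) powr (-3/4)))"
   using t x al by (intro mult_mono 1 powr_mono2) auto
  thus ?thesis by (simp add: b_def mult_ac)
 qed
 let ?f = "%t. t powr al*\<bar>bes n t\<bar>^3"
 have "nni (%t. ?f t) {x..} <= ennreal (4*b*x powr (1/4) + 81/100*(2*x) powr ((al - 3/2) + 1)/(- (al - 3/2) - 1))"
 proof (rule nni_split[of _ x])
  show "t \<in> {x..2*x} \<and> ?f t <= b*(t - x) powr (-3/4) \<or> t \<in> {2*x..} \<and> ?f t <= 81/100*t powr (al - 3/2)"
   if "t \<in> {x..}" "t ~= x" for t using near[of t] bes_cube_far[of t n al] that x by (cases "t <= 2*x") (auto simp: x_def)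
  show "nni (%t. b*(t - x) powr (-3/4)) {x..2*x} <= ennreal (4*b*x powr (1/4))"
   by (rule eq_refl, rule nn_integral_singular_left) (use x in \<open>auto simp: b_def\<close>)
  show "nni (%t. 81/100*t powr (al - 3/2)) {2*x..} <= ennreal (81/100*(2*x) powr ((al - 3/2) + 1)/(- (al - 3/2) - 1))"
   by (rule eq_refl, rule nn_integral_powr_tail) (use x al in auto)
 qed (use x al in \<open>auto simp: b_def\<close>)
 also have "... <= ennreal ((155/100 + 58/100/(1/2 - al))*2 powr al*x powr (al - 1/2))"
 proof (rule ennreal_leI)
  have "x powr (-3/4)*x powr (1/4) = x powr (-1/2)" by (subst powr_add[symmetric]) simp
  hence "4*b*x powr (1/4) = 1548/1000*(2*x) powr al*x powr (-1/2)" by (simp add: b_def)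
  also have "... = 1548/1000*2 powr al*x powr (al - 1/2)"
  proof -
   have "(2*x) powr al*x powr (-1/2) = 2 powr al*(x powr al*x powr (-1/2))" using x by (simp add: powr_mult)
   also have "x powr al*x powr (-1/2) = x powr (al - 1/2)" by (subst powr_add[symmetric]) simp
   finally show ?thesis by simp
  qed
  also have "... = 1548/1000*(2 powr al*x powr (al - 1/2))" by simp
  also have "... <= 155/100*(2 powr al*x powr (al - 1/2))" by (intro mult_right_mono) auto
  finally have 1: "4*b*x powr (1/4) <= 155/100*(2 powr al*x powr (al - 1/2))" .
  have s2: "2 powr (-1/2) <= (71/100::real)"
  proof -
   have "(100/71)^2 <= (2::real)" by (simp add: power2_eq_square)
   hence "100/71 <= sqrt (2::real)" by (rule real_le_rsqrt)
   hence "1 / sqrt 2 <= 1/(100/71::real)" by (intro divide_left_mono) auto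
   thus ?thesis using powr_minus_divide[of 2 "1/2::real"] by (simp add: powr_half_sqrt)
  qed
  have "(2*x) powr ((al - 3/2) + 1) = 2 powr (-1/2)*(2 powr al*x powr (al - 1/2))"
  proof -
   have "(2*x) powr ((al - 3/2) + 1) = 2 powr (al - 1/2)*x powr (al - 1/2)" using x by (simp add: powr_mult)
   moreover have "2 powr (al - 1/2) = 2 powr (-1/2)*2 powr al" for al :: real by (subst powr_add[symmetric]) simp
   ultimately show ?thesis by (simp only: mult.assoc)
  qed
  also have "... <= 71/100*(2 powr al*x powr (al - 1/2))" by (rule mult_right_mono[OF s2]) simp
  finally have "(2*x) powr ((al - 3/2) + 1) <= 71/100*(2 powr al*x powr (al - 1/2))" .
  moreover have "0 <= 2 powr al*x powr (al - 1/2)" by simp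
  ultimately have "81/100*(2*x) powr ((al - 3/2) + 1) <= 58/100*(2 powr al*x powr (al - 1/2))" by linarith
  from divide_right_mono[OF this, of "1/2 - al"]
  have 2: "81/100*(2*x) powr ((al - 3/2) + 1)/(- (al - 3/2) - 1) <= 58/100/(1/2 - al)*(2 powr al*x powr (al - 1/2))"
   using al by (simp add: algebra_simps)
  show "4*b*x powr (1/4) + 81/100*(2*x) powr ((al - 3/2) + 1)/(- (al - 3/2) - 1) <= (155/100 + 58/100/(1/2 - al))*2 powr al*x powr (al - 1/2)"
   using add_mono[OF 1 2] by (simp add: distrib_right mult.assoc)
 qed
 finally show ?thesis by (simp add: x_def)
qed

lemma bes_0_cube_integral:
 assumes al: "0 <= al" "al <= 1/4" shows "nni (%t. t powr al*\<bar>bes 0 t\<bar>^3) {0..} <= ennreal (1 + 81/100/(1/2 - al))"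
proof -
 let ?f = "%t. t powr al*\<bar>bes 0 t\<bar>^3"
 have near: "?f t <= 1" if "t \<in> {0..1}" for t
 proof -
  have "t powr al <= 1" by (rule powr_le1) (use that al in auto)
  moreover have "\<bar>bes 0 t\<bar>^3 <= 1" by (rule power_le_one) (auto intro: abs_bes_le_1)
  ultimately show ?thesis using mult_le_one[of "t powr al" "\<bar>bes 0 t\<bar>^3"] by simp
 qed
 have "nni (%t. ?f t) {0..} <= ennreal (1*(1 - 0) + 81/100*1 powr ((al - 3/2) + 1)/(- (al - 3/2) - 1))"
 proof (rule nni_split)
  show "t \<in> {0..1} \<and> ?f t <= ?f t \<or> t \<in> {1..} \<and> ?f t <= 81/100*t powr (al - 3/2)" if "t \<in> {0..}" for t
   using bes_cube_far[of t 0 al] that by (cases "t <= 1") auto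
  show "nni (%t. ?f t) {0..1} <= ennreal (1*(1 - 0))" by (rule nn_integral_le_const_interval[OF near]) auto
  show "nni (%t. 81/100*t powr (al - 3/2)) {1..} <= ennreal (81/100*1 powr ((al - 3/2) + 1)/(- (al - 3/2) - 1))"
   by (rule eq_refl, rule nn_integral_powr_tail) (use al in auto)
 qed (use al in auto)
 thus ?thesis by simp
qed

text \<open>The weight \<open>al = 0\<close> serves the size of the resolvent kernel,
  \<open>al = 1/4\<close> its Hoelder continuity in the spectral parameter. The numerator 81/100,
  larger than the 58/100 of the part to the right, lets the same constant cover order 0.\<close>

lemma bes_cube_integral:
 assumes al: "0 <= al" "al <= 1/4" shows "(nni (%t. t powr al*\<bar>bes n t\<bar>^3) {0..})
  <= ennreal ((140/100 + (155/100 + 81/100/(1/2 - al))*2 powr al)*max 1 \<bar>of_int n\<bar> powr (al - 1/2))"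
proof (cases "n = 0")
 case True
 have "1*(81/100/(1/2 - al)) <= 2 powr al*(155/100 + 81/100/(1/2 - al))" using al by (intro mult_mono ge_one_powr_ge_zero) auto
 moreover have "2 powr al*(155/100 + 81/100/(1/2 - al)) = (155/100 + 81/100/(1/2 - al))*2 powr al" by (rule mult.commute)
 ultimately have "1 + 81/100/(1/2 - al) <= 140/100 + (155/100 + 81/100/(1/2 - al))*2 powr al" by linarith
 from order_trans[OF bes_0_cube_integral[OF al] ennreal_leI[OF this]]
 show ?thesis using True by simp
next
 case False
 define m where "m = nat \<bar>n\<bar>"
 have m: "1 <= m" using False by (simp add: m_def)
 have am: "\<bar>bes n t\<bar> = \<bar>bes m t\<bar>" for t unfolding m_def using abs_bes_abs[of n t] by simp
 have xm: "max 1 \<bar>of_int n\<bar> = real m" using m by (simp add: m_def)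
 let ?f = "%t. t powr al*\<bar>bes m t\<bar>^3"
 have "real m powr al*(1.4*real m powr (-1/2)) = 140/100*real m powr (al + -1/2)" unfolding powr_add by simp
 hence e: "real m powr al*(1.4*real m powr (-1/2)) = 140/100*real m powr (al - 1/2)" by simp
 have "nni (%t. real m powr al*\<bar>bes m t\<bar>^3) {0..real m} = ennreal (real m powr al)*(nni (%t. \<bar>bes m t\<bar>^3) {0..real m})"
  by (simp add: ennreal_mult' mult.assoc nn_integral_cmult)
 also have "... <= ennreal (real m powr al)*ennreal (1.4*real m powr (-1/2))" by (intro mult_left_mono bes_cube_integral_left m) auto
 finally have near: "nni (%t. real m powr al*\<bar>bes m t\<bar>^3) {0..real m} <= ennreal (140/100*real m powr (al - 1/2))"
  unfolding e[symmetric] by (simp only: ennreal_mult' powr_ge_zero)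
 have "nni (%t. ?f t) {0..} <= ennreal (140/100*real m powr (al - 1/2) + (155/100 + 58/100/(1/2 - al))*2 powr al*real m powr (al - 1/2))"
 proof (rule nni_split[OF _ _ _ _ _ near bes_cube_integral_right[OF m al]])
  show "t \<in> {0..real m} \<and> ?f t <= real m powr al*\<bar>bes m t\<bar>^3 \<or> t \<in> {real m..} \<and> ?f t <= ?f t" if "t \<in> {0..}" for t
   using that al by (cases "t <= real m") (auto intro!: mult_right_mono powr_mono2)
 qed (use al in \<open>auto intro!: mult_nonneg_nonneg add_nonneg_nonneg\<close>)
 also have "... <= ennreal ((140/100 + (155/100 + 81/100/(1/2 - al))*2 powr al)*real m powr (al - 1/2))"
 proof (rule ennreal_leI)
  have "58/100/(1/2 - al) <= 81/100/(1/2 - al)" using al by (intro divide_right_mono) auto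
  hence "(155/100 + 58/100/(1/2 - al))*(2 powr al*real m powr (al - 1/2)) <= (155/100 + 81/100/(1/2 - al))*(2 powr al*real m powr (al - 1/2))"
   by (intro mult_right_mono) auto
  thus "140/100*real m powr (al - 1/2) + (155/100 + 58/100/(1/2 - al))*2 powr al*real m powr (al - 1/2)
   <= (140/100 + (155/100 + 81/100/(1/2 - al))*2 powr al)*real m powr (al - 1/2)" by (simp only: distrib_right mult.assoc)
 qed
 finally show ?thesis unfolding am xm .
qed

section \<open>The kernel of the free evolution\<close>

text \<open>The one-dimensional Laplacian has the symbol cos \<theta>, and exp (- i t cos \<theta>)
  has the Fourier coefficients (- i)^k J_k(t).\<close>

definition evk1 :: "int => real => complex" where "evk1 k t = (- \<i>) powi k * of_real (bes k t)"

text \<open>The kernel of \<open>e\<^sup>-\<^sup>i\<^sup>t\<^sup>\<Delta>\<close>.\<close>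

definition evk :: "int ^ 'n::finite => real => complex" where "evk n t = (\<Prod>i\<in>UNIV. evk1 (n $ i) t)"

definition evb :: "int ^ 'n::finite => real => real" where "evb n t = (\<Prod>i\<in>UNIV. \<bar>bes (n $ i) t\<bar>)"

lemma norm_evk: "cmod (evk n t) = evb n t" by (simp add: evk_def evb_def evk1_def norm_mult norm_power_int flip: prod_norm)

lemma evb_nonneg: "0 <= evb n t" and evb_le_1: "evb n t <= 1" by (auto simp: evb_def intro!: prod_nonneg prod_le_1 abs_bes_le_1)

lemma evk1_deriv: "(evk1 k has_vector_derivative (- \<i>/2)*(evk1 (k - 1) t + evk1 (k + 1) t)) (at t)"
proof -
 have "((%t. (- \<i>) powi k * complex_of_real (bes k t)) has_vector_derivative (- \<i>) powi k * of_real ((bes (k - 1) t - bes (k + 1) t)/2)) (at t)"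
  using bes_deriv[of k t] by (intro has_vector_derivative_mult_right has_vector_derivative_of_real)
   (simp add: has_real_derivative_iff_has_vector_derivative)
 moreover have "(- \<i>) powi (k - 1) = (- \<i>) powi k*\<i>" by (simp add: power_int_diff divide_i)
 moreover have "(- \<i>) powi (k + 1) = (- \<i>) powi k*(- \<i>)" by (simp add: power_int_add)
 ultimately show ?thesis by (simp add: evk1_def[abs_def] algebra_simps add_divide_distrib diff_divide_distrib)
qed

lemma evk_shift:
 fixes n :: "int ^ 'n::finite" shows "evk (n + axis i k) t = evk1 (n $ i + k) t*(\<Prod>j\<in>UNIV - {i}. evk1 (n $ j) t)"
proof -
 have "evk (n + axis i k) t = evk1 ((n + axis i k) $ i) t*(\<Prod>j\<in>UNIV - {i}. evk1 ((n + axis i k) $ j) t)"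
  unfolding evk_def by (rule prod.remove) auto
 also have "(\<Prod>j\<in>UNIV - {i}. evk1 ((n + axis i k) $ j) t) = (\<Prod>j\<in>UNIV - {i}. evk1 (n $ j) t)"
  by (intro prod.cong) (auto simp: axis_def)
 finally show ?thesis by (simp add: axis_def)
qed

text \<open>The free Schroedinger equation: the product rule makes the one-dimensional Laplacian act
  on each coordinate in turn.\<close>

lemma evk_deriv: "(evk n has_vector_derivative (- \<i>/2)*(\<Sum>i\<in>UNIV. evk (n + axis i (-1)) t + evk (n + axis i 1) t)) (at t)"
proof -
 have "((%t. \<Prod>i\<in>UNIV. evk1 (n $ i) t) has_derivative
  (%y. \<Sum>i\<in>UNIV. (y *\<^sub>R ((- \<i>/2)*(evk1 (n $ i - 1) t + evk1 (n $ i + 1) t)))*(\<Prod>j\<in>UNIV - {i}. evk1 (n $ j) t))) (at t)"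
  by (rule has_derivative_prod) (use evk1_deriv in \<open>auto simp: has_vector_derivative_def\<close>)
 moreover have "(%y. \<Sum>i\<in>UNIV. (y *\<^sub>R ((- \<i>/2)*(evk1 (n $ i - 1) t + evk1 (n $ i + 1) t)))*(\<Prod>j\<in>UNIV - {i}. evk1 (n $ j) t))
  = (%y. y *\<^sub>R ((- \<i>/2)*(\<Sum>i\<in>UNIV. evk (n + axis i (-1)) t + evk (n + axis i 1) t)))"
  by (simp add: evk_shift scaleR_sum_right sum_distrib_left algebra_simps)
 ultimately show ?thesis by (simp add: has_vector_derivative_def evk_def[abs_def])
qed

lemma evk_isCont: "isCont (evk n) t" using evk_deriv[of n t] by (rule has_vector_derivative_continuous)

lemma evk_measurable [measurable]: "evk n \<in> borel_measurable borel"
 by (rule borel_measurable_continuous_onI) (simp add: continuous_at_imp_continuous_on evk_isCont)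

lemma evb_measurable [measurable]: "evb n \<in> borel_measurable borel" unfolding evb_def[abs_def] by measurable

lemma evk_0: "evk n 0 = (if n = 0 then 1 else 0)"
proof -
 have b0: "bes k 0 = (if k = 0 then 1 else 0)" for k using bes_rec[of 0 k] by (auto simp: bes_def)
 show ?thesis
 proof (cases "n = 0")
  case True thus ?thesis by (simp add: evk_def evk1_def b0)
 next
  case False
  then obtain i where "n $ i ~= 0" by (metis vec_eq_iff zero_index)
  thus ?thesis using False by (auto simp: evk_def evk1_def b0 prod_zero_iff)
 qed
qed

lemma am_gm_3:
 fixes x y z :: real
 assumes "0 <= x" "0 <= y" "0 <= z" shows "x*y*z <= (x^3 + y^3 + z^3)/3"
proof -
 have "0 <= (x + y + z)*((x - y)^2 + (y - z)^2 + (z - x)^2)" using assms by (intro mult_nonneg_nonneg) auto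
 also have "... = 2*(x^3 + y^3 + z^3 - 3*(x*y*z))" by (simp add: power2_eq_square power3_eq_cube algebra_simps)
 finally show ?thesis by simp
qed

text \<open>Hoelder's inequality with three exponents 3, carried out pointwise: each factor is
  divided by \<open>e i\<close>, the cube root of the scale of its own integral, before the
  arithmetic-geometric mean is applied, so that all three integrals contribute the same
  amount.\<close>

lemma nn_integral_evb_3:
 fixes n :: "int ^ 'n::finite"
 assumes abc: "a ~= b" "b ~= c" "a ~= (c::'n)" and al: "0 <= al" "al <= 1/4" and K: "0 < K" "140/100 + (155/100 + 81/100/(1/2 - al))*2 powr al <= K"
 defines "m \<equiv> %i. max 1 \<bar>real_of_int (n $ i)\<bar>"
 shows "(nni (%t. t powr al*(\<bar>bes (n $ a) t\<bar>*\<bar>bes (n $ b) t\<bar>*\<bar>bes (n $ c) t\<bar>)) {0<..})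
  <= ennreal (K*(m a*m b*m c) powr ((al - 1/2)/3))"
proof -
 define e where "e = (%i. (m i) powr ((al - 1/2)/3))"
 have m1: "1 <= m i" for i by (simp add: m_def)
 have m0: "0 < m i" for i using m1[of i] by linarith
 have e0: "0 < e i" for i using m0[of i] by (simp add: e_def)
 have e3: "e i^3 = m i powr (al - 1/2)" for i
 proof -
  have "e i^3 = m i powr ((al - 1/2)/3*real 3)" unfolding powr_realpow[OF e0, symmetric] unfolding e_def by (rule powr_powr)
  moreover have "(al - 1/2)/3*real 3 = al - 1/2" by simp
  ultimately show ?thesis by (simp only:)
 qed
 let ?J = "%i t. \<bar>bes (n $ i) t\<bar>"
 let ?E = "e a*e b*e c"
 have "ennreal (t powr al*(?J a t*?J b t*?J c t))*indicator {0<..} t <=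
  (\<Sum>i\<in>{a,b,c}. ennreal (?E/(3*e i^3))*(ennreal (t powr al*?J i t^3)*indicator {0..} t))" for t
 proof (cases "0 < t")
  case True
  have "(?J a t/e a)*(?J b t/e b)*(?J c t/e c) <= ((?J a t/e a)^3 + (?J b t/e b)^3 + (?J c t/e c)^3)/3"
   using e0 by (intro am_gm_3) (auto simp: less_imp_le)
  hence "(t powr al*?E)*((?J a t/e a)*(?J b t/e b)*(?J c t/e c)) <= (t powr al*?E)*(((?J a t/e a)^3 + (?J b t/e b)^3 + (?J c t/e c)^3)/3)"
   using e0 by (intro mult_left_mono) (auto simp: less_imp_le)
  also have "(t powr al*?E)*((?J a t/e a)*(?J b t/e b)*(?J c t/e c)) = t powr al*(?J a t*?J b t*?J c t)" using e0[of a] e0[of b] e0[of c] by simp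
  also have "(t powr al*?E)*(((?J a t/e a)^3 + (?J b t/e b)^3 + (?J c t/e c)^3)/3) = (\<Sum>i\<in>{a,b,c}. ?E/(3*e i^3)*(t powr al*?J i t^3))"
   using abc by (simp add: power_divide add_divide_distrib distrib_left mult_ac)
  finally have "ennreal (t powr al*(?J a t*?J b t*?J c t)) <= ennreal (\<Sum>i\<in>{a,b,c}. ?E/(3*e i^3)*(t powr al*?J i t^3))" by (rule ennreal_leI)
  also have "... = (\<Sum>i\<in>{a,b,c}. ennreal (?E/(3*e i^3)*(t powr al*?J i t^3)))"
   using e0 by (intro sum_ennreal[symmetric]) (auto simp: less_imp_le intro!: mult_nonneg_nonneg divide_nonneg_nonneg)
  also have "... = (\<Sum>i\<in>{a,b,c}. ennreal (?E/(3*e i^3))*ennreal (t powr al*?J i t^3))"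
   using e0 by (intro sum.cong refl ennreal_mult) (auto simp: less_imp_le intro!: mult_nonneg_nonneg divide_nonneg_nonneg)
  finally show ?thesis using True by simp
 qed simp
 hence "nni (%t. t powr al*(?J a t*?J b t*?J c t)) {0<..} <=
  (\<integral>\<^sup>+t. (\<Sum>i\<in>{a,b,c}. ennreal (?E/(3*e i^3))*(ennreal (t powr al*?J i t^3)*indicator {0..} t)) \<partial>lborel)"
  by (rule nn_integral_mono)
 also have "... = (\<Sum>i\<in>{a,b,c}. ennreal (?E/(3*e i^3))*(nni (%t. t powr al*?J i t^3) {0..}))"
  by (subst nn_integral_sum) (auto simp: nn_integral_cmult)
 also have "... <= (\<Sum>i\<in>{a,b,c}. ennreal (?E/(3*e i^3))*ennreal (K*e i^3))"
 proof (intro sum_mono mult_left_mono)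
  fix i
  have "nni (%t. t powr al*?J i t^3) {0..} <= ennreal ((140/100 + (155/100 + 81/100/(1/2 - al))*2 powr al)*m i powr (al - 1/2))"
   unfolding m_def by (rule bes_cube_integral[OF al])
  also have "... <= ennreal (K*e i^3)" unfolding e3 by (intro ennreal_leI mult_right_mono K) auto
  finally show "nni (%t. t powr al*?J i t^3) {0..} <= ennreal (K*e i^3)" .
 qed auto
 also have "... = (\<Sum>i\<in>{a,b,c}. ennreal (?E*K/3))"
 proof (intro sum.cong refl)
  fix i
  have "ennreal (?E/(3*e i^3))*ennreal (K*e i^3) = ennreal (?E/(3*e i^3)*(K*e i^3))"
   using e0 K by (intro ennreal_mult[symmetric]) (auto simp: less_imp_le intro!: mult_nonneg_nonneg divide_nonneg_nonneg)
  also have "?E/(3*e i^3)*(K*e i^3) = ?E*K/3" using e0[of i] by simp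
  finally show "ennreal (?E/(3*e i^3))*ennreal (K*e i^3) = ennreal (?E*K/3)" .
 qed
 also have "... = ennreal (K*?E)" using abc e0 K by (subst sum_ennreal) (auto simp: less_imp_le mult_ac intro!: mult_nonneg_nonneg)
 also have "?E = (m a*m b*m c) powr ((al - 1/2)/3)" by (simp add: e_def powr_mult)
 finally show ?thesis .
qed

text \<open>Three coordinates already give an integrable product; the others are bounded by 1.
  Dropping the decay in n gives a constant uniform in n.\<close>

lemma nn_integral_evb_weighted:
 fixes n :: "int ^ 'n::finite"
 assumes d: "3 <= CARD('n)" and al: "0 <= al" "al <= 1/4" and K: "0 < K" "140/100 + (155/100 + 81/100/(1/2 - al))*2 powr al <= K"
 shows "nni (%t. t powr al*evb n t) {0<..} <= ennreal K"
proof -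
 obtain T where T: "T \<subseteq> (UNIV :: 'n set)" "card T = 3" using obtain_subset_with_card_n[OF d] by blast
 obtain a b c where abc: "T = {a, b, c}" "a ~= b" "b ~= c" "a ~= c" using T(2) by (auto simp: card_3_iff)
 let ?m = "%i. max 1 \<bar>real_of_int (n $ i)\<bar>"
 have "evb n t <= \<bar>bes (n $ a) t\<bar>*\<bar>bes (n $ b) t\<bar>*\<bar>bes (n $ c) t\<bar>" for t
 proof -
  have "evb n t = (\<Prod>i\<in>T. \<bar>bes (n $ i) t\<bar>)*(\<Prod>i\<in>UNIV - T. \<bar>bes (n $ i) t\<bar>)"
   unfolding evb_def by (subst prod.subset_diff[of T UNIV]) (auto simp: mult.commute)
  also have "... <= (\<Prod>i\<in>T. \<bar>bes (n $ i) t\<bar>)*1" by (intro mult_left_mono prod_le_1 prod_nonneg) (auto intro: abs_bes_le_1)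
  finally show ?thesis using abc by (simp add: mult_ac)
 qed
 hence "nni (%t. t powr al*evb n t) {0<..} <=
   (nni (%t. t powr al*(\<bar>bes (n $ a) t\<bar>*\<bar>bes (n $ b) t\<bar>*\<bar>bes (n $ c) t\<bar>)) {0<..})"
  by (intro nn_integral_mono mult_right_mono ennreal_leI mult_left_mono) auto
 also have "... <= ennreal (K*(?m a*?m b*?m c) powr ((al - 1/2)/3))" by (rule nn_integral_evb_3[OF abc(2-4) al K])
 also have "... <= ennreal (K*1)"
 proof (intro ennreal_leI mult_left_mono)
  have "1*1*1 <= ?m a*?m b*?m c" by (intro mult_mono) auto
  hence "1 <= ?m a*?m b*?m c" by simp
  from powr_mono2'[OF _ _ this, of "(al - 1/2)/3"]
  show "(?m a*?m b*?m c) powr ((al - 1/2)/3) <= 1" using al by simp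
 qed (use K in auto)
 finally show ?thesis by simp
qed

lemma nn_integral_evb:
 assumes "3 <= CARD('n)" shows "nni (%t. evb (n :: int ^ 'n::finite) t) {0<..} <= ennreal 5"
proof -
 have "nni (%t. evb n t) {0<..} = nni (%t. t powr 0*evb n t) {0<..}" by (intro nn_integral_cong) (auto simp: indicator_def)
 also have "... <= ennreal 5" by (rule nn_integral_evb_weighted[OF assms]) auto
 finally show ?thesis .
qed

text \<open>The factor t^(1/4) is the price of the Hoelder exponent 1/4 in
  \<open>grn_hoelder\<close>.\<close>

lemma nn_integral_evb_quarter:
 assumes "3 <= CARD('n)" shows "nni (%t. t powr (1/4)*evb (n :: int ^ 'n::finite) t) {0<..} <= ennreal 11"
proof (rule nn_integral_evb_weighted[OF assms])
 have "2 powr (1/4) <= 2 powr (1::real)" by (intro powr_mono) auto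
 thus "140/100 + (155/100 + 81/100/(1/2 - 1/4))*2 powr (1/4) <= (11::real)" by simp
qed auto

lemma nn_integral_evb_dim3:
 fixes n :: "int ^ 'n::finite"
 assumes d: "CARD('n) = 3" shows "nni (%t. evb n t) {0<..} <= ennreal (5*(\<Prod>i\<in>UNIV. max 1 \<bar>real_of_int (n $ i)\<bar> powr (-1/6)))"
proof -
 obtain a b c where abc: "(UNIV :: 'n set) = {a, b, c}" "a ~= b" "b ~= c" "a ~= c" using d by (auto simp: card_3_iff)
 let ?m = "%i. max 1 \<bar>real_of_int (n $ i)\<bar>"
 have "nni (%t. evb n t) {0<..} = (nni (%t. t powr 0*(\<bar>bes (n $ a) t\<bar>*\<bar>bes (n $ b) t\<bar>*\<bar>bes (n $ c) t\<bar>)) {0<..})"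
  unfolding evb_def abc(1) using abc(2-4) by (intro nn_integral_cong) (auto simp: indicator_def mult_ac)
 also have "... <= ennreal (5*(?m a*?m b*?m c) powr ((0 - 1/2)/3))" by (rule nn_integral_evb_3[OF abc(2-4)]) auto
 also have "(?m a*?m b*?m c) powr ((0 - 1/2)/3) = (\<Prod>i\<in>UNIV. ?m i powr (-1/6))"
  unfolding abc(1) using abc(2-4) by (simp add: powr_mult mult_ac)
 finally show ?thesis .
qed

section \<open>Summability of the resolvent kernel\<close>

lemma finite_box:
 fixes G :: "(int ^ 'n::finite) set"
 assumes "finite G"
 obtains N :: nat where "!!n i. n \<in> G ==> n $ i \<in> {-int N..int N}"
proof -
 define A where "A = (%(n, i). nat \<bar>n $ i\<bar>) ` (G \<times> (UNIV :: 'n set))"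
 have A: "finite A" using assms by (simp add: A_def)
 define M where "M = Max A"
 have "n $ i \<in> {- int M..int M}" if "n \<in> G" for n :: "int ^ 'n" and i
 proof -
  have "nat \<bar>n $ i\<bar> \<in> A" using that by (force simp: A_def)
  hence "nat \<bar>n $ i\<bar> <= M" using A unfolding M_def by (intro Max_ge)
  thus ?thesis by auto
 qed
 thus ?thesis by (rule that)
qed

lemma sum_prod_components_le:
 fixes G :: "(int ^ 'n::finite) set" and f :: "int => real"
 assumes "finite G" "!!k. 0 <= f k" and box: "!!n i. n \<in> G ==> n $ i \<in> {-int N..int N}"
 shows "(\<Sum>n\<in>G. \<Prod>i\<in>UNIV. f (n $ i)) <= (\<Sum>k\<in>{-int N..int N}. f k)^CARD('n)"
proof -
 have "(\<Sum>n\<in>G. \<Prod>i\<in>UNIV. f (n $ i)) = (\<Sum>g\<in>vec_nth ` G. \<Prod>i\<in>UNIV. f (g i))"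
  by (subst sum.reindex) (auto simp: inj_on_def vec_nth_inject)
 also have "... <= (\<Sum>g\<in>(UNIV :: 'n set) \<rightarrow>\<^sub>E {-int N..int N}. \<Prod>i\<in>UNIV. f (g i))"
 proof (rule sum_mono2)
  show "finite ((UNIV :: 'n set) \<rightarrow>\<^sub>E {-int N..int N})" by (intro finite_PiE) auto
  show "vec_nth ` G \<subseteq> (UNIV :: 'n set) \<rightarrow>\<^sub>E {-int N..int N}" using box by (auto simp: PiE_def)
 qed (use assms in \<open>auto intro!: prod_nonneg\<close>)
 also have "... = (\<Prod>i\<in>(UNIV::'n set). \<Sum>k\<in>{-int N..int N}. f k)" by (rule prod_sum_PiE[symmetric]) auto
 finally show ?thesis by simp
qed

text \<open>By duality with \<open>r\<^sup>q\<^sup>-\<^sup>1\<close>, normalised in the dual exponent.\<close>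

lemma minkowski_integral:
 fixes r :: "'a => real" and g :: "'a => real => real"
 assumes G: "finite G" and q: "1 < q" and r0: "!!n. n \<in> G ==> 0 <= r n" and r: "!!n. n \<in> G ==> ennreal (r n) <= (nni (%t. g n t) {0<..})"
  and g0: "!!n t. n \<in> G ==> 0 <= g n t" and gm: "!!n. n \<in> G ==> g n \<in> borel_measurable borel"
  and gh: "!!t. 0 < t ==> (\<Sum>n\<in>G. g n t powr q) <= h t powr q" and h0: "!!t. 0 < t ==> 0 < h t"
  and H: "nni (%t. h t) {0<..} <= ennreal H" "0 <= H" shows "(\<Sum>n\<in>G. r n powr q) <= H powr q"
proof (cases "(\<Sum>n\<in>G. r n powr q) = 0")
 case False
 define M where "M = (\<Sum>n\<in>G. r n powr q)"
 have M: "0 < M" using False sum_nonneg[of G "%n. r n powr q"] by (simp add: M_def)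
 define N where "N = M powr (1/q)"
 have N: "0 < N" and NM: "N powr q = M" using M q by (auto simp: N_def powr_powr)
 define q' where "q' = q/(q - 1)"
 have q': "1 < q'" "1/q + 1/q' = 1" using q by (auto simp: q'_def field_simps)
 define c where "c = (%n. (r n/N) powr (q - 1))"
 have c0: "0 <= c n" for n by (simp add: c_def)
 have cq: "c n powr q' = r n powr q/M" if "n \<in> G" for n
 proof -
  have "c n powr q' = (r n/N) powr q" using q by (simp add: c_def powr_powr q'_def)
  also have "... = r n powr q/M" using r0[OF that] N by (simp add: powr_divide NM)
  finally show ?thesis .
 qed
 have rc: "(\<Sum>n\<in>G. r n * c n) = N"
 proof -
  have "r n * c n = N*(r n powr q/M)" if "n \<in> G" for n
  proof (cases "r n = 0")
   case False
   hence rn: "0 < r n" using r0[OF that] by simp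
   have "r n * c n = N*((r n/N) powr 1*(r n/N) powr (q - 1))" using rn N by (simp add: c_def)
   also have "(r n/N) powr 1*(r n/N) powr (q - 1) = (r n/N) powr q" by (subst powr_add[symmetric]) simp
   also have "... = r n powr q/M" using r0[OF that] N by (simp add: powr_divide NM)
   finally show ?thesis .
  qed (use q in simp)
  hence "(\<Sum>n\<in>G. r n * c n) = (\<Sum>n\<in>G. N*(r n powr q/M))" by (rule sum.cong[OF refl])
  also have "... = N*((\<Sum>n\<in>G. r n powr q)/M)" by (simp add: sum_distrib_left sum_divide_distrib)
  finally show ?thesis using M by (simp add: M_def[symmetric])
 qed
 have pw: "(\<Sum>n\<in>G. g n t * c n) <= h t" if t: "0 < t" for t
 proof -
  have "(\<Sum>n\<in>G. g n t * c n) = (\<Sum>n\<in>G. h t*((g n t/h t) * c n))" using h0[OF t] by (intro sum.cong) auto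
  also have "... <= (\<Sum>n\<in>G. h t*(g n t powr q/h t powr q/q + (r n powr q/M)/q'))"
  proof (rule sum_mono)
   fix n assume n: "n \<in> G"
   \<comment> \<open>Young's inequality for normalised factors sums to 1/q + 1/q' = 1, which is
     Hoelder's inequality for the finite sum.\<close>
   have "(g n t/h t) * c n <= (g n t/h t) powr q/q + c n powr q'/q'"
    by (rule Youngs_inequality) (use q q' g0[OF n] h0[OF t] c0 in \<open>auto simp: less_imp_le\<close>)
   thus "h t*((g n t/h t) * c n) <= h t*(g n t powr q/h t powr q/q + (r n powr q/M)/q')"
    unfolding cq[OF n] using h0[OF t] g0[OF n] by (intro mult_left_mono) (auto simp: powr_divide less_imp_le)
  qed
  also have "... = h t*((\<Sum>n\<in>G. g n t powr q)/h t powr q/q + ((\<Sum>n\<in>G. r n powr q)/M)/q')"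
   by (simp only: sum_distrib_left[symmetric] sum.distrib sum_divide_distrib)
  also have "... = h t*((\<Sum>n\<in>G. g n t powr q)/h t powr q/q + (M/M)/q')" by (simp only: M_def)
  also have "... <= h t*(1/q + 1/q')" using gh[OF t] h0[OF t] q q' M by (intro mult_left_mono add_mono divide_right_mono) (auto simp: less_imp_le)
  finally show ?thesis by (simp add: q')
 qed
 have "ennreal N = (\<Sum>n\<in>G. ennreal (r n * c n))" unfolding rc[symmetric] by (rule sum_ennreal[symmetric]) (use r0 c0 in auto)
 also have "... = (\<Sum>n\<in>G. ennreal (c n)*ennreal (r n))"
  by (intro sum.cong refl) (use c0 r0 in \<open>simp add: ennreal_mult mult.commute\<close>)
 also have "... <= (\<Sum>n\<in>G. ennreal (c n)*(nni (%t. g n t) {0<..}))" by (intro sum_mono mult_left_mono r) auto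
 also have "... = (\<Sum>n\<in>G. (\<integral>\<^sup>+t. ennreal (c n)*(ennreal (g n t)*indicator {0<..} t) \<partial>lborel))"
  by (intro sum.cong refl nn_integral_cmult[symmetric]) (use gm in measurable)
 also have "... = (\<integral>\<^sup>+t. (\<Sum>n\<in>G. ennreal (c n)*(ennreal (g n t)*indicator {0<..} t)) \<partial>lborel)"
  by (rule nn_integral_sum[symmetric]) (use gm in measurable)
 also have "... <= (nni (%t. h t) {0<..})"
 proof (rule nn_integral_mono)
  fix t :: real
  show "(\<Sum>n\<in>G. ennreal (c n)*(ennreal (g n t)*indicator {0<..} t)) <= ennreal (h t)*indicator {0<..} t"
  proof (cases "0 < t")
   case True
   have "(\<Sum>n\<in>G. ennreal (c n)*(ennreal (g n t)*indicator {0<..} t)) = (\<Sum>n\<in>G. ennreal (g n t * c n))"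
    using True c0 g0 by (intro sum.cong refl) (simp add: ennreal_mult mult.commute)
   also have "... = ennreal (\<Sum>n\<in>G. g n t * c n)" by (rule sum_ennreal) (use c0 g0 in auto)
   also have "... <= ennreal (h t)" by (intro ennreal_leI pw True)
   finally show ?thesis using True by simp
  qed simp
 qed
 also have "... <= ennreal H" by (rule H)
 finally have "N <= H" using H(2) by (simp add: ennreal_le_iff)
 hence "N powr q <= H powr q" using N q by (intro powr_mono2) auto
 thus ?thesis by (simp add: NM M_def)
qed (simp add: H)

lemma bmaj_le_1: "bmaj t <= 1"
proof (cases "t <= 1/2")
 case False
 hence "ln (2*t) <= 2*t - 1" by (intro ln_le_minus_one) simp
 thus ?thesis using False by (simp add: bmaj_def divide_le_eq)
qed (simp add: bmaj_def)

lemma bmaj_pos: "0 < bmaj t" by (auto simp: bmaj_def intro!: divide_pos_pos add_pos_nonneg)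

lemma bmaj_measurable [measurable]: "bmaj \<in> borel_measurable borel" unfolding bmaj_def[abs_def] by measurable

text \<open>The logarithm is absorbed by ln y <= y - 1 at y = exp (ep - 1) (2 t)^ep. The constant
  exp (ep - 1)/ep is the maximum of (1 + ln s) s^(- ep), so nothing is lost.\<close>

lemma bmaj_le_powr:
 assumes "0 < ep" "1/2 < t" shows "bmaj t <= exp (ep - 1)/ep*(2*t) powr (ep - 1)"
proof -
 define s where "s = 2*t"
 have s: "0 < s" using assms by (simp add: s_def)
 have "ln (exp (ep - 1) * s powr ep) <= exp (ep - 1) * s powr ep - 1" using s by (intro ln_le_minus_one) simp
 also have "ln (exp (ep - 1) * s powr ep) = ep - 1 + ep*ln s" using s by (simp add: ln_mult ln_powr)
 finally have "ep*(1 + ln s) <= exp (ep - 1) * s powr ep" by (simp add: algebra_simps)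
 hence "1 + ln s <= exp (ep - 1)/ep * s powr ep" using assms(1) by (simp add: field_simps)
 hence "(1 + ln s) / s <= exp (ep - 1)/ep * s powr ep / s" using s by (intro divide_right_mono) auto
 also have "... = exp (ep - 1)/ep*(s powr ep / s powr 1)" using s by simp
 also have "s powr ep / s powr 1 = s powr (ep - 1)" by (rule powr_diff[symmetric])
 finally show ?thesis using assms by (simp add: bmaj_def s_def)
qed

lemma nn_integral_decay:
 assumes h: "!!t. 0 < t ==> t <= 1/2 ==> h t <= 1" "!!t. 1/2 < t ==> h t <= C*(2*t) powr (- 1 - sg)" and sg: "0 < sg" and C: "0 <= C"
 shows "nni (%t. h t) {0<..} <= ennreal (1/2 + C/(2 * sg))"
proof -
 let ?C = "C*2 powr (- 1 - sg)"
 have "nni h {0<..} <= ennreal (1*(1/2 - 0) + ?C*(1/2) powr (- 1 - sg + 1)/(- (- 1 - sg) - 1))"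
 proof (rule nni_split)
  show "t \<in> {0..1/2} \<and> h t <= 1 \<or> t \<in> {1/2..} \<and> h t <= ?C*t powr (- 1 - sg)" if "t \<in> {0<..}" for t
   using h[of t] that by (cases "t <= 1/2") (auto simp: powr_mult mult.assoc)
  show "nni (%_. 1) {0..1/2} <= ennreal (1*(1/2 - 0))" by (rule nn_integral_le_const_interval) auto
  show "nni (%t. ?C*t powr (- 1 - sg)) {1/2..} <= ennreal (?C*(1/2) powr (- 1 - sg + 1)/(- (- 1 - sg) - 1))"
   by (rule eq_refl, rule nn_integral_powr_tail) (use sg C in auto)
 qed (use sg C in auto)
 also have "?C*(1/2) powr (- 1 - sg + 1)/(- (- 1 - sg) - 1) = C/(2 * sg)"
 proof -
  have "(1/2::real) powr (- sg) = 2 powr sg" by (simp add: powr_divide powr_minus)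
  moreover have "2 powr (- 1 - sg)*2 powr sg = (2::real) powr (-1)" by (subst powr_add[symmetric]) simp
  moreover have "(2::real) powr (-1) = 1/2" by (simp add: powr_minus)
  ultimately have "2 powr (- 1 - sg)*(1/2::real) powr (- sg) = 1/2" by simp
  hence "C*(2 powr (- 1 - sg)*(1/2::real) powr (- sg)) / sg = C*(1/2) / sg" by (simp only:)
  thus ?thesis by (simp add: mult.assoc)
 qed
 finally show ?thesis by simp
qed

text \<open>The terms with k = -1, 0, 1 give 3, and the comparison with an integral gives 1/(s - 1)
  on each side. With s = q/6 this is the expression 3 + 2 \<kappa> in \<open>Gam\<close> for d =
  3.\<close>

lemma sum_max_powr_le:
 assumes "1 < s" shows "(\<Sum>k\<in>{-int N..int N}. max 1 \<bar>real_of_int k\<bar> powr (-s)) <= 3 + 2/(s - 1)"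
proof -
 have pos: "(\<Sum>k\<in>{1..N}. real k powr (-s)) <= 1 + 1/(s - 1)"
 proof (cases "N = 0")
  case False
  have step: "real (Suc k) powr (-s) <= (real k powr (1 - s) - real (Suc k) powr (1 - s))/(s - 1)" if "1 <= k" for k
  proof -
   have "\<exists>z>real k. z < real (Suc k) \<and> real (Suc k) powr (1 - s)/(1 - s) - real k powr (1 - s)/(1 - s) = (real (Suc k) - real k)*z powr (- s)"
    by (rule MVT2) (use that assms in \<open>auto intro!: derivative_eq_intros\<close>)
   then obtain z where z: "real k < z" "z < real (Suc k)" "real (Suc k) powr (1 - s)/(1 - s) - real k powr (1 - s)/(1 - s) = z powr (- s)" by auto
   have "real (Suc k) powr (-s) <= z powr (-s)" using z that assms by (intro powr_mono2') auto
   also have "z powr (-s) = (real k powr (1 - s) - real (Suc k) powr (1 - s))/(s - 1)"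
    unfolding z(3)[symmetric] by (metis diff_divide_distrib minus_diff_eq minus_divide_divide)
   finally show ?thesis .
  qed
  have "(\<Sum>k\<in>{1..Suc n}. real k powr (-s)) <= 1 + (1 - real (Suc n) powr (1 - s))/(s - 1)" for n
  proof (induction n)
   case (Suc n)
   thus ?case using step[of "Suc n"] by (simp add: diff_divide_distrib)
  qed simp
  from this[of "N - 1"] have "(\<Sum>k\<in>{1..N}. real k powr (-s)) <= 1 + (1 - real N powr (1 - s))/(s - 1)" using False by simp
  also have "... <= 1 + 1/(s - 1)" using assms by (intro add_mono divide_right_mono) auto
  finally show ?thesis .
 qed (use assms in simp)
 have split: "{-int N..int N} = insert 0 (int ` {1..N} \<union> (%k. - int k) ` {1..N})"
 proof (intro equalityI subsetI)
  fix k assume k: "k \<in> {-int N..int N}"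
  consider "k = 0" | "0 < k" | "k < 0" by linarith
  thus "k \<in> insert 0 (int ` {1..N} \<union> (%k. - int k) ` {1..N})"
  proof cases
   case 2
   hence "k = int (nat k)" "nat k \<in> {1..N}" using k by auto
   thus ?thesis by blast
  next
   case 3
   hence "k = - int (nat (- k))" "nat (- k) \<in> {1..N}" using k by auto
   thus ?thesis by blast
  qed simp
 qed auto
 let ?f = "%k. max 1 \<bar>real_of_int k\<bar> powr (-s)"
 have "sum ?f {-int N..int N} = 1 + (sum ?f (int ` {1..N}) + sum ?f ((%k. - int k) ` {1..N}))"
  unfolding split by (subst sum.insert) (auto intro!: sum.union_disjoint)
 also have "sum ?f (int ` {1..N}) = (\<Sum>k\<in>{1..N}. real k powr (-s))" by (subst sum.reindex) (auto intro!: sum.cong simp: max_def)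
 also have "sum ?f ((%k. - int k) ` {1..N}) = (\<Sum>k\<in>{1..N}. real k powr (-s))"
  by (subst sum.reindex) (auto intro!: sum.cong simp: max_def inj_on_def)
 finally show ?thesis using pos by simp
qed

lemma powr_prod: "(!!i. i \<in> A ==> 0 <= f i) ==> (\<Prod>i\<in>A. f i) powr s = (\<Prod>i\<in>A. (f i :: real) powr s)"
 by (induction A rule: infinite_finite_induct) (auto simp: powr_mult prod_nonneg)

text \<open>By \<open>nn_integral_evb_dim3\<close> the q-th power decays like |n_i|^(- q/6) in every
  coordinate, and the sum factorises over the three coordinates. The assumption 6 < q is the
  condition p < 6/5 for q = p/(p - 1).\<close>

lemma lq_bound_dim3:
 fixes G :: "(int ^ 'n::finite) set"
 assumes d: "CARD('n) = 3" and q: "6 < q" and G: "finite G" and r0: "!!n. n \<in> G ==> 0 <= r n"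
  and r: "!!n. n \<in> G ==> ennreal (r n) <= (nni (%t. evb n t) {0<..})"
 shows "(\<Sum>n\<in>G. r n powr q) <= (5*(3 + 2*(6/(q - 6))) powr (3/q)) powr q"
proof -
 let ?m = "%k. max 1 \<bar>real_of_int k\<bar>"
 obtain N where N: "!!n i. n \<in> G ==> n $ i \<in> {-int N..int N}" using finite_box[OF G] by blast
 have "r n powr q <= 5 powr q*(\<Prod>i\<in>UNIV. ?m (n $ i) powr (- (q/6)))" if n: "n \<in> G" for n
 proof -
  have "ennreal (r n) <= ennreal (5*(\<Prod>i\<in>UNIV. ?m (n $ i) powr (-1/6)))" by (rule order_trans[OF r[OF n] nn_integral_evb_dim3[OF d]])
  hence "r n <= 5*(\<Prod>i\<in>UNIV. ?m (n $ i) powr (-1/6))" by (subst (asm) ennreal_le_iff) (auto intro!: prod_nonneg)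
  hence "r n powr q <= (5*(\<Prod>i\<in>UNIV. ?m (n $ i) powr (-1/6))) powr q" using q r0[OF n] by (intro powr_mono2) auto
  also have "... = 5 powr q*(\<Prod>i\<in>UNIV. (?m (n $ i) powr (-1/6)) powr q)" by (simp add: powr_mult powr_prod prod_nonneg)
  also have "(%i. (?m (n $ i) powr (-1/6)) powr q) = (%i. ?m (n $ i) powr (- (q/6)))" unfolding powr_powr by (simp add: algebra_simps)
  finally show ?thesis .
 qed
 hence "(\<Sum>n\<in>G. r n powr q) <= (\<Sum>n\<in>G. 5 powr q*(\<Prod>i\<in>UNIV. ?m (n $ i) powr (- (q/6))))" by (rule sum_mono)
 also have "... = 5 powr q*(\<Sum>n\<in>G. \<Prod>i\<in>UNIV. ?m (n $ i) powr (- (q/6)))" by (rule sum_distrib_left[symmetric])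
 also have "... <= 5 powr q*(\<Sum>k\<in>{-int N..int N}. ?m k powr (- (q/6)))^CARD('n)"
  by (intro mult_left_mono sum_prod_components_le[OF G _ N]) auto
 also have "... <= 5 powr q*(3 + 2/(q/6 - 1))^CARD('n)" using q by (intro mult_left_mono power_mono sum_max_powr_le sum_nonneg) auto
 also have "... = 5 powr q*(3 + 2*(6/(q - 6)))^3"
 proof -
  have "2/(q/6 - 1) = 2*(6/(q - 6))" using q by (simp add: field_simps)
  thus ?thesis by (simp only: d)
 qed
 also have "(3 + 2*(6/(q - 6)))^3 = ((3 + 2*(6/(q - 6))) powr (3/q)) powr q"
 proof -
  have p: "0 < 3 + 2*(6/(q - 6))" using q by (intro add_pos_nonneg) auto
  have "((3 + 2*(6/(q - 6))) powr (3/q)) powr q = (3 + 2*(6/(q - 6))) powr (real 3)" unfolding powr_powr using q by simp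
  thus ?thesis using powr_realpow[OF p, of 3] by simp
 qed
 also have "5 powr q*... = (5*(3 + 2*(6/(q - 6))) powr (3/q)) powr q" by (rule powr_mult[symmetric])
 finally show ?thesis .
qed

text \<open>The sum factorises over the coordinates. Each factor is reduced to the fourth power sum
  by taking out q - 4 powers of the uniform bound \<open>b\<close>, the trivial 1 or the t^(-1/3)
  bound.\<close>

lemma sum_evb_powr_le:
 fixes G :: "(int ^ 'n::finite) set"
 assumes G: "finite G" and q: "4 <= q" and t: "0 < t" and b: "!!k. \<bar>bes k t\<bar> <= b" "0 < b"
 shows "(\<Sum>n\<in>G. evb n t powr q) <= (bmaj t powr (real CARD('n)/q)*b powr ((q - 4)*(real CARD('n)/q))) powr q"
proof -
 obtain N where N: "!!n i. n \<in> G ==> n $ i \<in> {-int N..int N}" using finite_box[OF G] by blast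
 have "(\<Sum>k\<in>{-int N..int N}. \<bar>bes k t\<bar> powr q) <= (\<Sum>k\<in>{-int N..int N}. bes k t^4*b powr (q - 4))"
 proof (rule sum_mono)
  fix k
  show "\<bar>bes k t\<bar> powr q <= bes k t^4*b powr (q - 4)"
  proof (cases "bes k t = 0")
   case False
   have "\<bar>bes k t\<bar> powr q = \<bar>bes k t\<bar> powr (real 4)*\<bar>bes k t\<bar> powr (q - 4)" by (subst powr_add[symmetric]) simp
   also have "\<bar>bes k t\<bar> powr (real 4) = bes k t^4" using False by (subst powr_realpow) auto
   also have "bes k t^4*\<bar>bes k t\<bar> powr (q - 4) <= bes k t^4*b powr (q - 4)" using b q by (intro mult_left_mono powr_mono2) auto
   finally show ?thesis .
  qed (use q in simp)
 qed
 also have "... = (\<Sum>k\<in>{-int N..int N}. bes k t^4)*b powr (q - 4)" by (rule sum_distrib_right[symmetric])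
 also have "... <= bmaj t*b powr (q - 4)" by (intro mult_right_mono sum_bes_power4_le t) auto
 finally have S: "(\<Sum>k\<in>{-int N..int N}. \<bar>bes k t\<bar> powr q) <= bmaj t*b powr (q - 4)" .
 have "(\<Sum>n\<in>G. evb n t powr q) = (\<Sum>n\<in>G. \<Prod>i\<in>UNIV. \<bar>bes (n $ i) t\<bar> powr q)" by (simp add: evb_def powr_prod)
 also have "... <= (\<Sum>k\<in>{-int N..int N}. \<bar>bes k t\<bar> powr q)^CARD('n)"
  by (rule sum_prod_components_le[OF G _ N, of "%k. \<bar>bes k t\<bar> powr q"]) auto
 also have "... <= (bmaj t*b powr (q - 4))^CARD('n)" by (intro power_mono S sum_nonneg) auto
 also have "... = (bmaj t*b powr (q - 4)) powr (real CARD('n))" using bmaj_pos[of t] b by (intro powr_realpow[symmetric]) simp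
 also have "... = (bmaj t powr (real CARD('n)/q)*b powr ((q - 4)*(real CARD('n)/q))) powr q" using q by (simp add: powr_mult powr_powr)
 finally show ?thesis .
qed

lemma nn_integral_bmaj_powr:
 assumes "0 < ep" "1 < s*(1 - ep)" "0 < s" shows "(nni (%t. bmaj t powr s) {0<..}) <= ennreal (1/2 + (exp (ep - 1)/ep) powr s/(2*(s*(1 - ep) - 1)))"
proof (rule nn_integral_decay)
 fix t :: real
 show "bmaj t powr s <= 1" using bmaj_le_1[of t] bmaj_pos[of t] assms by (intro powr_le1) (auto simp: less_imp_le)
 assume t: "1/2 < t"
 have "bmaj t powr s <= (exp (ep - 1)/ep*(2*t) powr (ep - 1)) powr s"
  using bmaj_le_powr[OF assms(1) t] bmaj_pos[of t] assms by (intro powr_mono2) (auto simp: less_imp_le)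
 also have "... = (exp (ep - 1)/ep) powr s*(2*t) powr ((ep - 1) * s)" by (simp only: powr_mult powr_powr)
 also have "(ep - 1) * s = - 1 - (s*(1 - ep) - 1)" by (simp add: algebra_simps)
 finally show "bmaj t powr s <= (exp (ep - 1)/ep) powr s*(2*t) powr (- 1 - (s*(1 - ep) - 1))" .
qed (use assms in auto)

text \<open>Minkowski's inequality at the exponent 4, followed by the contractive inclusion of l^4
  in l^q; the constant is therefore the same for all q.\<close>

lemma lq_bound_high_dim:
 fixes G :: "(int ^ 'n::finite) set"
 assumes q: "4 <= q" and G: "finite G" and r0: "!!n. n \<in> G ==> 0 <= r n" and r: "!!n. n \<in> G ==> ennreal (r n) <= (nni (%t. evb n t) {0<..})"
  and C: "nni (%t. bmaj t powr (real CARD('n)/4)) {0<..} <= ennreal C" "0 <= C" shows "(\<Sum>n\<in>G. r n powr q) <= C powr q"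
proof -
 have four: "(\<Sum>n\<in>G. r n powr 4) <= C powr 4"
 proof (rule minkowski_integral[where g = evb and h = "%t. bmaj t powr (real CARD('n)/4)"])
  fix t :: real assume t: "0 < t"
  show "(\<Sum>n\<in>G. evb n t powr 4) <= (bmaj t powr (real CARD('n)/4)) powr 4" using sum_evb_powr_le[OF G _ t abs_bes_le_1, of 4] by simp
 qed (use assms bmaj_pos in \<open>auto simp: evb_nonneg less_imp_neq[symmetric]\<close>)
 have rC: "r n <= C" if "n \<in> G" for n
 proof -
  have "r n powr 4 <= (\<Sum>n\<in>G. r n powr 4)" using that G by (intro member_le_sum) auto
  with four have "r n powr 4 <= C powr 4" by simp
  hence "(r n powr 4) powr (1/4) <= (C powr 4) powr (1/4)" by (intro powr_mono2[of "1/4" "r n powr 4" "C powr 4"]) auto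
  thus ?thesis using r0[OF that] C(2) unfolding powr_powr by simp
 qed
 have "(\<Sum>n\<in>G. r n powr q) <= (\<Sum>n\<in>G. r n powr 4*C powr (q - 4))"
 proof (rule sum_mono)
  fix n assume n: "n \<in> G"
  have "r n powr q = r n powr 4*r n powr (q - 4)" by (subst powr_add[symmetric]) simp
  also have "... <= r n powr 4*C powr (q - 4)" using r0[OF n] rC[OF n] q by (intro mult_left_mono powr_mono2) auto
  finally show "r n powr q <= r n powr 4*C powr (q - 4)" .
 qed
 also have "... = (\<Sum>n\<in>G. r n powr 4)*C powr (q - 4)" by (rule sum_distrib_right[symmetric])
 also have "... <= C powr 4*C powr (q - 4)" by (intro mult_right_mono four) auto
 also have "... = C powr q" by (subst powr_add[symmetric]) simp
 finally show ?thesis .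
qed

lemma exp_upper_bounds: "exp (-9/10) <= (434/1000::real)" "exp (-5/6) <= (46/100::real)"
proof -
 have e: "exp (- x) <= 1/(1 + x + x^2/2)" if "0 <= x" for x :: real using le_imp_inverse_le[OF exp_lower_Taylor_quadratic[OF that]] that
  by (simp add: exp_minus inverse_eq_divide add_pos_nonneg)
 show "exp (-9/10) <= (434/1000::real)" "exp (-5/6) <= (46/100::real)" using e[of "9/10"] e[of "5/6"] by (simp_all add: power2_eq_square)
qed

text \<open>The choices ep = 1/10 at the power 5/4 and ep = 1/6 at 3/2 leave the decay exponents 9/8
  and 5/4, both above 1, and give the integrals 28.5 and 10.5, below the 29 and 11 of the next
  lemma.\<close>

lemma exp_powr_bounds: "(exp (1/10 - 1)/(1/10)) powr (5/4) <= (7::real)" "(exp (1/6 - 1)/(1/6)) powr (3/2) <= (5::real)"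
proof -
 have "(exp (1/10 - 1)/(1/10)) powr (5/4) <= (434/100::real) powr (5/4)" using exp_upper_bounds(1) by (intro powr_mono2) auto
 also have "... = ((434/100)^5) powr (1/4)" using power_powr[of "434/100" 5 "1/4"] by simp
 also have "... <= (7^4) powr (1/4)" by (intro powr_mono2) (auto simp: power_divide)
 also have "... = 7" using power_powr[of 7 4 "1/4"] by simp
 finally show "(exp (1/10 - 1)/(1/10)) powr (5/4) <= (7::real)" .
 have "(exp (1/6 - 1)/(1/6)) powr (3/2) <= (276/100::real) powr (3/2)" using exp_upper_bounds(2) by (intro powr_mono2) auto
 also have "... = ((276/100)^3) powr (1/2)" using power_powr[of "276/100" 3 "1/2"] by simp
 also have "... <= (5^2) powr (1/2)" by (intro powr_mono2) (auto simp: power_divide)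
 also have "... = 5" using power_powr[of 5 2 "1/2"] by simp
 finally show "(exp (1/6 - 1)/(1/6)) powr (3/2) <= (5::real)" .
qed

text \<open>The constant of the theorem, \<open>14 * 2\<^bsup>d/4\<^esup> / (d - 4)\<close>, is above 33 for \<open>d = 5\<close> and at least 13 beyond.\<close>

lemma nn_integral_bmaj_high_dim:
 assumes "5 <= d" shows "nni (%t. bmaj t powr (real d/4)) {0<..} <= ennreal (if d = 5 then 29 else 11)"
proof (cases "d = 5")
 case True
 have "(nni (%t. bmaj t powr (5/4)) {0<..}) <= ennreal (1/2 + (exp (1/10 - 1)/(1/10)) powr (5/4)/(2*(5/4*(1 - 1/10) - 1)))"
  by (rule nn_integral_bmaj_powr) auto
 also have "... <= ennreal 29" using exp_powr_bounds(1) by (intro ennreal_leI) simp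
 finally show ?thesis using True by simp
next
 case False
 have "nni (%t. bmaj t powr (real d/4)) {0<..} <= (nni (%t. bmaj t powr (3/2)) {0<..})" using assms False bmaj_le_1 bmaj_pos
  by (intro nn_integral_mono mult_right_mono ennreal_leI powr_mono') (auto simp: less_imp_le)
 also have "... <= ennreal (1/2 + (exp (1/6 - 1)/(1/6)) powr (3/2)/(2*(3/2*(1 - 1/6) - 1)))" by (rule nn_integral_bmaj_powr) auto
 also have "... <= ennreal 11" using exp_powr_bounds(2) by (intro ennreal_leI) simp
 finally show ?thesis using False by simp
qed

text \<open>For d = 4 the l^4 norm decays only like (log t)/t, which just fails to be integrable.
  With be = 4/q < 1 the remaining share 1 - be is estimated by b^4 of order t^(-4/3), which raises
  the decay exponent above 1.\<close>

lemma lq_bound_dim4: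
 fixes G :: "(int ^ 'n::finite) set"
 assumes d: "CARD('n) = 4" and q: "4 < q" and G: "finite G" and r0: "!!n. n \<in> G ==> 0 <= r n"
  and r: "!!n. n \<in> G ==> ennreal (r n) <= (nni (%t. evb n t) {0<..})"
 defines "be \<equiv> 4/q"
 shows "(\<Sum>n\<in>G. r n powr q) <= (1/2 + 1/2*(276/100/(1 - be)) powr be*(62/10) powr (1 - be)*(6/((1 - be)*(2 - be)))) powr q"
proof -
 have be: "0 < be" "be < 1" using q by (auto simp: be_def)
 have qb: "(q - 4)*be = 4*(1 - be)" "real CARD('n)/q = be" using q by (simp_all add: be_def d field_simps)
 define b where "b = (%t::real. if t <= 1/2 then 1 else 5/4*t powr (-1/3))"
 have b: "0 < b t" "\<bar>bes k t\<bar> <= b t" if "0 < t" for k and t :: real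
  using that bes_uniform_bound[of t k] abs_bes_le_1[of k t] by (auto simp: b_def)
 have bm: "b \<in> borel_measurable borel" unfolding b_def by measurable
 define h where "h = (%t. bmaj t powr be*b t powr (4*(1 - be)))"
 \<comment> \<open>The gain over the exponent 1 is (1 - be)/3. The logarithm is absorbed at the cost
   ep * be = be (1 - be)/6, which leaves the positive exponent \<open>sg\<close>.\<close>
 define ep where "ep = (1 - be)/6"
 have ep: "0 < ep" "ep <= 1/6" using be by (auto simp: ep_def)
 define sg where "sg = (1 - be)*(1/3 - be/6)"
 have sg: "0 < sg" using be unfolding sg_def by (intro mult_pos_pos) auto
 define C where "C = (276/100/(1 - be)) powr be*(62/10) powr (1 - be)"
 have "nni (%t. h t) {0<..} <= ennreal (1/2 + C/(2 * sg))"
 proof (rule nn_integral_decay)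
  fix t :: real
  show "h t <= 1" if "0 < t" "t <= 1/2" using that be bmaj_le_1[of t] bmaj_pos[of t] by (auto simp: h_def b_def intro!: powr_le1)
  assume t: "1/2 < t"
  have K: "exp (ep - 1)/ep <= 276/100/(1 - be)"
  proof -
   have "exp (ep - 1) <= exp (-5/6)" using ep by simp
   with exp_upper_bounds(2) have "exp (ep - 1) <= 46/100" by linarith
   hence "exp (ep - 1)/ep <= 46/100/ep" using ep by (intro divide_right_mono) auto
   thus ?thesis by (simp add: ep_def)
  qed
  have "bmaj t <= exp (ep - 1)/ep*(2*t) powr (ep - 1)" by (rule bmaj_le_powr[OF ep(1) t])
  also have "... <= 276/100/(1 - be)*(2*t) powr (ep - 1)" by (intro mult_right_mono K) auto
  finally have "bmaj t powr be <= (276/100/(1 - be)*(2*t) powr (ep - 1)) powr be"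
   using bmaj_pos[of t] be by (intro powr_mono2) (auto simp: less_imp_le)
  hence 1: "bmaj t powr be <= (276/100/(1 - be)) powr be*(2*t) powr ((ep - 1)*be)" by (simp only: powr_mult powr_powr)
  \<comment> \<open>The number 62/10 rounds (5/4)^4 2^(4/3) up; 2 t is the variable of
    \<open>nn_integral_decay\<close>.\<close>
  have "b t^4 <= 62/10*(2*t) powr (-4/3)"
  proof -
   have "b t = 5/4*t powr (-1/3)" using t by (simp add: b_def)
   hence "b t^4 = (5/4)^4*(t powr (-1/3))^4" by (simp only: power_mult_distrib)
   also have "(t powr (-1/3))^4 = (t powr (-1/3)) powr real 4" using t by (intro powr_realpow[symmetric]) auto
   also have "... = t powr (-4/3)" unfolding powr_powr by simp
   also have "t powr (-4/3) = 2 powr (4/3)*(2*t) powr (-4/3)"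
   proof -
    have "2 powr (4/3)*2 powr (-4/3) = (1::real)" by (subst powr_add[symmetric]) simp
    thus ?thesis by (simp add: powr_mult)
   qed
   also have "(5/4)^4*(2 powr (4/3)*(2*t) powr (-4/3)) <= (5/4)^4*(2535/1000*(2*t) powr (-4/3))"
   proof (intro mult_left_mono mult_right_mono)
    have "2 powr (4/3) = ((2::real)^4) powr (1/3)" using power_powr[of 2 4 "1/3"] by simp
    also have "... <= ((2535/1000)^3) powr (1/3)" by (intro powr_mono2) (auto simp: power_divide)
    also have "... = 2535/1000" using power_powr[of "2535/1000" 3 "1/3"] by simp
    finally show "2 powr (4/3) <= (2535/1000::real)" .
   qed auto
   also have "... <= 62/10*(2*t) powr (-4/3)" unfolding mult.assoc[symmetric] by (intro mult_right_mono) (auto simp: power_divide)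
   finally show ?thesis .
  qed
  hence "(b t^4) powr (1 - be) <= (62/10*(2*t) powr (-4/3)) powr (1 - be)" using be by (intro powr_mono2) auto
  moreover have "(b t^4) powr (1 - be) = b t powr (4*(1 - be))" using power_powr[of "b t" 4 "1 - be"] b[of t] t by simp
  ultimately have 2: "b t powr (4*(1 - be)) <= (62/10) powr (1 - be)*(2*t) powr (-4/3*(1 - be))" by (simp only: powr_mult powr_powr)
  have "h t <= ((276/100/(1 - be)) powr be*(2*t) powr ((ep - 1)*be))*((62/10) powr (1 - be)*(2*t) powr (-4/3*(1 - be)))"
   unfolding h_def by (intro mult_mono 1 2) auto
  also have "... = C*((2*t) powr ((ep - 1)*be)*(2*t) powr (-4/3*(1 - be)))" by (simp only: C_def mult_ac)
  also have "(2*t) powr ((ep - 1)*be)*(2*t) powr (-4/3*(1 - be)) = (2*t) powr (- 1 - sg)"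
   by (subst powr_add[symmetric], rule arg_cong[of _ _ "%e. (2*t) powr e"]) (simp add: sg_def ep_def field_simps)
  finally show "h t <= C*(2*t) powr (- 1 - sg)" .
 qed (use sg in \<open>auto simp: C_def\<close>)
 also have "C/(2 * sg) = 1/2*(276/100/(1 - be)) powr be*(62/10) powr (1 - be)*(6/((1 - be)*(2 - be)))"
 proof -
  have "sg = (1 - be)*(2 - be)/6" by (simp add: sg_def field_simps)
  moreover have "1/(2*(X/6)) = 1/2*(6/X)" for X :: real by simp
  ultimately have e: "1/(2 * sg) = 1/2*(6/((1 - be)*(2 - be)))" by (simp only:)
  have "C/(2 * sg) = C*(1/(2 * sg))" by simp
  thus ?thesis unfolding e C_def by (simp only: mult_ac)
 qed
 finally have H: "(nni (%t. h t) {0<..}) <= ennreal (1/2 + 1/2*(276/100/(1 - be)) powr be*(62/10) powr (1 - be)*(6/((1 - be)*(2 - be))))" .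
 show ?thesis
 proof (rule minkowski_integral[OF G _ r0 r _ _ _ _ H])
  show "(\<Sum>n\<in>G. evb n t powr q) <= h t powr q" if t: "0 < t" for t
   using sum_evb_powr_le[OF G less_imp_le[OF q] t b(2)[OF t] b(1)[OF t]] unfolding qb h_def .
  show "0 < h t" if t: "0 < t" for t using b(1)[OF t] bmaj_pos[of t] by (simp add: h_def)
 qed (use q be in \<open>auto simp: evb_nonneg\<close>)
qed

section \<open>The Green function as a Laplace transform\<close>

definition grn :: "complex => int ^ 'n::finite => complex" where "grn mu n = \<i>*(LINT t:{0<..}|lborel. exp (\<i>*mu * of_real t)*evk n t)"

lemma norm_exp_phase: "cmod (exp (\<i>*mu * of_real t)) = exp (- (Im mu*t))" by simp

lemma phase_measurable [measurable]: "(%t. exp (\<i>*mu * complex_of_real t)) \<in> borel_measurable borel"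
 by (intro borel_measurable_continuous_onI continuous_intros)

lemma grn_integrand_bound:
 assumes "0 <= Im mu"
 shows "ennreal (norm (indicator {0<..} t *\<^sub>R (exp (\<i>*mu * of_real t)*evk n t))) <= ennreal (evb n t)*indicator {0<..} t"
proof (cases "0 < t")
 case True
 have "exp (- (Im mu*t))*evb n t <= 1*evb n t" using assms True by (intro mult_right_mono evb_nonneg) simp
 thus ?thesis using True by (simp add: norm_mult norm_evk ennreal_leI)
qed simp

text \<open>The kernel \<open>evb\<close> alone is integrable, so the exponential is not asked to
  decay and the integral exists up to the real axis. This is how the estimates reach the
  cut.\<close>

lemma grn_integrable:
 fixes n :: "int ^ 'n::finite"
 assumes d: "3 <= CARD('n)" and "0 <= Im mu" shows "set_integrable lborel {0<..} (%t. exp (\<i>*mu * of_real t)*evk n t)" unfolding set_integrable_def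
proof (rule integrableI_bounded)
 have "(\<integral>\<^sup>+t. ennreal (norm (indicator {0<..} t *\<^sub>R (exp (\<i>*mu * of_real t)*evk n t))) \<partial>lborel)
   <= (nni (%t. evb n t) {0<..})" by (intro nn_integral_mono grn_integrand_bound assms)
 also have "... <= ennreal 5" by (rule nn_integral_evb[OF d])
 also have "... < \<infinity>" by simp
 finally show "(\<integral>\<^sup>+t. ennreal (norm (indicator {0<..} t *\<^sub>R (exp (\<i>*mu * of_real t)*evk n t))) \<partial>lborel) < \<infinity>" .
qed measurable

lemma grn_bound:
 fixes n :: "int ^ 'n::finite"
 assumes d: "3 <= CARD('n)" and "0 <= Im mu" shows "ennreal (cmod (grn mu n)) <= (nni (%t. evb n t) {0<..})"
proof -
 have "ennreal (cmod (grn mu n)) <= (\<integral>\<^sup>+t. ennreal (norm (indicator {0<..} t *\<^sub>R (exp (\<i>*mu * of_real t)*evk n t))) \<partial>lborel)"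
  unfolding grn_def norm_mult norm_ii mult_1 set_lebesgue_integral_def
  using grn_integrable[OF assms, of n] unfolding set_integrable_def by (rule integral_norm_bound_ennreal)
 also have "... <= (nni (%t. evb n t) {0<..})" by (intro nn_integral_mono grn_integrand_bound assms)
 finally show ?thesis .
qed

text \<open>Each use of the recurrence trades a factor k for a factor of order 1 + t. Two uses give
  summability over k with polynomial growth in t.\<close>

lemma abs_bes_le_square: "0 <= t ==> \<bar>bes k t\<bar> <= (1 + t)^2*max 1 \<bar>real_of_int k\<bar> powr (-2)"
proof (cases "k = 0")
 case True
 assume t: "0 <= t"
 have "1 <= (1 + t)^2" using t by (simp add: one_le_power)
 thus ?thesis using True abs_bes_le_1[of 0 t] by simp
next
 case False
 assume t: "0 <= t"
 have rec: "2*(\<bar>of_int k\<bar>*\<bar>bes k t\<bar>) <= t*(\<bar>bes (k - 1) t\<bar> + \<bar>bes (k + 1) t\<bar>)" for k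
 proof -
  have "2*(\<bar>of_int k\<bar>*\<bar>bes k t\<bar>) = \<bar>t*(bes (k - 1) t + bes (k + 1) t)\<bar>" unfolding bes_rec by (simp add: abs_mult)
  also have "... = t*\<bar>bes (k - 1) t + bes (k + 1) t\<bar>" using t by (simp add: abs_mult)
  also have "... <= t*(\<bar>bes (k - 1) t\<bar> + \<bar>bes (k + 1) t\<bar>)" using t by (intro mult_left_mono abs_triangle_ineq)
  finally show ?thesis .
 qed
 have lin: "\<bar>of_int k\<bar>*\<bar>bes k t\<bar> <= t" for k
 proof -
  have "t*(\<bar>bes (k - 1) t\<bar> + \<bar>bes (k + 1) t\<bar>) <= t*2"
   using abs_bes_le_1[of "k - 1" t] abs_bes_le_1[of "k + 1" t] t by (intro mult_left_mono) auto
  with rec[of k] show ?thesis by simp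
 qed
 have lin': "\<bar>of_int k\<bar>*\<bar>bes (k + j) t\<bar> <= t + 1" if "\<bar>j\<bar> = 1" for j
 proof -
  have "\<bar>real_of_int k\<bar> <= \<bar>of_int (k + j)\<bar> + 1" using that by auto
  hence "\<bar>of_int k\<bar>*\<bar>bes (k + j) t\<bar> <= (\<bar>of_int (k + j)\<bar> + 1)*\<bar>bes (k + j) t\<bar>" by (intro mult_right_mono) auto
  also have "... <= t + 1" using lin[of "k + j"] abs_bes_le_1[of "k + j" t] by (simp add: distrib_right)
  finally show ?thesis .
 qed
 have "2*(\<bar>real_of_int k\<bar>^2*\<bar>bes k t\<bar>) = \<bar>of_int k\<bar>*(2*(\<bar>of_int k\<bar>*\<bar>bes k t\<bar>))"
  by (simp only: power2_eq_square mult_ac)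
 also have "... <= \<bar>of_int k\<bar>*(t*(\<bar>bes (k - 1) t\<bar> + \<bar>bes (k + 1) t\<bar>))" by (intro mult_left_mono rec) auto
 also have "... = t*(\<bar>of_int k\<bar>*\<bar>bes (k + (-1)) t\<bar> + \<bar>of_int k\<bar>*\<bar>bes (k + 1) t\<bar>)" by (simp add: algebra_simps)
 also have "... <= t*((t + 1) + (t + 1))" using t by (intro mult_left_mono add_mono lin') auto
 also have "... <= 2*(1 + t)^2" using t by (simp add: power2_eq_square algebra_simps)
 finally have "\<bar>of_int k\<bar>^2*\<bar>bes k t\<bar> <= (1 + t)^2" by simp
 moreover have k1: "1 <= \<bar>real_of_int k\<bar>" using False by linarith
 moreover have "\<bar>real_of_int k\<bar> powr (-2) = 1/\<bar>of_int k\<bar>^2" using k1 powr_minus_divide[of "\<bar>real_of_int k\<bar>" 2] by simp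
 moreover have "max 1 \<bar>real_of_int k\<bar> = \<bar>of_int k\<bar>" using k1 by simp
 moreover have "\<bar>bes k t\<bar> = \<bar>of_int k\<bar>^2*\<bar>bes k t\<bar>/\<bar>real_of_int k\<bar>^2" using False by simp
 moreover have "\<bar>of_int k\<bar>^2*\<bar>bes k t\<bar>/\<bar>real_of_int k\<bar>^2 <= (1 + t)^2/\<bar>real_of_int k\<bar>^2"
  using calculation(1) by (rule divide_right_mono) simp
 ultimately show ?thesis by (metis mult.right_neutral times_divide_eq_right)
qed

lemma power_le_fact_exp: "0 <= x ==> x^m <= fact m*exp (x::real)"
proof -
 assume x: "0 <= x"
 have "(\<Sum>k\<in>{m}. inverse (fact k)*x^k) <= (\<Sum>k. inverse (fact k)*x^k)" using x summable_exp[of x] by (intro sum_le_suminf) auto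
 also have "... = exp x" by (simp add: exp_def)
 finally show ?thesis by (simp add: field_simps)
qed

text \<open>For Im mu > 0 the exponential beats the polynomial growth. The bound degenerates at the
  real axis; it serves only to make convolution with \<open>grn mu\<close> a bounded
  operator.\<close>

lemma grn_l1:
 assumes d: "3 <= CARD('n::finite)" and mu: "0 < Im mu"
 shows "\<exists>B. \<forall>G. finite G --> (\<Sum>n\<in>G. cmod (grn mu (n :: int ^ 'n))) <= B"
proof -
 define et where "et = Im mu"
 have et: "0 < et" using mu by (simp add: et_def)
 define m where "m = 2*CARD('n)"
 define C where "C = 5^CARD('n)*((2/et)^m*fact m*exp (et/2))"
 have C: "0 <= C" using et by (simp add: C_def)
 have sum_evb: "(\<Sum>n\<in>G. evb (n :: int ^ 'n) t) <= C*exp (et*t/2)" if G: "finite G" and t: "0 < t" for G t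
 proof -
  obtain N where N: "!!(n :: int ^ 'n) i. n \<in> G ==> n $ i \<in> {-int N..int N}" using finite_box[OF G] by blast
  have "(\<Sum>n\<in>G. evb n t) <= (\<Sum>k\<in>{-int N..int N}. \<bar>bes k t\<bar>)^CARD('n)"
   unfolding evb_def by (rule sum_prod_components_le[OF G _ N]) auto
  also have "... <= (5*(1 + t)^2)^CARD('n)"
  proof (intro power_mono sum_nonneg)
   have "(\<Sum>k\<in>{-int N..int N}. \<bar>bes k t\<bar>) <= (\<Sum>k\<in>{-int N..int N}. (1 + t)^2*max 1 \<bar>real_of_int k\<bar> powr (-2))"
    using t by (intro sum_mono abs_bes_le_square) auto
   also have "... <= (1 + t)^2*(3 + 2/(2 - 1))" unfolding sum_distrib_left[symmetric] by (intro mult_left_mono sum_max_powr_le) auto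
   finally show "(\<Sum>k\<in>{-int N..int N}. \<bar>bes k t\<bar>) <= 5*(1 + t)^2" by simp
  qed auto
  also have "... = 5^CARD('n)*(1 + t)^m" by (simp only: power_mult_distrib m_def power_mult)
  \<comment> \<open>The polynomial is bounded by x^m <= m! e^x at x = et (1 + t)/2, which uses half
    of the available exponential decay.\<close>
  also have "(1 + t)^m = (2/et)^m*(et*(1 + t)/2)^m"
  proof -
   have "2/et*(et*(1 + t)/2) = 1 + t" using et by simp
   thus ?thesis by (simp only: power_mult_distrib[symmetric])
  qed
  also have "5^CARD('n)*((2/et)^m*(et*(1 + t)/2)^m) <= 5^CARD('n)*((2/et)^m*(fact m*exp (et*(1 + t)/2)))"
   using et t by (intro mult_left_mono power_le_fact_exp) auto
  also have "et*(1 + t)/2 = et/2 + et*t/2" by (simp add: field_simps)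
  finally show ?thesis by (simp add: C_def exp_add mult_ac)
 qed
 have "(\<Sum>n\<in>G. cmod (grn mu (n :: int ^ 'n))) <= 2*C/et" if G: "finite G" for G
 proof -
  have "ennreal (\<Sum>n\<in>G. cmod (grn mu n)) = (\<Sum>n\<in>G. ennreal (cmod (grn mu n)))" by (rule sum_ennreal[symmetric]) auto
  also have "... <= (\<Sum>n\<in>G. (nni (%t. exp (- (et*t))*evb n t) {0<..}))"
  proof (rule sum_mono)
   fix n :: "int ^ 'n"
   have "ennreal (cmod (grn mu n)) <= (\<integral>\<^sup>+t. ennreal (norm (indicator {0<..} t *\<^sub>R (exp (\<i>*mu * of_real t)*evk n t))) \<partial>lborel)"
    unfolding grn_def norm_mult norm_ii mult_1 set_lebesgue_integral_def
    using grn_integrable[OF d, of mu n] mu unfolding set_integrable_def by (intro integral_norm_bound_ennreal) auto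
   also have "... = nni (%t. exp (- (et*t))*evb n t) {0<..}" by (intro nn_integral_cong) (auto simp: indicator_def norm_mult norm_evk et_def)
   finally show "ennreal (cmod (grn mu n)) <= (nni (%t. exp (- (et*t))*evb n t) {0<..})" .
  qed
  also have "... = (\<integral>\<^sup>+t. (\<Sum>n\<in>G. ennreal (exp (- (et*t))*evb n t)*indicator {0<..} t) \<partial>lborel)"
   by (rule nn_integral_sum[symmetric]) measurable
  also have "... <= (nni (%t. C*exp (- (et/2*t))) {0..})"
  proof (rule nn_integral_mono)
   fix t :: real
   show "(\<Sum>n\<in>G. ennreal (exp (- (et*t))*evb n t)*indicator {0<..} t) <= ennreal (C*exp (- (et/2*t)))*indicator {0..} t"
   proof (cases "0 < t")
    case True
    hence "(\<Sum>n\<in>G. ennreal (exp (- (et*t))*evb n t)*indicator {0<..} t) = ennreal (exp (- (et*t))*(\<Sum>n\<in>G. evb n t))"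
     by (simp add: sum_distrib_left sum_ennreal evb_nonneg)
    also have "... <= ennreal (exp (- (et*t))*(C*exp (et*t/2)))" by (intro ennreal_leI mult_left_mono sum_evb G True) simp
    also have "exp (- (et*t))*(C*exp (et*t/2)) = C*(exp (- (et*t))*exp (et*t/2))" by simp
    also have "exp (- (et*t))*exp (et*t/2) = exp (- (et/2*t))" unfolding exp_add[symmetric] by simp
    finally show ?thesis using True by simp
   qed simp
  qed
  also have "... = ennreal (0 - (- 2*C/et*exp (- (et/2*0))))"
  proof (rule nn_integral_FTC_atLeast)
   show "((%t. - 2*C/et*exp (- (et/2*t))) has_real_derivative C*exp (- (et/2*x))) (at x)" for x using et by (auto intro!: derivative_eq_intros)
   have "filterlim (%t. et/2*t) at_top at_top" using et by (intro filterlim_tendsto_pos_mult_at_top[OF tendsto_const _ filterlim_ident]) auto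
   hence "((%t. exp (- (et/2*t))) \<longlongrightarrow> 0) at_top" by (intro filterlim_compose[OF exp_at_bot]) (simp add: filterlim_uminus_at_bot)
   from tendsto_mult_right_zero[OF this, of "- 2*C/et"]
   show "((%t. - 2*C/et*exp (- (et/2*t))) \<longlongrightarrow> 0) at_top" .
  qed (use C in auto)
  also have "0 - (- 2*C/et*exp (- (et/2*0))) = 2*C/et" by simp
  finally show ?thesis using C et by simp
 qed
 thus ?thesis by blast
qed

lemma set_integral_sum_finite:
 fixes f :: "'i => 'a => complex"
 assumes "!!i. i \<in> I ==> set_integrable M A (f i)"
 shows "set_integrable M A (%t. \<Sum>i\<in>I. f i t)" "(LINT t:A|M. (\<Sum>i\<in>I. f i t)) = (\<Sum>i\<in>I. LINT t:A|M. f i t)"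
 using assms unfolding set_integrable_def set_lebesgue_integral_def scaleR_sum_right by (auto intro: integrable_sum Bochner_Integration.integral_sum)

text \<open>Integrate the derivative of exp (i mu t) \<open>evk n t\<close> over (0, \<infinity>):
  the Schroedinger equation produces (\<Delta> - mu) \<open>grn\<close>, and the boundary term at 0
  is the unit mass at the origin.\<close>

lemma grn_resolvent:
 fixes n :: "int ^ 'n::finite"
 assumes d: "3 <= CARD('n)" and mu: "0 < Im mu"
 shows "(1/2)*(\<Sum>i\<in>UNIV. grn mu (n + axis i (-1)) + grn mu (n + axis i 1)) - mu*grn mu n = (if n = 0 then 1 else 0)"
proof -
 let ?e = "%t. exp (\<i>*mu * of_real t)"
 define I where "I = (%n :: int ^ 'n. LINT t:{0<..}|lborel. ?e t*evk n t)"
 define f where "f = (%t. \<i>*mu*(?e t*evk n t) + (- \<i>/2)*(\<Sum>i\<in>UNIV. ?e t*evk (n + axis i (-1)) t + ?e t*evk (n + axis i 1) t))"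
 have F: "((%t. ?e t*evk n t) has_vector_derivative f t) (at t)" for t
 proof -
  have e: "(?e has_vector_derivative \<i>*mu*?e t) (at t)" by (auto intro!: derivative_eq_intros has_vector_derivative_real_field)
  show ?thesis
  proof -
   let ?S = "\<Sum>i\<in>UNIV. evk (n + axis i (-1)) t + evk (n + axis i 1) t"
   have "(\<Sum>i\<in>UNIV. ?e t*evk (n + axis i (-1)) t + ?e t*evk (n + axis i 1) t) = ?e t*?S" by (simp only: sum_distrib_left distrib_left)
   hence "f t = ?e t*((- \<i>/2)*?S) + \<i>*mu*?e t*evk n t" unfolding f_def by (simp only: mult_ac add.commute)
   with has_vector_derivative_mult[OF e evk_deriv[of n t]] show ?thesis by (simp only:)
  qed
 qed
 have int: "set_integrable lborel {0<..} (%t. ?e t*evk m t)" for m :: "int ^ 'n" using mu by (intro grn_integrable d) simp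
 have fint: "set_integrable lborel {0<..} f" unfolding f_def by (intro set_integral_add set_integrable_mult_right set_integral_sum_finite int; auto?)
 have "(LBINT t=0..\<infinity>. f t) = 0 - evk n 0"
 proof (rule interval_integral_FTC_integrable[where F = "%t. ?e t*evk n t"])
  show "isCont f t" for t unfolding f_def by (intro continuous_intros evk_isCont)
  show "set_integrable lborel (einterval 0 \<infinity>) f" using fint by (simp add: zero_ereal_def)
  have "isCont (%t. ?e t*evk n t) 0" using F by (rule has_vector_derivative_continuous)
  hence "((%t. ?e t*evk n t) \<longlongrightarrow> evk n 0) (at_right 0)" unfolding isCont_def by (simp add: filterlim_at_split)
  thus "(((%t. ?e t*evk n t) \<circ> real_of_ereal) \<longlongrightarrow> evk n 0) (at_right 0)" unfolding zero_ereal_def ereal_tendsto_simps .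
  have "filterlim (%t. Im mu*t) at_top at_top" using mu by (intro filterlim_tendsto_pos_mult_at_top[OF tendsto_const _ filterlim_ident]) auto
  hence ex: "((%t. exp (- (Im mu*t))) \<longlongrightarrow> 0) at_top" by (intro filterlim_compose[OF exp_at_bot]) (simp add: filterlim_uminus_at_bot)
  have "((%t. ?e t*evk n t) \<longlongrightarrow> 0) at_top"
  proof (rule Lim_null_comparison[OF _ ex], rule always_eventually, rule allI)
   fix t show "norm (?e t*evk n t) <= exp (- (Im mu*t))" using evb_le_1[of n t] by (simp add: norm_mult norm_evk)
  qed
  thus "(((%t. ?e t*evk n t) \<circ> real_of_ereal) \<longlongrightarrow> 0) (at_left \<infinity>)" unfolding ereal_tendsto_simps .
 qed (use F in auto)
 moreover have "(LBINT t=0..\<infinity>. f t) = (LINT t:{0<..}|lborel. f t)" unfolding zero_ereal_def by (rule interval_integral_to_infinity_eq)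
 moreover have "(LINT t:{0<..}|lborel. f t) = \<i>*mu*I n + (- \<i>/2)*(\<Sum>i\<in>UNIV. I (n + axis i (-1)) + I (n + axis i 1))"
 proof -
  have s1: "((LINT t:{0<..}|lborel. (\<Sum>i\<in>UNIV. ?e t*evk (n + axis i (-1)) t + ?e t*evk (n + axis i 1) t)))
   = (\<Sum>i\<in>UNIV. I (n + axis i (-1)) + I (n + axis i 1))"
   unfolding I_def by (subst set_integral_sum_finite(2)) (auto intro!: set_integral_add int sum.cong)
  have s2: "set_integrable lborel {0<..} (%t. \<Sum>i\<in>UNIV. ?e t*evk (n + axis i (-1)) t + ?e t*evk (n + axis i 1) t)"
   by (intro set_integral_sum_finite set_integral_add int; auto?)
  note s = s1 s2
  let ?S = "%t. \<Sum>i\<in>UNIV. ?e t*evk (n + axis i (-1)) t + ?e t*evk (n + axis i 1) t"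
  have "(LINT t:{0<..}|lborel. f t) = (LINT t:{0<..}|lborel. \<i>*mu*(?e t*evk n t)) + (LINT t:{0<..}|lborel. (- \<i>/2)*?S t)"
   unfolding f_def by (rule set_integral_add(2)) (rule set_integrable_mult_right, rule int, rule set_integrable_mult_right, rule s(2))
  also have "(LINT t:{0<..}|lborel. \<i>*mu*(?e t*evk n t)) = \<i>*mu*I n" unfolding I_def by (rule set_integral_mult_right)
  also have "(LINT t:{0<..}|lborel. (- \<i>/2)*?S t) = (- \<i>/2)*(LINT t:{0<..}|lborel. ?S t)" by (rule set_integral_mult_right)
  finally show ?thesis by (simp only: s(1))
 qed
 ultimately have "\<i>*mu*I n + (- \<i>/2)*(\<Sum>i\<in>UNIV. I (n + axis i (-1)) + I (n + axis i 1)) = - evk n 0" by simp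
 moreover have "(\<Sum>i\<in>UNIV. \<i>*I (n + axis i (-1)) + \<i>*I (n + axis i 1)) = \<i>*(\<Sum>i\<in>UNIV. I (n + axis i (-1)) + I (n + axis i 1))"
  by (simp only: sum_distrib_left distrib_left)
 moreover have "(1/2)*(\<i>*X) - mu*(\<i>*Y) = - (\<i>*mu*Y + (- \<i>/2)*X)" for X Y by (simp add: algebra_simps)
 ultimately have "(1/2)*(\<Sum>i\<in>UNIV. \<i>*I (n + axis i (-1)) + \<i>*I (n + axis i 1)) - mu*(\<i>*I n) = evk n 0" by (simp only: minus_minus)
 thus ?thesis unfolding evk_0 grn_def I_def .
qed

lemma norm_exp_diff_le:
 assumes "Re a <= 0" "Re b <= 0" shows "cmod (exp a - exp b) <= cmod (a - b)"
proof -
 have "convex {z :: complex. Re z <= 0}" using convex_halfspace_Re_le by simp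
 from field_differentiable_bound[OF this, of exp exp 1 a b] show ?thesis using assms by (auto intro: DERIV_exp has_field_derivative_at_within)
qed

text \<open>The difference of the exponentials is at most min (2, x) <= 2 x^(1/4) with x = t |mu -
  nv|; the weight t^(1/4) is integrated by \<open>nn_integral_evb_quarter\<close>, and 22 = 2 *
  11.\<close>

lemma grn_hoelder:
 fixes n :: "int ^ 'n::finite"
 assumes d: "3 <= CARD('n)" and mu: "0 <= Im mu" and nv: "0 <= Im nv" shows "cmod (grn mu n - grn nv n) <= 22 * cmod (mu - nv) powr (1/4)"
proof -
 let ?c = "2 * cmod (mu - nv) powr (1/4)"
 let ?g = "%t. exp (\<i>*mu * of_real t)*evk n t - exp (\<i>*nv * of_real t)*evk n t"
 note i = grn_integrable[OF d mu, of n] grn_integrable[OF d nv, of n]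
 have int: "set_integrable lborel {0<..} ?g" by (intro set_integral_diff i)
 have pt: "ennreal (norm (indicator {0<..} t *\<^sub>R ?g t)) <= ennreal ?c*(ennreal (t powr (1/4)*evb n t)*indicator {0<..} t)" for t
 proof (cases "0 < t")
  case True
  let ?x = "t * cmod (mu - nv)"
  have "cmod (exp (\<i>*mu * of_real t) - exp (\<i>*nv * of_real t)) <= cmod (\<i>*mu * of_real t - \<i>*nv * of_real t)"
   using True mu nv by (intro norm_exp_diff_le) auto
  also have "\<i>*mu * of_real t - \<i>*nv * of_real t = \<i> * of_real t*(mu - nv)" by (simp add: algebra_simps)
  finally have a: "cmod (exp (\<i>*mu * of_real t) - exp (\<i>*nv * of_real t)) <= ?x" using True by (simp add: norm_mult)
  have "cmod (exp (\<i>*mu * of_real t) - exp (\<i>*nv * of_real t)) <= exp (- (Im mu*t)) + exp (- (Im nv*t))"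
   using norm_triangle_ineq4 by (metis norm_exp_phase)
  also have "... <= 1 + 1" using True mu nv by (intro add_mono) auto
  finally have b: "cmod (exp (\<i>*mu * of_real t) - exp (\<i>*nv * of_real t)) <= 2" by simp
  have "cmod (exp (\<i>*mu * of_real t) - exp (\<i>*nv * of_real t)) <= 2*?x powr (1/4)"
  proof (cases "?x <= 1")
   case le: True
   have "?x powr 1 <= ?x powr (1/4)" using True le by (intro powr_mono') auto
   hence "?x <= ?x powr (1/4)" using True by simp
   thus ?thesis using a powr_ge_zero[of ?x "1/4"] by linarith
  next
   case False
   hence "1 <= ?x powr (1/4)" by (intro ge_one_powr_ge_zero) auto
   thus ?thesis using b by simp
  qed
  hence "cmod (exp (\<i>*mu * of_real t) - exp (\<i>*nv * of_real t))*evb n t <= 2*?x powr (1/4)*evb n t" by (intro mult_right_mono evb_nonneg)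
  also have "2*?x powr (1/4)*evb n t = ?c*(t powr (1/4)*evb n t)" by (simp add: powr_mult)
  finally have "norm (?g t) <= ?c*(t powr (1/4)*evb n t)" by (simp add: left_diff_distrib[symmetric] norm_mult norm_evk)
  hence "ennreal (norm (?g t)) <= ennreal ?c*ennreal (t powr (1/4)*evb n t)"
   by (subst ennreal_mult[symmetric]) (auto simp: evb_nonneg intro!: ennreal_leI)
  thus ?thesis using True by simp
 qed simp
 have "ennreal (cmod (LINT t:{0<..}|lborel. ?g t)) <= (\<integral>\<^sup>+t. ennreal (norm (indicator {0<..} t *\<^sub>R ?g t)) \<partial>lborel)"
  unfolding set_lebesgue_integral_def using int unfolding set_integrable_def by (rule integral_norm_bound_ennreal)
 also have "... <= (\<integral>\<^sup>+t. ennreal ?c*(ennreal (t powr (1/4)*evb n t)*indicator {0<..} t) \<partial>lborel)"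
  by (intro nn_integral_mono pt)
 also have "... = ennreal ?c*(nni (%t. t powr (1/4)*evb n t) {0<..})" by (rule nn_integral_cmult) measurable
 also have "... <= ennreal ?c*ennreal 11" by (intro mult_left_mono nn_integral_evb_quarter d) auto
 also have "... = ennreal (?c*11)" by (rule ennreal_mult[symmetric]) auto
 finally have "cmod (LINT t:{0<..}|lborel. ?g t) <= ?c*11" by (simp add: ennreal_le_iff)
 moreover have "grn mu n - grn nv n = \<i>*(LINT t:{0<..}|lborel. ?g t)"
  unfolding grn_def by (subst set_integral_diff(2)[OF i]) (simp add: algebra_simps)
 ultimately show ?thesis by (simp add: norm_mult)
qed

section \<open>Determinants over finite sets\<close>

text \<open>Indexed by a set rather than a type, so that boxes and principal minors of all sizes
  live in one index type, and with the same sum over permutations as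
  \<open>principal_minor\<close>.\<close>

definition detS :: "'a set => ('a => 'a => complex) => complex" where
 "detS F M = (\<Sum>pe | pe permutes F. of_int (sign pe)*(\<Prod>x\<in>F. M x (pe x)))"

lemma principal_minor_eq_detS: "principal_minor T S = detS S (entry T)" by (simp add: principal_minor_def detS_def)

lemma detS_cong:
 assumes "!!x y. x \<in> F ==> y \<in> F ==> M x y = M' x y" shows "detS F M = detS F M'"
 unfolding detS_def using assms by (intro sum.cong refl arg_cong2[of _ _ _ _ "(*)"] prod.cong) (auto simp: permutes_in_image)

text \<open>Expanding the product over F by subsets, the identity matrix leaves only the
  permutations that fix F - S pointwise. This identifies Fredholm's sum of minors with a
  determinant.\<close>

lemma detS_one_plus:
 assumes F: "finite F" shows "detS F (%x y. (if x = y then 1 else 0) + M x y) = (\<Sum>S\<in>Pow F. detS S M)"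
proof -
 let ?d = "%x y. (if x = y then 1 else 0) :: complex"
 have "detS F (%x y. ?d x y + M x y) = (\<Sum>pe | pe permutes F. \<Sum>S\<in>Pow F. of_int (sign pe)*((\<Prod>x\<in>S. M x (pe x))*(\<Prod>x\<in>F - S. ?d x (pe x))))"
  unfolding detS_def by (subst add.commute) (simp only: prod_add[OF F] sum_distrib_left)
 also have "... = (\<Sum>S\<in>Pow F. \<Sum>pe | pe permutes F. of_int (sign pe)*((\<Prod>x\<in>S. M x (pe x))*(\<Prod>x\<in>F - S. ?d x (pe x))))"
  by (rule sum.swap)
 also have "... = (\<Sum>S\<in>Pow F. detS S M)"
 proof (rule sum.cong[OF refl])
  fix S assume S: "S \<in> Pow F"
  have "(\<Sum>pe | pe permutes F. of_int (sign pe)*((\<Prod>x\<in>S. M x (pe x))*(\<Prod>x\<in>F - S. ?d x (pe x))))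
   = (\<Sum>pe | pe permutes S. of_int (sign pe)*((\<Prod>x\<in>S. M x (pe x))*(\<Prod>x\<in>F - S. ?d x (pe x))))"
  proof (rule sum.mono_neutral_right)
   show "finite {pe. pe permutes F}" using F by (rule finite_permutations)
   show "{pe. pe permutes S} \<subseteq> {pe. pe permutes F}" using S by (auto intro: permutes_subset)
   show "\<forall>pe\<in>{pe. pe permutes F} - {pe. pe permutes S}. of_int (sign pe)*((\<Prod>x\<in>S. M x (pe x))*(\<Prod>x\<in>F - S. ?d x (pe x))) = 0"
   proof
    fix pe assume p: "pe \<in> {pe. pe permutes F} - {pe. pe permutes S}"
    then obtain x where "x \<in> F - S" "pe x ~= x" using permutes_superset[of pe F S] by blast
    hence "(\<Prod>x\<in>F - S. ?d x (pe x)) = 0" using F by (intro prod_zero) force+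
    thus "of_int (sign pe)*((\<Prod>x\<in>S. M x (pe x))*(\<Prod>x\<in>F - S. ?d x (pe x))) = 0" by simp
   qed
  qed
  also have "... = detS S M" unfolding detS_def
  proof (rule sum.cong[OF refl])
   fix pe assume "pe \<in> {pe. pe permutes S}"
   hence "(\<Prod>x\<in>F - S. ?d x (pe x)) = 1" by (intro prod.neutral) (auto simp: permutes_not_in)
   thus "of_int (sign pe)*((\<Prod>x\<in>S. M x (pe x))*(\<Prod>x\<in>F - S. ?d x (pe x))) = of_int (sign pe)*(\<Prod>x\<in>S. M x (pe x))" by simp
  qed
  finally show "(\<Sum>pe | pe permutes F. of_int (sign pe)*((\<Prod>x\<in>S. M x (pe x))*(\<Prod>x\<in>F - S. ?d x (pe x)))) = detS S M" .
 qed
 finally show ?thesis .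
qed

lemma detS_equal_rows:
 assumes F: "finite F" and xy: "x \<in> F" "y \<in> F" "x ~= y" and eq: "!!z. z \<in> F ==> M x z = M y z" shows "detS F M = 0"
proof -
 define ta where "ta = Transposition.transpose x y"
 have ta: "ta permutes F" unfolding ta_def using xy by (intro permutes_swap_id)
 have "detS F M = (\<Sum>pe | pe permutes F. of_int (sign (pe \<circ> ta))*(\<Prod>z\<in>F. M z ((pe \<circ> ta) z)))"
  unfolding detS_def by (rule sum_permutations_compose_right[OF ta])
 also have "... = (\<Sum>pe | pe permutes F. - (of_int (sign pe)*(\<Prod>z\<in>F. M z (pe z))))"
 proof (rule sum.cong[OF refl])
  fix pe assume "pe \<in> {pe. pe permutes F}"
  hence p: "pe permutes F" by simp
  have "sign (pe \<circ> ta) = sign pe * sign ta" using p ta F by (intro sign_compose) (auto intro: permutation_permutes[THEN iffD2])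
  also have "sign ta = - 1" using xy by (simp add: ta_def sign_swap_id)
  also have "sign pe*- 1 = - sign pe" by simp
  finally have s: "sign (pe \<circ> ta) = - sign pe" .
  have "(\<Prod>z\<in>F. M z ((pe \<circ> ta) z)) = (\<Prod>z\<in>F. M (ta z) ((pe \<circ> ta) (ta z)))"
   by (rule prod.reindex_bij_betw[OF permutes_imp_bij[OF ta], symmetric])
  also have "... = (\<Prod>z\<in>F. M z (pe z))"
  proof (rule prod.cong[OF refl])
   fix z assume "z \<in> F"
   hence "pe z \<in> F" using p by (simp add: permutes_in_image)
   thus "M (ta z) ((pe \<circ> ta) (ta z)) = M z (pe z)" using eq by (auto simp: ta_def Transposition.transpose_def)
  qed
  finally show "of_int (sign (pe \<circ> ta))*(\<Prod>z\<in>F. M z ((pe \<circ> ta) z)) = - (of_int (sign pe)*(\<Prod>z\<in>F. M z (pe z)))"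
   by (simp only: s) simp
 qed
 also have "... = - detS F M" by (simp add: detS_def sum_negf)
 finally have "2*detS F M = 0" by simp
 thus ?thesis by simp
qed

lemma detS_mult:
 assumes F: "finite F" shows "detS F (%x y. \<Sum>u\<in>F. A x u*B u y) = detS F A*detS F B"
proof -
 let ?P = "{pe. pe permutes F}"
 have fP: "finite ?P" using F by (rule finite_permutations)
 define E where "E = F \<rightarrow>\<^sub>E F"
 have fE: "finite E" unfolding E_def using F by (intro finite_PiE) auto
 have "detS F (%x y. \<Sum>u\<in>F. A x u*B u y) = (\<Sum>pe\<in>?P. \<Sum>g\<in>E. (\<Prod>x\<in>F. A x (g x))*(of_int (sign pe)*(\<Prod>x\<in>F. B (g x) (pe x))))"
  unfolding detS_def E_def by (intro sum.cong refl) (simp add: prod_sum_PiE[OF F] F sum_distrib_left prod.distrib mult_ac)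
 also have "... = (\<Sum>g\<in>E. (\<Prod>x\<in>F. A x (g x))*detS F (%x. B (g x)))" unfolding detS_def sum_distrib_left by (rule sum.swap)
 also have "... = (\<Sum>g\<in>{g\<in>E. inj_on g F}. (\<Prod>x\<in>F. A x (g x))*detS F (%x. B (g x)))"
 proof (rule sum.mono_neutral_right[OF fE], blast, rule ballI)
  fix g assume "g \<in> E - {g \<in> E. inj_on g F}"
  then obtain x y where "x \<in> F" "y \<in> F" "x ~= y" "g x = g y" by (auto simp: inj_on_def)
  hence "detS F (%x. B (g x)) = 0" by (intro detS_equal_rows[OF F, of x y]) auto
  thus "(\<Prod>x\<in>F. A x (g x))*detS F (%x. B (g x)) = 0" by simp
 qed
 also have "... = (\<Sum>\<gamma>\<in>?P. (\<Prod>x\<in>F. A x (\<gamma> x))*detS F (%x. B (\<gamma> x)))"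
 proof (rule sum.reindex_bij_witness[where i = "%\<gamma>. restrict \<gamma> F" and j = "%g x. if x \<in> F then g x else x"])
  fix g assume g: "g \<in> {g \<in> E. inj_on g F}"
  thus "restrict (%x. if x \<in> F then g x else x) F = g" by (auto simp: E_def PiE_def extensional_def restrict_def)
  have "g ` F = F" using g F by (intro endo_inj_surj) (auto simp: E_def)
  hence "bij_betw (%x. if x \<in> F then g x else x) F F" using g by (auto simp: bij_betw_def inj_on_def)
  thus "(%x. if x \<in> F then g x else x) \<in> ?P" by (auto intro!: bij_imp_permutes)
  show "(\<Prod>x\<in>F. A x (if x \<in> F then g x else x))*detS F (%x. B (if x \<in> F then g x else x)) = (\<Prod>x\<in>F. A x (g x))*detS F (%x. B (g x))"
   by (intro arg_cong2[of _ _ _ _ "(*)"] prod.cong detS_cong) auto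
 next
  fix \<gamma> assume "\<gamma> \<in> ?P"
  hence p: "\<gamma> permutes F" by simp
  show "(%x. if x \<in> F then restrict \<gamma> F x else x) = \<gamma>" using p by (auto simp: permutes_not_in)
  show "restrict \<gamma> F \<in> {g \<in> E. inj_on g F}" using p by (auto simp: E_def permutes_in_image permutes_inj_on inj_on_restrict_eq)
 qed
 also have "... = (\<Sum>\<gamma>\<in>?P. (of_int (sign \<gamma>)*(\<Prod>x\<in>F. A x (\<gamma> x)))*detS F B)"
 proof (rule sum.cong[OF refl])
  fix \<gamma> assume "\<gamma> \<in> ?P"
  hence p: "\<gamma> permutes F" by simp
  have "detS F (%x. B (\<gamma> x)) = (\<Sum>pe\<in>?P. of_int (sign (pe \<circ> \<gamma>))*(\<Prod>x\<in>F. B (\<gamma> x) ((pe \<circ> \<gamma>) x)))"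
   unfolding detS_def by (rule sum_permutations_compose_right[OF p])
  also have "... = (\<Sum>pe\<in>?P. of_int (sign \<gamma>)*(of_int (sign pe)*(\<Prod>x\<in>F. B x (pe x))))"
  proof (rule sum.cong[OF refl])
   fix pe assume "pe \<in> ?P"
   hence "sign (pe \<circ> \<gamma>) = sign pe * sign \<gamma>" using p F by (intro sign_compose) (auto intro: permutation_permutes[THEN iffD2])
   moreover have "(\<Prod>x\<in>F. B (\<gamma> x) ((pe \<circ> \<gamma>) x)) = (\<Prod>x\<in>F. B x (pe x))"
    using prod.reindex_bij_betw[OF permutes_imp_bij[OF p], of "%x. B x (pe x)"] by simp
   ultimately show "of_int (sign (pe \<circ> \<gamma>))*(\<Prod>x\<in>F. B (\<gamma> x) ((pe \<circ> \<gamma>) x)) = of_int (sign \<gamma>)*(of_int (sign pe)*(\<Prod>x\<in>F. B x (pe x)))"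
    by simp
  qed
  also have "... = of_int (sign \<gamma>)*detS F B" by (simp add: detS_def sum_distrib_left)
  finally show "(\<Prod>x\<in>F. A x (\<gamma> x))*detS F (%x. B (\<gamma> x)) = (of_int (sign \<gamma>)*(\<Prod>x\<in>F. A x (\<gamma> x)))*detS F B"
   by simp
 qed
 finally show ?thesis by (simp add: detS_def sum_distrib_right)
qed

lemma detS_transpose:
 assumes F: "finite F" shows "detS F (%x y. M y x) = detS F M"
proof -
 have "detS F (%x y. M y x) = (\<Sum>pe | pe permutes F. of_int (sign (inv pe))*(\<Prod>x\<in>F. M (inv pe x) x))"
  unfolding detS_def by (rule sum_permutations_inverse)
 also have "... = detS F M" unfolding detS_def
 proof (rule sum.cong[OF refl])
  fix pe assume "pe \<in> {pe. pe permutes F}"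
  hence p: "pe permutes F" by simp
  have "(\<Prod>x\<in>F. M (inv pe x) x) = (\<Prod>x\<in>F. M (inv pe (pe x)) (pe x))"
   by (rule prod.reindex_bij_betw[OF permutes_imp_bij[OF p], symmetric])
  also have "... = (\<Prod>x\<in>F. M x (pe x))" using p by (simp add: permutes_inverses)
  finally show "of_int (sign (inv pe))*(\<Prod>x\<in>F. M (inv pe x) x) = of_int (sign pe)*(\<Prod>x\<in>F. M x (pe x))"
   using p F by (simp add: sign_inverse permutation_permutes[THEN iffD2, OF exI, of F])
 qed
 finally show ?thesis .
qed

section \<open>Hadamard's inequality\<close>

lemma detS_cnj: "detS F (%x y. cnj (M x y)) = cnj (detS F M)" by (simp add: detS_def)

lemma detS_diagonal:
 assumes F: "finite F" and "!!x y. x \<in> F ==> y \<in> F ==> x ~= y ==> M x y = 0" shows "detS F M = (\<Prod>x\<in>F. M x x)"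
proof -
 have "detS F M = (\<Sum>pe\<in>{id}. of_int (sign pe)*(\<Prod>x\<in>F. M x (pe x)))" unfolding detS_def
 proof (rule sum.mono_neutral_right)
  show "\<forall>pe\<in>{pe. pe permutes F} - {id}. of_int (sign pe)*(\<Prod>x\<in>F. M x (pe x)) = 0"
  proof
   fix pe assume p: "pe \<in> {pe. pe permutes F} - {id}"
   then obtain x where x: "pe x ~= x" by (metis DiffE eq_id_iff singletonI)
   hence "x \<in> F" "pe x \<in> F" using p by (auto simp: permutes_in_image dest: permutes_not_in)
   hence "M x (pe x) = 0" using assms(2) x by metis
   thus "of_int (sign pe)*(\<Prod>x\<in>F. M x (pe x)) = 0" using F \<open>x \<in> F\<close> by auto
  qed
 qed (use F in \<open>auto simp: finite_permutations permutes_id\<close>)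
 thus ?thesis by (simp add: sign_id)
qed

lemma detS_row_diff_sum:
 assumes F: "finite F" and x: "x \<in> F"
 shows "detS F (M(x := %k. v k - (\<Sum>j\<in>T. c j*R j k))) = detS F (M(x := v)) - (\<Sum>j\<in>T. c j*detS F (M(x := R j)))"
proof -
 have e: "(\<Prod>z\<in>F. (M(x := w)) z (pe z)) = w (pe x)*(\<Prod>z\<in>F - {x}. M z (pe z))" for w pe
  by (subst prod.remove[OF F x]) (auto intro!: prod.cong arg_cong2[of _ _ _ _ "(*)"])
 have d: "detS F (M(x := w)) = (\<Sum>pe | pe permutes F. w (pe x)*(of_int (sign pe)*(\<Prod>z\<in>F - {x}. M z (pe z))))" for w
  unfolding detS_def e by (simp add: mult_ac)
 let ?P = "%pe. of_int (sign pe)*(\<Prod>z\<in>F - {x}. M z (pe z))"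
 have "(\<Sum>pe | pe permutes F. (\<Sum>j\<in>T. c j*R j (pe x))*?P pe) = (\<Sum>pe | pe permutes F. \<Sum>j\<in>T. c j*(R j (pe x)*?P pe))"
  by (simp only: sum_distrib_right mult.assoc)
 also have "... = (\<Sum>j\<in>T. c j*(\<Sum>pe | pe permutes F. R j (pe x)*?P pe))" unfolding sum_distrib_left by (rule sum.swap)
 finally show ?thesis unfolding d by (simp only: left_diff_distrib sum_subtractf)
qed

definition ipF :: "'a set => ('a => complex) => ('a => complex) => complex" where "ipF F u v = (\<Sum>k\<in>F. u k * cnj (v k))"

lemma ipF_self: "ipF F u u = of_real (\<Sum>k\<in>F. (cmod (u k))^2)" by (simp only: ipF_def of_real_sum complex_norm_square)

text \<open>One row at a time is replaced by its component orthogonal to the rows treated before.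
  Subtracting multiples of other rows preserves the determinant, and projecting does not increase
  the norm.\<close>

lemma gram_schmidt_rows:
 assumes F: "finite F" and T: "finite T" "T \<subseteq> F"
 shows "\<exists>U. detS F U = detS F M \<and> (\<forall>x. x \<notin> T --> U x = M x) \<and>
  (\<forall>x\<in>T. \<forall>y\<in>T. x ~= y --> ipF F (U x) (U y) = 0) \<and>
  (\<forall>x\<in>T. (\<Sum>k\<in>F. (cmod (U x k))^2) <= (\<Sum>k\<in>F. (cmod (M x k))^2))" using T
proof (induction T rule: finite_induct)
 case empty
 show ?case by (intro exI[of _ M]) auto
next
 case (insert x T)
 then obtain U where U: "detS F U = detS F M" "!!z. z \<notin> T ==> U z = M z" "!!y z. y \<in> T ==> z \<in> T ==> y ~= z ==> ipF F (U y) (U z) = 0"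
  "!!z. z \<in> T ==> (\<Sum>k\<in>F. (cmod (U z k))^2) <= (\<Sum>k\<in>F. (cmod (M z k))^2)" by auto
 have xF: "x \<in> F" and TF: "T \<subseteq> F" and xT: "x \<notin> T" using insert by auto
 \<comment> \<open>If the row \<open>U j\<close> vanishes on F the quotient is 0 by the convention
   for division; the orthogonality \<open>ipw\<close> still holds, because all products with this
   row are 0.\<close>
 define c where "c = (%j. ipF F (M x) (U j)/ipF F (U j) (U j))"
 define p where "p = (%k. \<Sum>j\<in>T. c j*U j k)"
 define w where "w = (%k. M x k - p k)"
 define U' where "U' = U(x := w)"
 have "detS F U' = detS F (U(x := M x)) - (\<Sum>j\<in>T. c j*detS F (U(x := U j)))" unfolding U'_def w_def p_def by (rule detS_row_diff_sum[OF F xF])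
 also have "(\<Sum>j\<in>T. c j*detS F (U(x := U j))) = 0"
 proof (rule sum.neutral, rule ballI)
  fix j assume j: "j \<in> T"
  hence "detS F (U(x := U j)) = 0" using xT TF by (intro detS_equal_rows[OF F xF, of j]) auto
  thus "c j*detS F (U(x := U j)) = 0" by simp
 qed
 also have "U(x := M x) = U" using U(2)[OF xT] by auto
 finally have 1: "detS F U' = detS F M" using U(1) by simp
 have ipw: "ipF F w (U j) = 0" if j: "j \<in> T" for j
 proof -
  have "ipF F w (U j) = ipF F (M x) (U j) - ipF F p (U j)" by (simp add: ipF_def w_def left_diff_distrib sum_subtractf)
  also have "ipF F p (U j) = (\<Sum>i\<in>T. c i*ipF F (U i) (U j))" unfolding ipF_def p_def sum_distrib_right sum_distrib_left
   by (subst sum.swap) (simp add: mult.assoc)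
  also have "... = (\<Sum>i\<in>T. if i = j then c j*ipF F (U j) (U j) else 0)" using U(3) j by (intro sum.cong) auto
  also have "... = c j*ipF F (U j) (U j)" using j insert.hyps(1) by simp
  also have "... = ipF F (M x) (U j)"
  proof (cases "ipF F (U j) (U j) = 0")
   case True
   hence "(\<Sum>k\<in>F. (cmod (U j k))^2) = 0" by (simp only: ipF_self of_real_eq_0_iff)
   hence "\<forall>k\<in>F. U j k = 0" using F by (simp add: sum_nonneg_eq_0_iff)
   thus ?thesis by (simp add: ipF_def)
  qed (simp add: c_def)
  finally show ?thesis by simp
 qed
 have ip_swap: "ipF F u v = cnj (ipF F v u)" for u v by (simp add: ipF_def mult.commute)
 have ipwp: "ipF F w p = 0"
 proof -
  have "ipF F w p = (\<Sum>j\<in>T. cnj (c j)*ipF F w (U j))" unfolding ipF_def p_def cnj_sum complex_cnj_mult sum_distrib_left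
   by (subst sum.swap) (simp add: mult_ac)
  thus ?thesis using ipw by simp
 qed
 have "complex_of_real (\<Sum>k\<in>F. (cmod (M x k))^2) = ipF F (%k. w k + p k) (%k. w k + p k)" by (simp only: ipF_self) (simp add: w_def)
 also have "... = ipF F w w + ipF F p p + ipF F w p + ipF F p w" by (simp add: ipF_def algebra_simps sum.distrib)
 also have "... = of_real ((\<Sum>k\<in>F. (cmod (w k))^2) + (\<Sum>k\<in>F. (cmod (p k))^2))" using ipwp ip_swap[of p w] by (simp add: ipF_self)
 finally have "(\<Sum>k\<in>F. (cmod (M x k))^2) = (\<Sum>k\<in>F. (cmod (w k))^2) + (\<Sum>k\<in>F. (cmod (p k))^2)" by (simp only: of_real_eq_iff)
 hence nw: "(\<Sum>k\<in>F. (cmod (w k))^2) <= (\<Sum>k\<in>F. (cmod (M x k))^2)" by (simp add: sum_nonneg)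
 show ?case
 proof (intro exI[of _ U'] conjI allI ballI impI)
  show "detS F U' = detS F M" by (rule 1)
  show "U' z = M z" if "z \<notin> insert x T" for z using that U(2) by (simp add: U'_def)
  show "ipF F (U' y) (U' z) = 0" if "y \<in> insert x T" "z \<in> insert x T" "y ~= z" for y z
   using that U(3) ipw ip_swap[of "U y" w] xT by (auto simp: U'_def)
  show "(\<Sum>k\<in>F. (cmod (U' z k))^2) <= (\<Sum>k\<in>F. (cmod (M z k))^2)" if "z \<in> insert x T" for z
   using that U(4) nw by (auto simp: U'_def)
 qed
qed

text \<open>After Gram-Schmidt the Gram matrix of the rows is diagonal, and its determinant is the
  squared modulus of the original one.\<close>

theorem hadamard_inequality:
 assumes F: "finite F" shows "(cmod (detS F M))^2 <= (\<Prod>x\<in>F. \<Sum>y\<in>F. (cmod (M x y))^2)"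
proof -
 obtain U where U: "detS F U = detS F M" "!!y z. y \<in> F ==> z \<in> F ==> y ~= z ==> ipF F (U y) (U z) = 0"
  "!!z. z \<in> F ==> (\<Sum>k\<in>F. (cmod (U z k))^2) <= (\<Sum>k\<in>F. (cmod (M z k))^2)" using gram_schmidt_rows[OF F F order_refl, of M] by auto
 have "detS F U * cnj (detS F U) = detS F U*detS F (%u y. cnj (U y u))" using detS_transpose[OF F, of "%x y. cnj (U x y)"] by (simp add: detS_cnj)
 also have "... = detS F (%x y. ipF F (U x) (U y))" unfolding detS_mult[OF F, symmetric] ipF_def ..
 also have "... = (\<Prod>x\<in>F. ipF F (U x) (U x))" by (rule detS_diagonal[OF F U(2)])
 also have "... = of_real (\<Prod>x\<in>F. \<Sum>k\<in>F. (cmod (U x k))^2)" unfolding ipF_self by simp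
 finally have "complex_of_real ((cmod (detS F U))^2) = of_real (\<Prod>x\<in>F. \<Sum>k\<in>F. (cmod (U x k))^2)"
  by (simp only: complex_norm_square[symmetric])
 hence "(cmod (detS F U))^2 = (\<Prod>x\<in>F. \<Sum>k\<in>F. (cmod (U x k))^2)" by (simp only: of_real_eq_iff)
 also have "... <= (\<Prod>x\<in>F. \<Sum>y\<in>F. (cmod (M x y))^2)" using U(3) by (intro prod_mono) (auto intro: sum_nonneg)
 finally show ?thesis by (simp add: U(1))
qed

section \<open>The regularized determinant of a finite matrix\<close>

definition det2S :: "'a set => ('a => 'a => complex) => complex" where
 "det2S F M = detS F (%x y. (if x = y then 1 else 0) + M x y)*exp (- (\<Sum>x\<in>F. M x x))"

definition hsS :: "'a set => ('a => 'a => complex) => real" where "hsS F M = L2_set (%(x, y). cmod (M x y)) (F \<times> F)"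

lemma hsS_square: "(hsS F M)^2 = (\<Sum>x\<in>F. \<Sum>y\<in>F. (cmod (M x y))^2)"
 by (simp add: hsS_def L2_set_def sum_nonneg sum.cartesian_product case_prod_unfold)

lemma hsS_nonneg: "0 <= hsS F M" by (simp add: hsS_def)

lemma hsS_triangle: "hsS F (%x y. M x y + N x y) <= hsS F M + hsS F N"
proof -
 have "hsS F (%x y. M x y + N x y) <= L2_set (%(x, y). cmod (M x y) + cmod (N x y)) (F \<times> F)"
  unfolding hsS_def by (intro L2_set_mono) (auto intro: norm_triangle_ineq)
 also have "... <= hsS F M + hsS F N" unfolding hsS_def by (rule order_trans[OF _ L2_set_triangle_ineq]) (simp add: case_prod_unfold)
 finally show ?thesis .
qed

lemma hsS_scale: "hsS F (%x y. c*M x y) = cmod c*hsS F M" by (simp add: hsS_def L2_set_right_distrib case_prod_unfold norm_mult)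

text \<open>Hadamard's inequality bounds each row norm of \<open>1 + M\<close> by \<open>exp (Re M\<^sub>x\<^sub>x + |M\<^sub>x|\<^sup>2 / 2)\<close>.\<close>

lemma det2S_bound:
 assumes F: "finite F" shows "cmod (det2S F M) <= exp ((hsS F M)^2/2)"
proof -
 let ?N = "%x y. (if x = y then 1 else 0) + M x y"
 have row: "(\<Sum>y\<in>F. (cmod (?N x y))^2) <= exp (2*Re (M x x) + (\<Sum>y\<in>F. (cmod (M x y))^2))" if x: "x \<in> F" for x
 proof -
  have "(\<Sum>y\<in>F. (cmod (?N x y))^2) = (cmod (1 + M x x))^2 + (\<Sum>y\<in>F - {x}. (cmod (M x y))^2)"
   by (subst sum.remove[OF F x]) (auto intro!: sum.cong split: if_split_asm)
  also have "(cmod (1 + M x x))^2 = 1 + 2*Re (M x x) + (cmod (M x x))^2" unfolding cmod_power2 by (simp add: power2_eq_square algebra_simps)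
  also have "1 + 2*Re (M x x) + (cmod (M x x))^2 + (\<Sum>y\<in>F - {x}. (cmod (M x y))^2) = 1 + (2*Re (M x x) + (\<Sum>y\<in>F. (cmod (M x y))^2))"
   by (simp add: sum.remove[OF F x])
  also have "... <= exp (2*Re (M x x) + (\<Sum>y\<in>F. (cmod (M x y))^2))" by (rule exp_ge_add_one_self)
  finally show ?thesis .
 qed
 have "(cmod (detS F ?N))^2 <= (\<Prod>x\<in>F. \<Sum>y\<in>F. (cmod (?N x y))^2)" by (rule hadamard_inequality[OF F])
 also have "... <= (\<Prod>x\<in>F. exp (2*Re (M x x) + (\<Sum>y\<in>F. (cmod (M x y))^2)))" using row by (intro prod_mono) (auto intro: sum_nonneg)
 also have "... = exp (2*(\<Sum>x\<in>F. Re (M x x)) + (hsS F M)^2)" by (simp add: exp_sum[OF F, symmetric] sum.distrib hsS_square sum_distrib_left)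
 finally have "(cmod (det2S F M))^2 <= exp (2*(\<Sum>x\<in>F. Re (M x x)) + (hsS F M)^2)*(exp (- (\<Sum>x\<in>F. Re (M x x))))^2"
  by (simp add: det2S_def norm_mult power_mult_distrib mult_right_mono)
 also have "... = (exp ((hsS F M)^2/2))^2" by (simp add: power2_eq_square exp_add[symmetric])
 finally show ?thesis by (rule power2_le_imp_le) simp
qed

lemma detS_holomorphic:
 assumes "!!x y. x \<in> F ==> y \<in> F ==> (%z. M z x y) holomorphic_on A" shows "(%z. detS F (M z)) holomorphic_on A" unfolding detS_def
 by (intro holomorphic_intros) (auto intro!: assms simp: permutes_in_image)

lemma det2S_holomorphic:
 assumes "!!x y. x \<in> F ==> y \<in> F ==> (%z. M z x y) holomorphic_on A" shows "(%z. det2S F (M z)) holomorphic_on A" unfolding det2S_def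
 by (intro holomorphic_intros detS_holomorphic) (auto intro!: assms holomorphic_intros)

text \<open>Along the complex line through M and N the determinant is an entire function of one
  variable. Cauchy's inequality on circles of radius 1/de bounds its derivative, so the growth bound
  \<open>det2S_bound\<close> alone yields a Lipschitz estimate.\<close>

lemma det2S_lipschitz:
 assumes F: "finite F" and M: "hsS F M <= B" and N: "hsS F N <= B"
 shows "cmod (det2S F M - det2S F N) <= hsS F (%x y. M x y - N x y)*exp ((2*B + 1)^2/2)"
proof (cases "hsS F (%x y. M x y - N x y) = 0")
 case True
 hence "(\<Sum>x\<in>F. \<Sum>y\<in>F. (cmod (M x y - N x y))^2) = 0" using hsS_square[of F "%x y. M x y - N x y"] by simp
 hence "\<forall>x\<in>F. \<forall>y\<in>F. M x y = N x y" using F by (simp add: sum_nonneg_eq_0_iff sum_nonneg)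
 hence "det2S F M = det2S F N" unfolding det2S_def by (auto intro!: arg_cong2[of _ _ _ _ "(*)"] detS_cong)
 thus ?thesis by (simp add: hsS_nonneg)
next
 case False
 define de where "de = hsS F (%x y. M x y - N x y)"
 have de: "0 < de" using False hsS_nonneg[of F "%x y. M x y - N x y"] by (simp add: de_def)
 define g where "g = (%ze. det2S F (%x y. (1/2)*(M x y + N x y) + ze*(M x y - N x y)))"
 have hol: "g holomorphic_on A" for A unfolding g_def by (intro det2S_holomorphic holomorphic_intros)
 have B0: "0 <= B" using M hsS_nonneg[of F M] by linarith
 have deB: "de <= 2*B"
 proof -
  have "hsS F (%x y. M x y + (-1)*N x y) <= hsS F M + hsS F (%x y. (-1)*N x y)" by (rule hsS_triangle)
  also have "hsS F (%x y. (-1)*N x y) = hsS F N" unfolding hsS_scale by simp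
  finally show ?thesis using M N by (simp add: de_def)
 qed
 \<comment> \<open>This disc contains the circle of radius 1/de around every point with |ze| <= 1/2.
   There the norm is at most B + de/2 + 1 <= 2 B + 1, because de <= 2 B.\<close>
 have bound: "cmod (g ze) <= exp ((2*B + 1)^2/2)" if "cmod ze <= 1/2 + 1/de" for ze
 proof -
  have "hsS F (%x y. (1/2)*(M x y + N x y) + ze*(M x y - N x y)) <= hsS F (%x y. (1/2)*(M x y + N x y)) + hsS F (%x y. ze*(M x y - N x y))"
   by (rule hsS_triangle)
  also have "hsS F (%x y. (1/2)*(M x y + N x y)) <= B" unfolding hsS_scale using hsS_triangle[of F M N] M N by simp
  also have "hsS F (%x y. ze*(M x y - N x y)) <= (1/2 + 1/de)*de" unfolding hsS_scale de_def[symmetric] using that de by (intro mult_right_mono) auto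
  also have "(1/2 + 1/de)*de <= B + 1" using de deB by (simp add: distrib_right)
  finally have h: "hsS F (%x y. (1/2)*(M x y + N x y) + ze*(M x y - N x y)) <= 2*B + 1" by simp
  have "cmod (g ze) <= exp ((hsS F (%x y. (1/2)*(M x y + N x y) + ze*(M x y - N x y)))^2/2)" unfolding g_def by (rule det2S_bound[OF F])
  also have "... <= exp ((2*B + 1)^2/2)" using power_mono[OF h hsS_nonneg, of 2] by simp
  finally show ?thesis .
 qed
 define C where "C = exp ((2*B + 1)^2/2)"
 have der: "cmod (deriv g ze) <= C*de" if "ze \<in> cball 0 (1/2)" for ze
 proof -
  have "cmod ((deriv ^^ 1) g ze) <= fact 1*C/(1/de)^1"
  proof (rule Cauchy_inequality)
   fix w assume "cmod (ze - w) = 1/de"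
   moreover have "cmod w <= cmod ze + cmod (ze - w)" by (metis add.commute norm_minus_commute norm_triangle_sub)
   ultimately show "cmod (g w) <= C" unfolding C_def using that by (intro bound) auto
  qed (use de hol in \<open>auto intro: holomorphic_on_imp_continuous_on\<close>)
  thus ?thesis by simp
 qed
 have "cmod (g (1/2) - g (- 1/2)) <= (C*de) * cmod (1/2 - (- 1/2))"
 proof (rule field_differentiable_bound[of "cball 0 (1/2)"])
  show "(g has_field_derivative deriv g z) (at z within cball 0 (1/2))" for z
   by (rule has_field_derivative_at_within[OF holomorphic_derivI[OF hol[of UNIV] open_UNIV UNIV_I]])
 qed (use der in auto)
 moreover have "g (1/2) = det2S F M" unfolding g_def by (intro arg_cong[of _ _ "det2S F"] ext) (simp add: field_simps)
 moreover have "g (- 1/2) = det2S F N" unfolding g_def by (intro arg_cong[of _ _ "det2S F"] ext) (simp add: field_simps)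
 ultimately show ?thesis by (simp add: de_def C_def mult.commute)
qed

section \<open>The algebra of bounded operators\<close>

lemma coord_delta: "coord (delta y) x = (if x = y then 1 else 0)"
proof -
 have "(%x. (cmod (if x = y then 1 else 0 :: complex))^2) summable_on UNIV"
  by (rule finite_nonzero_values_imp_summable_on) (rule finite_subset[of _ "{y}"], auto)
 thus ?thesis by (simp add: delta_def Abs_ell2_inverse)
qed

lemma coord_bounded_linear: "bounded_linear (%f. coord f x)" by (rule bounded_linear_intro[where K = 1])
  (auto simp: coord_plus coord_scaleR scaleR_conv_of_real norm_coord_le)

lemma norm_ell2_le:
 assumes "!!F. finite F ==> L2_set (%x. cmod (coord f x)) F <= b" shows "norm f <= b" unfolding norm_ell2_def by (rule ell2_criterion(2)[OF assms])

lemma L2_set_coord_le: "finite F ==> L2_set (%x. cmod (coord f x)) F <= norm f"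
 unfolding norm_ell2_def by (rule L2_set_le_ell2_norm[OF coord_summable])

lemma coord_sum: "coord (sum g A) x = (\<Sum>y\<in>A. coord (g y) x)" by (induction A rule: infinite_finite_induct) (auto simp: coord_zero coord_plus)

lemma norm_delta_le: "norm (delta y) <= 1"
proof (rule norm_ell2_le)
 fix F :: "'a set" assume F: "finite F"
 have "(\<Sum>x\<in>F. (cmod (coord (delta y) x))^2) = (\<Sum>x\<in>F. if x = y then 1 else 0)" by (intro sum.cong) (auto simp: coord_delta)
 also have "... <= 1" using F by simp
 finally show "L2_set (%x. cmod (coord (delta y) x)) F <= 1" unfolding L2_set_def by (simp add: real_sqrt_le_1_iff)
qed

lemma delta_nonzero: "delta y ~= 0"
proof
 assume "delta y = 0"
 hence "coord (delta y) y = coord 0 y" by simp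
 thus False by (simp add: coord_delta coord_zero)
qed

text \<open>The type of bounded operators has no product, hence a copy in the class of Banach algebras,
  where \<open>exp\<close> and powers are available.\<close>

typedef 'a opalg = "UNIV :: 'a ell2_op set"
 morphisms rep opa by simp

lemma opa_inverse' [simp]: "rep (opa A) = A" by (rule opa_inverse) simp

lemma rep_eqI: "(!!f. rep A f = rep B f) ==> A = B" by (metis blinfun_eqI rep_inject)

instantiation opalg :: (type) real_normed_algebra_1
begin

definition zero_opalg :: "'a opalg" where "0 = opa 0"
definition one_opalg :: "'a opalg" where "1 = opa id_blinfun"
definition plus_opalg :: "'a opalg => 'a opalg => 'a opalg" where "A + B = opa (rep A + rep B)"
definition minus_opalg :: "'a opalg => 'a opalg => 'a opalg" where "A - B = opa (rep A - rep B)"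
definition uminus_opalg :: "'a opalg => 'a opalg" where "- A = opa (- rep A)"
definition times_opalg :: "'a opalg => 'a opalg => 'a opalg" where "A*B = opa (rep A o\<^sub>L rep B)"
definition scaleR_opalg :: "real => 'a opalg => 'a opalg" where "c *\<^sub>R A = opa (c *\<^sub>R rep A)"
definition norm_opalg :: "'a opalg => real" where "norm A = norm (rep A)"
definition dist_opalg :: "'a opalg => 'a opalg => real" where "dist_opalg A B = norm (A - B)"
definition sgn_opalg :: "'a opalg => 'a opalg" where "sgn_opalg A = inverse (norm A) *\<^sub>R A"
definition uniformity_opalg :: "('a opalg \<times> 'a opalg) filter" where "uniformity_opalg = (INF e\<in>{0 <..}. principal {(f, g). dist f g < e})"
definition open_opalg :: "'a opalg set => bool"
 where "open_opalg U \<longleftrightarrow> (\<forall>f\<in>U. eventually (%(f', g). f' = f --> g \<in> U) uniformity)"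

lemma rep_simps: "rep (0 :: 'a opalg) = 0" "rep (1 :: 'a opalg) = id_blinfun"
 "rep (A + B) = rep A + rep B" "rep (A - B) = rep A - rep B" "rep (- A) = - rep A"
 "rep (A*B) = rep A o\<^sub>L rep B" "rep (c *\<^sub>R A) = c *\<^sub>R rep (A :: 'a opalg)"
 by (auto simp: zero_opalg_def one_opalg_def plus_opalg_def minus_opalg_def uminus_opalg_def
   times_opalg_def scaleR_opalg_def)

lemmas rep_apply_simps = rep_simps blinfun.add_left blinfun.diff_left blinfun.minus_left
 blinfun.scaleR_left blinfun_apply_blinfun_compose blinfun.zero_left

instance
proof
 fix A B C :: "'a opalg" and a b :: real
 show "A + B + C = A + (B + C)" "A + B = B + A" "0 + A = A" "- A + A = 0" "A - B = A + - B"
  "a *\<^sub>R (A + B) = a *\<^sub>R A + a *\<^sub>R B" "(a + b) *\<^sub>R A = a *\<^sub>R A + b *\<^sub>R A"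
  "a *\<^sub>R b *\<^sub>R A = (a*b) *\<^sub>R A" "1 *\<^sub>R A = A" "A*B*C = A*(B*C)" "(A + B)*C = A*C + B*C" "A*(B + C) = A*B + A*C"
  "a *\<^sub>R A*B = a *\<^sub>R (A*B)" "A*a *\<^sub>R B = a *\<^sub>R (A*B)" "1*A = A" "A*1 = A"
  by (rule rep_eqI, simp add: rep_apply_simps blinfun.add_right blinfun.scaleR_right algebra_simps)+
 show "(0 :: 'a opalg) ~= 1"
 proof
  assume "(0 :: 'a opalg) = 1"
  hence "rep (0 :: 'a opalg) (delta undefined) = rep 1 (delta undefined)" by simp
  thus False by (simp add: rep_simps delta_nonzero)
 qed
 show "dist A B = norm (A - B)" by (rule dist_opalg_def)
 show "sgn A = inverse (norm A) *\<^sub>R A" by (rule sgn_opalg_def)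
 show "(uniformity :: ('a opalg \<times> 'a opalg) filter) = (INF e\<in>{0 <..}. principal {(f, g). dist f g < e})" by (rule uniformity_opalg_def)
 show "open U \<longleftrightarrow> (\<forall>f\<in>U. eventually (%(f', g). f' = f --> g \<in> U) uniformity)" for U :: "'a opalg set"
  by (rule open_opalg_def)
 show "norm A = 0 \<longleftrightarrow> A = 0" by (auto simp: norm_opalg_def rep_simps) (metis rep_inject rep_simps(1))
 show "norm (A + B) <= norm A + norm B" by (simp add: norm_opalg_def rep_simps norm_triangle_ineq)
 show "norm (a *\<^sub>R A) = \<bar>a\<bar>*norm A" by (simp add: norm_opalg_def rep_simps)
 show "norm (A*B) <= norm A*norm B" by (simp add: norm_opalg_def rep_simps norm_blinfun_compose)
 show "norm (1 :: 'a opalg) = 1"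
 proof (rule antisym)
  show "norm (1 :: 'a opalg) <= 1" by (simp add: norm_opalg_def rep_simps norm_blinfun_id_le)
  have "norm (blinfun_apply id_blinfun (delta undefined :: 'a ell2)) <= norm (id_blinfun :: 'a ell2_op)*norm (delta undefined :: 'a ell2)"
   by (rule norm_blinfun)
  hence "1*norm (delta undefined :: 'a ell2) <= norm (id_blinfun :: 'a ell2_op)*norm (delta undefined :: 'a ell2)" by simp
  moreover have "0 < norm (delta undefined :: 'a ell2)" using delta_nonzero by simp
  ultimately show "1 <= norm (1 :: 'a opalg)" unfolding norm_opalg_def rep_simps by (rule mult_right_le_imp_le)
 qed
qed

end

lemma rep_bounded_linear: "bounded_linear rep" by (rule bounded_linear_intro[where K = 1]) (auto simp: rep_simps norm_opalg_def)

instance opalg :: (type) banach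
proof
 fix X :: "nat => 'a opalg" assume X: "Cauchy X"
 have d: "dist (rep A) (rep B) = dist A B" for A B :: "'a opalg" by (simp add: dist_norm norm_opalg_def rep_simps)
 have "Cauchy (%n. rep (X n))" using X by (simp add: Cauchy_def d)
 then obtain L where L: "(%n. rep (X n)) \<longlonglongrightarrow> L" using Cauchy_convergent convergent_def by blast
 have "(%n. dist (X n) (opa L)) = (%n. dist (rep (X n)) L)" using d by (metis opa_inverse')
 hence "X \<longlonglongrightarrow> opa L" using L by (metis tendsto_dist_iff)
 thus "convergent X" by (auto simp: convergent_def)
qed

lemma rep_apply_bounded_linear: "bounded_linear (%A. rep A f)" using bounded_linear_compose[OF blinfun.bounded_linear_left rep_bounded_linear] .

lemma rep_coord_bounded_linear: "bounded_linear (%A. coord (rep A f) x)"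
 using bounded_linear_compose[OF coord_bounded_linear rep_apply_bounded_linear] .

lemma rep_power: "rep (A^k) = op_pow (rep A) k" by (induction k) (simp_all add: op_pow_def rep_simps)

lemma rep_exp: "rep (exp A) = op_exp (rep A)"
proof -
 have "rep (exp A) = (\<Sum>k. rep (A^k /\<^sub>R fact k))"
  unfolding exp_def by (rule bounded_linear.suminf[OF rep_bounded_linear summable_exp_generic])
 thus ?thesis by (simp add: op_exp_def rep_simps rep_power inverse_eq_divide)
qed

definition ent :: "'a opalg => 'a => 'a => complex" where "ent A x y = coord (rep A (delta y)) x"

lemma entry_rep: "entry (rep A) = ent A" by (intro ext) (simp add: entry_def ent_def)

lemma ent_bounded_linear: "bounded_linear (%A. ent A x y)" unfolding ent_def by (rule rep_coord_bounded_linear)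

lemma ent_simps: "ent 1 x y = (if x = y then 1 else 0)" "ent 0 x y = 0"
 "ent (A + B) x y = ent A x y + ent B x y" "ent (A - B) x y = ent A x y - ent B x y"
 "ent (- A) x y = - ent A x y" "ent (c *\<^sub>R A) x y = of_real c*ent A x y"
 by (simp_all add: ent_def rep_apply_simps coord_delta coord_zero coord_plus coord_minus coord_uminus coord_scaleR)

lemma norm_ent_le: "cmod (ent A x y) <= norm A"
proof -
 have "cmod (ent A x y) <= norm (rep A (delta y))" unfolding ent_def by (rule norm_coord_le)
 also have "... <= norm A*norm (delta y)" unfolding norm_opalg_def by (rule norm_blinfun)
 also have "... <= norm A*1" by (intro mult_left_mono norm_delta_le) simp
 finally show ?thesis by simp
qed

section \<open>Complex linearity and operators with range over a finite set\<close>

definition cs :: "complex => 'a ell2 => 'a ell2" where "cs c f = mult_op (%_. c) f"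

lemma coord_cs: "coord (cs c f) x = c * coord f x" by (simp add: cs_def mult_op_apply)

definition jop :: "'a opalg" where "jop = opa (mult_op (%_. \<i>))"

text \<open>\<open>ell2\<close> is an instance of a real vector space only, so
  \<open>ell2_op\<close> contains maps that are merely real-linear, and these are not determined by
  their entries. Commuting with multiplication by i singles out the complex-linear ones.\<close>

definition clin :: "'a opalg => bool" where "clin A \<longleftrightarrow> A*jop = jop*A"

lemma rep_cs:
 assumes "clin A" shows "rep A (cs c f) = cs c (rep A f)"
proof -
 have j: "rep jop f = cs \<i> f" for f :: "'a ell2" by (simp add: jop_def cs_def)
 have "rep A (cs \<i> f) = cs \<i> (rep A f)" for f using arg_cong[OF assms[unfolded clin_def], of "%T. rep T f"] by (simp add: rep_apply_simps j)
 moreover have "cs c g = Re c *\<^sub>R g + Im c *\<^sub>R cs \<i> g" for g :: "'a ell2"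
  by (rule ell2_eqI) (simp add: coord_cs coord_plus coord_scaleR, subst complex_eq[of c], simp add: algebra_simps)
 ultimately show ?thesis by (simp add: blinfun.add_right blinfun.scaleR_right)
qed

lemma clinI:
 assumes "!!f. rep A (cs \<i> f) = cs \<i> (rep A f)" shows "clin A"
 unfolding clin_def by (rule rep_eqI) (simp add: rep_apply_simps jop_def assms cs_def[symmetric])

lemma clin_closed:
 "clin (0 :: 'a opalg)" "clin (1 :: 'a opalg)" "clin A ==> clin B ==> clin (A + B)" "clin A ==> clin B ==> clin (A - (B :: 'a opalg))"
 "clin A ==> clin (- A)" "clin A ==> clin B ==> clin (A*B)" "clin A ==> clin (r *\<^sub>R A)" "clin A ==> clin (A^k)"
proof -
 show m: "clin A ==> clin B ==> clin (A*B)" for A B :: "'a opalg" unfolding clin_def by (metis mult.assoc)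
 show o: "clin (1 :: 'a opalg)" by (simp add: clin_def)
 show "clin A ==> clin (A^k)" by (induction k) (auto intro: m o)
qed (auto simp: clin_def algebra_simps)

lemma clin_exp:
 assumes "clin A" shows "clin (exp A)"
proof -
 have "jop*(A^n /\<^sub>R fact n) = (A^n /\<^sub>R fact n)*jop" for n using clin_closed(8)[OF assms, of n] by (simp add: clin_def)
 hence "(\<Sum>n. jop*(A^n /\<^sub>R fact n)) = (\<Sum>n. (A^n /\<^sub>R fact n)*jop)" by simp
 thus ?thesis unfolding clin_def exp_def by (simp only: suminf_mult[OF summable_exp_generic] suminf_mult2[OF summable_exp_generic])
qed

lemma rep_finite_combination:
 assumes "clin A" shows "coord (rep A (\<Sum>y\<in>B. cs (c y) (delta y))) x = (\<Sum>y\<in>B. c y*ent A x y)"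
 by (simp add: blinfun.sum_right coord_sum rep_cs[OF assms] coord_cs ent_def)

text \<open>Only the range is restricted: the columns with index outside F may be nonzero, as they
  are for a truncated potential times the resolvent.\<close>

definition supp_in :: "'a set => 'a opalg => bool" where "supp_in F A \<longleftrightarrow> (\<forall>f x. x \<notin> F --> coord (rep A f) x = 0)"

lemma supp_in_closed: "supp_in F A ==> supp_in F (A*B)" "supp_in F A ==> supp_in F B ==> supp_in F (A + B)"
 "supp_in F A ==> supp_in F B ==> supp_in F (A - B)" "supp_in F A ==> supp_in F (r *\<^sub>R A)" "supp_in F A ==> supp_in F (- A)"
 by (simp_all add: supp_in_def rep_apply_simps coord_plus coord_minus coord_scaleR coord_uminus)

lemma supp_in_power: "supp_in F A ==> 0 < k ==> supp_in F (A^k)" by (cases k) (auto intro: supp_in_closed)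

lemma supp_in_exp:
 assumes "supp_in F A" shows "supp_in F (exp A - 1)" unfolding supp_in_def
proof (intro allI impI)
 fix f x assume x: "x \<notin> F"
 have z: "coord (rep (A^n /\<^sub>R fact n) f) x = (if n = 0 then coord f x else 0)" for n using supp_in_power[OF assms, of n] x
  by (cases "n = 0") (auto simp: supp_in_def rep_apply_simps coord_scaleR)
 have "coord (rep (exp A) f) x = (\<Sum>n. coord (rep (A^n /\<^sub>R fact n) f) x)"
  unfolding exp_def by (rule bounded_linear.suminf[OF rep_coord_bounded_linear summable_exp_generic])
 also have "... = (\<Sum>n. if n = 0 then coord f x else 0)" by (simp only: z)
 also have "... = coord f x" using suminf_finite[of "{0}" "%n. if n = 0 then coord f x else 0"] by simp
 finally show "coord (rep (exp A - 1) f) x = 0" by (simp add: rep_apply_simps coord_minus)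
qed

lemma supp_in_one_mult:
 assumes "supp_in F (X - 1)" "supp_in F (Y - 1)" shows "supp_in F (X*Y - 1)"
proof -
 have e: "X*Y - 1 = (X - 1)*Y + (Y - 1)" by (simp add: algebra_simps)
 show ?thesis unfolding e by (rule supp_in_closed(2)[OF supp_in_closed(1)[OF assms(1)] assms(2)])
qed

lemma ent_mult_supp:
 assumes F: "finite F" and X: "clin X" and Y: "supp_in F Y" shows "ent (X*Y) x y = (\<Sum>u\<in>F. ent X x u*ent Y u y)"
proof -
 have "rep Y (delta y) = (\<Sum>u\<in>F. cs (ent Y u y) (delta u))" by (rule ell2_eqI)
   (use F Y in \<open>auto simp: supp_in_def coord_sum coord_cs coord_delta ent_def if_distrib cong: if_cong\<close>)
 hence "ent (X*Y) x y = coord (rep X (\<Sum>u\<in>F. cs (ent Y u y) (delta u))) x" by (simp add: ent_def rep_apply_simps)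
 thus ?thesis by (simp add: rep_finite_combination[OF X] mult.commute)
qed

definition dF :: "'a set => 'a opalg => complex" where "dF F X = detS F (ent X)"

text \<open>Compression to F is not multiplicative in general. Here Y is the identity modulo
  functions supported on F, so a column of Y with index in F has no entry outside F, and the sum
  over intermediate points stays in F.\<close>

lemma dF_mult:
 assumes F: "finite F" and X: "clin X" and Y: "supp_in F (Y - 1)" shows "dF F (X*Y) = dF F X*dF F Y"
proof -
 have e: "ent (X*Y) x y = (\<Sum>u\<in>F. ent X x u*ent Y u y)" if y: "y \<in> F" for x y
 proof -
  have "ent (X*(Y - 1)) x y = (\<Sum>u\<in>F. ent X x u*ent Y u y) - (\<Sum>u\<in>F. if u = y then ent X x u else 0)"
   unfolding ent_mult_supp[OF F X Y] sum_subtractf[symmetric] by (intro sum.cong) (auto simp: ent_simps algebra_simps)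
  thus ?thesis using F y by (simp add: ent_simps algebra_simps)
 qed
 show ?thesis unfolding dF_def detS_mult[OF F, symmetric] by (rule detS_cong) (simp add: e)
qed

lemma dF_one: "finite F ==> dF F 1 = 1" unfolding dF_def by (subst detS_diagonal) (auto simp: ent_simps)

text \<open>By \<open>dF_mult\<close> the function of s is a one-parameter group in the complex
  numbers; its derivative at 0 is the trace, which determines it.\<close>

lemma dF_exp:
 assumes F: "finite F" and A: "clin A" "supp_in F A" shows "dF F (exp (s *\<^sub>R A)) = exp (of_real s*(\<Sum>x\<in>F. ent A x x))"
proof -
 define f where "f = (%s. dF F (exp (s *\<^sub>R A)))"
 define tr where "tr = (\<Sum>x\<in>F. ent A x x)"
 have add: "f (s + h) = f s*f h" for s h
 proof -
  have "exp ((s + h) *\<^sub>R A) = exp (s *\<^sub>R A)*exp (h *\<^sub>R A)"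
   unfolding scaleR_add_left by (rule exp_add_commuting) (simp add: mult.commute)
  thus ?thesis unfolding f_def by (simp add: dF_mult[OF F clin_exp[OF clin_closed(7)[OF A(1)]] supp_in_exp[OF supp_in_closed(4)[OF A(2)]]])
 qed
 have f0: "f 0 = 1" using F by (simp add: f_def dF_one)
 have e: "((%s. ent (exp (s *\<^sub>R A)) x y) has_derivative (%h. h *\<^sub>R ent A x y)) (at 0)" for x y
 proof -
  have "((%s. exp (s *\<^sub>R A)) has_derivative (%h. h *\<^sub>R (exp (0 *\<^sub>R A)*A))) (at 0)"
   using exp_scaleR_has_vector_derivative_right[of A 0 UNIV] by (simp add: has_vector_derivative_def)
  from bounded_linear.has_derivative[OF ent_bounded_linear this, of x y]
  show ?thesis by (simp add: ent_simps scaleR_conv_of_real[where 'a = complex])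
 qed
 have d0: "(f has_derivative (%h. h *\<^sub>R tr)) (at 0)"
 proof -
  let ?P = "{pe. pe permutes F}"
  let ?d = "%x y. (if x = y then 1 else 0) :: complex"
  have ent0: "ent (exp (0 *\<^sub>R A)) x y = ?d x y" for x y by (simp add: ent_simps)
  have "(f has_derivative (%h. \<Sum>pe\<in>?P. of_int (sign pe)*(\<Sum>x\<in>F. (h *\<^sub>R ent A x (pe x))*(\<Prod>z\<in>F - {x}. ent (exp (0 *\<^sub>R A)) z (pe z))))) (at 0)"
   unfolding f_def dF_def detS_def by (intro has_derivative_sum has_derivative_mult_right has_derivative_prod e)
  moreover have "(\<Sum>pe\<in>?P. of_int (sign pe)*(\<Sum>x\<in>F. (h *\<^sub>R ent A x (pe x))*(\<Prod>z\<in>F - {x}. ent (exp (0 *\<^sub>R A)) z (pe z)))) = h *\<^sub>R tr" for h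
  proof -
   \<comment> \<open>A permutation other than the identity moves at least two points, so one
     off-diagonal entry of the identity matrix survives after differentiating a single
     factor.\<close>
   have "(\<Sum>pe\<in>?P. of_int (sign pe)*(\<Sum>x\<in>F. (h *\<^sub>R ent A x (pe x))*(\<Prod>z\<in>F - {x}. ?d z (pe z))))
    = (\<Sum>pe\<in>{id}. of_int (sign pe)*(\<Sum>x\<in>F. (h *\<^sub>R ent A x (pe x))*(\<Prod>z\<in>F - {x}. ?d z (pe z))))"
   proof (rule sum.mono_neutral_right)
    show "\<forall>pe\<in>?P - {id}. of_int (sign pe)*(\<Sum>x\<in>F. (h *\<^sub>R ent A x (pe x))*(\<Prod>z\<in>F - {x}. ?d z (pe z))) = 0"
    proof
     fix pe assume "pe \<in> ?P - {id}"
     hence p: "pe permutes F" and "pe ~= id" by auto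
     then obtain y where y: "pe y ~= y" by (auto simp: fun_eq_iff)
     have yF: "y \<in> F" "pe y \<in> F" using p y by (auto simp: permutes_in_image dest: permutes_not_in)
     have y2: "pe (pe y) ~= pe y" using p y by (metis permutes_inverses(2))
     have "(\<Prod>z\<in>F - {x}. ?d z (pe z)) = 0" for x
     proof -
      obtain z where "z \<in> F - {x}" "pe z ~= z" using y y2 yF by (cases "x = y") auto
      thus ?thesis using F by (intro prod_zero) force+
     qed
     thus "of_int (sign pe)*(\<Sum>x\<in>F. (h *\<^sub>R ent A x (pe x))*(\<Prod>z\<in>F - {x}. ?d z (pe z))) = 0" by simp
    qed
   qed (use F in \<open>auto simp: finite_permutations permutes_id\<close>)
   thus ?thesis by (simp only: ent0) (simp add: tr_def sign_id scaleR_sum_right)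
  qed
  ultimately show ?thesis by simp
 qed
 have ds: "(f has_vector_derivative f s*tr) (at s)" for s
 proof -
  have 0: "(f has_vector_derivative tr) (at (s - s))" using d0 by (simp add: has_vector_derivative_def)
  have 1: "((%t. t - s) has_vector_derivative 1) (at s)" by (auto intro!: derivative_eq_intros)
  have "((f \<circ> (%t. t - s)) has_vector_derivative 1 *\<^sub>R tr) (at s)" by (rule vector_diff_chain_at[OF 1 0])
  hence "((%t. f s*f (t - s)) has_vector_derivative f s*(1 *\<^sub>R tr)) (at s)" unfolding o_def by (rule has_vector_derivative_mult_right)
  moreover have "f s*f (t - s) = f t" for t using add[of s "t - s"] by simp
  ultimately show ?thesis by simp
 qed
 have "((%s. f s*exp (- (of_real s*tr))) has_vector_derivative 0) (at s within UNIV)" for s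
 proof -
  have "((%s. exp (- (of_real s*tr))) has_vector_derivative - tr*exp (- (of_real s*tr))) (at s)"
   by (auto intro!: derivative_eq_intros has_vector_derivative_real_field)
  from has_vector_derivative_mult[OF ds[of s] this] show ?thesis by (simp add: algebra_simps)
 qed
 hence "f s*exp (- (of_real s*tr)) = f 0*exp (- (of_real 0*tr))" using has_vector_derivative_zero_constant[of UNIV "%s. f s*exp (- (of_real s*tr))"]
  by (metis UNIV_I convex_UNIV)
 hence "f s*exp (- (of_real s*tr)) = 1" by (simp add: f0)
 hence "f s = exp (of_real s*tr)" by (simp add: exp_minus field_simps)
 thus ?thesis by (simp add: f_def tr_def)
qed

text \<open>The operator whose principal minors are summed in the series for \<open>det2\<close>,
  that is, det2 A = det (1 + \<open>regT A\<close>).\<close>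

definition regT :: "'a opalg => 'a opalg" where "regT A = (1 + A)*exp (- A) - 1"

lemma det2_rep: "det2 (rep A) = (\<Sum>\<^sub>\<infinity>S\<in>{S. finite S}. detS S (ent (regT A)))"
proof -
 have "(id_blinfun + rep A) o\<^sub>L op_exp (- rep A) = rep ((1 + A)*exp (- A))" by (simp add: rep_simps rep_exp)
 moreover have "rep ((1 + A)*exp (- A)) - id_blinfun = rep (regT A)" by (simp add: regT_def rep_simps)
 ultimately show ?thesis by (simp add: det2_def fredholm_det_def principal_minor_eq_detS entry_rep)
qed

lemma detS_zero_row:
 assumes "finite S" "x \<in> S" "!!y. y \<in> S ==> M x y = 0" shows "detS S M = 0" unfolding detS_def
proof (rule sum.neutral, rule ballI)
 fix pe assume "pe \<in> {pe. pe permutes S}"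
 hence "M x (pe x) = 0" using assms by (simp add: permutes_in_image)
 hence "(\<Prod>x\<in>S. M x (pe x)) = 0" using assms by (intro prod_zero) auto
 thus "of_int (sign pe)*(\<Prod>x\<in>S. M x (pe x)) = 0" by simp
qed

lemma dF_one_plus: "finite F ==> dF F X = (\<Sum>S\<in>Pow F. detS S (ent (X - 1)))"
 unfolding dF_def detS_one_plus[symmetric] by (rule detS_cong) (simp add: ent_simps)

lemma dF_exp_minus:
 assumes "finite F" "clin A" "supp_in F A" shows "dF F (exp (- A)) = exp (- (\<Sum>x\<in>F. ent A x x))" using dF_exp[OF assms, of "-1"] by simp

text \<open>A minor with an index outside F has a zero row, so Fredholm's series collapses to the
  subsets of F and is a determinant over F. There multiplicativity splits off the exponential, which
  \<open>dF_exp\<close> evaluates.\<close>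

lemma det2_finite:
 assumes F: "finite F" and A: "clin A" "supp_in F A" shows "det2 (rep A) = det2S F (ent A)"
proof -
 have s: "supp_in F (exp (- A) - 1)" by (rule supp_in_exp[OF supp_in_closed(5)[OF A(2)]])
 have sT: "supp_in F (regT A)" unfolding regT_def by (rule supp_in_one_mult[OF _ s]) (simp add: A)
 have z: "detS S (ent (regT A)) = 0" if "finite S" "S \<notin> Pow F" for S
 proof -
  obtain x where "x \<in> S" "x \<notin> F" using \<open>S \<notin> Pow F\<close> by blast
  thus ?thesis using sT that by (intro detS_zero_row[of S x]) (auto simp: supp_in_def ent_def)
 qed
 have "det2 (rep A) = (\<Sum>\<^sub>\<infinity>S\<in>Pow F. detS S (ent (regT A)))"
  unfolding det2_rep by (rule infsum_cong_neutral) (use z F finite_subset in auto)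
 also have "... = (\<Sum>S\<in>Pow F. detS S (ent (regT A)))" using F by (intro infsum_finite) simp
 also have "... = dF F ((1 + A)*exp (- A))" unfolding dF_one_plus[OF F] regT_def ..
 also have "... = dF F (1 + A)*dF F (exp (- A))" by (rule dF_mult[OF F clin_closed(3)[OF clin_closed(2) A(1)] s])
 also have "dF F (1 + A) = detS F (%x y. (if x = y then 1 else 0) + ent A x y)" unfolding dF_def by (rule detS_cong) (simp add: ent_simps)
 finally show ?thesis by (simp add: dF_exp_minus[OF F A] det2S_def)
qed

section \<open>Dominated convergence of the Fredholm series\<close>

lemma row_bound_entries:
 assumes T: "clin T" and b: "!!f. cmod (coord (rep T f) x) <= b*norm f" and S: "finite S" shows "(\<Sum>y\<in>S. (cmod (ent T x y))^2) <= b^2"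
proof -
 define q where "q = (\<Sum>y\<in>S. (cmod (ent T x y))^2)"
 have q0: "0 <= q" by (simp add: q_def sum_nonneg)
 \<comment> \<open>The conjugated row is the extremal test vector: T maps it to the squared norm q
   of the row at x, while its own norm is sqrt q.\<close>
 define f where "f = (\<Sum>y\<in>S. cs (cnj (ent T x y)) (delta y))"
 have "coord (rep T f) x = (\<Sum>y\<in>S. cnj (ent T x y)*ent T x y)" unfolding f_def by (rule rep_finite_combination[OF T])
 also have "... = of_real q" unfolding q_def of_real_sum complex_norm_square by (simp add: mult.commute)
 finally have 1: "cmod (coord (rep T f) x) = q" using q0 by simp
 have cf: "coord f z = (if z \<in> S then cnj (ent T x z) else 0)" for z
  using S by (simp add: f_def coord_sum coord_cs coord_delta if_distrib cong: if_cong)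
 have "norm f <= sqrt q"
 proof (rule norm_ell2_le)
  fix G :: "'a set" assume G: "finite G"
  have "(\<Sum>z\<in>G. (cmod (coord f z))^2) = (\<Sum>z\<in>G \<inter> S. (cmod (ent T x z))^2)"
   unfolding cf using G by (subst sum.inter_restrict[OF G]) (auto intro!: sum.cong)
  also have "... <= q" unfolding q_def using S by (intro sum_mono2) auto
  finally show "L2_set (%z. cmod (coord f z)) G <= sqrt q" by (simp add: L2_set_def)
 qed
 moreover have b0: "0 <= b"
 proof -
  have "0 <= b*norm (delta x :: 'a ell2)" using b[of "delta x"] norm_ge_zero order_trans by blast
  thus ?thesis using delta_nonzero[of x] by (simp add: zero_le_mult_iff)
 qed
 ultimately have "q <= b * sqrt q" using b[of f] 1 mult_left_mono by fastforce
 hence "sqrt q * sqrt q <= b * sqrt q" using q0 by simp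
 have "sqrt q <= b"
 proof (cases "q = 0")
  case False
  show ?thesis by (rule mult_right_le_imp_le[OF \<open>sqrt q * sqrt q <= b * sqrt q\<close>]) (use False q0 in simp)
 qed (use b0 in simp)
 hence "(sqrt q)^2 <= b^2" using q0 by (intro power_mono) auto
 thus ?thesis using q0 by (simp add: q_def)
qed

lemma minor_bound:
 assumes T: "clin T" and b: "!!x f. cmod (coord (rep T f) x) <= b x*norm f" and b0: "!!x. 0 <= b x" and S: "finite S"
 shows "cmod (detS S (ent T)) <= (\<Prod>x\<in>S. b x)"
proof -
 have "(cmod (detS S (ent T)))^2 <= (\<Prod>x\<in>S. \<Sum>y\<in>S. (cmod (ent T x y))^2)" by (rule hadamard_inequality[OF S])
 also have "... <= (\<Prod>x\<in>S. (b x)^2)" by (intro prod_mono conjI sum_nonneg row_bound_entries[OF T b S]) auto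
 also have "... = (\<Prod>x\<in>S. b x)^2" by (rule prod_power_distrib[symmetric])
 finally show ?thesis by (rule power2_le_imp_le) (simp add: prod_nonneg b0)
qed

text \<open>The sum over the subsets of a finite X is the product of the factors 1 + b x, hence at
  most exp of the sum of b.\<close>

lemma summable_prod_finite_sets:
 fixes b :: "'a => real"
 assumes b0: "!!x. 0 <= b x" and be: "!!X. finite X ==> sum b X <= be" shows "(%S. \<Prod>x\<in>S. b x) summable_on {S. finite S}"
proof (rule nonneg_bdd_above_summable_on)
 show "bdd_above (sum (%S. \<Prod>x\<in>S. b x) ` {\<F>. \<F> \<subseteq> {S. finite S} \<and> finite \<F>})"
 proof (rule bdd_aboveI2)
  fix \<F> :: "'a set set" assume F: "\<F> \<in> {\<F>. \<F> \<subseteq> {S. finite S} \<and> finite \<F>}"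
  define X where "X = \<Union>\<F>"
  have X: "finite X" using F by (auto simp: X_def)
  have "sum (%S. \<Prod>x\<in>S. b x) \<F> <= (\<Sum>S\<in>Pow X. \<Prod>x\<in>S. b x)"
   by (intro sum_mono2) (use X b0 in \<open>auto simp: X_def intro: prod_nonneg\<close>)
  also have "... = (\<Prod>x\<in>X. b x + 1)" by (subst prod_add[OF X]) simp
  also have "... <= (\<Prod>x\<in>X. exp (b x))" using b0 by (intro prod_mono) (auto simp: add.commute add_nonneg_nonneg)
  also have "... = exp (sum b X)" by (rule exp_sum[OF X, symmetric])
  also have "... <= exp be" using be[OF X] by simp
  finally show "sum (%S. \<Prod>x\<in>S. b x) \<F> <= exp be" .
 qed
qed (use b0 in \<open>auto intro: prod_nonneg\<close>)

lemma infsum_dominated_limit: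
 fixes a :: "nat => 'b => complex"
 assumes M: "M summable_on A" and a: "!!n s. s \<in> A ==> cmod (a n s) <= M s"
  and lim: "!!s. s \<in> A ==> (%n. a n s) \<longlonglongrightarrow> l s"
 shows "(%n. \<Sum>\<^sub>\<infinity>s\<in>A. a n s) \<longlonglongrightarrow> (\<Sum>\<^sub>\<infinity>s\<in>A. l s)"
proof -
 have l: "cmod (l s) <= M s" if "s \<in> A" for s using tendsto_norm[OF lim[OF that]] by (rule LIMSEQ_le_const2) (use a[OF that] in auto)
 have M0: "0 <= M s" if "s \<in> A" for s using l[OF that] norm_ge_zero order_trans by blast
 have "(%s. norm (M s)) summable_on A" using M M0 by (subst summable_on_cong[where g = M]) auto
 hence Mc: "integrable (count_space A) M" by (metis abs_summable_equivalent abs_summable_on_def)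
 have suma: "(%s. norm (a n s)) summable_on A" for n by (rule summable_on_comparison_test[OF M]) (use a in auto)
 have suml: "(%s. norm (l s)) summable_on A" by (rule summable_on_comparison_test[OF M]) (use l in auto)
 have ea: "(\<Sum>\<^sub>\<infinity>s\<in>A. a n s) = (\<integral>s. a n s \<partial>count_space A)" for n
  using infsetsum_infsum[of "a n" A] suma by (simp add: infsetsum_def abs_summable_equivalent)
 have el: "(\<Sum>\<^sub>\<infinity>s\<in>A. l s) = (\<integral>s. l s \<partial>count_space A)"
  using infsetsum_infsum[of l A] suml by (simp add: infsetsum_def abs_summable_equivalent)
 show ?thesis unfolding ea el by (rule integral_dominated_convergence[where w = M]) (use Mc a lim in \<open>auto simp: AE_count_space\<close>)
qed

lemma norm_power_diff_le:
 fixes X Y :: "'a::real_normed_algebra_1"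
 assumes "norm X <= m" "norm Y <= m" shows "norm (X^Suc n - Y^Suc n) <= real (Suc n)*(m^n*norm (X - Y))"
proof (induction n)
 case (Suc n)
 have m: "0 <= m" using assms norm_ge_zero order_trans by blast
 have e: "X^Suc (Suc n) - Y^Suc (Suc n) = X*(X^Suc n - Y^Suc n) + (X - Y)*Y^Suc n" by (simp add: algebra_simps)
 have "norm (X*(X^Suc n - Y^Suc n)) <= norm X*norm (X^Suc n - Y^Suc n)" by (rule norm_mult_ineq)
 also have "... <= m*(real (Suc n)*(m^n*norm (X - Y)))" using Suc assms m by (intro mult_mono) auto
 finally have 1: "norm (X*(X^Suc n - Y^Suc n)) <= real (Suc n)*(m^Suc n*norm (X - Y))" by (simp add: mult_ac)
 have "norm (Y^Suc n) <= norm Y^Suc n" by (rule norm_power_ineq)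
 also have "... <= m^Suc n" using assms by (intro power_mono) auto
 finally have "norm (Y^Suc n) <= m^Suc n" .
 hence "norm (X - Y)*norm (Y^Suc n) <= norm (X - Y)*m^Suc n" by (intro mult_left_mono) auto
 hence 2: "norm ((X - Y)*Y^Suc n) <= m^Suc n*norm (X - Y)" using norm_mult_ineq[of "X - Y" "Y^Suc n"] by (simp add: mult.commute)
 have "norm (X^Suc (Suc n) - Y^Suc (Suc n)) <= norm (X*(X^Suc n - Y^Suc n)) + norm ((X - Y)*Y^Suc n)" unfolding e by (rule norm_triangle_ineq)
 also have "... <= real (Suc n)*(m^Suc n*norm (X - Y)) + m^Suc n*norm (X - Y)" by (rule add_mono[OF 1 2])
 also have "... = real (Suc (Suc n))*(m^Suc n*norm (X - Y))" by (simp add: distrib_right)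
 finally show ?case .
qed simp

lemma norm_exp_diff_algebra_le:
 fixes X Y :: "'a::{real_normed_algebra_1, banach}"
 assumes "norm X <= m" "norm Y <= m" shows "norm (exp X - exp Y) <= exp m*norm (X - Y)"
proof -
 have "exp X - exp Y = (\<Sum>n. X^n /\<^sub>R fact n - Y^n /\<^sub>R fact n)"
  unfolding exp_def by (rule suminf_diff[OF summable_exp_generic summable_exp_generic])
 also have "... = (\<Sum>n. X^Suc n /\<^sub>R fact (Suc n) - Y^Suc n /\<^sub>R fact (Suc n))"
  by (subst suminf_split_head) (auto intro: summable_diff summable_exp_generic)
 finally have e: "exp X - exp Y = (\<Sum>n. X^Suc n /\<^sub>R fact (Suc n) - Y^Suc n /\<^sub>R fact (Suc n))" .
 have t: "norm (X^Suc n /\<^sub>R fact (Suc n) - Y^Suc n /\<^sub>R fact (Suc n)) <= (m^n /\<^sub>R fact n)*norm (X - Y)" for n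
 proof -
  have "norm (X^Suc n /\<^sub>R fact (Suc n) - Y^Suc n /\<^sub>R fact (Suc n)) = norm (X^Suc n - Y^Suc n)/fact (Suc n)"
   by (simp add: scaleR_diff_right[symmetric] divide_inverse mult.commute del: power_Suc fact_Suc)
  also have "... <= real (Suc n)*(m^n*norm (X - Y))/fact (Suc n)" by (intro divide_right_mono norm_power_diff_le assms) auto
  also have "... = m^n*norm (X - Y)/fact n" unfolding fact_Suc[where 'a = real] by (rule mult_divide_mult_cancel_left) simp
  also have "... = (m^n /\<^sub>R fact n)*norm (X - Y)" by (simp add: divide_inverse mult_ac)
  finally show ?thesis .
 qed
 have sm: "summable (%n. (m^n /\<^sub>R fact n)*norm (X - Y))" by (intro summable_mult2 summable_exp_generic)
 have "norm (exp X - exp Y) <= (\<Sum>n. (m^n /\<^sub>R fact n)*norm (X - Y))" unfolding e by (rule norm_suminf_le[OF t sm])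
 also have "... = exp m*norm (X - Y)" unfolding exp_def by (rule suminf_mult2[OF summable_exp_generic, symmetric])
 finally show ?thesis .
qed

lemma tendsto_exp_algebra:
 fixes A :: "nat => 'a::{real_normed_algebra_1, banach}"
 assumes "A \<longlonglongrightarrow> L" shows "(%n. exp (A n)) \<longlonglongrightarrow> exp L"
proof -
 have "Bseq A" using assms by (simp add: convergent_imp_Bseq convergentI)
 then obtain m where m: "!!n. norm (A n) <= m" by (auto simp: Bseq_def)
 have mL: "norm L <= m" by (rule LIMSEQ_le_const2[OF tendsto_norm[OF assms]]) (use m in auto)
 have "(%n. exp m*norm (A n - L)) \<longlonglongrightarrow> 0"
  using assms by (intro tendsto_mult_right_zero) (simp add: LIM_zero_iff tendsto_norm_zero)
 hence "(%n. exp (A n) - exp L) \<longlonglongrightarrow> 0" by (rule Lim_null_comparison[rotated]) (use norm_exp_diff_algebra_le[OF m mL] in auto)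
 thus ?thesis by (simp add: LIM_zero_iff)
qed

text \<open>(1 + A) exp (- A) = (1 + A)(1 - A + A^2 E) differs from 1 by a multiple of A^2. Row
  bounds for A^2 therefore suffice, which is the reason for the regularization when A itself is not
  of trace class.\<close>

lemma regT_factor: "\<exists>G. regT A = A*A*G \<and> norm G <= 1 + (1 + norm A)*exp (norm A)"
proof -
 define t where "t = (%k. (- A)^k /\<^sub>R fact (k + 2))"
 have nt: "norm (t k) <= norm A^k /\<^sub>R fact k" for k
 proof -
  have "norm ((- A)^k) <= norm A^k" using norm_power_ineq[of "- A" k] by simp
  moreover have "fact k <= (fact (k + 2) :: real)" by (rule fact_mono) simp
  ultimately have "norm ((- A)^k)/fact (k + 2) <= norm A^k/fact k" by (intro frac_le) auto
  thus ?thesis by (simp add: t_def divide_inverse mult.commute del: fact_Suc add_2_eq_Suc')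
 qed
 have st: "summable t" by (rule summable_norm_cancel, rule summable_comparison_test'[OF summable_exp_generic[of "norm A"]]) (use nt in auto)
 define E where "E = suminf t"
 have nE: "norm E <= exp (norm A)" unfolding E_def exp_def by (rule norm_suminf_le[OF nt summable_exp_generic])
 have "exp (- A) = (\<Sum>k. (- A)^(k + 2) /\<^sub>R fact (k + 2)) + (\<Sum>k<2. (- A)^k /\<^sub>R fact k)"
  unfolding exp_def by (rule suminf_split_initial_segment[OF summable_exp_generic])
 also have "(\<Sum>k<2. (- A)^k /\<^sub>R fact k) = 1 - A" by (simp add: numeral_2_eq_2)
 also have "(%k. (- A)^(k + 2) /\<^sub>R fact (k + 2)) = (%k. A*A*t k)"
 proof
  fix k
  have "(- A)^(k + 2) = (- A)^2*(- A)^k" by (subst add.commute) (rule power_add)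
  also have "(- A)^2 = A*A" by (simp add: power2_eq_square)
  finally show "(- A)^(k + 2) /\<^sub>R fact (k + 2) = A*A*t k" by (simp add: t_def)
 qed
 also have "(\<Sum>k. A*A*t k) = A*A*E" unfolding E_def by (rule suminf_mult[OF st])
 finally have e: "exp (- A) = A*A*E + (1 - A)" .
 have AE: "A*E = E*A"
 proof -
  have "A*t k = t k*A" for k unfolding t_def using power_commutes[of "- A" k] by simp
  thus ?thesis unfolding E_def by (simp add: suminf_mult[OF st, symmetric] suminf_mult2[OF st])
 qed
 have "regT A = A*A*(- 1 + (1 + A)*E)"
 proof -
  have "A*(A*A*E) = A*A*(A*E)" by (simp add: mult.assoc)
  thus ?thesis unfolding regT_def e by (simp add: algebra_simps)
 qed
 moreover have "norm (- 1 + (1 + A)*E) <= 1 + (1 + norm A)*exp (norm A)"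
 proof -
  have "norm (- 1 + (1 + A)*E) <= norm (- 1 :: 'a opalg) + norm ((1 + A)*E)" by (rule norm_triangle_ineq)
  also have "norm ((1 + A)*E) <= norm (1 + A)*norm E" by (rule norm_mult_ineq)
  also have "... <= (1 + norm A)*exp (norm A)" using nE norm_triangle_ineq[of 1 A] by (intro mult_mono) auto
  finally show ?thesis by simp
 qed
 ultimately show ?thesis by blast
qed

text \<open>Norm convergence gives convergence of every minor. The row bounds for A n * A n pass to
  \<open>regT\<close> through \<open>regT_factor\<close>, and Hadamard's inequality turns them into
  a summable majorant over all finite sets.\<close>

lemma det2_tendsto:
 assumes A: "!!n. clin (A n)" "A \<longlonglongrightarrow> L" "clin L"
  and b: "!!n x f. cmod (coord (rep (A n*A n) f) x) <= b x*norm f" and b0: "!!x. 0 <= b x" and be: "!!X. finite X ==> sum b X <= be"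
 shows "(%n. det2 (rep (A n))) \<longlonglongrightarrow> det2 (rep L)"
proof -
 have "Bseq A" using A(2) by (simp add: convergent_imp_Bseq convergentI)
 then obtain m where m: "!!n. norm (A n) <= m" by (auto simp: Bseq_def)
 have m0: "0 <= m" using m norm_ge_zero order_trans by blast
 define K where "K = 1 + (1 + m)*exp m"
 have K0: "0 <= K" using m0 by (simp add: K_def)
 have lim: "(%n. regT (A n)) \<longlonglongrightarrow> regT L" unfolding regT_def by (intro tendsto_intros A tendsto_exp_algebra tendsto_minus)
 have cl: "clin (regT B)" if "clin B" for B :: "'a opalg" unfolding regT_def by (intro clin_closed clin_exp that)
 have bn: "cmod (coord (rep (regT (A n)) f) x) <= (K*b x)*norm f" for n x f
 proof -
  obtain G where G: "regT (A n) = A n*A n*G" "norm G <= 1 + (1 + norm (A n))*exp (norm (A n))" using regT_factor by blast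
  have GK: "norm G <= K" unfolding K_def using m m0 by (intro order_trans[OF G(2)] add_left_mono mult_mono) auto
  have "cmod (coord (rep (regT (A n)) f) x) = cmod (coord (rep (A n*A n) (rep G f)) x)" by (simp add: G(1) rep_apply_simps)
  also have "... <= b x*norm (rep G f)" by (rule b)
  also have "... <= b x*(K*norm f)"
  proof (rule mult_left_mono[OF _ b0])
   have "norm (rep G f) <= norm G*norm f" unfolding norm_opalg_def by (rule norm_blinfun)
   also have "... <= K*norm f" by (rule mult_right_mono[OF GK]) simp
   finally show "norm (rep G f) <= K*norm f" .
  qed
  finally show ?thesis by (simp add: mult_ac)
 qed
 have entlim: "(%n. ent (regT (A n)) x y) \<longlonglongrightarrow> ent (regT L) x y" for x y
  by (rule bounded_linear.tendsto[OF ent_bounded_linear lim])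
 show ?thesis unfolding det2_rep
 proof (rule infsum_dominated_limit)
  show "(%S. \<Prod>x\<in>S. K*b x) summable_on {S. finite S}"
  proof (rule summable_prod_finite_sets)
   show "sum (%x. K*b x) X <= K*be" if "finite X" for X using mult_left_mono[OF be[OF that] K0] by (simp add: sum_distrib_left)
  qed (use K0 b0 in simp)
  show "cmod (detS S (ent (regT (A n)))) <= (\<Prod>x\<in>S. K*b x)" if "S \<in> {S. finite S}" for n S
   using that K0 b0 by (intro minor_bound cl A bn) auto
  show "(%n. detS S (ent (regT (A n)))) \<longlonglongrightarrow> detS S (ent (regT L))" for S unfolding detS_def by (intro tendsto_intros entlim)
 qed
qed

section \<open>The free resolvent up to the cut\<close>

lemma norm_opalg_leI: "0 <= b ==> (!!f. norm (rep A f) <= b*norm f) ==> norm A <= b" unfolding norm_opalg_def by (rule norm_blinfun_bound)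

lemma norm_mult_op_le:
 assumes b: "!!x. cmod (v x) <= b" shows "norm (opa (mult_op v)) <= b"
proof (rule norm_opalg_leI)
 show "0 <= b" using b norm_ge_zero order_trans by blast
 have bd: "bounded (range v)" using b by (auto simp: bounded_iff)
 show "norm (rep (opa (mult_op v)) f) <= b*norm f" for f
 proof (rule norm_ell2_le)
  fix F :: "'a set" assume "finite F"
  from ell2_scale_bound[OF coord_summable[of f] b this]
  show "L2_set (%x. cmod (coord (rep (opa (mult_op v)) f) x)) F <= b*norm f" by (simp add: mult_op_apply[OF bd] norm_ell2_def)
 qed
qed

lemma clin_mult_op: "bounded (range v) ==> clin (opa (mult_op v))" by (rule clinI, rule ell2_eqI) (simp add: mult_op_apply coord_cs)

text \<open>The scalars of the algebra \<open>opalg\<close> are real; complex numbers enter as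
  elements, which commute with the complex-linear operators (\<open>sc_commute\<close>).\<close>

definition sc :: "complex => 'a opalg" where "sc c = opa (mult_op (%_. c))"

lemma rep_sc: "rep (sc c) f = cs c f" by (simp add: sc_def cs_def)

lemma opalg_coord_eqI: "(!!f x. coord (rep A f) x = coord (rep B f) x) ==> A = B" by (intro rep_eqI ell2_eqI)

lemma sc_simps: "sc 0 = 0" "sc 1 = 1" "sc (a + b) = sc a + sc b" "sc (a - b) = sc a - sc b"
 "sc (- a) = - sc a" "sc (a*b) = sc a * sc b" "sc (a * of_real r) = r *\<^sub>R sc a" by (rule opalg_coord_eqI;
   simp add: rep_sc rep_apply_simps coord_cs coord_plus coord_minus coord_zero coord_uminus coord_scaleR algebra_simps)+

lemma norm_sc_le: "norm (sc c) <= cmod c" unfolding sc_def by (rule norm_mult_op_le) simp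

lemma clin_sc: "clin (sc c)" unfolding sc_def by (rule clin_mult_op) auto

lemma sc_commute: "clin A ==> A * sc c = sc c*A" by (rule rep_eqI) (simp add: rep_apply_simps rep_sc rep_cs)

lemma ent_sc_mult: "ent (sc c*A) x y = c*ent A x y" by (simp add: ent_def rep_apply_simps rep_sc coord_cs)

definition Sh :: "int ^ 'n::finite => (int ^ 'n) opalg" where "Sh v = opa (Blinfun (%f. Abs_ell2 (%n. coord f (n - v))))"

lemma coord_Sh: "coord (rep (Sh v) f) n = coord f (n - v)" and norm_Sh_le: "norm (Sh v) <= 1"
proof -
 define S where "S = (%f. Abs_ell2 (%n. coord f (n - v)))"
 have r: "bij_betw (%n. n - v) UNIV UNIV" by (rule bij_betwI[where g = "%n. n + v"]) auto
 have c: "coord (S f) n = coord f (n - v)" for n f unfolding S_def by (subst Abs_ell2_inverse)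
   (auto simp: summable_on_reindex_bij_betw[OF r, of "%n. (cmod (coord f n))^2"] coord_summable)
 have nS: "norm (S f) = norm f" for f unfolding norm_ell2_def c by (simp add: infsum_reindex_bij_betw[OF r, of "%n. (cmod (coord f n))^2"])
 have bl: "bounded_linear S"
 proof (rule bounded_linear_intro[where K = 1])
  show "S (f + g) = S f + S g" for f g by (rule ell2_eqI) (simp only: c coord_plus)
  show "S (s *\<^sub>R f) = s *\<^sub>R S f" for s f by (rule ell2_eqI) (simp only: c coord_scaleR)
 qed (simp add: nS)
 have app: "rep (Sh v) f = S f" for f unfolding Sh_def opa_inverse' S_def[symmetric] by (simp add: bounded_linear_Blinfun_apply[OF bl])
 show "coord (rep (Sh v) f) n = coord f (n - v)" by (simp add: app c)
 show "norm (Sh v) <= 1" by (rule norm_opalg_leI) (simp_all add: app nS)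
qed

lemma Sh_add: "Sh u*Sh v = Sh (u + v)" by (rule opalg_coord_eqI) (simp add: rep_apply_simps coord_Sh algebra_simps)

lemma Sh_zero: "Sh 0 = 1" by (rule opalg_coord_eqI) (simp add: rep_apply_simps coord_Sh)

lemma clin_Sh: "clin (Sh v)" by (rule clinI, rule ell2_eqI) (simp add: coord_Sh coord_cs)

lemma ent_Sh: "ent (Sh v) x y = (if x = y + v then 1 else 0)" by (auto simp: ent_def coord_Sh coord_delta algebra_simps)

lemma ent_shift_invariant:
 assumes "!!v. A*Sh v = Sh v * A" shows "ent A x y = ent A (x - y) 0"
proof -
 have "rep (Sh y) (delta 0) = delta y" by (rule ell2_eqI) (simp add: coord_Sh coord_delta)
 hence "ent A x y = coord (rep (A*Sh y) (delta 0)) x" by (simp add: ent_def rep_apply_simps)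
 also have "... = ent A (x - y) 0" by (simp add: assms rep_apply_simps coord_Sh ent_def)
 finally show ?thesis .
qed

lemma lat_norm_square: "(lat_norm v)^2 = of_int (\<Sum>i\<in>UNIV. (v $ i)^2)"
 unfolding lat_norm_def norm_eq_sqrt_inner inner_vec_def by (simp add: power2_eq_square sum_nonneg)

text \<open>A sum of squares of integers equals 1 only if one of them is 1 and the others
  vanish.\<close>

lemma unit_sphere_eq: "{v :: int ^ 'n::finite. lat_norm v = 1} = range (%i. axis i 1) \<union> range (%i. axis i (-1))"
proof (intro set_eqI iffI)
 fix v :: "int ^ 'n" assume "v \<in> {v. lat_norm v = 1}"
 hence "(lat_norm v)^2 = 1" by simp
 hence s: "(\<Sum>i\<in>UNIV. (v $ i)^2) = 1" unfolding lat_norm_square by (simp only: of_int_eq_1_iff)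
 hence "\<exists>i. v $ i ~= 0" by (rule contrapos_pp) simp
 then obtain i where i: "v $ i ~= 0" by blast
 have "(\<Sum>j\<in>UNIV. (v $ j)^2) = (v $ i)^2 + (\<Sum>j\<in>UNIV - {i}. (v $ j)^2)" by (simp add: sum.remove)
 moreover have "0 < (v $ i)^2" using i by simp
 moreover have nn: "0 <= (\<Sum>j\<in>UNIV - {i}. (v $ j)^2)" by (simp add: sum_nonneg)
 ultimately have "(v $ i)^2 = 1" and z: "(\<Sum>j\<in>UNIV - {i}. (v $ j)^2) = 0" using s by linarith+
 hence vi: "v $ i = 1 \<or> v $ i = -1" by (simp add: power2_eq_1_iff)
 have "v $ j = 0" if "j ~= i" for j using z that by (subst (asm) sum_nonneg_eq_0_iff) auto
 hence "v = axis i (v $ i)" by (auto simp: vec_eq_iff axis_def)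
 thus "v \<in> range (%i. axis i 1) \<union> range (%i. axis i (-1))" using vi by (metis UnCI rangeI)
next
 fix v :: "int ^ 'n" assume "v \<in> range (%i. axis i 1) \<union> range (%i. axis i (-1))"
 then obtain i c where v: "v = axis i c" "c^2 = (1::int)" by auto
 have "(\<Sum>j\<in>UNIV. (v $ j)^2) = (\<Sum>j\<in>UNIV. if j = i then 1 else 0)" by (intro sum.cong) (auto simp: v axis_def)
 hence "(lat_norm v)^2 = 1" unfolding lat_norm_square by simp
 moreover have "0 <= lat_norm v" by (simp add: lat_norm_def)
 ultimately have "lat_norm v = 1" by (metis power2_eq_1_iff one_neq_neg_one neg_0_le_iff_le not_one_le_zero)
 thus "v \<in> {v. lat_norm v = 1}" by simp
qed

lemma sum_unit_sphere: "(\<Sum>v\<in>{v :: int ^ 'n::finite. lat_norm v = 1}. f v) = (\<Sum>i\<in>UNIV. f (axis i 1) + f (axis i (-1)))"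
proof -
 have inj: "inj (%i :: 'n. axis i c)" if "c ~= (0::int)" for c using that by (auto intro!: injI simp: axis_eq_axis)
 have disj: "range (%i :: 'n. axis i (1::int)) \<inter> range (%i. axis i (-1)) = {}" by (auto simp: axis_eq_axis)
 show ?thesis unfolding unit_sphere_eq by (subst sum.union_disjoint[OF _ _ disj]) (simp_all add: sum.reindex inj sum.distrib)
qed

lemma H0_eq_shifts: "opa H0 = (1/2) *\<^sub>R (\<Sum>v\<in>{v :: int ^ 'n::finite. lat_norm v = 1}. Sh v)"
proof (rule opalg_coord_eqI)
 fix f :: "(int ^ 'n) ell2" and n :: "int ^ 'n"
 let ?U = "{v :: int ^ 'n. lat_norm v = 1}"
 interpret b: bounded_linear "%A. coord (rep A f) n" by (rule rep_coord_bounded_linear)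
 have "coord (rep (opa H0) f) n = 1/2*(\<Sum>m | lat_norm (n - m) = 1. coord f m)" by (simp add: H0_apply lattice_laplacian_def)
 also have "(\<Sum>m | lat_norm (n - m) = 1. coord f m) = (\<Sum>v\<in>?U. coord f (n - v))"
  by (rule sum.reindex_bij_witness[where j = "%m. n - m" and i = "%v. n - v"]) auto
 finally show "coord (rep (opa H0) f) n = coord (rep ((1/2) *\<^sub>R (\<Sum>v\<in>?U. Sh v)) f) n"
  by (simp add: b.scaleR b.sum coord_Sh scaleR_conv_of_real[where 'a = complex])
qed

abbreviation Hop :: "(int ^ 'n::finite) opalg" where "Hop \<equiv> opa H0"

lemma clin_sum: "(!!v. v \<in> A ==> clin (f v)) ==> clin (sum f A)" by (induction A rule: infinite_finite_induct) (auto intro: clin_closed)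

lemma clin_Hop: "clin Hop" unfolding H0_eq_shifts by (intro clin_closed clin_sum clin_Sh)

lemma Sh_commute: "Sh u*Sh v = Sh v * Sh u" by (simp add: Sh_add add.commute)

lemma Hop_Sh: "Hop*Sh v = Sh v * Hop" unfolding H0_eq_shifts by (simp add: sum_distrib_left sum_distrib_right Sh_commute)

lemma norm_Hop_le: "norm (Hop :: (int ^ 'n::finite) opalg) <= CARD('n)"
proof -
 have "norm (\<Sum>v\<in>{v :: int ^ 'n. lat_norm v = 1}. Sh v) <= (\<Sum>i\<in>(UNIV :: 'n set). 2)" unfolding sum_unit_sphere
 proof (rule order_trans[OF norm_sum sum_mono])
  fix i :: 'n
  show "norm (Sh (axis i 1) + Sh (axis i (-1))) <= (2::real)"
   using norm_triangle_ineq[of "Sh (axis i 1)" "Sh (axis i (-1))"] norm_Sh_le[of "axis i 1"] norm_Sh_le[of "axis i (-1)"] by linarith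
 qed
 thus ?thesis unfolding H0_eq_shifts by simp
qed

definition conv_op :: "(int ^ 'n::finite => complex) => (int ^ 'n) opalg" where "conv_op g = (\<Sum>\<^sub>\<infinity>v. sc (g v)*Sh v)"

lemma conv_op_has_sum:
 fixes g :: "int ^ 'n::finite => complex"
 assumes "(%v. cmod (g v)) summable_on UNIV" shows "((%v. sc (g v)*Sh v) has_sum conv_op g) UNIV"
proof -
 have "norm (sc (g v)*Sh v) <= cmod (g v)" for v
 proof -
  have "norm (sc (g v)*Sh v) <= norm (sc (g v) :: (int ^ 'n) opalg)*norm (Sh v)" by (rule norm_mult_ineq)
  also have "... <= cmod (g v)*1" by (intro mult_mono norm_sc_le norm_Sh_le) auto
  finally show ?thesis by simp
 qed
 hence "(%v. norm (sc (g v)*Sh v)) summable_on UNIV" by (intro summable_on_comparison_test[OF assms]) auto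
 hence "(%v. sc (g v)*Sh v) summable_on UNIV" by (rule abs_summable_summable)
 thus ?thesis unfolding conv_op_def by (rule has_sum_infsum)
qed

lemma has_sum_finite_sum:
 fixes f :: "'i => 'a => 'b::{topological_comm_monoid_add}"
 assumes "finite I" "!!i. i \<in> I ==> (f i has_sum s i) A" shows "((%x. \<Sum>i\<in>I. f i x) has_sum (\<Sum>i\<in>I. s i)) A"
 using assms by (induction I rule: finite_induct) (auto intro: has_sum_add has_sum_0)

lemma conv_op_commute:
 assumes g: "(%v. cmod (g v)) summable_on UNIV" and X: "clin X" "!!v. X*Sh v = Sh v * X" shows "X * conv_op g = conv_op g*X"
proof -
 have "((%v. X*(sc (g v)*Sh v)) has_sum X * conv_op g) UNIV" by (rule has_sum_bounded_linear[OF bounded_linear_mult_right conv_op_has_sum[OF g]])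
 moreover have "((%v. (sc (g v)*Sh v)*X) has_sum conv_op g*X) UNIV"
  by (rule has_sum_bounded_linear[OF bounded_linear_mult_left conv_op_has_sum[OF g]])
 moreover have "X*(sc (g v)*Sh v) = (sc (g v)*Sh v)*X" for v by (metis X sc_commute mult.assoc)
 ultimately show ?thesis by (simp add: has_sum_unique)
qed

lemma conv_op_mult_Sh:
 assumes g: "(%v. cmod (g v)) summable_on UNIV" shows "((%v. sc (g (v - u))*Sh v) has_sum conv_op g*Sh u) UNIV"
proof -
 have "((%v. (sc (g v)*Sh v)*Sh u) has_sum conv_op g*Sh u) UNIV" by (rule has_sum_bounded_linear[OF bounded_linear_mult_left conv_op_has_sum[OF g]])
 hence *: "((%v. sc (g v)*Sh (v + u)) has_sum conv_op g*Sh u) UNIV" by (simp add: mult.assoc Sh_add)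
 have "bij_betw (%v. v - u) UNIV UNIV" by (rule bij_betwI[where g = "%v. v + u"]) auto
 from has_sum_reindex_bij_betw[OF this, of "%v. sc (g v)*Sh (v + u)"] *
 show ?thesis by simp
qed

lemma sc_sum: "sc (sum f A) = (\<Sum>x\<in>A. sc (f x))" by (induction A rule: infinite_finite_induct) (auto simp: sc_simps)

text \<open>Multiplying the absolutely convergent series of shifts by Hop - mu and collecting the
  coefficient of each shift leaves the kernel equation; commutation makes the inverse
  two-sided.\<close>

lemma conv_op_inverse:
 fixes g :: "int ^ 'n::finite => complex"
 assumes g: "(%v. cmod (g v)) summable_on UNIV" and eq: "!!n. 1/2*(\<Sum>v | lat_norm v = 1. g (n - v)) - mu*g n = (if n = 0 then 1 else 0)"
 shows "conv_op g*(Hop - sc mu) = 1" "(Hop - sc mu) * conv_op g = 1"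
proof -
 let ?U = "{v :: int ^ 'n. lat_norm v = 1}"
 have 1: "((%v. (1/2) *\<^sub>R (\<Sum>u\<in>?U. sc (g (v - u))*Sh v) :: (int ^ 'n) opalg) has_sum ((1/2) *\<^sub>R (\<Sum>u\<in>?U. conv_op g*Sh u))) UNIV"
  by (intro has_sum_scaleR has_sum_finite_sum finite_lat_sphere conv_op_mult_Sh g)
 have 2: "((%v. sc (- mu)*(sc (g v)*Sh v)) has_sum sc (-mu) * conv_op g) UNIV"
  by (rule has_sum_bounded_linear[OF bounded_linear_mult_right conv_op_has_sum[OF g]])
 have c: "sc mu * conv_op g = conv_op g * sc mu" by (rule conv_op_commute[OF g clin_sc]) (simp add: sc_commute clin_Sh)
 have h: "Hop * conv_op g = conv_op g*(Hop :: (int ^ 'n) opalg)" by (rule conv_op_commute[OF g clin_Hop Hop_Sh])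
 have s: "(1/2) *\<^sub>R (\<Sum>u\<in>?U. sc (g (v - u))*Sh v) + sc (- mu)*(sc (g v)*Sh v) = (if v = 0 then 1 else 0 :: (int ^ 'n) opalg)" for v
 proof -
  have ssum: "(\<Sum>u\<in>?U. sc (g (v - u))) = sc (\<Sum>u\<in>?U. g (v - u))" by (rule sc_sum[symmetric])
  have "(1/2) *\<^sub>R (\<Sum>u\<in>?U. sc (g (v - u))*Sh v) = sc ((\<Sum>u\<in>?U. g (v - u)) * of_real (1/2))*Sh v"
   by (simp add: sum_distrib_right[symmetric] ssum sc_simps(7)[of _ "1/2", simplified])
  hence "(1/2) *\<^sub>R (\<Sum>u\<in>?U. sc (g (v - u))*Sh v) + sc (- mu)*(sc (g v)*Sh v) = sc (1/2*(\<Sum>u\<in>?U. g (v - u)) - mu*g v)*Sh v"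
   by (simp add: sc_simps algebra_simps)
  thus ?thesis unfolding eq by (simp add: sc_simps Sh_zero)
 qed
 have "((%v :: int ^ 'n. if v = 0 then 1 else 0) has_sum ((1/2) *\<^sub>R (\<Sum>u\<in>?U. conv_op g*Sh u) + sc (-mu) * conv_op g)) UNIV"
  using has_sum_add[OF 1 2] unfolding s .
 also have "(1/2) *\<^sub>R (\<Sum>u\<in>?U. conv_op g*Sh u) + sc (-mu) * conv_op g = conv_op g*(Hop - sc mu)"
  by (simp add: H0_eq_shifts sum_distrib_left sc_simps c right_diff_distrib)
 finally have a: "((%v :: int ^ 'n. if v = 0 then 1 else 0) has_sum conv_op g*(Hop - sc mu)) UNIV" .
 have b: "((%v :: int ^ 'n. if v = 0 then 1 else 0) has_sum (1 :: (int ^ 'n) opalg)) UNIV"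
 proof -
  have "((%v :: int ^ 'n. if v = 0 then 1 else 0) has_sum (1 :: (int ^ 'n) opalg)) {0}" by (rule has_sum_finiteI) auto
  thus ?thesis by (subst has_sum_cong_neutral[where S = "{0}" and f = "%v. if v = 0 then 1 else 0", symmetric]) auto
 qed
 show "conv_op g*(Hop - sc mu) = 1" by (rule has_sum_unique[OF a b])
 thus "(Hop - sc mu) * conv_op g = 1" by (simp add: left_diff_distrib right_diff_distrib c h)
qed

lemma ent_conv_op:
 assumes g: "(%v. cmod (g v)) summable_on UNIV" shows "ent (conv_op g) n 0 = g n"
proof -
 have "((%v. ent (sc (g v)*Sh v) n 0) has_sum ent (conv_op g) n 0) UNIV" by (rule has_sum_bounded_linear[OF ent_bounded_linear conv_op_has_sum[OF g]])
 moreover have "ent (sc (g v)*Sh v) n 0 = (if v = n then g n else 0)" for v by (auto simp: ent_sc_mult ent_Sh)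
 ultimately have "((%v. if v = n then g n else 0) has_sum ent (conv_op g) n 0) UNIV" by simp
 moreover have "((%v. if v = n then g n else 0) has_sum g n) UNIV"
 proof -
  have "((%v. if v = n then g n else 0) has_sum g n) {n}" by (rule has_sum_finiteI) auto
  thus ?thesis by (subst has_sum_cong_neutral[where S = "{n}" and f = "%v. if v = n then g n else 0", symmetric]) auto
 qed
 ultimately show ?thesis by (rule has_sum_unique)
qed

section \<open>Existence, uniqueness and size of the free resolvent\<close>

abbreviation Rs :: "complex => (int ^ 'n::finite) opalg" where "Rs mu \<equiv> opa (R0 mu)"

lemma Rs_eqI:
 fixes R :: "(int ^ 'n::finite) opalg"
 assumes "(Hop - sc mu)*R = 1" "R*(Hop - sc mu) = 1" shows "Rs mu = R"
proof -
 have r: "rep (Hop - sc mu) = (H0 - mult_op (%_. mu) :: (int ^ 'n) ell2_op)" by (simp add: rep_simps sc_def)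
 have "R0 mu = rep R" unfolding R0_def op_inverse_def
 proof (rule the_equality)
  show "(H0 - mult_op (%_. mu)) o\<^sub>L rep R = id_blinfun \<and> rep R o\<^sub>L (H0 - mult_op (%_. mu)) = id_blinfun"
   using assms by (metis r rep_simps(2) rep_simps(6))
  fix B :: "(int ^ 'n) ell2_op" assume B: "(H0 - mult_op (%_. mu)) o\<^sub>L B = id_blinfun \<and> B o\<^sub>L (H0 - mult_op (%_. mu)) = id_blinfun"
  have "rep (opa B*(Hop - sc mu)) = rep 1" using B by (simp add: rep_simps sc_def)
  hence 1: "opa B*(Hop - sc mu) = 1" by (simp only: rep_inject)
  have "opa B = opa B*((Hop - sc mu)*R)" by (simp add: assms)
  also have "... = R" by (simp only: mult.assoc[symmetric] 1 mult_1_left)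
  finally show "B = rep R" by (metis opa_inverse')
 qed
 thus ?thesis by (simp add: rep_inverse)
qed

definition resolv :: "complex => (int ^ 'n::finite) opalg => bool" where
 "resolv mu R \<longleftrightarrow> (Hop - sc mu)*R = 1 \<and> R*(Hop - sc mu) = 1"

lemma sum_unit_sphere_shift:
 "(\<Sum>v | lat_norm (v :: int ^ 'n::finite) = 1. g (n - v)) = (\<Sum>i\<in>UNIV. g (n + axis i (-1)) + g (n + axis i 1))"
proof -
 have "n - axis i 1 = n + axis i (-1)" "n - axis i (-1) = n + axis i 1" for i :: 'n by (auto simp: vec_eq_iff axis_def)
 thus ?thesis unfolding sum_unit_sphere by (simp only:)
qed

lemma grn_summable:
 assumes "3 <= CARD('n::finite)" "0 < Im mu" shows "(%v. cmod (grn mu (v :: int ^ 'n))) summable_on UNIV"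
proof -
 obtain B where B: "!!G. finite G ==> (\<Sum>n\<in>G. cmod (grn mu (n :: int ^ 'n))) <= B" using grn_l1[OF assms] by blast
 show ?thesis by (rule nonneg_bdd_above_summable_on) (auto intro!: bdd_aboveI[of _ B] B)
qed

lemma resolv_upper:
 assumes d: "3 <= CARD('n::finite)" and "0 < Im mu" shows "resolv mu (conv_op (grn mu) :: (int ^ 'n) opalg)" unfolding resolv_def
 using conv_op_inverse[OF grn_summable[OF assms], of mu] grn_resolvent[OF assms] by (simp add: sum_unit_sphere_shift)

text \<open>The Laplacian has a real kernel, so conjugating the resolvent equation at
  \<open>cnj mu\<close> solves it at mu.\<close>

lemma resolv_lower:
 assumes d: "3 <= CARD('n::finite)" and "Im mu < 0" shows "resolv mu (conv_op (%n. cnj (grn (cnj mu) n)) :: (int ^ 'n) opalg)"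
proof -
 have i: "0 < Im (cnj mu)" using assms by simp
 have s: "(%v. cmod (cnj (grn (cnj mu) (v :: int ^ 'n)))) summable_on UNIV" using grn_summable[OF d i] by simp
 have "1/2*(\<Sum>v | lat_norm v = 1. cnj (grn (cnj mu) (n - v))) - mu * cnj (grn (cnj mu) n) = (if n = 0 then 1 else 0)"
  for n :: "int ^ 'n" using arg_cong[OF grn_resolvent[OF d i, of n], of cnj]
  unfolding sum_unit_sphere_shift[where g = "%m. cnj (grn (cnj mu) m)" and n = n] by (simp add: cnj_sum split: if_splits)
 from conv_op_inverse[OF s this] show ?thesis unfolding resolv_def by simp
qed

lemma Neumann_inverse:
 fixes Y :: "'a::{real_normed_algebra_1, banach}"
 assumes "norm Y < 1" shows "\<exists>P. P*(1 - Y) = 1 \<and> (1 - Y)*P = 1"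
proof -
 have s: "summable (%n. Y^n)" by (rule complete_algebra_summable_geometric[OF assms])
 define P where "P = (\<Sum>n. Y^n)"
 have e: "P = 1 + (\<Sum>n. Y^Suc n)" unfolding P_def using suminf_split_head[OF s] by simp
 have l: "(\<Sum>n. Y^Suc n) = Y*P" unfolding P_def power_Suc by (rule suminf_mult[OF s])
 have r: "(\<Sum>n. Y^Suc n) = P*Y" unfolding P_def power_Suc2 by (rule suminf_mult2[OF s, symmetric])
 have "P = 1 + Y*P" "P = 1 + P*Y" using e l r by simp_all
 thus ?thesis by (intro exI[of _ P]) (simp add: algebra_simps)
qed

text \<open>Neumann series for |mu| > d. It covers the real points outside the spectrum, where the
  Laplace transform is not summable a priori.\<close>

lemma resolv_outer:
 assumes mu: "real CARD('n::finite) < cmod mu" shows "\<exists>R :: (int ^ 'n) opalg. resolv mu R"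
proof -
 have mu0: "mu ~= 0" using mu by auto
 define Y where "Y = (sc (1/mu)*Hop :: (int ^ 'n) opalg)"
 have "norm Y <= norm (sc (1/mu) :: (int ^ 'n) opalg)*norm (Hop :: (int ^ 'n) opalg)" unfolding Y_def by (rule norm_mult_ineq)
 also have "... <= cmod (1/mu)*CARD('n)" by (intro mult_mono norm_sc_le norm_Hop_le) auto
 also have "... < 1" using mu mu0 by (simp add: norm_divide)
 finally obtain P where P: "P*(1 - Y) = 1" "(1 - Y)*P = 1" using Neumann_inverse[of Y] by blast
 have X: "Hop - sc mu = sc (- mu)*(1 - Y)"
 proof -
  have "sc (- mu) * sc (1/mu) = (-1 :: (int ^ 'n) opalg)" unfolding sc_simps(6)[symmetric] using mu0 by (simp add: sc_simps)
  hence "sc (- mu)*Y = - Hop" unfolding Y_def mult.assoc[symmetric] by simp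
  thus ?thesis by (simp add: right_diff_distrib sc_simps)
 qed
 have inv: "sc (- mu) * sc (- (1/mu)) = (1 :: (int ^ 'n) opalg)" "sc (- (1/mu)) * sc (- mu) = (1 :: (int ^ 'n) opalg)"
  unfolding sc_simps(6)[symmetric] using mu0 by (simp_all add: sc_simps)
 have c: "sc (- mu)*(1 - Y) = (1 - Y) * sc (- mu)" by (rule sc_commute[symmetric]) (auto simp: Y_def intro!: clin_closed clin_sc clin_Hop)
 have "(Hop - sc mu)*(P * sc (- (1/mu))) = sc (-mu)*((1 - Y)*P) * sc (- (1/mu))" unfolding X by (simp add: mult.assoc)
 moreover have "(P * sc (- (1/mu)))*(Hop - sc mu) = P*(sc (- (1/mu)) * sc (- mu))*(1 - Y)" unfolding X by (simp add: mult.assoc)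
 ultimately show ?thesis unfolding resolv_def using P inv by (intro exI[of _ "P * sc (- (1/mu))"]) simp
qed

text \<open>Laplace transforms off the real axis and the Neumann series on it exhaust
  \<open>Lam\<close>, so the spectrum of the Laplacian need not be computed by Fourier
  analysis.\<close>

lemma resolv_exists:
 assumes d: "3 <= CARD('n::finite)" and mu: "mu \<in> Lam CARD('n)" shows "\<exists>R :: (int ^ 'n) opalg. resolv mu R"
proof -
 consider "0 < Im mu" | "Im mu < 0" | "Im mu = 0" by linarith
 thus ?thesis
 proof cases
  case 3
  hence e: "mu = of_real (Re mu)" by (simp add: complex_eq_iff)
  hence "Re mu \<notin> {- real CARD('n)..real CARD('n)}" using mu unfolding Lam_def by (metis DiffD2 imageI)
  hence "real CARD('n) < \<bar>Re mu\<bar>" by auto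
  hence "real CARD('n) < cmod mu" using abs_Re_le_cmod[of mu] by linarith
  thus ?thesis by (rule resolv_outer)
 qed (use resolv_upper[OF d] resolv_lower[OF d] in blast)+
qed

lemma resolv_unique: "resolv mu R ==> Rs mu = R" by (auto simp: resolv_def intro: Rs_eqI)

lemma resolv_Rs:
 assumes "3 <= CARD('n::finite)" "mu \<in> Lam CARD('n)" shows "resolv mu (Rs mu :: (int ^ 'n) opalg)"
 using resolv_exists[OF assms] resolv_unique by metis

lemma resolv_commute:
 fixes R :: "(int ^ 'n::finite) opalg"
 assumes R: "resolv mu R" and X: "clin X" "X*Hop = Hop*X" shows "X*R = R*X"
proof -
 let ?A = "Hop - sc mu :: (int ^ 'n) opalg"
 have c: "X*?A = ?A*X" by (simp add: algebra_simps X sc_commute)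
 have "X*R = (R*?A)*(X*R)" using R by (simp add: resolv_def)
 also have "... = R*(X*?A)*R" by (simp add: c mult.assoc)
 also have "... = R*X*(?A*R)" by (simp add: mult.assoc)
 also have "... = R*X" using R by (simp add: resolv_def)
 finally show ?thesis .
qed

lemma resolv_Sh: "resolv mu R ==> R*Sh v = Sh v * R" using resolv_commute[OF _ clin_Sh, of mu R v] Hop_Sh by metis

lemma resolv_clin:
 fixes R :: "(int ^ 'n::finite) opalg"
 assumes R: "resolv mu R" shows "clin R"
proof -
 let ?A = "Hop - sc mu :: (int ^ 'n) opalg"
 have c: "jop*?A = ?A*jop" using clin_closed(4)[OF clin_Hop clin_sc, of mu] unfolding clin_def by (rule sym)
 have "R*jop = R*(jop*(?A*R))" using R by (simp add: resolv_def)
 also have "... = R*(?A*jop)*R" by (simp add: mult.assoc c[symmetric])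
 also have "... = jop*R" using R by (simp add: resolv_def mult.assoc[symmetric])
 finally show ?thesis unfolding clin_def .
qed

lemma resolvent_identity:
 assumes R: "resolv mu R" "resolv nv S" shows "R - S = sc (mu - nv)*(R*S)"
proof -
 have "R - S = R*((Hop - sc nv)*S) - (R*(Hop - sc mu))*S" using R by (simp add: resolv_def)
 also have "... = R * sc (mu - nv)*S" by (simp add: algebra_simps sc_simps)
 also have "... = sc (mu - nv)*(R*S)" by (simp add: sc_commute[OF resolv_clin[OF R(1)]] mult.assoc)
 finally show ?thesis .
qed

text \<open>Half of norm S is absorbed on the left; the local bound so obtained turns the resolvent
  identity into continuity.\<close>

lemma norm_resolv_near:
 assumes R: "resolv mu R" "resolv nv S" and s: "cmod (mu - nv)*norm R <= 1/2"
 shows "norm S <= 2*norm R" "norm (R - S) <= cmod (mu - nv)*(2*(norm R)^2)"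
proof -
 have "norm (R - S) <= cmod (mu - nv)*(norm R*norm S)" unfolding resolvent_identity[OF R]
  by (intro order_trans[OF norm_mult_ineq] mult_mono norm_sc_le norm_mult_ineq) auto
 moreover have "norm S <= norm R + norm (R - S)" using norm_triangle_ineq4[of R "R - S"] by simp
 moreover have "cmod (mu - nv)*(norm R*norm S) <= 1/2*norm S" using mult_right_mono[OF s, of "norm S"] by (simp add: mult.assoc)
 ultimately show *: "norm S <= 2*norm R" by linarith
 have "cmod (mu - nv)*(norm R*norm S) <= cmod (mu - nv)*(norm R*(2*norm R))" by (intro mult_left_mono *) auto
 with \<open>norm (R - S) <= cmod (mu - nv)*(norm R*norm S)\<close>
 show "norm (R - S) <= cmod (mu - nv)*(2*(norm R)^2)" by (simp add: power2_eq_square mult.left_commute)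
qed

lemma norm_resolv_outer:
 assumes R: "resolv mu (R :: (int ^ 'n::finite) opalg)" and mu: "real CARD('n) < cmod mu" shows "norm R <= 1/(cmod mu - CARD('n))"
proof -
 have "Hop*R - sc mu*R = 1" using R by (simp add: resolv_def left_diff_distrib)
 hence "sc mu*R = Hop*R - 1" by (simp add: diff_eq_eq eq_diff_eq add.commute)
 hence "sc (1/mu)*(sc mu*R) = sc (1/mu)*(Hop*R - 1)" by simp
 moreover have "sc (1/mu)*(sc mu*R) = R" unfolding mult.assoc[symmetric] sc_simps(6)[symmetric] using mu by (auto simp: sc_simps)
 ultimately have "norm R = norm (sc (1/mu)*(Hop*R - 1))" by simp
 also have "... <= cmod (1/mu)*(norm (Hop*R) + norm (1 :: (int ^ 'n) opalg))"
  by (intro order_trans[OF norm_mult_ineq] mult_mono norm_sc_le norm_triangle_ineq4) auto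
 also have "... <= cmod (1/mu)*(CARD('n)*norm R + 1)"
  by (intro mult_left_mono add_mono order_trans[OF norm_mult_ineq] mult_right_mono norm_Hop_le) auto
 finally have "norm R <= cmod (1/mu)*(CARD('n)*norm R + 1)" .
 moreover have "0 < cmod mu" using mu of_nat_0_le_iff[of "CARD('n)"] by linarith
 ultimately have "cmod mu*norm R <= CARD('n)*norm R + 1" by (simp add: norm_divide field_simps)
 thus ?thesis using mu by (simp add: field_simps)
qed

section \<open>The conformal map and the resolvent kernel on the disc\<close>

lemma open_Lam: "open (Lam d)"
proof -
 have "compact (complex_of_real ` {- real d..real d})" by (intro compact_continuous_image continuous_intros) auto
 hence "closed (complex_of_real ` {- real d..real d})" by (rule compact_imp_closed)
 thus ?thesis unfolding Lam_def by (intro open_Diff) auto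
qed

lemma cnj_joukowski: "joukowski d (cnj z) = cnj (joukowski d z)" by (simp add: joukowski_def)

lemma Im_joukowski: "z ~= 0 ==> Im (joukowski d z) = real d/2*(Im z*(1 - 1/(cmod z)^2))"
proof -
 assume "z ~= 0"
 have "Im (1/z) = - Im z/(cmod z)^2" by (simp add: Im_divide cmod_power2)
 moreover have "joukowski d z = of_real (real d/2)*(z + 1/z)" by (simp add: joukowski_def)
 ultimately show ?thesis by (simp only: Im_complex_of_real Re_complex_of_real times_complex.sel plus_complex.sel) (simp add: algebra_simps)
qed

lemma Re_joukowski_real: "Im z = 0 ==> Re (joukowski d z) = real d/2*(Re z + 1/Re z)"
 unfolding joukowski_def by (simp add: Re_divide power2_eq_square)

text \<open>The lower half of the disc corresponds to the upper half plane, where \<open>grn\<close>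
  represents the resolvent. Hence the lower half disc is treated directly and the upper one by
  conjugation.\<close>

lemma joukowski_Im_sign:
 assumes "z \<in> ball 0 1" "z ~= 0" "0 < d" shows "Im z < 0 ==> 0 < Im (joukowski d z)" "0 < Im z ==> Im (joukowski d z) < 0"
  "Im z <= 0 ==> 0 <= Im (joukowski d z)"
proof -
 have "(cmod z)^2 < 1" using assms by (simp add: power_less_one_iff)
 hence "1 - 1/(cmod z)^2 < 0" using assms by (simp add: field_simps)
 thus "Im z < 0 ==> 0 < Im (joukowski d z)" "0 < Im z ==> Im (joukowski d z) < 0" "Im z <= 0 ==> 0 <= Im (joukowski d z)"
  unfolding Im_joukowski[OF assms(2)] using assms(3) by (auto simp: zero_less_mult_iff mult_less_0_iff zero_le_mult_iff)
qed

lemma joukowski_in_Lam: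
 assumes z: "z \<in> ball 0 1" "z ~= 0" and d: "0 < d" shows "joukowski d z \<in> Lam d"
proof (cases "Im z = 0")
 case False
 hence "Im (joukowski d z) ~= 0" using joukowski_Im_sign[OF z d] by linarith
 thus ?thesis unfolding Lam_def by auto
next
 case True
 have x: "\<bar>Re z\<bar> < 1" "Re z ~= 0" using z True abs_Re_le_cmod[of z] by (auto simp: complex_eq_iff)
 have "2 < \<bar>Re z + 1/Re z\<bar>"
 proof -
  have "0 < (1 - \<bar>Re z\<bar>)^2" using x by simp
  hence "2*\<bar>Re z\<bar> < (Re z)^2 + 1" by (simp add: power2_eq_square algebra_simps abs_mult_self_eq)
  moreover have "Re z + 1/Re z = ((Re z)^2 + 1)/Re z" using x by (simp add: field_simps power2_eq_square)
  hence "\<bar>Re z + 1/Re z\<bar> = ((Re z)^2 + 1)/\<bar>Re z\<bar>" by (simp add: abs_divide)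
  ultimately show ?thesis using x by (simp add: field_simps)
 qed
 hence "real d < \<bar>Re (joukowski d z)\<bar>" unfolding Re_joukowski_real[OF True] abs_mult using d by (simp add: field_simps)
 thus ?thesis unfolding Lam_def by auto
qed

lemma Rs_tendsto:
 assumes d: "3 <= CARD('n::finite)" and mu: "mu \<in> Lam CARD('n)" shows "(Rs \<longlongrightarrow> (Rs mu :: (int ^ 'n) opalg)) (at mu)"
proof -
 let ?R = "Rs mu :: (int ^ 'n) opalg"
 have ev: "\<forall>\<^sub>F nv in at mu. nv \<in> Lam CARD('n)" using open_Lam mu by (rule eventually_at_in_open')
 have "((%nv. cmod (mu - nv)*norm ?R) \<longlongrightarrow> cmod (mu - mu)*norm ?R) (at mu)" by (intro tendsto_intros)
 hence "\<forall>\<^sub>F nv in at mu. cmod (mu - nv)*norm ?R < 1/2" by (rule order_tendstoD) simp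
 with ev have b: "\<forall>\<^sub>F nv in at mu. norm (Rs nv - ?R) <= cmod (mu - nv)*(2*(norm ?R)^2)"
 proof eventually_elim
  case (elim nv)
  hence "cmod (mu - nv)*norm ?R <= 1/2" by simp
  from norm_resolv_near(2)[OF resolv_Rs[OF d mu] resolv_Rs[OF d elim(1)] this]
  show ?case by (simp add: norm_minus_commute)
 qed
 have "((%nv. cmod (mu - nv)*(2*(norm ?R)^2)) \<longlongrightarrow> cmod (mu - mu)*(2*(norm ?R)^2)) (at mu)" by (intro tendsto_intros)
 hence "((%nv. Rs nv - ?R) \<longlongrightarrow> 0) (at mu)" by (intro Lim_null_comparison[OF b]) simp
 thus ?thesis by (rule LIM_zero_cancel)
qed

lemma ent_Rs_holomorphic:
 assumes d: "3 <= CARD('n::finite)" shows "(%mu. ent (Rs mu :: (int ^ 'n) opalg) x y) holomorphic_on Lam CARD('n)"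
proof -
 have "((%mu. ent (Rs mu :: (int ^ 'n) opalg) x y) has_field_derivative ent (Rs mu*Rs mu) x y) (at mu)"
  if mu: "mu \<in> Lam CARD('n)" for mu unfolding has_field_derivative_iff
 proof (rule Lim_transform_eventually)
  show "((%nv. ent (Rs nv*Rs mu :: (int ^ 'n) opalg) x y) \<longlongrightarrow> ent (Rs mu*Rs mu) x y) (at mu)"
   by (intro bounded_linear.tendsto[OF ent_bounded_linear] tendsto_mult Rs_tendsto d mu tendsto_const)
  have ev: "\<forall>\<^sub>F nv in at mu. nv \<in> Lam CARD('n)" using open_Lam mu by (rule eventually_at_in_open')
  have ne: "\<forall>\<^sub>F nv in at mu. nv ~= mu" by (simp add: eventually_at_filter)
  from ev ne show "\<forall>\<^sub>F nv in at mu. ent (Rs nv*Rs mu :: (int ^ 'n) opalg) x y = (ent (Rs nv) x y - ent (Rs mu) x y)/(nv - mu)"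
  proof eventually_elim
   case (elim nv)
   have "ent (Rs nv :: (int ^ 'n) opalg) x y - ent (Rs mu) x y = (nv - mu)*ent (Rs nv*Rs mu) x y"
    unfolding ent_simps[symmetric] resolvent_identity[OF resolv_Rs[OF d elim(1)] resolv_Rs[OF d mu]] ent_sc_mult ..
   thus ?case using elim by simp
  qed
 qed
 thus ?thesis using holomorphic_on_open[OF open_Lam] by blast
qed

text \<open>The column at the origin suffices because the resolvent commutes with shifts. The value
  at z = 0 is the limit of the resolvent at infinity.\<close>

definition rho :: "complex => int ^ 'n::finite => complex" where "rho z n = (if z = 0 then 0 else ent (Rs (joukowski CARD('n) z)) n 0)"

lemma norm_joukowski_small:
 assumes "z ~= 0" "cmod z <= 1/8" "0 < d" shows "real d/(4 * cmod z) <= cmod (joukowski d z) - d"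
proof -
 have z: "0 < cmod z" using assms by simp
 have "cmod (1/z) - cmod z <= cmod (z + 1/z)" by (metis add.commute norm_diff_ineq)
 hence "real d/2*(1 / cmod z - cmod z) <= real d/2 * cmod (z + 1/z)" using assms by (intro mult_left_mono) (auto simp: norm_divide)
 also have "... = cmod (joukowski d z)" by (simp add: joukowski_def norm_mult norm_divide)
 finally have a: "real d/2*(1 / cmod z - cmod z) <= cmod (joukowski d z)" .
 have "8 <= 1 / cmod z" using assms z by (simp add: field_simps)
 hence "1/(2 * cmod z) <= 1 / cmod z - cmod z - 2" using assms z by simp
 hence "real d/2*(1/(2 * cmod z)) <= real d/2*(1 / cmod z - cmod z - 2)" by (intro mult_left_mono) auto
 hence "real d/2*(1/(2 * cmod z)) <= real d/2*(1 / cmod z - cmod z) - real d/2*2" by (simp only: right_diff_distrib)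
 moreover have "real d/2*(1/(2 * cmod z)) = real d/(4 * cmod z)" by simp
 ultimately show ?thesis using a by linarith
qed

lemma norm_Rs_small:
 assumes d: "3 <= CARD('n::finite)" and z: "z ~= 0" "cmod z <= 1/8" shows "norm (Rs (joukowski CARD('n) z) :: (int ^ 'n) opalg) <= 4 * cmod z"
proof -
 let ?mu = "joukowski CARD('n) z"
 have pos: "0 < CARD('n)" using d by simp
 have zb: "z \<in> ball 0 1" using z by simp
 have s: "CARD('n)/(4 * cmod z) <= cmod ?mu - CARD('n)" by (rule norm_joukowski_small[OF z pos])
 have q: "0 < CARD('n)/(4 * cmod z)" using pos z by simp
 have "norm (Rs ?mu :: (int ^ 'n) opalg) <= 1/(cmod ?mu - CARD('n))"
  by (rule norm_resolv_outer[OF resolv_Rs[OF d joukowski_in_Lam[OF zb z(1) pos]]]) (use s q in linarith)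
 also have "... <= 1/(CARD('n)/(4 * cmod z))" by (intro divide_left_mono[OF s] mult_pos_pos) (use s q in linarith)+
 also have "... = 4 * cmod z/CARD('n)" by simp
 also have "... <= 4 * cmod z/1" using pos by (intro divide_left_mono) auto
 finally show ?thesis by simp
qed

lemma rho_small:
 assumes d: "3 <= CARD('n::finite)" and z: "cmod z <= 1/8" shows "cmod (rho z (n :: int ^ 'n)) <= 4 * cmod z"
 unfolding rho_def using norm_Rs_small[OF d _ z] order_trans[OF norm_ent_le] by auto

text \<open>The linear bound \<open>rho_small\<close> makes the origin, the point at infinity of the
  spectral plane, a removable singularity.\<close>

lemma rho_holomorphic:
 assumes d: "3 <= CARD('n::finite)" shows "(%z. rho z (n :: int ^ 'n)) holomorphic_on ball 0 1"
proof -
 have pos: "0 < CARD('n)" using d by simp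
 let ?f = "%z. rho z n"
 have j: "joukowski CARD('n) holomorphic_on (ball 0 1 - {0})" unfolding joukowski_def[abs_def] by (auto intro!: holomorphic_intros)
 have "(%mu. ent (Rs mu) n 0) \<circ> joukowski CARD('n) holomorphic_on (ball 0 1 - {0})"
  by (rule holomorphic_on_compose_gen[OF j ent_Rs_holomorphic[OF d]]) (auto intro!: joukowski_in_Lam pos)
 hence "(%z. ent (Rs (joukowski CARD('n) z)) n 0) holomorphic_on (ball 0 1 - {0})" by (simp add: o_def)
 hence h: "?f holomorphic_on (ball 0 1 - {0})" by (rule holomorphic_transform) (simp add: rho_def)
 have c0: "isCont ?f 0" unfolding isCont_def
 proof (rule Lim_null_comparison[where g = "%z. 4 * cmod z", THEN tendsto_eq_rhs])
  have "\<forall>\<^sub>F z in at 0. z \<in> ball (0::complex) (1/8)" by (rule eventually_at_in_open') auto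
  thus "\<forall>\<^sub>F z in at 0. norm (?f z) <= 4 * cmod z" by eventually_elim (auto intro!: rho_small d)
  show "((%z. 4 * cmod z) \<longlongrightarrow> 0) (at (0::complex))" by (auto intro!: tendsto_eq_intros)
 qed (simp add: rho_def)
 have "continuous_on (ball 0 1) ?f"
 proof (rule continuous_at_imp_continuous_on, intro ballI)
  fix z :: complex assume z: "z \<in> ball 0 1"
  show "isCont ?f z"
  proof (cases "z = 0")
   case False
   hence "z \<in> ball 0 1 - {0}" using z by simp
   with holomorphic_on_imp_continuous_on[OF h] show ?thesis by (subst (asm) continuous_on_eq_continuous_at) (auto intro: open_Diff)
  qed (use c0 in simp)
 qed
 thus ?thesis by (rule no_isolated_singularity[OF _ h]) auto
qed

lemma rho_tendsto:
 assumes d: "3 <= CARD('n::finite)" and z: "z \<in> ball 0 1" and s: "s \<longlonglongrightarrow> z"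
 shows "(%k. rho (s k) (n :: int ^ 'n)) \<longlonglongrightarrow> rho z n"
proof -
 have "isCont (%z. rho z n) z" using holomorphic_on_imp_continuous_on[OF rho_holomorphic[OF d, of n]] z by (simp add: continuous_on_eq_continuous_at)
 thus ?thesis using s by (rule isCont_tendsto_compose)
qed

lemma rho_lower_half:
 assumes d: "3 <= CARD('n::finite)" and z: "z \<in> ball 0 1" "Im z < 0" shows "rho z (n :: int ^ 'n) = grn (joukowski CARD('n) z) n"
proof -
 have pos: "0 < CARD('n)" and z0: "z ~= 0" using d z by auto
 note i = joukowski_Im_sign(1)[OF z(1) z0 pos z(2)]
 have "(Rs (joukowski CARD('n) z) :: (int ^ 'n) opalg) = conv_op (grn (joukowski CARD('n) z))" by (rule resolv_unique[OF resolv_upper[OF d i]])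
 thus ?thesis using z0 by (simp add: rho_def ent_conv_op[OF grn_summable[OF d i]])
qed

lemma rho_upper_half:
 assumes d: "3 <= CARD('n::finite)" and z: "z \<in> ball 0 1" "0 < Im z" shows "rho z (n :: int ^ 'n) = cnj (rho (cnj z) n)"
proof -
 let ?mu = "joukowski CARD('n) z"
 have pos: "0 < CARD('n)" and z0: "z ~= 0" using d z by auto
 note i = joukowski_Im_sign(2)[OF z(1) z0 pos z(2)]
 have s: "(%v. cmod (cnj (grn (cnj ?mu) (v :: int ^ 'n)))) summable_on UNIV" using grn_summable[OF d, of "cnj ?mu"] i by simp
 have "(Rs ?mu :: (int ^ 'n) opalg) = conv_op (%n. cnj (grn (cnj ?mu) n))" by (rule resolv_unique[OF resolv_lower[OF d i]])
 hence "rho z n = cnj (grn (cnj ?mu) n)" using z0 by (simp add: rho_def ent_conv_op[OF s])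
 moreover have "rho (cnj z) n = grn (cnj ?mu) n" using rho_lower_half[OF d, of "cnj z" n] z by (simp add: cnj_joukowski)
 ultimately show ?thesis by simp
qed

lemma lower_half_approx:
 assumes z: "z \<in> ball 0 1" "Im z <= 0"
 obtains s where "!!k::nat. s k \<in> ball 0 1" "!!k. Im (s k) < 0" "s \<longlonglongrightarrow> z"
proof
 \<comment> \<open>Moving straight down by at most half of the distance to the unit circle stays
   inside the disc.\<close>
 let ?s = "%k::nat. z - \<i> * of_real ((1 - cmod z)*inverse (real (Suc (Suc k))))"
 have c: "0 < 1 - cmod z" using z by simp
 show "?s k \<in> ball 0 1" for k
 proof -
  have "cmod (?s k) <= cmod z + cmod (\<i> * of_real ((1 - cmod z)*inverse (real (Suc (Suc k)))))" by (rule norm_triangle_ineq4)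
  also have "... = cmod z + (1 - cmod z)*inverse (real (Suc (Suc k)))" using c by (simp only: norm_mult norm_ii norm_of_real abs_mult abs_of_pos) simp
  also have "... < cmod z + (1 - cmod z)*1" using c by (intro add_strict_left_mono mult_strict_left_mono) (auto simp: field_simps)
  finally show ?thesis by simp
 qed
 have "Im (z - \<i> * of_real a) = Im z - a" for a by simp
 moreover have "0 < (1 - cmod z)*inverse (real (Suc (Suc k)))" for k using c by (intro mult_pos_pos) auto
 ultimately show "Im (?s k) < 0" for k using z(2) by (smt (verit))
 have "(%k. inverse (real (Suc (Suc k)))) \<longlonglongrightarrow> 0" using LIMSEQ_Suc[OF LIMSEQ_inverse_real_of_nat] .
 hence "?s \<longlonglongrightarrow> z - \<i> * of_real ((1 - cmod z)*0)" by (intro tendsto_intros)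
 thus "?s \<longlonglongrightarrow> z" by simp
qed

text \<open>On the real segment neither half plane formula applies; there both sides are limits of
  the identity along a sequence from below.\<close>

lemma rho_cnj:
 assumes d: "3 <= CARD('n::finite)" and z: "z \<in> ball 0 1" shows "rho z (n :: int ^ 'n) = cnj (rho (cnj z) n)"
proof -
 consider "0 < Im z" | "Im z < 0" | "Im z = 0" by linarith
 thus ?thesis
 proof cases
  case 1
  thus ?thesis by (rule rho_upper_half[OF d z])
 next
  case 2
  thus ?thesis using rho_upper_half[OF d, of "cnj z" n] z by simp
 next
  case 3
  hence zc: "cnj z = z" by (simp add: complex_eq_iff)
  obtain s where s: "!!k::nat. s k \<in> ball 0 1" "!!k. Im (s k) < 0" "s \<longlonglongrightarrow> z" using lower_half_approx[OF z] 3 by auto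
  have "(%k. cnj (s k)) \<longlonglongrightarrow> z" using tendsto_cnj[OF s(3)] by (simp add: zc)
  from rho_tendsto[OF d z this] have 1: "(%k. rho (cnj (s k)) n) \<longlonglongrightarrow> rho z n" .
  have 2: "(%k. cnj (rho (s k) n)) \<longlonglongrightarrow> cnj (rho z n)" by (intro tendsto_cnj rho_tendsto[OF d z s(3)])
  have "rho (cnj (s k)) n = cnj (rho (s k) n)" for k
  proof -
   have "cnj (s k) \<in> ball 0 1" "0 < Im (cnj (s k))" using s(1)[of k] s(2)[of k] by simp_all
   from rho_upper_half[OF d this, of n] show ?thesis by simp
  qed
  hence e: "(%k. rho (cnj (s k)) n) = (%k. cnj (rho (s k) n))" by (intro ext)
  show ?thesis using LIMSEQ_unique[OF 1[unfolded e] 2] zc by simp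
 qed
qed

text \<open>The z-independent majorant of the resolvent kernel. The integral is finite by
  \<open>nn_integral_evb\<close>, so the conversion to a real number is faithful in dimension at
  least 3.\<close>

definition kmaj :: "int ^ 'n::finite => real" where "kmaj n = enn2real (nni (%t. evb n t) {0<..})"

lemma ennreal_kmaj:
 assumes d: "3 <= CARD('n::finite)" shows "ennreal (kmaj (n :: int ^ 'n)) = nni (%t. evb n t) {0<..}" unfolding kmaj_def
 by (rule ennreal_enn2real) (rule le_less_trans[OF nn_integral_evb[OF d]], simp)

lemma kmaj_nonneg: "0 <= kmaj n" by (simp add: kmaj_def)

lemma kmaj_le_5:
 assumes d: "3 <= CARD('n::finite)" shows "kmaj (n :: int ^ 'n) <= 5"
proof -
 have "ennreal (kmaj n) <= ennreal 5" unfolding ennreal_kmaj[OF d] using nn_integral_evb[OF d] by simp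
 thus ?thesis by (subst (asm) ennreal_le_iff) auto
qed

lemma norm_rho_le:
 assumes d: "3 <= CARD('n::finite)" and z: "z \<in> ball 0 1" shows "cmod (rho z (n :: int ^ 'n)) <= kmaj n"
proof -
 have pos: "0 < CARD('n)" using d by simp
 have 1: "cmod (rho z n) <= kmaj n" if z: "z \<in> ball 0 1" "Im z < 0" for z
 proof -
  have "z ~= 0" using z(2) by auto
  hence "0 <= Im (joukowski CARD('n) z)" using joukowski_Im_sign(3)[OF z(1) _ pos] z(2) by simp
  hence "ennreal (cmod (rho z n)) <= ennreal (kmaj n)" unfolding rho_lower_half[OF d z] ennreal_kmaj[OF d] by (rule grn_bound[OF d])
  thus ?thesis by (subst (asm) ennreal_le_iff) (auto simp: kmaj_nonneg)
 qed
 have 2: "cmod (rho z n) <= kmaj n" if z: "z \<in> ball 0 1" "Im z <= 0" for z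
 proof -
  obtain s where s: "!!k::nat. s k \<in> ball 0 1" "!!k. Im (s k) < 0" "s \<longlonglongrightarrow> z" using lower_half_approx[OF z] by auto
  show ?thesis by (rule tendsto_upperbound[OF tendsto_norm[OF rho_tendsto[OF d z(1) s(3)]]]) (use 1 s in auto)
 qed
 show ?thesis
 proof (cases "Im z <= 0")
  case False
  thus ?thesis using 2[of "cnj z"] rho_cnj[OF d z, of n] z by simp
 qed (use 2 z in simp)
qed

text \<open>Away from the origin the conformal map is Lipschitz: with both moduli at least 3/8 one
  has |1 - 1/(z w)| <= 1 + 64/9 <= 10, whence 5 d. The Hoelder bound of \<open>grn\<close> then
  passes to points with real parts on the segment by approximation from below.\<close>

lemma rho_hoelder_lower:
 assumes d: "3 <= CARD('n::finite)" and z: "z \<in> ball 0 1" "Im z <= 0" "3/8 <= cmod z" and w: "w \<in> ball 0 1" "Im w <= 0" "3/8 <= cmod w"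
 shows "cmod (rho z (n :: int ^ 'n) - rho w n) <= 22*(5*CARD('n)) powr (1/4) * cmod (z - w) powr (1/4)"
proof -
 have pos: "0 < CARD('n)" using d by simp
 let ?J = "joukowski CARD('n)"
 have nz: "z ~= 0" "w ~= 0" using z w by auto
 obtain s where s: "!!k::nat. s k \<in> ball 0 1" "!!k. Im (s k) < 0" "s \<longlonglongrightarrow> z" using lower_half_approx[OF z(1,2)] by auto
 obtain t where t: "!!k::nat. t k \<in> ball 0 1" "!!k. Im (t k) < 0" "t \<longlonglongrightarrow> w" using lower_half_approx[OF w(1,2)] by auto
 have Js: "(%k. ?J (s k)) \<longlonglongrightarrow> ?J z" "(%k. ?J (t k)) \<longlonglongrightarrow> ?J w"
  unfolding joukowski_def using nz by (intro tendsto_intros s(3) t(3); simp)+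
 have l: "(%k. cmod (rho (s k) n - rho (t k) n)) \<longlonglongrightarrow> cmod (rho z n - rho w n)"
  by (intro tendsto_norm tendsto_diff rho_tendsto[OF d z(1) s(3)] rho_tendsto[OF d w(1) t(3)])
 have r: "(%k. 22 * cmod (?J (s k) - ?J (t k)) powr (1/4)) \<longlonglongrightarrow> 22 * cmod (?J z - ?J w) powr (1/4)"
  by (intro tendsto_mult tendsto_const tendsto_powr' tendsto_norm tendsto_diff Js) simp
 have "cmod (rho (s k) n - rho (t k) n) <= 22 * cmod (?J (s k) - ?J (t k)) powr (1/4)" for k
 proof -
  have "s k ~= 0" "t k ~= 0" using s(2)[of k] t(2)[of k] by auto
  hence "0 <= Im (?J (s k))" "0 <= Im (?J (t k))"
   using joukowski_Im_sign(1)[OF s(1) _ pos s(2), of k] joukowski_Im_sign(1)[OF t(1) _ pos t(2), of k] by simp_all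
  thus ?thesis unfolding rho_lower_half[OF d s(1) s(2)] rho_lower_half[OF d t(1) t(2)] by (rule grn_hoelder[OF d])
 qed
 hence A: "cmod (rho z n - rho w n) <= 22 * cmod (?J z - ?J w) powr (1/4)" by (intro LIMSEQ_le[OF l r] exI[of _ 0] allI impI)
 have "cmod (?J z - ?J w) <= 5*CARD('n) * cmod (z - w)"
 proof -
  have "?J z - ?J w = of_real (CARD('n)/2)*((z - w)*(1 - 1/(z*w)))" using nz by (simp add: joukowski_def field_simps)
  hence e: "cmod (?J z - ?J w) = CARD('n)/2*(cmod (z - w) * cmod (1 - 1/(z*w)))"
   by (simp only: norm_mult norm_of_real abs_of_nonneg of_nat_0_le_iff divide_nonneg_nonneg zero_le_numeral)
  have "3/8*(3/8) <= cmod z * cmod w" using z(3) w(3) by (intro mult_mono) auto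
  hence "1/(cmod z * cmod w) <= 1/(9/64)" by (intro divide_left_mono) auto
  hence "cmod (1/(z*w)) <= 9" by (simp add: norm_divide norm_mult)
  hence "cmod (1 - 1/(z*w)) <= 10" using norm_triangle_ineq4[of 1 "1/(z*w)"] by simp
  hence "cmod (?J z - ?J w) <= CARD('n)/2*(cmod (z - w)*10)" unfolding e by (intro mult_left_mono) auto
  thus ?thesis by simp
 qed
 hence "cmod (?J z - ?J w) powr (1/4) <= (5*CARD('n) * cmod (z - w)) powr (1/4)" by (intro powr_mono2) auto
 also have "... = real (5*CARD('n)) powr (1/4) * cmod (z - w) powr (1/4)" by (subst powr_mult) auto
 finally show ?thesis using A by linarith
qed

lemma rho_hoelder_lower_any:
 assumes d: "3 <= CARD('n::finite)" and z: "z \<in> ball 0 1" "0 <= Im z" "3/8 <= cmod z" and w: "w \<in> ball 0 1" "0 <= Im w" "3/8 <= cmod w"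
 shows "cmod (rho z (n :: int ^ 'n) - rho w n) <= 22*(5*CARD('n)) powr (1/4) * cmod (z - w) powr (1/4)"
proof -
 have "cmod (rho (cnj z) n - rho (cnj w) n) <= 22*(5*CARD('n)) powr (1/4) * cmod (cnj z - cnj w) powr (1/4)"
  by (rule rho_hoelder_lower[OF d]) (use z w in auto)
 moreover have "rho z n - rho w n = cnj (rho (cnj z) n - rho (cnj w) n)" using rho_cnj[OF d z(1), of n] rho_cnj[OF d w(1), of n] by simp
 ultimately show ?thesis by (metis complex_cnj_diff complex_mod_cnj)
qed

lemma rho_lipschitz_inner:
 assumes d: "3 <= CARD('n::finite)" and z: "cmod z <= 1/2" and w: "cmod w <= 1/2" shows "cmod (rho z (n :: int ^ 'n) - rho w n) <= 20 * cmod (z - w)"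
proof -
 let ?f = "%z. rho z n"
 note h = rho_holomorphic[OF d, of n]
 show ?thesis
 proof (rule field_differentiable_bound[where S = "cball 0 (1/2)" and f' = "deriv ?f"])
  fix x :: complex assume x: "x \<in> cball 0 (1/2)"
  have sub: "cball x (1/4) \<subseteq> ball 0 1"
  proof
   fix y assume "y \<in> cball x (1/4)"
   hence "cmod (y - x) <= 1/4" by (simp add: dist_norm norm_minus_commute)
   thus "y \<in> ball 0 1" using x norm_triangle_ineq2[of y x] by simp
  qed
  have "x \<in> ball 0 1" using x by simp
  hence "(?f has_field_derivative deriv ?f x) (at x)" by (rule holomorphic_derivI[OF h open_ball])
  thus "(?f has_field_derivative deriv ?f x) (at x within cball 0 (1/2))" by (rule has_field_derivative_at_within)
  have "cmod ((deriv ^^ 1) ?f x) <= fact 1*5/(1/4)^1"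
  proof (rule Cauchy_inequality)
   show "?f holomorphic_on ball x (1/4)" using holomorphic_on_subset[OF h] sub ball_subset_cball by blast
   show "continuous_on (cball x (1/4)) ?f" using holomorphic_on_imp_continuous_on[OF holomorphic_on_subset[OF h sub]] .
   fix y assume "cmod (x - y) = 1/4"
   hence "y \<in> ball 0 1" using sub by (auto simp: dist_norm subset_iff)
   thus "cmod (?f y) <= 5" using order_trans[OF norm_rho_le[OF d] kmaj_le_5[OF d]] by blast
  qed simp
  thus "cmod (deriv ?f x) <= 20" by simp
 qed (use z w in auto)
qed

text \<open>Distant points are covered by the uniform bound, points near the origin by Cauchy's
  inequality. In the remaining case both moduli are at least 3/8 and the half disc estimates apply,
  with a detour over the real axis for points in opposite halves.\<close>

lemma rho_hoelder:
 assumes d: "3 <= CARD('n::finite)"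
 shows "\<exists>K\<ge>0. \<forall>z\<in>ball 0 1. \<forall>w\<in>ball 0 1. \<forall>n :: int ^ 'n. cmod (rho z n - rho w n) <= K * cmod (z - w) powr (1/4)"
proof -
 define L where "L = 22*real (5*CARD('n)) powr (1/4)"
 have L0: "0 <= L" by (simp add: L_def)
 have main: "cmod (rho z n - rho w n) <= (40 + 2*L) * cmod (z - w) powr (1/4)"
  if z: "z \<in> ball 0 1" and w: "w \<in> ball 0 1" for z w and n :: "int ^ 'n"
 proof -
  let ?h = "cmod (z - w)"
  have b: "cmod (rho z n - rho w n) <= 10"
   using norm_triangle_ineq4[of "rho z n" "rho w n"] norm_rho_le[OF d z, of n] norm_rho_le[OF d w, of n] kmaj_le_5[OF d, of n] by linarith
  have goal: ?thesis if "cmod (rho z n - rho w n) <= c*?h powr (1/4)" "c <= 40 + 2*L" for c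
   using that by (meson mult_right_mono order_trans powr_ge_zero)
  show ?thesis
  proof (cases "1/8 <= ?h")
   case True
   have "((1/2) powr 4) powr (1/4) = (1/2 :: real)" unfolding powr_powr by simp
   moreover have "(1/2 :: real) powr 4 = 1/16" by (simp add: powr_numeral eval_nat_numeral)
   ultimately have "1/2 = (1/16) powr (1/4 :: real)" by simp
   also have "... <= ?h powr (1/4)" using True by (intro powr_mono2) auto
   finally have "10 <= 20*?h powr (1/4)" by simp
   with b have "cmod (rho z n - rho w n) <= 20*?h powr (1/4)" by linarith
   thus ?thesis by (rule goal) (use L0 in simp)
  next
   case h: False
   show ?thesis
   proof (cases "cmod z <= 1/2 \<and> cmod w <= 1/2")
    case True
    have "?h <= ?h powr (1/4)"
    proof (cases "?h = 0")
     case False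
     thus ?thesis using powr_mono'[of "1/4" 1 ?h] h by simp
    qed simp
    hence "cmod (rho z n - rho w n) <= 20*?h powr (1/4)" using rho_lipschitz_inner[OF d, of z w n] True by linarith
    thus ?thesis by (rule goal) (use L0 in simp)
   next
    case False
    hence big: "(1/2 <= cmod z \<or> 1/2 <= cmod w)" by auto
    have h8: "?h < 1/8" using h by simp
    have z3: "3/8 <= cmod z" and w3: "3/8 <= cmod w" using big h8 norm_triangle_ineq3[of z w] by (auto simp: abs_le_iff)
    show ?thesis
    proof (cases "(Im z <= 0 \<and> Im w <= 0) \<or> (0 <= Im z \<and> 0 <= Im w)")
     case True
     hence "cmod (rho z n - rho w n) <= L*?h powr (1/4)"
      unfolding L_def using rho_hoelder_lower[OF d z _ z3 w _ w3] rho_hoelder_lower_any[OF d z _ z3 w _ w3] by blast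
     thus ?thesis by (rule goal) (use L0 in simp)
    next
     case False
     \<comment> \<open>The parameter at which the segment from z to w meets the real axis. The
       crossing point stays close to both ends, so its modulus is still at least 3/8.\<close>
     define t where "t = Im z/(Im z - Im w)"
     define x where "x = z + of_real t*(w - z)"
     have ne: "Im z - Im w ~= 0" using False by auto
     have t: "0 <= t" "t <= 1"
     proof -
      have "(0 < Im z \<and> Im w < 0) \<or> (Im z < 0 \<and> 0 < Im w)" using False by linarith
      thus "0 <= t" "t <= 1" unfolding t_def by (auto simp: field_simps)
     qed
     have "Im x = Im z + t*(Im w - Im z)" by (simp add: x_def)
     also have "t*(Im w - Im z) = - Im z" using ne unfolding t_def by (simp add: field_simps)
     finally have Ix: "Im x = 0" by simp
     have zx: "cmod (z - x) = t*?h" using t by (simp add: x_def norm_mult norm_minus_commute)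
     have "x - w = of_real (1 - t)*(z - w)" by (simp add: x_def algebra_simps)
     hence xw: "cmod (x - w) = (1 - t)*?h" using t by (simp only: norm_mult norm_of_real abs_of_nonneg)
     have zx': "cmod (z - x) <= ?h" and xw': "cmod (x - w) <= ?h" unfolding zx xw using t by (auto intro: mult_left_le_one_le)
     have x3: "3/8 <= cmod x" using big h8 zx' xw' norm_triangle_ineq3[of z x] norm_triangle_ineq3[of x w] by (auto simp: abs_le_iff)
     have "x = (1 - t) *\<^sub>R z + t *\<^sub>R w" by (simp add: x_def scaleR_conv_of_real algebra_simps)
     hence xb: "x \<in> ball 0 1" using convexD[OF convex_ball z w, of "1 - t" t] t by simp
     have "cmod (rho z n - rho x n) <= L * cmod (z - x) powr (1/4)"
      unfolding L_def using rho_hoelder_lower[OF d z _ z3 xb _ x3] rho_hoelder_lower_any[OF d z _ z3 xb _ x3] Ix by (metis linear order_refl)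
     also have "... <= L*?h powr (1/4)" using zx' L0 by (intro mult_left_mono powr_mono2) auto
     finally have 1: "cmod (rho z n - rho x n) <= L*?h powr (1/4)" .
     have "cmod (rho x n - rho w n) <= L * cmod (x - w) powr (1/4)"
      unfolding L_def using rho_hoelder_lower[OF d xb _ x3 w _ w3] rho_hoelder_lower_any[OF d xb _ x3 w _ w3] Ix by (metis linear order_refl)
     also have "... <= L*?h powr (1/4)" using xw' L0 by (intro mult_left_mono powr_mono2) auto
     finally have 2: "cmod (rho x n - rho w n) <= L*?h powr (1/4)" .
     have "cmod (rho z n - rho w n) <= (2*L)*?h powr (1/4)" using 1 2 norm_triangle_ineq[of "rho z n - rho x n" "rho x n - rho w n"] by simp
     thus ?thesis by (rule goal) (use L0 in simp)
    qed
   qed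
  qed
 qed
 have "0 <= 40 + 2*L" using L0 by simp
 with main show ?thesis by blast
qed

text \<open>The reciprocal of the spectral parameter, in a form that is analytic at z = 0 with value
  0.\<close>

definition nu :: "nat => complex => complex" where "nu d z = 2 / of_nat d*(z/(1 + z^2))"

lemma nu_eq: "z ~= 0 ==> nu d z = 1/joukowski d z"
proof -
 assume z: "z ~= 0"
 hence "z + 1/z = (1 + z^2)/z" by (simp add: field_simps power2_eq_square)
 thus ?thesis by (simp add: nu_def joukowski_def)
qed

lemma norm_nu_le:
 assumes "3 <= d" "cmod z <= 1/8" shows "cmod (nu d z) <= cmod z"
proof -
 have "(cmod z)^2 <= (1/8)^2" using assms by (intro power_mono) auto
 hence "1 - 1/64 <= cmod (1 + z^2)" using norm_diff_ineq[of 1 "z^2"] by (simp add: norm_power power2_eq_square norm_mult)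
 moreover have "2/real d <= 2/3" using assms by (intro divide_left_mono) auto
 ultimately have "2/real d*(cmod z / cmod (1 + z^2)) <= 2/3*(cmod z/(63/64))" by (intro mult_mono[OF _ divide_left_mono]) (auto intro: mult_pos_pos)
 also have "2/3*(cmod z/(63/64)) <= cmod z" by simp
 finally show ?thesis by (simp add: nu_def norm_mult norm_divide)
qed

text \<open>Iterating R = \<nu> H R - \<nu> three times gives R = \<nu>^3 H^3 R - (\<nu> + \<nu>^2 H
  + \<nu>^3 H^2); the remainder is of order z^4 since R itself is of order z.\<close>

lemma rho_expansion:
 assumes d: "3 <= CARD('n::finite)" and z: "cmod z <= 1/8"
 defines "nv \<equiv> nu CARD('n) z"
 shows "cmod (rho z n + (nv*(if n = 0 then 1 else 0) + nv^2*ent (Hop :: (int ^ 'n) opalg) n 0 + nv^3*ent (Hop*Hop) n 0))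
  <= 4*real CARD('n)^3 * cmod z^4"
proof (cases "z = 0")
 case True
 thus ?thesis by (simp add: nv_def nu_def rho_def)
next
 case False
 let ?mu = "joukowski CARD('n) z"
 let ?H = "Hop :: (int ^ 'n) opalg"
 define R where "R = (Rs ?mu :: (int ^ 'n) opalg)"
 have pos: "0 < CARD('n)" using d by simp
 have L: "?mu \<in> Lam CARD('n)" by (rule joukowski_in_Lam) (use z False pos in auto)
 have rs: "resolv ?mu R" unfolding R_def by (rule resolv_Rs[OF d L])
 have n1: "nv*?mu = 1" using Lam_nonzero[OF L] by (simp add: nv_def nu_eq[OF False])
 have cH: "?H * sc nv = sc nv*?H" by (rule sc_commute[OF clin_Hop])
 have "?H*R - sc ?mu*R = 1" using rs by (simp add: resolv_def left_diff_distrib)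
 hence "sc ?mu*R = ?H*R - 1" by (simp add: diff_eq_eq eq_diff_eq add.commute)
 hence "sc nv*(sc ?mu*R) = sc nv*(?H*R - 1)" by simp
 hence step: "R = sc nv*(?H*R) - sc nv"
  unfolding mult.assoc[symmetric] sc_simps(6)[symmetric] n1 by (simp add: sc_simps right_diff_distrib mult.assoc)
 have "?H*R = sc nv*(?H*(?H*R)) - sc nv*?H" by (subst step) (simp add: right_diff_distrib mult.assoc[symmetric] cH)
 moreover have "?H*(?H*R) = sc nv*(?H*(?H*(?H*R))) - sc nv*(?H*?H)"
 proof -
  have 1: "?H*R = sc nv*(?H*(?H*R)) - sc nv*?H" by fact
  have c: "?H*(sc nv*X) = sc nv*(?H*X)" for X by (metis cH mult.assoc)
  have "?H*(?H*R) = ?H*(sc nv*(?H*(?H*R)) - sc nv*?H)" using 1 by simp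
  also have "... = sc nv*(?H*(?H*(?H*R))) - sc nv*(?H*?H)" by (simp only: c right_diff_distrib)
  finally show ?thesis .
 qed
 ultimately have "R = sc nv*(sc nv*(sc nv*(?H*(?H*(?H*R))) - sc nv*(?H*?H)) - sc nv*?H) - sc nv" using step by metis
 hence R3: "R = sc nv*(sc nv*(sc nv*(?H*(?H*(?H*R))))) - (sc nv*1 + sc nv*(sc nv*?H) + sc nv*(sc nv*(sc nv*(?H*?H))))"
  unfolding right_diff_distrib distrib_left mult_1_right diff_diff_eq by (simp only: add.assoc add.commute add.left_commute)
 have "rho z n = ent R n 0" using False by (simp add: rho_def R_def)
 also have "... = nv^3*ent (?H*(?H*(?H*R))) n 0 - (nv*(if n = 0 then 1 else 0) + nv^2*ent ?H n 0 + nv^3*ent (?H*?H) n 0)"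
  by (subst R3) (simp only: ent_simps ent_sc_mult power2_eq_square power3_eq_cube mult.assoc)
 finally have "cmod (rho z n + (nv*(if n = 0 then 1 else 0) + nv^2*ent ?H n 0 + nv^3*ent (?H*?H) n 0)) = cmod nv^3 * cmod (ent (?H*(?H*(?H*R))) n 0)"
  by (simp add: norm_mult norm_power)
 also have "... <= cmod z^3*(real CARD('n)*(real CARD('n)*(real CARD('n)*(4 * cmod z))))"
 proof (intro mult_mono power_mono)
  show "cmod nv <= cmod z" unfolding nv_def by (rule norm_nu_le[OF d z])
  have "norm (?H*X) <= real CARD('n)*b" if "norm X <= b" for X b by (rule order_trans[OF norm_mult_ineq]) (intro mult_mono norm_Hop_le that; simp)
  moreover have "norm R <= 4 * cmod z" unfolding R_def by (rule norm_Rs_small[OF d False z])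
  ultimately show "cmod (ent (?H*(?H*(?H*R))) n 0) <= real CARD('n)*(real CARD('n)*(real CARD('n)*(4 * cmod z)))"
   by (intro order_trans[OF norm_ent_le]) blast
 qed auto
 also have "... = 4*real CARD('n)^3 * cmod z^4" by (simp add: eval_nat_numeral)
 finally show ?thesis .
qed

section \<open>Hilbert-Schmidt bounds for the modified determinant\<close>

text \<open>Each term is X^th sqrt (Y Z)^(2/q) with th = 1 - 2/q, where X, Y, Z pair two of the
  three normalised powers; the weighted and the ordinary mean inequality then reduce everything to
  sums equal to at most 1. The weight th is nonnegative because p <= 2 means q >= 2.\<close>

lemma young_kernel_normalized:
 fixes a :: "'a::ab_group_add => real"
 assumes p: "1 < p" "p <= 2" and q: "q = p/(p - 1)" and F: "finite F" and a0: "!!x. 0 <= a x" and g0: "!!n. 0 <= g n"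
  and a: "(\<Sum>x\<in>F. a x powr p) <= 1" and g: "!!G. finite G ==> (\<Sum>n\<in>G. g n powr q) <= 1"
 shows "(\<Sum>x\<in>F. \<Sum>y\<in>F. a x*(g (x - y))^2*a y) <= 1"
proof -
 define th where "th = 1 - 2/q"
 have q2: "2 <= q" using p by (simp add: q field_simps)
 have th: "0 <= th" "0 <= 2/q" "th + 2/q = 1" using q2 by (auto simp: th_def field_simps)
 have e1: "p*th + p/q = 1" using p by (simp add: th_def q field_simps)
 have term_le: "a x*(g (x - y))^2*a y <= th*(a x powr p*a y powr p) + 1/q*(a x powr p*g (x - y) powr q + a y powr p*g (x - y) powr q)" for x y
 proof (cases "a x = 0 \<or> a y = 0 \<or> g (x - y) = 0")
  case True
  thus ?thesis using th q2 by auto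
 next
  case False
  hence pos: "0 < a x" "0 < a y" "0 < g (x - y)" using a0[of x] a0[of y] g0[of "x - y"] by linarith+
  let ?X = "a x powr p*a y powr p" and ?Y = "a x powr p*g (x - y) powr q" and ?Z = "a y powr p*g (x - y) powr q"
  have eq: "?X powr th * sqrt (?Y*?Z) powr (2/q) = a x*(g (x - y))^2*a y"
  proof -
   have "sqrt (?Y*?Z) powr (2/q) = (?Y*?Z) powr (1/q)" using pos by (simp add: powr_half_sqrt[symmetric] powr_powr)
   also have "... = (a x powr (p/q)*a y powr (p/q))*g (x - y) powr (1 + 1)" using q2 pos unfolding powr_add by (simp add: powr_mult powr_powr)
   also have "g (x - y) powr (1 + 1) = (g (x - y))^2" using pos by (simp add: powr_numeral)
   finally have s: "sqrt (?Y*?Z) powr (2/q) = (a x powr (p/q)*a y powr (p/q))*(g (x - y))^2" .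
   have "?X powr th = a x powr (p*th)*a y powr (p*th)" using pos by (simp add: powr_mult powr_powr)
   hence "?X powr th * sqrt (?Y*?Z) powr (2/q) = a x powr (p*th + p/q)*(g (x - y))^2*a y powr (p*th + p/q)" unfolding s powr_add by simp
   thus ?thesis using pos by (simp add: e1)
  qed
  have "?X powr th * sqrt (?Y*?Z) powr (2/q) <= th*?X + 2/q * sqrt (?Y*?Z)" by (rule Youngs_inequality_0[OF th]) (use pos in simp_all)
  moreover have "2/q * sqrt (?Y*?Z) <= 2/q*((?Y + ?Z)/2)" using th(2) by (intro mult_left_mono arith_geo_mean_sqrt) auto
  moreover have h: "2/q*(s/2) = 1/q * s" for s :: real by simp
  ultimately show ?thesis unfolding eq h[of "?Y + ?Z"] by linarith
 qed
 define A where "A = (\<Sum>x\<in>F. a x powr p)"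
 have A: "0 <= A" "A <= 1" using a by (auto simp: A_def sum_nonneg)
 have row: "(\<Sum>y\<in>F. g (x - y) powr q) <= 1" for x
 proof -
  have "(\<Sum>n\<in>(%y. x - y) ` F. g n powr q) = (\<Sum>y\<in>F. g (x - y) powr q)" by (subst sum.reindex) (auto simp: inj_on_def)
  thus ?thesis using g[of "(%y. x - y) ` F"] F by simp
 qed
 have col: "(\<Sum>x\<in>F. g (x - y) powr q) <= 1" for y
 proof -
  have "(\<Sum>n\<in>(%x. x - y) ` F. g n powr q) = (\<Sum>x\<in>F. g (x - y) powr q)" by (subst sum.reindex) (auto simp: inj_on_def)
  thus ?thesis using g[of "(%x. x - y) ` F"] F by simp
 qed
 have "(\<Sum>x\<in>F. \<Sum>y\<in>F. a x*(g (x - y))^2*a y)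
   <= (\<Sum>x\<in>F. \<Sum>y\<in>F. th*(a x powr p*a y powr p) + 1/q*(a x powr p*g (x - y) powr q + a y powr p*g (x - y) powr q))"
  by (intro sum_mono term_le)
 also have "... = th*(A*A) + 1/q*((\<Sum>x\<in>F. a x powr p*(\<Sum>y\<in>F. g (x - y) powr q)) + (\<Sum>y\<in>F. a y powr p*(\<Sum>x\<in>F. g (x - y) powr q)))"
 proof -
  have "(\<Sum>x\<in>F. \<Sum>y\<in>F. a y powr p*g (x - y) powr q) = (\<Sum>y\<in>F. a y powr p*(\<Sum>x\<in>F. g (x - y) powr q))"
   unfolding sum_distrib_left by (rule sum.swap)
  moreover have "(\<Sum>x\<in>F. \<Sum>y\<in>F. a x powr p*a y powr p) = A*A" by (simp add: A_def sum_product)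
  ultimately show ?thesis by (simp only: sum.distrib sum_distrib_left[symmetric])
 qed
 also have "... <= th*(1*1) + 1/q*((\<Sum>x\<in>F. a x powr p*1) + (\<Sum>y\<in>F. a y powr p*1))"
  using th q2 A by (intro add_mono mult_left_mono mult_mono sum_mono row col) auto
 also have "... = th + 1/q*(A + A)" by (simp add: A_def)
 also have "... <= th + 1/q*(1 + 1)" using A q2 by (intro add_left_mono mult_left_mono add_mono) auto
 also have "... = 1" using th(3) by simp
 finally show ?thesis .
qed

text \<open>The norm of g in l^q with the dual exponent q = p/(p - 1) is at most C. For p = 1 the
  quotient would be 0 by convention, so the supremum norm is written out.\<close>

definition ker_bound :: "real => ('a => real) => real => bool" where "ker_bound p g C \<longleftrightarrow> 0 <= C \<and>
  (if p = 1 then \<forall>n. g n <= C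
   else \<forall>G. finite G --> (\<Sum>n\<in>G. g n powr (p/(p - 1))) <= C powr (p/(p - 1)))"

lemma powr_inverse_cancel: "0 <= x ==> p ~= 0 ==> (x powr (1/p)) powr p = (x :: real)" by (cases "x = 0") (auto simp: powr_powr)

lemma young_kernel:
 fixes a :: "'a::ab_group_add => real"
 assumes p: "1 <= p" "p <= 2" and F: "finite F" and a0: "!!x. 0 <= a x" and g0: "!!n. 0 <= g n" and kb: "ker_bound p g C"
 shows "(\<Sum>x\<in>F. \<Sum>y\<in>F. a x*(g (x - y))^2*a y) <= (C*(\<Sum>x\<in>F. a x powr p) powr (1/p))^2"
proof (cases "p = 1")
 case True
 have "(\<Sum>x\<in>F. \<Sum>y\<in>F. a x*(g (x - y))^2*a y) <= (\<Sum>x\<in>F. \<Sum>y\<in>F. a x*C^2*a y)"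
  using kb True a0 g0 by (intro sum_mono mult_right_mono mult_left_mono power_mono) (auto simp: ker_bound_def)
 also have "... = (C*(\<Sum>x\<in>F. a x))^2" by (simp add: power_mult_distrib power2_eq_square sum_product sum_distrib_left algebra_simps)
 finally show ?thesis using True a0 by (simp add: sum_nonneg)
next
 case False
 hence p1: "1 < p" using p by simp
 define q where "q = p/(p - 1)"
 have q0: "0 < q" using p1 by (simp add: q_def)
 have C0: "0 <= C" and g: "!!G. finite G ==> (\<Sum>n\<in>G. g n powr q) <= C powr q" using kb False by (auto simp: ker_bound_def q_def)
 define A where "A = (\<Sum>x\<in>F. a x powr p)"
 define s where "s = A powr (1/p)"
 have A0: "0 <= A" by (simp add: A_def sum_nonneg)
 show ?thesis
 proof (cases "A = 0 \<or> C = 0")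
  case True
  have "a x*(g (x - y))^2*a y = 0" if "x \<in> F" "y \<in> F" for x y using True
  proof
   assume "A = 0"
   hence "a x powr p = 0" unfolding A_def using that F by (subst (asm) sum_nonneg_eq_0_iff) auto
   thus ?thesis by simp
  next
   assume "C = 0"
   hence "g (x - y) powr q <= 0" using g[of "{x - y}"] q0 by simp
   hence "g (x - y) = 0" by (metis powr_ge_zero powr_eq_0_iff antisym)
   thus ?thesis by simp
  qed
  hence "(\<Sum>x\<in>F. \<Sum>y\<in>F. a x*(g (x - y))^2*a y) = 0" by (intro sum.neutral ballI)
  thus ?thesis by (simp only: zero_le_power2)
 next
  case False
  hence pos: "0 < A" "0 < C" "0 < s" using A0 C0 by (auto simp: s_def)
  have sp: "s powr p = A" using A0 p1 unfolding s_def by (intro powr_inverse_cancel) auto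
  have "(\<Sum>x\<in>F. \<Sum>y\<in>F. (a x / s)*(g (x - y)/C)^2*(a y / s)) <= 1"
  proof (rule young_kernel_normalized[OF p1 p(2) q_def F])
   show "(\<Sum>x\<in>F. (a x / s) powr p) <= 1" using pos a0 by (simp add: powr_divide sp sum_divide_distrib[symmetric] A_def[symmetric])
   show "(\<Sum>n\<in>G. (g n/C) powr q) <= 1" if "finite G" for G using pos g0 g[OF that] by (simp add: powr_divide sum_divide_distrib[symmetric])
  qed (use pos a0 g0 in auto)
  also have "(\<Sum>x\<in>F. \<Sum>y\<in>F. (a x / s)*(g (x - y)/C)^2*(a y / s)) = (\<Sum>x\<in>F. \<Sum>y\<in>F. a x*(g (x - y))^2*a y)/(C * s)^2"
   unfolding sum_divide_distrib by (intro sum.cong refl) (simp add: power2_eq_square)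
  finally show ?thesis unfolding A_def[symmetric] s_def[symmetric] using pos by (simp add: divide_le_eq)
 qed
qed

lemma lp_norm_finite_sum_le:
 assumes V: "in_lp p V" and p: "1 <= p" and F: "finite F" shows "(\<Sum>x\<in>F. cmod (V x) powr p) powr (1/p) <= lp_norm p V" unfolding lp_norm_def
 using finite_sum_le_infsum[OF V[unfolded in_lp_def] F] p by (intro powr_mono2) (auto simp: sum_nonneg)

lemma lp_norm_nonneg: "0 <= lp_norm p V" by (simp add: lp_norm_def)

text \<open>The complex square root stands on both sides in place of |V|^(1/2) with a separate
  phase. The moduli of the entries are those of the symmetrised kernel, and each minor equals that
  of V k, since a permutation only reorders the roots.\<close>

definition Ksq :: "('a::ab_group_add => complex) => ('a => complex) => 'a => 'a => complex" where "Ksq V k x y = csqrt (V x)*k (x - y) * csqrt (V y)"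

lemma norm_csqrt_square: "(cmod (csqrt z))^2 = cmod z" by (metis norm_power power2_csqrt)

lemma hsS_Ksq_le:
 assumes p: "1 <= p" "p <= 2" and F: "finite F" and V: "in_lp p V" and kb: "ker_bound p (%n. cmod (k n)) C" shows "hsS F (Ksq V k) <= C*lp_norm p V"
proof -
 have C0: "0 <= C" using kb by (simp add: ker_bound_def)
 have "(hsS F (Ksq V k))^2 = (\<Sum>x\<in>F. \<Sum>y\<in>F. cmod (V x)*(cmod (k (x - y)))^2 * cmod (V y))"
  unfolding hsS_square by (simp add: Ksq_def norm_mult power_mult_distrib norm_csqrt_square)
 also have "... <= (C*(\<Sum>x\<in>F. cmod (V x) powr p) powr (1/p))^2" by (rule young_kernel[OF p F _ _ kb]) auto
 also have "... <= (C*lp_norm p V)^2" using C0 lp_norm_finite_sum_le[OF V p(1) F] by (intro power_mono mult_left_mono) auto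
 finally show ?thesis using C0 lp_norm_nonneg[of p V] by (meson mult_nonneg_nonneg power2_le_imp_le)
qed

lemma detS_Ksq: "finite S ==> detS S (Ksq V k) = detS S (%x y. V x*k (x - y))"
proof -
 assume S: "finite S"
 have "(\<Prod>x\<in>S. Ksq V k x (pe x)) = (\<Prod>x\<in>S. V x*k (x - pe x))" if "pe permutes S" for pe
 proof -
  have "(\<Prod>x\<in>S. Ksq V k x (pe x)) = (\<Prod>x\<in>S. csqrt (V x))*(\<Prod>x\<in>S. k (x - pe x))*(\<Prod>x\<in>S. csqrt (V (pe x)))"
   unfolding Ksq_def prod.distrib ..
  also have "(\<Prod>x\<in>S. csqrt (V (pe x))) = (\<Prod>x\<in>S. csqrt (V x))"
   using prod.permute[OF that, of "%x. csqrt (V x)"] by (simp add: o_def)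
  also have "(\<Prod>x\<in>S. csqrt (V x))*(\<Prod>x\<in>S. k (x - pe x))*(\<Prod>x\<in>S. csqrt (V x))
    = (\<Prod>x\<in>S. (csqrt (V x))^2*k (x - pe x))" unfolding power2_eq_square prod.distrib by simp
  finally show ?thesis by simp
 qed
 thus ?thesis unfolding detS_def by simp
qed

lemma det2S_Ksq:
 assumes F: "finite F" shows "det2S F (Ksq V k) = det2S F (%x y. V x*k (x - y))"
proof -
 have "detS F (%x y. (if x = y then 1 else 0) + Ksq V k x y) = detS F (%x y. (if x = y then 1 else 0) + V x*k (x - y))"
  unfolding detS_one_plus[OF F] using F by (intro sum.cong refl detS_Ksq) (auto intro: finite_subset)
 moreover have "Ksq V k x x = V x*k (x - x)" for x by (simp add: Ksq_def) (metis mult.assoc mult.commute power2_csqrt power2_eq_square)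
 ultimately show ?thesis unfolding det2S_def by simp
qed

section \<open>Boxes and the limit of the truncated determinants\<close>

definition zbox :: "nat => (int ^ 'n::finite) set" where "zbox N = {n. \<forall>i. n $ i \<in> {-int N..int N}}"

lemma finite_zbox: "finite (zbox N :: (int ^ 'n::finite) set)"
proof -
 have "zbox N \<subseteq> vec_lambda ` (PiE (UNIV :: 'n set) (%_. {-int N..int N}))"
 proof
  fix v :: "int ^ 'n" assume "v \<in> zbox N"
  hence "vec_nth v \<in> PiE UNIV (%_. {-int N..int N})" by (auto simp: zbox_def)
  thus "v \<in> vec_lambda ` (PiE UNIV (%_. {-int N..int N}))" by (metis image_eqI vec_nth_inverse)
 qed
 thus ?thesis by (rule finite_subset) (intro finite_imageI finite_PiE; simp)
qed

lemma zbox_exhausts: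
 assumes "finite (G :: (int ^ 'n::finite) set)"
 obtains N0 where "!!N. N0 <= N ==> G \<subseteq> zbox N"
proof -
 obtain N0 :: nat where N0: "!!n i. n \<in> G ==> n $ i \<in> {-int N0..int N0}" using finite_box[OF assms] by blast
 have "G \<subseteq> zbox N" if "N0 <= N" for N
 proof
  fix n assume "n \<in> G"
  hence "- int N0 <= n $ i \<and> n $ i <= int N0" for i using N0[of n i] by simp
  hence "- int N <= n $ i \<and> n $ i <= int N" for i using that by (meson of_nat_mono neg_le_iff_le order_trans)
  thus "n \<in> zbox N" by (simp add: zbox_def)
 qed
 thus ?thesis by (rule that)
qed

lemma norm_le_lp_norm:
 assumes "in_lp p V" "1 <= p" shows "cmod (V x) <= lp_norm p V" using lp_norm_finite_sum_le[OF assms, of "{x}"] assms(2) by (simp add: powr_powr)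

lemma bounded_of_le: "(!!x. cmod (v x) <= b) ==> bounded (range v)" by (auto simp: bounded_iff)

lemma in_lp_tail:
 assumes V: "in_lp p V" and p: "1 <= p" and e: "0 < e"
 obtains F where "finite F" "!!x. x \<notin> F ==> cmod (V x) <= e"
proof -
 let ?f = "%x. cmod (V x) powr p"
 have s: "?f summable_on UNIV" using V by (simp add: in_lp_def)
 obtain F where F: "finite F" "dist (sum ?f F) (infsum ?f UNIV) <= e powr p"
  using has_sum_finite_approximation[OF has_sum_infsum[OF s], of "e powr p"] e by auto
 have "cmod (V x) <= e" if x: "x \<notin> F" for x
 proof -
  have "sum ?f (insert x F) <= infsum ?f UNIV" by (rule finite_sum_le_infsum[OF s]) (use F in auto)
  hence "?f x <= e powr p" using F x by (simp add: dist_real_def)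
  thus ?thesis using p e by (metis powr_less_mono2 not_le norm_ge_zero zero_less_one less_le_trans less_imp_le)
 qed
 thus ?thesis using that F(1) by blast
qed

lemma in_lp_imp_square_sums:
 assumes V: "in_lp p V" and p: "1 <= p" "p <= 2"
 obtains S where "0 <= S" "!!F. finite F ==> (\<Sum>x\<in>F. (cmod (V x))^2) <= S"
proof -
 let ?M = "lp_norm p V"
 have le: "(cmod (V x))^2 <= ?M powr (2 - p) * cmod (V x) powr p" for x
 proof (cases "V x = 0")
  case False
  hence "(cmod (V x))^2 = cmod (V x) powr (2 - p) * cmod (V x) powr p" by (simp add: powr_add[symmetric])
  also have "... <= ?M powr (2 - p) * cmod (V x) powr p" using p norm_le_lp_norm[OF V p(1)] by (intro mult_right_mono powr_mono2) auto
  finally show ?thesis .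
 qed simp
 have "(\<Sum>x\<in>F. (cmod (V x))^2) <= ?M powr (2 - p)*(\<Sum>\<^sub>\<infinity>x. cmod (V x) powr p)" if "finite F" for F
 proof -
  have "(\<Sum>x\<in>F. (cmod (V x))^2) <= ?M powr (2 - p)*(\<Sum>x\<in>F. cmod (V x) powr p)" unfolding sum_distrib_left by (intro sum_mono le)
  also have "... <= ?M powr (2 - p)*(\<Sum>\<^sub>\<infinity>x. cmod (V x) powr p)"
   using V that by (intro mult_left_mono finite_sum_le_infsum) (auto simp: in_lp_def)
  finally show ?thesis .
 qed
 moreover have "0 <= ?M powr (2 - p)*(\<Sum>\<^sub>\<infinity>x. cmod (V x) powr p)" by (intro mult_nonneg_nonneg infsum_nonneg) auto
 ultimately show ?thesis using that by blast
qed

text \<open>Taken with the symmetrised kernel, to which the Hilbert-Schmidt bound applies. At z = 0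
  the kernel vanishes, and the value 1 agrees with \<open>modD\<close>.\<close>

definition DN :: "(int ^ 'n::finite => complex) => nat => complex => complex" where "DN V N z = det2S (zbox N) (Ksq V (rho z))"

lemma coord_mult_op_mult:
 assumes "bounded (range v)" shows "coord (rep (opa (mult_op v)*R) f) x = v x * coord (rep R f) x"
 by (simp add: rep_apply_simps mult_op_apply[OF assms])

lemma ent_mult_op_mult:
 assumes "bounded (range v)" shows "ent (opa (mult_op v)*R) x y = v x*ent R x y" unfolding ent_def by (rule coord_mult_op_mult[OF assms])

text \<open>The row bound behind the dominated convergence of the Fredholm series: two factors
  \<open>V R\<close> together are trace class row by row, although one of them is only Hilbert-Schmidt.\<close>

lemma row_bound_square:
 fixes v V :: "int ^ 'n::finite => complex"
 assumes R: "clin R" "!!u. R*Sh u = Sh u*R" and F: "finite F" and v: "!!x. v x = (if x \<in> F then V x else 0)" and Vb: "!!x. cmod (V x) <= M"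
  and w: "!!x. (\<Sum>y\<in>F. (cmod (ent R x y) * cmod (V y))^2) <= (w x)^2" "!!x. 0 <= w x"
 shows "cmod (coord (rep ((opa (mult_op v)*R)*(opa (mult_op v)*R)) f) x) <= cmod (V x)*w x*norm R*norm f"
proof -
 have "cmod (v x) <= M" for x using Vb[of x] by (auto simp: v intro: order_trans[OF norm_ge_zero])
 hence bv: "bounded (range v)" by (rule bounded_of_le)
 define g where "g = rep R f"
 have ng: "norm g <= norm R*norm f" unfolding g_def norm_opalg_def by (rule norm_blinfun)
 have fin: "rep (opa (mult_op v)) g = (\<Sum>y\<in>F. cs (V y * coord g y) (delta y))"
  by (rule ell2_eqI) (use F in \<open>auto simp: mult_op_apply[OF bv] coord_sum coord_cs coord_delta v if_distrib cong: if_cong\<close>)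
 have "coord (rep ((opa (mult_op v)*R)*(opa (mult_op v)*R)) f) x = v x * coord (rep R (rep (opa (mult_op v)) g)) x"
  unfolding mult.assoc coord_mult_op_mult[OF bv] by (simp add: rep_apply_simps g_def)
 also have "... = v x*(\<Sum>y\<in>F. V y * coord g y*ent R x y)" unfolding fin rep_finite_combination[OF R(1)] ..
 finally have "cmod (coord (rep ((opa (mult_op v)*R)*(opa (mult_op v)*R)) f) x)
   = cmod (v x) * cmod (\<Sum>y\<in>F. V y * coord g y*ent R x y)" by (simp add: norm_mult)
 also have "... <= cmod (V x)*(w x*norm g)"
 proof (intro mult_mono)
  show "cmod (v x) <= cmod (V x)" by (simp add: v)
  have "cmod (\<Sum>y\<in>F. V y * coord g y*ent R x y) <= (\<Sum>y\<in>F. \<bar>cmod (ent R x y) * cmod (V y)\<bar>*\<bar>cmod (coord g y)\<bar>)"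
   by (rule order_trans[OF norm_sum]) (simp add: norm_mult mult.commute mult.left_commute)
  also have "... <= L2_set (%y. cmod (ent R x y) * cmod (V y)) F*L2_set (%y. cmod (coord g y)) F" by (rule L2_set_mult_ineq)
  also have "... <= w x*norm g"
  proof (intro mult_mono L2_set_coord_le F)
   have "L2_set (%y. cmod (ent R x y) * cmod (V y)) F <= sqrt ((w x)^2)" unfolding L2_set_def by (intro real_sqrt_le_mono w)
   thus "L2_set (%y. cmod (ent R x y) * cmod (V y)) F <= w x" using w(2) by simp
  qed (auto simp: w)
  finally show "cmod (\<Sum>y\<in>F. V y * coord g y*ent R x y) <= w x*norm g" .
 qed auto
 also have "... <= cmod (V x)*(w x*(norm R*norm f))" by (intro mult_left_mono ng w) auto
 finally show ?thesis by (simp add: mult.assoc)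
qed

text \<open>A function in l^p is small outside a finite set, hence the truncations converge
  uniformly and the multiplication operators in norm.\<close>

lemma truncation_tendsto:
 fixes V :: "int ^ 'n::finite => complex"
 assumes V: "in_lp p V" and p: "1 <= p" shows "(%N. opa (mult_op (%x. if x \<in> zbox N then V x else 0))) \<longlonglongrightarrow> opa (mult_op V)"
proof (rule LIMSEQ_I)
 fix e :: real assume e: "0 < e"
 then obtain F where F: "finite F" "!!x. x \<notin> F ==> cmod (V x) <= e/2" using in_lp_tail[OF V p, of "e/2"] by auto
 obtain N0 where N0: "!!N. N0 <= N ==> F \<subseteq> zbox N" using zbox_exhausts[OF F(1)] by blast
 have "norm (opa (mult_op (%x. if x \<in> zbox N then V x else 0)) - opa (mult_op V)) < e" if N: "N0 <= N" for N
 proof -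
  let ?v = "%x. if x \<in> zbox N then V x else 0"
  let ?u = "%x. if x \<in> zbox N then 0 else - V x"
  have b: "bounded (range V)" using norm_le_lp_norm[OF V p] by (rule bounded_of_le)
  have bv: "bounded (range ?v)" using norm_le_lp_norm[OF V p] lp_norm_nonneg[of p V] by (intro bounded_of_le[where b = "lp_norm p V"]) auto
  have u: "cmod (?u x) <= e/2" for x using F(2)[of x] N0[OF N] e by auto
  have "opa (mult_op ?v) - opa (mult_op V) = opa (mult_op ?u)" by (rule opalg_coord_eqI)
    (simp add: rep_apply_simps coord_minus mult_op_apply[OF b] mult_op_apply[OF bv] mult_op_apply[OF bounded_of_le, OF u])
  hence "norm (opa (mult_op ?v) - opa (mult_op V)) <= e/2" using norm_mult_op_le[of ?u, OF u] by simp
  thus ?thesis using e by simp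
 qed
 thus "\<exists>no. \<forall>n\<ge>no. norm (opa (mult_op (%x. if x \<in> zbox n then V x else 0)) - opa (mult_op V)) < e" by blast
qed

lemma det2S_zero: "finite F ==> (!!x y. M x y = 0) ==> det2S F M = 1" by (simp add: det2S_def detS_diagonal)

lemma ent_Rs:
 assumes d: "3 <= CARD('n::finite)" and z: "z \<in> ball 0 1" "z ~= 0" shows "ent (Rs (joukowski CARD('n) z) :: (int ^ 'n) opalg) x y = rho z (x - y)"
proof -
 have "resolv (joukowski CARD('n) z) (Rs (joukowski CARD('n) z) :: (int ^ 'n) opalg)" by (rule resolv_Rs[OF d joukowski_in_Lam[OF z]]) (use d in simp)
 from ent_shift_invariant[of "Rs (joukowski CARD('n) z)", OF resolv_Sh[OF this], of x y] show ?thesis using z by (simp add: rho_def)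
qed

text \<open>The bridge from operators to matrices: only rows in the box survive the truncation, and
  \<open>det2S_Ksq\<close> replaces V R by its symmetrised form.\<close>

lemma DN_eq_det2:
 fixes V :: "int ^ 'n::finite => complex"
 assumes d: "3 <= CARD('n)" and z: "z \<in> ball 0 1" "z ~= 0" and b: "bounded (range V)"
 defines "v \<equiv> %N x. if x \<in> zbox N then V x else 0" and "R \<equiv> Rs (joukowski CARD('n) z) :: (int ^ 'n) opalg"
 shows "det2 (rep (opa (mult_op (v N))*R)) = DN V N z" and "clin (opa (mult_op (v N))*R)" "supp_in (zbox N) (opa (mult_op (v N))*R)"
  and "ent (opa (mult_op (v N))*R) x y = v N x*rho z (x - y)"
proof -
 obtain M where "!!x. cmod (V x) <= M" using b by (auto simp: bounded_iff)
 hence "cmod (v N x) <= M" for x by (auto simp: v_def intro: order_trans[OF norm_ge_zero])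
 hence bv: "bounded (range (v N))" by (rule bounded_of_le)
 have "resolv (joukowski CARD('n) z) R" unfolding R_def by (rule resolv_Rs[OF d joukowski_in_Lam[OF z]]) (use d in simp)
 hence cR: "clin R" by (rule resolv_clin)
 show c: "clin (opa (mult_op (v N))*R)" by (intro clin_closed clin_mult_op bv cR)
 show s: "supp_in (zbox N) (opa (mult_op (v N))*R)" unfolding supp_in_def coord_mult_op_mult[OF bv] by (simp add: v_def)
 show e: "ent (opa (mult_op (v N))*R) x y = v N x*rho z (x - y)" for x y unfolding ent_mult_op_mult[OF bv] R_def ent_Rs[OF d z] ..
 have e': "ent (opa (mult_op (v N))*R) x y = V x*rho z (x - y)" if "x \<in> zbox N" for x y using that by (simp only: e) (simp add: v_def)
 have "det2 (rep (opa (mult_op (v N))*R)) = det2S (zbox N) (ent (opa (mult_op (v N))*R))" by (rule det2_finite[OF finite_zbox c s])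
 also have "... = det2S (zbox N) (%x y. V x*rho z (x - y))"
  unfolding det2S_def by (intro arg_cong2[where f = "(*)"] detS_cong arg_cong[where f = exp] arg_cong[where f = uminus] sum.cong)
   (simp_all only: e' diff_self)
 finally show "det2 (rep (opa (mult_op (v N))*R)) = DN V N z" by (simp add: DN_def det2S_Ksq finite_zbox)
qed

text \<open>Convergence at a fixed interior z, where the resolvent is bounded. Since p <= 2 puts V
  into l^2, the row bounds |V x| \<open>w x\<close> are summable; uniformity in z is supplied
  separately by \<open>norm_DN_le\<close>.\<close>

lemma DN_tendsto:
 fixes V :: "int ^ 'n::finite => complex"
 assumes d: "3 <= CARD('n)" and V: "in_lp p V" and p: "1 <= p" "p <= 2" and z: "z \<in> ball 0 1"
 shows "(%N. DN V N z) \<longlonglongrightarrow> modD V z"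
proof (cases "z = 0")
 case True
 thus ?thesis by (simp add: DN_def modD_def Ksq_def rho_def det2S_zero finite_zbox)
next
 case False
 define R where "R = (Rs (joukowski CARD('n) z) :: (int ^ 'n) opalg)"
 define v where "v = (%N x. if x \<in> zbox N then V x else 0)"
 have b: "bounded (range V)" using norm_le_lp_norm[OF V p(1)] by (rule bounded_of_le)
 have rR: "resolv (joukowski CARD('n) z) R" unfolding R_def by (rule resolv_Rs[OF d joukowski_in_Lam[OF z False]]) (use d in simp)
 note cR = resolv_clin[OF rR]
 obtain S where S: "0 <= S" "!!F. finite F ==> (\<Sum>x\<in>F. (cmod (V x))^2) <= S" using in_lp_imp_square_sums[OF V p] by blast
 have eR: "ent R x y = rho z (x - y)" for x y unfolding R_def by (rule ent_Rs[OF d z False])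
 let ?f = "%x y. (cmod (ent R x y) * cmod (V y))^2"
 have col: "(\<Sum>x\<in>X. (cmod (ent R x y))^2) <= (norm R)^2" if "finite X" for X y
 proof -
  have "L2_set (%x. cmod (coord (rep R (delta y)) x)) X <= norm (rep R (delta y))" by (rule L2_set_coord_le[OF that])
  also have "... <= norm R*norm (delta y)" unfolding norm_opalg_def by (rule norm_blinfun)
  also have "... <= norm R*1" by (intro mult_left_mono norm_delta_le) simp
  finally show ?thesis unfolding ent_def L2_set_def by (simp add: sqrt_le_D)
 qed
 have fs: "(\<Sum>y\<in>F. ?f x y) <= (norm R)^2*S" if "finite F" for F x
 proof -
  have "(\<Sum>y\<in>F. ?f x y) <= (\<Sum>y\<in>F. (norm R)^2*(cmod (V y))^2)"
   unfolding power_mult_distrib by (intro sum_mono mult_right_mono power_mono norm_ent_le) auto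
  also have "... <= (norm R)^2*S" unfolding sum_distrib_left[symmetric] by (intro mult_left_mono S that) auto
  finally show ?thesis .
 qed
 have sm: "?f x summable_on UNIV" for x by (rule nonneg_bdd_above_summable_on) (auto intro!: bdd_aboveI[of _ "(norm R)^2*S"] fs)
 \<comment> \<open>The l^2 norm of row x of R V over the whole lattice, hence valid for every box.
   Summing the squares over x first uses that the columns of R have norm at most
   \<open>norm R\<close>.\<close>
 define w where "w = (%x. sqrt (infsum (?f x) UNIV))"
 have w0: "0 <= w x" for x by (simp add: w_def infsum_nonneg)
 have w2: "(w x)^2 = infsum (?f x) UNIV" for x by (simp add: w_def infsum_nonneg)
 have wF: "(\<Sum>y\<in>F. ?f x y) <= (w x)^2" if "finite F" for F x unfolding w2 by (rule finite_sum_le_infsum[OF sm that]) auto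
 have wX: "(\<Sum>x\<in>X. (w x)^2) <= (norm R)^2*S" if X: "finite X" for X
 proof -
  have "((%y. \<Sum>x\<in>X. ?f x y) has_sum (\<Sum>x\<in>X. (w x)^2)) UNIV" unfolding w2 by (intro has_sum_finite_sum X has_sum_infsum sm)
  thus ?thesis
  proof (rule has_sum_le_finite_sums)
   fix F :: "(int ^ 'n) set" assume F: "finite F"
   have "(\<Sum>y\<in>F. \<Sum>x\<in>X. ?f x y) = (\<Sum>y\<in>F. (\<Sum>x\<in>X. (cmod (ent R x y))^2)*(cmod (V y))^2)"
    unfolding power_mult_distrib sum_distrib_right ..
   also have "... <= (\<Sum>y\<in>F. (norm R)^2*(cmod (V y))^2)" by (intro sum_mono mult_right_mono col X) auto
   also have "... <= (norm R)^2*S" unfolding sum_distrib_left[symmetric] by (intro mult_left_mono S F) auto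
   finally show "(\<Sum>y\<in>F. \<Sum>x\<in>X. ?f x y) <= (norm R)^2*S" .
  qed
 qed
 have "(%N. det2 (rep (opa (mult_op (v N))*R))) \<longlonglongrightarrow> det2 (rep (opa (mult_op V)*R))"
 proof (rule det2_tendsto[where b = "%x. cmod (V x)*w x*norm R" and be = "(S + (norm R)^2*S)/2*norm R"])
  show "clin (opa (mult_op (v N))*R)" for N unfolding v_def R_def by (rule DN_eq_det2(2)[OF d z False b])
  show "(%N. opa (mult_op (v N))*R) \<longlonglongrightarrow> opa (mult_op V)*R"
   unfolding v_def by (intro tendsto_mult tendsto_const truncation_tendsto[OF V p(1)])
  show "clin (opa (mult_op V)*R)" by (intro clin_closed clin_mult_op b cR)
  show "cmod (coord (rep (opa (mult_op (v N))*R*(opa (mult_op (v N))*R)) f) x) <= cmod (V x)*w x*norm R*norm f" for N x f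
   by (rule row_bound_square[OF cR resolv_Sh[OF rR] finite_zbox[of N] _ norm_le_lp_norm[OF V p(1)] wF[OF finite_zbox] w0]) (simp add: v_def)
  show "0 <= cmod (V x)*w x*norm R" for x by (simp add: w0)
  show "(\<Sum>x\<in>X. cmod (V x)*w x*norm R) <= (S + (norm R)^2*S)/2*norm R" if X: "finite X" for X
  proof -
   have "(\<Sum>x\<in>X. cmod (V x)*w x) <= (\<Sum>x\<in>X. ((cmod (V x))^2 + (w x)^2)/2)"
   proof (intro sum_mono)
    fix x
    show "cmod (V x)*w x <= ((cmod (V x))^2 + (w x)^2)/2" using sum_squares_bound[of "cmod (V x)" "w x"] by simp
   qed
   also have "... <= (S + (norm R)^2*S)/2" unfolding sum_divide_distrib[symmetric] sum.distrib using S(2)[OF X] wX[OF X] by simp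
   finally show ?thesis unfolding sum_distrib_right[symmetric] by (intro mult_right_mono) auto
  qed
 qed
 moreover have "modD V z = det2 (rep (opa (mult_op V)*R))" using False by (simp add: modD_def calD_def rep_simps R_def)
 moreover have "det2 (rep (opa (mult_op (v N))*R)) = DN V N z" for N unfolding v_def R_def by (rule DN_eq_det2(1)[OF d z False b])
 ultimately show ?thesis by simp
qed

lemma ker_bound_mono:
 assumes kb: "ker_bound p g C" and p: "1 <= p" and h: "!!n. 0 <= h n" "!!n. h n <= g n" shows "ker_bound p h C"
proof -
 have "(\<Sum>n\<in>G. h n powr (p/(p - 1))) <= C powr (p/(p - 1))" if "p ~= 1" "finite G" for G
 proof -
  have "(\<Sum>n\<in>G. h n powr (p/(p - 1))) <= (\<Sum>n\<in>G. g n powr (p/(p - 1)))" using p h by (intro sum_mono powr_mono2) auto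
  also have "... <= C powr (p/(p - 1))" using kb that by (simp add: ker_bound_def)
  finally show ?thesis .
 qed
 moreover have "h n <= C" if "p = 1" for n using kb that h(2)[of n] by (auto simp: ker_bound_def intro: order_trans)
 ultimately show ?thesis using kb by (auto simp: ker_bound_def)
qed

lemma ker_bound_rho:
 assumes "3 <= CARD('n::finite)" "z \<in> ball 0 1" "1 <= p" "ker_bound p (kmaj :: int ^ 'n => real) C"
 shows "ker_bound p (%n :: int ^ 'n. cmod (rho z n)) C" by (rule ker_bound_mono[OF assms(4,3)]) (auto intro: norm_rho_le assms)

lemma DN_holomorphic:
 assumes d: "3 <= CARD('n)" shows "(%z. DN (V :: int ^ 'n::finite => complex) N z) holomorphic_on ball 0 1" unfolding DN_def Ksq_def
 by (intro det2S_holomorphic holomorphic_intros rho_holomorphic d)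

lemma norm_DN_le:
 fixes V :: "int ^ 'n::finite => complex"
 assumes d: "3 <= CARD('n)" and V: "in_lp p V" and p: "1 <= p" "p <= 2" and z: "z \<in> ball 0 1" and kb: "ker_bound p (kmaj :: int ^ 'n => real) C"
 shows "cmod (DN V N z) <= exp (C^2*(lp_norm p V)^2/2)"
proof -
 have "hsS (zbox N) (Ksq V (rho z)) <= C*lp_norm p V" by (rule hsS_Ksq_le[OF p finite_zbox V ker_bound_rho[OF d z p(1) kb]])
 hence "(hsS (zbox N) (Ksq V (rho z)))^2 <= (C*lp_norm p V)^2" by (intro power_mono hsS_nonneg)
 hence "exp ((hsS (zbox N) (Ksq V (rho z)))^2/2) <= exp (C^2*(lp_norm p V)^2/2)" by (simp add: power_mult_distrib)
 thus ?thesis unfolding DN_def by (rule order_trans[OF det2S_bound[OF finite_zbox]])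
qed

lemma norm_modD_le:
 fixes V :: "int ^ 'n::finite => complex"
 assumes d: "3 <= CARD('n)" and V: "in_lp p V" and p: "1 <= p" "p <= 2" and z: "z \<in> ball 0 1" and kb: "ker_bound p (kmaj :: int ^ 'n => real) C"
 shows "cmod (modD V z) <= exp (C^2*(lp_norm p V)^2/2)" by (rule tendsto_upperbound[OF tendsto_norm[OF DN_tendsto[OF d V p z]]])
  (auto intro!: always_eventually norm_DN_le[OF d V p z kb])

text \<open>The truncated determinants are uniformly bounded, so Montel's theorem gives an analytic
  limit of a subsequence, which the pointwise limit identifies.\<close>

lemma modD_holomorphic:
 fixes V :: "int ^ 'n::finite => complex"
 assumes d: "3 <= CARD('n)" and V: "in_lp p V" and p: "1 <= p" "p <= 2" and kb: "ker_bound p (kmaj :: int ^ 'n => real) C"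
 shows "modD V holomorphic_on ball 0 1"
proof -
 obtain g r where g: "g holomorphic_on ball 0 1" "strict_mono (r :: nat => nat)"
   "!!x. x \<in> ball 0 1 ==> ((%n. DN V (r n) x) \<longlongrightarrow> g x) sequentially"
 proof (rule Montel[of "ball 0 1" "range (DN V)" "DN V"])
  show "h holomorphic_on ball 0 1" if "h \<in> range (DN V)" for h using that DN_holomorphic[OF d] by auto
  show "\<exists>B. \<forall>h\<in>range (DN V). \<forall>z\<in>K. cmod (h z) <= B" if "K \<subseteq> ball 0 1" for K
   using norm_DN_le[OF d V p _ kb] that by (intro exI[of _ "exp (C^2*(lp_norm p V)^2/2)"]) auto
 qed auto
 have "g z = modD V z" if "z \<in> ball 0 1" for z
  using LIMSEQ_unique[OF g(3)[OF that] LIMSEQ_subseq_LIMSEQ[OF DN_tendsto[OF d V p that] g(2), unfolded o_def]] .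
 thus ?thesis by (rule holomorphic_transform[OF g(1)])
qed

text \<open>Interpolation of the uniform Hoelder estimate of the kernel with an \<open>l\<^sup>s\<close> bound of smaller
  exponent \<open>s\<close>.\<close>

lemma ker_bound_rho_diff:
 assumes d: "3 <= CARD('n::finite)" and p: "1 <= p"
  and lq: "1 < p ==> \<exists>s B. 0 < s \<and> s < p/(p - 1) \<and> (\<forall>G. finite G --> (\<Sum>n\<in>G. kmaj (n :: int ^ 'n) powr s) <= B)"
 shows "\<exists>al c. 0 < al \<and> al <= 1 \<and> 0 <= c \<and> (\<forall>z\<in>ball 0 1. \<forall>w\<in>ball 0 1.
  ker_bound p (%n :: int ^ 'n. cmod (rho z n - rho w n)) (c * cmod (z - w) powr al))"
proof -
 obtain K where K: "0 <= K" "!!z w n. z \<in> ball 0 1 ==> w \<in> ball 0 1 ==>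
   cmod (rho z (n :: int ^ 'n) - rho w n) <= K * cmod (z - w) powr (1/4)" using rho_hoelder[OF d] by blast
 show ?thesis
 proof (cases "p = 1")
  case True
  show ?thesis by (rule exI[of _ "1/4"], rule exI[of _ K]) (use K True in \<open>auto simp: ker_bound_def\<close>)
 next
  case False
  hence p1: "1 < p" using p by simp
  define q where "q = p/(p - 1)"
  obtain s B where s: "0 < s" "s < q" "!!G. finite G ==> (\<Sum>n\<in>G. kmaj (n :: int ^ 'n) powr s) <= B" using lq[OF p1] unfolding q_def by blast
  have q0: "0 < q" using s by simp
  have B0: "0 <= B" using s(3)[of "{}"] by simp
  define E where "E = K powr (q - s)*(2 powr s*B)"
  define c where "c = E powr (1/q)"
  \<comment> \<open>Of the q powers of the difference, q - s are estimated by the Hoelder bound with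
    exponent 1/4 and s by summability; the q-th root gives this exponent.\<close>
  define al where "al = (q - s)/(4*q)"
  have E0: "0 <= E" using B0 by (simp add: E_def)
  have "ker_bound p (%n :: int ^ 'n. cmod (rho z n - rho w n)) (c * cmod (z - w) powr al)"
   if z: "z \<in> ball 0 1" and w: "w \<in> ball 0 1" for z w
  proof -
   let ?h = "cmod (z - w)" and ?D = "%n :: int ^ 'n. cmod (rho z n - rho w n)"
   have "(\<Sum>n\<in>G. ?D n powr q) <= (c*?h powr al) powr q" if G: "finite G" for G
   proof -
    have 1: "?D n powr q <= (K*?h powr (1/4)) powr (q - s)*(2 powr s*kmaj n powr s)" for n
    proof -
     have b: "?D n <= 2*kmaj n" using norm_triangle_ineq4[of "rho z n" "rho w n"] norm_rho_le[OF d z, of n] norm_rho_le[OF d w, of n] by linarith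
     have "?D n powr q = ?D n powr (q - s)*?D n powr s" by (simp add: powr_add[symmetric])
     also have "... <= (K*?h powr (1/4)) powr (q - s)*(2*kmaj n) powr s" using s b by (intro mult_mono powr_mono2 K z w) auto
     finally show ?thesis using kmaj_nonneg[of n] by (simp add: powr_mult)
    qed
    have "(\<Sum>n\<in>G. ?D n powr q) <= (\<Sum>n\<in>G. (K*?h powr (1/4)) powr (q - s)*(2 powr s*kmaj n powr s))" by (intro sum_mono 1)
    also have "... = (K*?h powr (1/4)) powr (q - s)*(2 powr s*(\<Sum>n\<in>G. kmaj n powr s))" by (simp add: sum_distrib_left)
    also have "... <= (K*?h powr (1/4)) powr (q - s)*(2 powr s*B)" by (intro mult_left_mono s(3) G) auto
    also have "... = E*?h powr (al*q)"
    proof -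
     have "1/4*(q - s) = al*q" using q0 by (simp add: al_def)
     hence "(K*?h powr (1/4)) powr (q - s) = K powr (q - s)*?h powr (al*q)" using K(1) by (simp add: powr_mult powr_powr)
     thus ?thesis by (simp add: E_def)
    qed
    also have "... = (c*?h powr al) powr q"
    proof -
     have "c powr q = E" unfolding c_def using E0 q0 by (intro powr_inverse_cancel) auto
     thus ?thesis by (simp add: powr_mult powr_powr c_def)
    qed
    finally show ?thesis .
   qed
   thus ?thesis using False by (simp add: ker_bound_def q_def c_def)
  qed
  moreover have "0 < al" "al <= 1" using s by (auto simp: al_def field_simps)
  moreover have "0 <= c" by (simp add: c_def)
  ultimately show ?thesis by blast
 qed
qed

lemma modD_hoelder_interior:
 fixes V :: "int ^ 'n::finite => complex"
 assumes d: "3 <= CARD('n)" and V: "in_lp p V" and p: "1 <= p" "p <= 2" and kb: "ker_bound p (kmaj :: int ^ 'n => real) C"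
  and al: "!!z w. z \<in> ball 0 1 ==> w \<in> ball 0 1 ==>
   ker_bound p (%n :: int ^ 'n. cmod (rho z n - rho w n)) (c * cmod (z - w) powr al)" and z: "z \<in> ball 0 1" and w: "w \<in> ball 0 1"
 shows "cmod (modD V z - modD V w) <= c*lp_norm p V*exp ((2*(C*lp_norm p V) + 1)^2/2) * cmod (z - w) powr al"
proof -
 let ?L = "exp ((2*(C*lp_norm p V) + 1)^2/2)"
 have "cmod (DN V N z - DN V N w) <= c*lp_norm p V*?L * cmod (z - w) powr al" for N
 proof -
  have hz: "hsS (zbox N) (Ksq V (rho z)) <= C*lp_norm p V" if "z \<in> ball 0 1" for z
   by (rule hsS_Ksq_le[OF p finite_zbox V ker_bound_rho[OF d that p(1) kb]])
  have "(%x y. Ksq V (rho z) x y - Ksq V (rho w) x y) = Ksq V (%n. rho z n - rho w n)" by (intro ext) (simp add: Ksq_def algebra_simps)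
  hence hd: "hsS (zbox N) (%x y. Ksq V (rho z) x y - Ksq V (rho w) x y) <= c * cmod (z - w) powr al*lp_norm p V"
   using hsS_Ksq_le[OF p finite_zbox V al[OF z w]] by simp
  have "cmod (DN V N z - DN V N w) <= hsS (zbox N) (%x y. Ksq V (rho z) x y - Ksq V (rho w) x y)*?L"
   unfolding DN_def by (rule det2S_lipschitz[OF finite_zbox hz[OF z] hz[OF w]])
  also have "... <= c * cmod (z - w) powr al*lp_norm p V*?L" by (intro mult_right_mono hd) auto
  finally show ?thesis by (simp add: mult_ac)
 qed
 thus ?thesis by (intro tendsto_upperbound[OF tendsto_norm[OF tendsto_diff[OF DN_tendsto[OF d V p z] DN_tendsto[OF d V p w]]]])
   auto
qed

text \<open>The Hoelder estimate gives uniform continuity, hence a continuous extension to the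
  closed disc; the estimate passes to the extension along radii.\<close>

lemma holder_up_to_boundaryI:
 assumes h: "!!z w. z \<in> ball 0 1 ==> w \<in> ball 0 1 ==> cmod (F z - F w) <= c * cmod (z - w) powr al" and al: "0 < al" "al <= 1"
 shows "holder_up_to_boundary F"
proof -
 \<comment> \<open>A positive constant is required for the division in the modulus of
   continuity.\<close>
 define c' where "c' = max c 1"
 have h': "cmod (F z - F w) <= c' * cmod (z - w) powr al" if "z \<in> ball 0 1" "w \<in> ball 0 1" for z w
  using h[OF that] mult_right_mono[of c c' "cmod (z - w) powr al"] by (simp add: c'_def)
 have c': "0 < c'" by (simp add: c'_def)
 have "uniformly_continuous_on (ball 0 1) F" unfolding uniformly_continuous_on_def
 proof (intro allI impI)
  fix e :: real assume e: "0 < e"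
  define de where "de = (e / c') powr (1/al)"
  have "0 < de" using e c' by (simp add: de_def)
  moreover have "dist (F w) (F z) < e" if "z \<in> ball 0 1" "w \<in> ball 0 1" "dist w z < de" for z w
  proof -
   have "cmod (w - z) powr al < de powr al" using that al by (intro powr_less_mono2) (auto simp: dist_norm)
   also have "de powr al = e / c'" using e c' al unfolding de_def by (intro powr_inverse_cancel) auto
   finally have "c' * cmod (w - z) powr al < e" using c' by (simp add: field_simps)
   thus ?thesis using h'[OF that(2,1)] by (simp add: dist_norm)
  qed
  ultimately show "\<exists>de>0. \<forall>z\<in>ball 0 1. \<forall>w\<in>ball 0 1. dist w z < de --> dist (F w) (F z) < e" by blast
 qed
 then obtain G where G: "uniformly_continuous_on (closure (ball 0 1)) G" "!!x. x \<in> ball 0 1 ==> F x = G x"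
  using uniformly_continuous_on_extension_on_closure by metis
 have cG: "continuous_on (cball 0 1) G" using uniformly_continuous_imp_continuous[OF G(1)] by simp
 define r where "r = (%k::nat. 1 - inverse (real (Suc k)))"
 have r: "r \<longlonglongrightarrow> 1" using tendsto_diff[OF tendsto_const[of 1] LIMSEQ_inverse_real_of_nat] by (simp add: r_def)
 have r01: "0 <= r k" "r k < 1" for k by (auto simp: r_def field_simps)
 have rb: "of_real (r k)*z \<in> ball 0 1" if "z \<in> cball 0 1" for z :: complex and k
 proof -
  have "r k * cmod z <= r k*1" using that r01[of k] by (intro mult_left_mono) auto
  thus ?thesis using r01[of k] by (simp add: norm_mult)
 qed
 have rl: "(%k. of_real (r k)*z) \<longlonglongrightarrow> z" for z :: complex
  using tendsto_mult[OF tendsto_of_real[OF r] tendsto_const[of z]] by simp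
 have Gl: "(%k. G (of_real (r k)*z)) \<longlonglongrightarrow> G z" if "z \<in> cball 0 1" for z
  by (rule continuous_on_tendsto_compose[OF cG rl that]) (use rb[OF that] in \<open>auto simp: less_imp_le\<close>)
 have "cmod (G z - G w) <= c' * cmod (z - w) powr al" if z: "z \<in> cball 0 1" and w: "w \<in> cball 0 1" for z w
 proof (rule LIMSEQ_le)
  show "(%k. cmod (G (of_real (r k)*z) - G (of_real (r k)*w))) \<longlonglongrightarrow> cmod (G z - G w)" by (intro tendsto_norm tendsto_diff Gl z w)
  show "(%k. c' * cmod (of_real (r k)*z - of_real (r k)*w) powr al) \<longlonglongrightarrow> c' * cmod (z - w) powr al"
   using al by (intro tendsto_mult tendsto_const tendsto_powr' tendsto_norm tendsto_diff rl) auto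
  show "\<exists>N. \<forall>k\<ge>N. cmod (G (of_real (r k)*z) - G (of_real (r k)*w)) <= c' * cmod (of_real (r k)*z - of_real (r k)*w) powr al"
   using h'[OF rb[OF z] rb[OF w]] G(2)[OF rb[OF z]] G(2)[OF rb[OF w]] by simp
 qed
 moreover have "\<forall>z\<in>ball 0 1. G z = F z" using G(2) by simp
 ultimately show ?thesis unfolding holder_up_to_boundary_def using al by blast
qed

section \<open>Comparison with the constant of the theorem\<close>

lemma kap_nonneg:
 assumes "3 <= d" "1 <= p" "d = 3 ==> p < 6/5" "4 <= d ==> p < 4/3" shows "0 <= kap p d"
proof -
 consider "d = 3" | "d = 4" | "5 <= d" using assms by linarith
 thus ?thesis
 proof cases
  case 3
  have "(2*real d + 1)*p <= (2*real d + 1)*(4/3)" using assms 3 by (intro mult_left_mono) auto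
  also have "... <= 3*real d" using 3 by simp
  finally show ?thesis using 3 assms by (auto simp: kap_def intro!: divide_nonneg_nonneg)
 qed (use assms in \<open>auto simp: kap_def\<close>)
qed

lemma Gam_ge_1:
 assumes "3 <= d" "1 <= p" "d = 3 ==> p < 6/5" "4 <= d ==> p < 4/3" shows "1 <= Gam p d"
 unfolding Gam_def using kap_nonneg[OF assms] assms by (intro ge_one_powr_ge_zero) auto

lemma Cpd_ge_1: "1 <= p ==> 1 <= Cpd p d" unfolding Cpd_def by (auto intro!: ge_one_powr_ge_zero)

text \<open>For d = 5 the fourth power of 2^(5/4) is compared with (29/14)^4. For d >= 6 write d/4 =
  1 + y; a tangent line of the exponential gives 2^y >= e (ln 2) y >= (5/3) y, whence 35/3 > 11 for
  every d.\<close>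

lemma Cd0_high_dim:
 assumes "5 <= d" shows "(if d = 5 then 29 else 11) <= Cd0 d"
proof (cases "d = 5")
 case True
 have "(29/14 :: real)^4 <= (2 powr (5/4))^4"
 proof -
  have "(2 powr (5/4))^4 = 2 powr (5/4*4 :: real)" by (simp add: powr_powr powr_numeral[symmetric] del: powr_numeral)
  also have "... = 32" by (simp add: powr_numeral)
  finally show ?thesis by (simp add: eval_nat_numeral)
 qed
 hence "29/14 <= 2 powr (5/4 :: real)" by (rule power_le_imp_le_base[where n = 3, simplified]) auto
 thus ?thesis using True by (simp add: Cd0_def)
next
 case False
 define y where "y = (real d - 4)/4"
 have y0: "0 < y" using assms by (simp add: y_def)
 have "5/2 <= exp (1::real)" using exp_lower_Taylor_quadratic[of 1] by simp
 hence "5/2*(2/3*y) <= exp 1*(ln 2*y)" using y0 ln2_ge_two_thirds by (intro mult_mono) auto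
 also have "ln 2*y <= exp (ln 2*y - 1)" using exp_ge_add_one_self[of "ln 2*y - 1"] by simp
 hence "exp 1*(ln 2*y) <= exp 1*exp (ln 2*y - 1)" by (intro mult_left_mono) auto
 also have "... = 2 powr y" by (simp add: exp_add[symmetric] powr_def mult.commute)
 finally have "5/3*y <= 2 powr y" by simp
 moreover have "2 powr (real d/4) = 2*2 powr y"
 proof -
  have e: "real d/4 = 1 + y" by (simp add: y_def field_simps)
  show ?thesis unfolding e by (simp add: powr_add)
 qed
 ultimately have "10/3*y <= 2 powr (real d/4)" by simp
 hence "14*(10/3*y)/(4*y) <= 14*2 powr (real d/4)/(4*y)" using y0 by (intro divide_right_mono) auto
 moreover have "4*y = real d - 4" by (simp add: y_def)
 moreover have "14*(10/3*y)/(4*y) = 35/3" using y0 by simp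
 ultimately show ?thesis using False assms by (simp add: Cd0_def)
qed

text \<open>This explains the exponent in \<open>kap\<close> for d = 4: it equals (1 + be)/be with
  be = 4 (p - 1)/p, so that the outer power be in \<open>Gam\<close> produces the power 1 + be of
  1/(1 - be) that appears in \<open>lq_bound_dim4\<close>.\<close>

lemma Gam_dim4_ge:
 assumes p: "1 < p" "p < 4/3"
 defines "be \<equiv> 4*(p - 1)/p" shows "2 powr be*(4/(1 - be)) powr (1 + be) <= Gam p 4"
proof -
 have be: "0 < be" "be < 1" using p by (auto simp: be_def field_simps)
 have de: "1 - be = (4 - 3*p)/p" using p by (simp add: be_def field_simps)
 have "4/(1 - be) <= (5*p - 1)/(4 - 3*p)" unfolding de using p by (simp add: divide_right_mono)
 hence "(4/(1 - be)) powr ((1 + be)/be) <= ((5*p - 1)/(4 - 3*p)) powr ((1 + be)/be)" using be by (intro powr_mono2) auto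
 also have "(1 + be)/be = (5*p - 4)/(4*(p - 1))" using p by (simp add: be_def field_simps)
 finally have k: "(4/(1 - be)) powr ((1 + be)/be) <= kap p 4" by (simp add: kap_def \<open>(1 + be)/be = _\<close>)
 have "2 powr be*(4/(1 - be)) powr (1 + be) = (2*(4/(1 - be)) powr ((1 + be)/be)) powr be" using be by (simp add: powr_mult powr_powr)
 also have "... <= (3 + 2*kap p 4) powr be" using k be by (intro powr_mono2) auto
 finally show ?thesis by (simp add: Gam_def be_def)
qed

text \<open>Once the common factor (1/(1 - be))^(1 + be) is split off, the claim is
  \<open>key\<close>. Up to be = 4/5 the denominator 1 + de >= 12/10 decides, giving 15.5 < 16;
  beyond, (62/10)^de <= 5/2 is small enough.\<close>

lemma dim4_constant_le:
 assumes p: "1 < p" "p < 4/3"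
 defines "be \<equiv> 4*(p - 1)/p" shows "1/2 + 1/2*(276/100/(1 - be)) powr be*(62/10) powr (1 - be)*(6/((1 - be)*(2 - be))) <= Cstar p 4"
proof -
 define de where "de = 1 - be"
 have be: "0 < be" "be < 1" using p by (auto simp: be_def field_simps)
 hence de: "0 < de" "de < 1" by (auto simp: de_def)
 have key: "3*((276/100) powr be*(62/10) powr de)/(1 + de) <= 16*8 powr be"
 proof (cases "be <= 4/5")
  case True
  have "(62/10) powr de <= (62/10) powr (1::real)" using de by (intro powr_mono) auto
  hence "(276/100) powr be*(62/10) powr de <= 8 powr be*(62/10)" using be by (intro mult_mono powr_mono2) auto
  hence "3*((276/100) powr be*(62/10) powr de)/(1 + de) <= 3*(8 powr be*(62/10))/(12/10)"
   using True de by (intro frac_le mult_left_mono) (auto simp: de_def)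
  also have "... <= 16*8 powr be" by simp
  finally show ?thesis .
 next
  case False
  have "(62/10) powr de <= (62/10) powr (1/2)" using False by (intro powr_mono) (auto simp: de_def)
  also have "... = sqrt (62/10)" by (simp add: powr_half_sqrt)
  also have "... <= 5/2" by (rule real_le_lsqrt) (simp_all add: power2_eq_square)
  finally have "(276/100) powr be*(62/10) powr de <= 8 powr be*(5/2)" using be by (intro mult_mono powr_mono2) auto
  hence "3*((276/100) powr be*(62/10) powr de)/(1 + de) <= 3*(8 powr be*(5/2))/1" using de by (intro frac_le mult_left_mono) auto
  also have "... <= 16*8 powr be" by simp
  finally show ?thesis .
 qed
 have "1/2*(276/100/de) powr be*(62/10) powr de*(6/(de*(1 + de))) = 3*((276/100) powr be*(62/10) powr de)/(1 + de)*(1/de) powr (1 + be)"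
 proof -
  have a: "(276/100/de) powr be = (276/100) powr be*(1/de) powr be" using powr_mult[of "276/100" "1/de" be] de by simp
  have b: "(1/de) powr (1 + be) = (1/de) powr be/de" using de by (simp add: powr_add)
  have "1/2*(A*B)*C*(6/(de*(1 + de))) = 3*(A*C)/(1 + de)*(B/de)" for A B C :: real using de by (simp add: divide_simps)
  thus ?thesis unfolding a b .
 qed
 also have "... <= 16*8 powr be*(1/de) powr (1 + be)" by (intro mult_right_mono key) auto
 also have "... = 4*(2 powr be*(4/de) powr (1 + be))"
 proof -
  have "(4/de) powr (1 + be) = 4 powr (1 + be)*(1/de) powr (1 + be)" using powr_mult[of 4 "1/de" "1 + be"] de by simp
  moreover have "(8 :: real) powr be = 2 powr be*4 powr be" using powr_mult[of 2 4 be] by simp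
  moreover have "(4 :: real) powr (1 + be) = 4*4 powr be" by (simp add: powr_add)
  ultimately show ?thesis by simp
 qed
 also have "... <= 4*Gam p 4" using Gam_dim4_ge[OF p] by (intro mult_left_mono) (simp_all add: de_def be_def)
 finally have "1/2*(276/100/de) powr be*(62/10) powr de*(6/(de*(1 + de))) <= 4*Gam p 4" .
 moreover have e: "2 - be = 1 + de" by (simp add: de_def)
 moreover have "1 <= Cpd p 4" using p by (intro Cpd_ge_1) auto
 moreover have "Cstar p 4 = Cpd p 4 + 4*Gam p 4" by (simp add: Cstar_def Cd0_def)
 ultimately show ?thesis unfolding de_def[symmetric] e by linarith
qed

text \<open>The restriction on p is q > 6 for d = 3 and q > 4 for d >= 4. In dimension 3 the factor
  5 is compared with 16, in dimension 4 the p-dependent constant with 4 \<open>Gam\<close>, and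
  above it 29 or 11 with \<open>Cd0\<close>.\<close>

lemma kmaj_lq_bounds:
 assumes d: "3 <= CARD('n::finite)" and p: "1 < p" "CARD('n) = 3 ==> p < 6/5" "CARD('n) >= 4 ==> p < 4/3" and G: "finite (G :: (int ^ 'n) set)"
 shows "(\<Sum>n\<in>G. kmaj n powr (p/(p - 1))) <= Cstar p CARD('n) powr (p/(p - 1))"
proof -
 let ?q = "p/(p - 1)"
 have q0: "0 <= ?q" using p by simp
 have km: "ennreal (kmaj n) <= (nni (%t. evb n t) {0<..})" for n :: "int ^ 'n" using ennreal_kmaj[OF d] by simp
 have Gm: "1 <= Gam p CARD('n)" using d p by (intro Gam_ge_1) auto
 have Cp: "1 <= Cpd p CARD('n)" using p by (intro Cpd_ge_1) auto
 consider (3) "CARD('n) = 3" | (4) "CARD('n) = 4" | (5) "5 <= CARD('n)" using d by linarith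
 thus ?thesis
 proof cases
  case 3
  have q6: "6 < ?q" using p(1) p(2)[OF 3] by (simp add: field_simps)
  have "?q - 6 = (6 - 5*p)/(p - 1)" using p(1) by (simp add: field_simps)
  hence k: "6/(?q - 6) = kap p 3" by (simp add: kap_def)
  have "3/?q = real 3*(p - 1)/p" by simp
  hence "(\<Sum>n\<in>G. kmaj n powr ?q) <= (5*Gam p 3) powr ?q" using lq_bound_dim3[OF 3 q6 G kmaj_nonneg km] unfolding k Gam_def by simp
  also have "... <= Cstar p 3 powr ?q" using Gm Cp q0 unfolding 3 by (intro powr_mono2) (auto simp: Cstar_def Cd0_def)
  finally show ?thesis by (simp only: 3)
 next
  case 4
  have p4: "p < 4/3" using p(3) 4 by simp
  have q4: "4 < ?q" using p(1) p4 by (simp add: field_simps)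
  have b: "4/?q = 4*(p - 1)/p" by simp
  have b0: "0 < 4*(p - 1)/p" "4*(p - 1)/p < 1" using p(1) p4 by (auto simp: field_simps)
  have "(\<Sum>n\<in>G. kmaj n powr ?q) <= (1/2 + 1/2*(276/100/(1 - 4/?q)) powr (4/?q)*(62/10) powr (1 - 4/?q)*(6/((1 - 4/?q)*(2 - 4/?q)))) powr ?q"
   by (rule lq_bound_dim4[OF 4 q4 G kmaj_nonneg km])
  also have "... <= Cstar p 4 powr ?q" unfolding b using dim4_constant_le[OF p(1) p4] q0 b0 by (intro powr_mono2) auto
  finally show ?thesis by (simp only: 4)
 next
  case 5
  have q4: "4 <= ?q" using p(1) p(3) 5 by (simp add: field_simps)
  let ?C = "if CARD('n) = 5 then 29 else 11 :: real"
  have "(\<Sum>n\<in>G. kmaj n powr ?q) <= ?C powr ?q" by (rule lq_bound_high_dim[OF q4 G kmaj_nonneg km nn_integral_bmaj_high_dim[OF 5]]) auto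
  also have "... <= Cstar p CARD('n) powr ?q"
  proof (intro powr_mono2 q0)
   have "?C*1 <= Cd0 CARD('n)*Gam p CARD('n)"
    by (rule mult_mono[OF Cd0_high_dim[OF 5] Gm]) (use Cd0_high_dim[OF 5] in \<open>auto split: if_splits\<close>)
   thus "?C <= Cstar p CARD('n)" using Cp unfolding Cstar_def by linarith
  qed auto
  finally show ?thesis .
 qed
qed

lemma ker_bound_kmaj:
 assumes d: "3 <= CARD('n::finite)" and p: "1 <= p" "CARD('n) = 3 ==> p < 6/5" "CARD('n) >= 4 ==> p < 4/3"
 shows "ker_bound p (kmaj :: int ^ 'n => real) (Cstar p CARD('n))"
proof -
 have Gm: "1 <= Gam p CARD('n)" using d p by (intro Gam_ge_1) auto
 have Cp: "1 <= Cpd p CARD('n)" using p by (intro Cpd_ge_1) auto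
 have C0: "4 <= Cd0 CARD('n)"
 proof -
  consider "CARD('n) = 3" | "CARD('n) = 4" | "5 <= CARD('n)" using d by linarith
  thus ?thesis
  proof cases
   case 3
   thus ?thesis using Cd0_high_dim[OF 3] by (auto split: if_splits)
  qed (auto simp: Cd0_def)
 qed
 have "4*1 <= Cd0 CARD('n)*Gam p CARD('n)" using C0 Gm by (intro mult_mono) auto
 hence "5 <= Cstar p CARD('n)" using Cp unfolding Cstar_def by linarith
 hence "0 <= Cstar p CARD('n)" "kmaj n <= Cstar p CARD('n)" for n :: "int ^ 'n" using kmaj_le_5[OF d, of n] by linarith+
 thus ?thesis unfolding ker_bound_def using kmaj_lq_bounds[OF d _ p(2,3)] p(1) by auto
qed

text \<open>The admissible range of p is open above; a p' between p and its endpoint has a smaller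
  dual exponent, which leaves room for the interpolation in
  \<open>ker_bound_rho_diff\<close>.\<close>

lemma kmaj_smaller_exponent:
 assumes d: "3 <= CARD('n::finite)" and p: "1 < p" "CARD('n) = 3 ==> p < 6/5" "CARD('n) >= 4 ==> p < 4/3"
 shows "\<exists>s B. 0 < s \<and> s < p/(p - 1) \<and> (\<forall>G. finite G --> (\<Sum>n\<in>G. kmaj (n :: int ^ 'n) powr s) <= B)"
proof -
 define p0 where "p0 = (if CARD('n) = 3 then 6/5 else 4/3 :: real)"
 define p' where "p' = (p + p0)/2"
 have pp: "p < p0" using p d by (auto simp: p0_def)
 hence p': "1 < p'" "p < p'" "p' < p0" using p(1) by (auto simp: p'_def)
 have "p'/(p' - 1) < p/(p - 1)" using p' p(1) by (simp add: field_simps)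
 moreover have "0 < p'/(p' - 1)" using p' by simp
 moreover have "\<forall>G. finite G --> (\<Sum>n\<in>G. kmaj (n :: int ^ 'n) powr (p'/(p' - 1))) <= Cstar p' CARD('n) powr (p'/(p' - 1))"
  using kmaj_lq_bounds[OF d p'(1)] p'(3) by (auto simp: p0_def split: if_splits)
 ultimately show ?thesis by blast
qed

section \<open>Zeros\<close>

text \<open>Order by \<open>h\<close> and break ties by an encoding in the naturals. The rank of an
  element is its number of predecessors, finite by assumption; the ranks fill an initial segment of
  the naturals.\<close>

lemma enumerate_by_size:
 fixes h :: "'a => real"
 assumes cnt: "countable Z" and fin: "!!x. x \<in> Z ==> finite {y \<in> Z. h y <= h x}"
 shows "\<exists>(N::enat) g. bij_betw g (indices N) Z \<and> (\<forall>i\<in>indices N. \<forall>j\<in>indices N. i <= j --> h (g i) <= h (g j))"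
proof -
 define e where "e = to_nat_on Z"
 have inj: "inj_on e Z" unfolding e_def using cnt by (rule inj_on_to_nat_on)
 define lt where "lt = (%y x. h y < h x \<or> (h y = h x \<and> e y < e x))"
 define L where "L = (%x. {y \<in> Z. lt y x})"
 define rk where "rk = (%x. card (L x))"
 have Lfin: "finite (L x)" if "x \<in> Z" for x by (rule finite_subset[OF _ fin[OF that]]) (auto simp: L_def lt_def)
 have tot: "lt x y \<or> lt y x" if "x \<in> Z" "y \<in> Z" "x ~= y" for x y
  using inj that unfolding lt_def inj_on_def by (metis linorder_neqE_linordered_idom nat_neq_iff)
 have mono: "rk y < rk x" if "x \<in> Z" "y \<in> Z" "lt y x" for x y
 proof -
  have "L y \<subset> L x" using that by (auto simp: L_def lt_def)
  thus ?thesis unfolding rk_def by (rule psubset_card_mono[OF Lfin[OF that(1)]])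
 qed
 have rinj: "inj_on rk Z"
 proof (rule inj_onI, rule ccontr)
  fix x y assume a: "x \<in> Z" "y \<in> Z" "rk x = rk y" "x ~= y"
  from tot[OF a(1,2,4)] mono[OF a(1,2)] mono[OF a(2,1)] a(3) show False by auto
 qed
 have down: "\<exists>y\<in>Z. rk y = m" if x: "x \<in> Z" and m: "m < rk x" for x m
 proof -
  have "rk ` L x = {..<rk x}"
  proof (rule card_subset_eq)
   show "rk ` L x \<subseteq> {..<rk x}" using mono[OF x] by (auto simp: L_def)
   have "inj_on rk (L x)" using rinj by (rule inj_on_subset) (auto simp: L_def)
   thus "card (rk ` L x) = card {..<rk x}" by (simp add: card_image) (simp add: rk_def)
  qed simp
  hence "m \<in> rk ` L x" using m by simp
  thus ?thesis by (auto simp: L_def)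
 qed
 have hmono: "h x <= h y" if "x \<in> Z" "y \<in> Z" "rk x <= rk y" for x y
 proof (rule ccontr)
  assume "\<not> h x <= h y"
  hence "lt y x" by (simp add: lt_def)
  thus False using mono[OF that(1,2)] that(3) by simp
 qed
 define N where "N = (if finite Z then enat (card Z) else \<infinity>)"
 have img: "rk ` Z = {m. enat m < N}"
 proof (cases "finite Z")
  case True
  have "rk ` Z \<subseteq> {..<card Z}"
  proof
   fix m assume "m \<in> rk ` Z"
   then obtain x where x: "x \<in> Z" "m = rk x" by auto
   have "L x \<subset> Z" using x by (auto simp: L_def lt_def)
   thus "m \<in> {..<card Z}" unfolding x(2) rk_def using psubset_card_mono[OF True] by simp
  qed
  hence "rk ` Z = {..<card Z}" by (rule card_subset_eq[rotated]) (auto simp: card_image[OF rinj])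
  thus ?thesis using True by (auto simp: N_def)
 next
  case False
  hence inf: "infinite (rk ` Z)" using rinj finite_imageD by blast
  have "m \<in> rk ` Z" for m
  proof -
   obtain n where "n > m" "n \<in> rk ` Z" using inf by (metis infinite_nat_iff_unbounded)
   thus ?thesis using down by auto
  qed
  thus ?thesis using False by (auto simp: N_def)
 qed
 \<comment> \<open>Ranks start at 0 and \<open>indices\<close> at 1.\<close>
 define g where "g = (%j. the_inv_into Z rk (j - 1))"
 have b1: "bij_betw (%j. j - 1) (indices N) {m. enat m < N}"
 proof (rule bij_betwI[where g = Suc])
  show "(%j. j - 1) \<in> indices N \<rightarrow> {m. enat m < N}"
  proof
   fix j assume "j \<in> indices N"
   hence "enat (Suc (j - 1)) <= N" by (simp add: indices_def)
   thus "j - 1 \<in> {m. enat m < N}" by (simp add: Suc_ile_eq)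
  qed
 qed (auto simp: indices_def Suc_ile_eq)
 have b2: "bij_betw (the_inv_into Z rk) {m. enat m < N} Z" by (rule bij_betw_the_inv_into) (use rinj img in \<open>simp add: bij_betw_def\<close>)
 have "bij_betw g (indices N) Z" using bij_betw_trans[OF b1 b2] by (simp add: g_def o_def)
 moreover have "rk (g j) = j - 1" if "j \<in> indices N" for j
 proof -
  have "j - 1 \<in> rk ` Z" unfolding img using bij_betwE[OF b1] that by blast
  thus ?thesis unfolding g_def by (rule f_the_inv_into_f[OF rinj])
 qed
 ultimately have "bij_betw g (indices N) Z \<and> (\<forall>i\<in>indices N. \<forall>j\<in>indices N. i <= j --> h (g i) <= h (g j))"
  using hmono bij_betwE by (metis diff_le_mono)
 thus ?thesis by blast
qed

section \<open>Blaschke factors and the sum over the zeros\<close>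

definition blf :: "complex => complex => complex" where "blf w z = (z - w)/(1 - cnj w*z)"

lemma blf_eq_Moebius: "blf w = Moebius_function 0 w" by (intro ext) (simp add: blf_def Moebius_function_simple)

lemma blf_denominator_nonzero: "cmod w < 1 ==> cmod z < 1 ==> 1 - cnj w*z ~= 0"
proof
 assume "cmod w < 1" "cmod z < 1" "1 - cnj w*z = 0"
 hence "cmod (cnj w*z) = 1" "cmod w * cmod z < 1" using mult_strict_mono[of "cmod w" 1 "cmod z" 1] by auto
 thus False by (simp add: norm_mult)
qed

text \<open>Transporting w to the origin by a Moebius map, Schwarz's lemma gives |f| <= M |blf w|;
  hence dividing out the zero does not increase the bound M. At w itself the bound follows by
  continuity.\<close>

lemma blf_divide:
 assumes f: "f holomorphic_on ball 0 1" and M: "!!z. z \<in> ball 0 1 ==> cmod (f z) <= M" and w: "cmod w < 1" "f w = 0"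
 obtains g where "g holomorphic_on ball 0 1" "!!z. z \<in> ball 0 1 ==> cmod (g z) <= M" "!!z. z \<in> ball 0 1 ==> f z = blf w z*g z"
proof -
 define F where "F = (%z. if z = w then deriv f w else f z/(z - w))"
 have "F holomorphic_on ball 0 1" by (rule pole_theorem_open_0[OF f, of w]) (auto simp: F_def w(2))
 define g where "g = (%z. F z*(1 - cnj w*z))"
 have g: "g holomorphic_on ball 0 1" unfolding g_def by (intro holomorphic_intros \<open>F holomorphic_on ball 0 1\<close>)
 have eq: "f z = blf w z*g z" if "z \<in> ball 0 1" for z using blf_denominator_nonzero[OF w(1), of z] that w(2) by (auto simp: blf_def g_def F_def)
 have le: "cmod (f z) <= M * cmod (blf w z)" if z: "z \<in> ball 0 1" for z
 proof (cases "z = w")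
  case False
  have bz: "cmod (blf w z) < 1" unfolding blf_eq_Moebius using w z by (intro Moebius_function_norm_lt_1) auto
  have b0: "blf w z ~= 0" using False blf_denominator_nonzero[OF w(1), of z] z by (auto simp: blf_def)
  have "cmod (f z) / cmod (blf w z) <= M"
  \<comment> \<open>Schwarz's lemma asks for a strict bound by 1, so f is divided by an arbitrary M'
    > M instead of M.\<close>
  proof (rule dense_ge)
   fix M' assume M': "M < M'"
   have "cmod (f 0) <= M" by (rule M) simp
   hence M0: "0 <= M" using norm_ge_zero[of "f 0"] by linarith
   define k where "k = (%ze. f (Moebius_function 0 (-w) ze) / of_real M')"
   have mb: "Moebius_function 0 (-w) ` ball 0 1 \<subseteq> ball 0 1" using w by (auto intro!: Moebius_function_norm_lt_1)
   have "cmod (k (blf w z)) <= cmod (blf w z)"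
   proof (rule Schwarz_Lemma(1))
    have "(f \<circ> Moebius_function 0 (-w)) holomorphic_on ball 0 1"
     by (rule holomorphic_on_compose_gen[OF Moebius_function_holomorphic f mb]) (use w in simp)
    thus "k holomorphic_on ball 0 1" unfolding k_def using M0 M' by (intro holomorphic_intros) (auto simp: o_def)
    show "k 0 = 0" by (simp add: k_def Moebius_function_of_zero w(2))
    show "cmod (k ze) < 1" if "cmod ze < 1" for ze
    proof -
     have "ze \<in> ball 0 1" using that by simp
     hence "Moebius_function 0 (-w) ze \<in> ball 0 1" using mb by blast
     from M[OF this] show ?thesis using M0 M' by (simp add: k_def norm_divide)
    qed
   qed (rule bz)
   moreover have "Moebius_function 0 (-w) (blf w z) = z" unfolding blf_eq_Moebius using w z by (intro Moebius_function_compose) auto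
   ultimately show "cmod (f z) / cmod (blf w z) <= M'" using b0 M0 M' by (simp add: k_def norm_divide field_simps)
  qed
  thus ?thesis using b0 by (simp add: field_simps)
 qed (use w in \<open>simp add: blf_def\<close>)
 have g1: "cmod (g z) <= M" if z: "z \<in> ball 0 1" "z ~= w" for z
 proof -
  have b0: "blf w z ~= 0" using z blf_denominator_nonzero[OF w(1), of z] by (auto simp: blf_def)
  thus ?thesis using le[OF z(1)] eq[OF z(1)] by (simp add: norm_mult mult.commute)
 qed
 have "cmod (g z) <= M" if z: "z \<in> ball 0 1" for z
 proof (cases "z = w")
  case True
  have "isCont g w" using holomorphic_on_imp_continuous_on[OF g] w by (simp add: continuous_on_eq_continuous_at)
  hence t: "((%z. cmod (g z)) \<longlongrightarrow> cmod (g w)) (at w)" by (intro tendsto_norm) (simp add: isCont_def)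
  have "\<forall>\<^sub>F z in at w. z \<in> ball 0 1 - {w}" using eventually_at_in_open[of "ball 0 1" w] w by simp
  hence "\<forall>\<^sub>F z in at w. cmod (g z) <= M" by eventually_elim (use g1 in auto)
  thus ?thesis using tendsto_upperbound[OF t] True by simp
 qed (use g1 z in simp)
 thus ?thesis using that g eq by blast
qed

text \<open>A zero of order m is represented by the m pairs (w, 0), ..., (w, m - 1), so that
  multiplicities become cardinalities.\<close>

definition zmult :: "(complex => complex) => (complex \<times> nat) set" where
 "zmult f = (SIGMA w:{w \<in> ball 0 1. f w = 0}. {..<nat (zorder f w)})"

text \<open>If the quotient did not vanish at the next point w, the order of f at w would equal the
  number of factors already divided out there; but X contains fewer than that order, since the new
  pair is still missing.\<close>

lemma blaschke_factorization:
 assumes f: "f holomorphic_on ball 0 1" and M: "!!z. z \<in> ball 0 1 ==> cmod (f z) <= M" and X: "finite X" "X \<subseteq> zmult f"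
 shows "\<exists>g. g holomorphic_on ball 0 1 \<and> (\<forall>z\<in>ball 0 1. cmod (g z) <= M) \<and>
  (\<forall>z\<in>ball 0 1. f z = (\<Prod>x\<in>X. blf (fst x) z)*g z)" using X
proof (induction X rule: finite_induct)
 case empty
 thus ?case using f M by (intro exI[of _ f]) auto
next
 case (insert x X)
 then obtain g where g: "g holomorphic_on ball 0 1" "!!z. z \<in> ball 0 1 ==> cmod (g z) <= M"
  "!!z. z \<in> ball 0 1 ==> f z = (\<Prod>x\<in>X. blf (fst x) z)*g z" by auto
 obtain w k where x: "x = (w, k)" by (cases x)
 have w: "w \<in> ball 0 1" "f w = 0" "k < nat (zorder f w)" using insert.prems by (auto simp: x zmult_def)
 define Y where "Y = {y \<in> X. fst y = w}"
 have Yfin: "finite Y" using insert.hyps by (simp add: Y_def)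
 have "g w = 0"
 proof (rule ccontr)
  assume gw: "g w ~= 0"
  have "insert x Y \<subseteq> {w} \<times> {..<nat (zorder f w)}" using insert.prems by (auto simp: Y_def x zmult_def)
  hence "card (insert x Y) <= nat (zorder f w)"
   using card_mono[of "{w} \<times> {..<nat (zorder f w)}" "insert x Y"] by (simp add: card_cartesian_product)
  moreover have "card (insert x Y) = Suc (card Y)" using insert.hyps Yfin by (simp add: Y_def)
  ultimately have less: "int (card Y) < zorder f w" by linarith
  define G where "G = (%z. (1/(1 - cnj w*z)) ^ card Y*(\<Prod>y\<in>X - Y. blf (fst y) z)*g z)"
  have fsts: "cmod (fst y) < 1" if "y \<in> X" for y using insert.prems that by (auto simp: zmult_def)
  have dn: "1 - cnj u*z ~= 0" if "cmod u < 1" "z \<in> ball 0 1" for u z using blf_denominator_nonzero[OF that(1), of z] that(2) by simp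
  have "zorder f w = int (card Y)"
  proof (rule zorder_eqI[where S = "ball 0 1" and g = G])
   show "G holomorphic_on ball 0 1" unfolding G_def blf_def using w(1) fsts by (intro holomorphic_intros g dn) auto
   have "blf (fst y) w ~= 0" if "y \<in> X - Y" for y using that fsts[of y] dn[of "fst y" w] w by (auto simp: blf_def Y_def)
   thus "G w ~= 0" unfolding G_def using gw dn[of w w] w insert.hyps by auto
   fix z assume z: "z \<in> ball 0 1" "z ~= w"
   have "f z = (\<Prod>y\<in>Y. blf (fst y) z)*(\<Prod>y\<in>X - Y. blf (fst y) z)*g z"
    unfolding g(3)[OF z(1)] using prod.subset_diff[of Y X "%y. blf (fst y) z"] insert.hyps by (simp add: Y_def mult.commute)
   also have "(\<Prod>y\<in>Y. blf (fst y) z) = blf w z ^ card Y" by (simp add: Y_def)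
   finally show "f z = G z*(z - w) powi int (card Y)" by (simp add: G_def blf_def power_divide)
  qed (use w in auto)
  thus False using less by simp
 qed
 from blf_divide[OF g(1,2) _ this] w(1) obtain g' where
  "g' holomorphic_on ball 0 1" "!!z. z \<in> ball 0 1 ==> cmod (g' z) <= M" "!!z. z \<in> ball 0 1 ==> g z = blf w z*g' z" by (metis mem_ball_0)
 thus ?case using g(3) insert.hyps by (intro exI[of _ g']) (simp add: x mult_ac)
qed

text \<open>At the origin the factorization reads 1 <= M times the product of the |w|. Taking
  logarithms and ln x <= x - 1 gives the bound for every finite X.\<close>

lemma blaschke_sum:
 assumes f: "f holomorphic_on ball 0 1" and M: "!!z. z \<in> ball 0 1 ==> cmod (f z) <= M" and f0: "f 0 = 1" and X: "finite X" "X \<subseteq> zmult f"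
 shows "(\<Sum>x\<in>X. 1 - cmod (fst x)) <= ln M"
proof -
 obtain g where g: "!!z. z \<in> ball 0 1 ==> cmod (g z) <= M" "!!z. z \<in> ball 0 1 ==> f z = (\<Prod>x\<in>X. blf (fst x) z)*g z"
  using blaschke_factorization[OF f M X] by blast
 have pos: "0 < cmod (fst x)" if "x \<in> X" for x
 proof -
  have "f (fst x) = 0" using X(2) that by (auto simp: zmult_def)
  thus ?thesis using f0 by auto
 qed
 have "1 = cmod (f 0)" by (simp add: f0)
 also have "... = (\<Prod>x\<in>X. cmod (fst x)) * cmod (g 0)" by (subst g(2)) (simp_all add: norm_mult prod_norm[symmetric] blf_def)
 also have "... <= (\<Prod>x\<in>X. cmod (fst x))*M" using g(1)[of 0] by (intro mult_left_mono prod_nonneg) auto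
 finally have 1: "1 <= (\<Prod>x\<in>X. cmod (fst x))*M" .
 have P: "0 < (\<Prod>x\<in>X. cmod (fst x))" using pos by (intro prod_pos) auto
 hence M0: "0 < M" using 1 by (metis less_le_trans zero_less_mult_pos zero_less_one)
 have "0 <= ln ((\<Prod>x\<in>X. cmod (fst x))*M)" using 1 by simp
 also have "... = ln (\<Prod>x\<in>X. cmod (fst x)) + ln M" using P M0 by (simp add: ln_mult)
 also have "ln (\<Prod>x\<in>X. cmod (fst x)) = (\<Sum>x\<in>X. ln (cmod (fst x)))" using pos X(1) by (intro ln_prod) auto
 also have "... <= (\<Sum>x\<in>X. cmod (fst x) - 1)" using pos by (intro sum_mono ln_le_minus_one) auto
 finally show ?thesis by (simp add: sum_subtractf)
qed

lemma zeros_finite_in_disc: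
 assumes f: "f holomorphic_on ball 0 1" and f0: "f 0 = 1" and w: "f w = 0" "w \<in> ball 0 1" and r: "r < 1"
 shows "finite {z \<in> cball 0 r. f z = 0}"
proof (rule holomorphic_compact_finite_zeros[OF f])
 show "\<not> f constant_on ball 0 1" using f0 w unfolding constant_on_def by (metis centre_in_ball zero_less_one zero_neq_one)
qed (use r in auto)

lemma zeros_enumeration:
 assumes f: "f holomorphic_on ball 0 1" and M: "!!z. z \<in> ball 0 1 ==> cmod (f z) <= M" and f0: "f 0 = 1"
 shows "\<exists>(N::enat) ze. zeros_in_disc f N ze \<and> (\<forall>i\<in>indices N. \<forall>j\<in>indices N. i <= j --> cmod (ze i) <= cmod (ze j)) \<and>
  (%j. 1 - cmod (ze j)) summable_on indices N"
proof -
 let ?Z = "zmult f"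
 have fin: "finite {y \<in> ?Z. cmod (fst y) <= r}" if "r < 1" for r
 proof (cases "?Z = {}")
  case False
  then obtain w where w: "f w = 0" "w \<in> ball 0 1" by (auto simp: zmult_def)
  have "{y \<in> ?Z. cmod (fst y) <= r} \<subseteq> (SIGMA w:{z \<in> cball 0 r. f z = 0}. {..<nat (zorder f w)})" by (auto simp: zmult_def)
  thus ?thesis by (rule finite_subset) (intro finite_SigmaI zeros_finite_in_disc[OF f f0 w that]; simp)
 qed simp
 have "?Z \<subseteq> (\<Union>n::nat. {y \<in> ?Z. cmod (fst y) <= 1 - inverse (real (Suc n))})"
 proof
  fix y assume y: "y \<in> ?Z"
  hence "0 < 1 - cmod (fst y)" by (auto simp: zmult_def)
  then obtain n where "inverse (real (Suc n)) < 1 - cmod (fst y)" using reals_Archimedean by blast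
  thus "y \<in> (\<Union>n::nat. {y \<in> ?Z. cmod (fst y) <= 1 - inverse (real (Suc n))})" using y by (auto intro!: exI[of _ n])
 qed
 hence cnt: "countable ?Z" by (rule countable_subset) (rule countable_UN[OF countableI_type countable_finite[OF fin]], simp)
 obtain N :: enat and g where g: "bij_betw g (indices N) ?Z"
  "!!i j. i \<in> indices N ==> j \<in> indices N ==> i <= j ==> cmod (fst (g i)) <= cmod (fst (g j))"
  using enumerate_by_size[OF cnt, of "%y. cmod (fst y)"] fin by (auto simp: zmult_def)
 define ze where "ze = fst \<circ> g"
 have gZ: "g j \<in> ?Z" if "j \<in> indices N" for j using g(1) that bij_betwE by blast
 have "finite {j \<in> indices N. ze j = w} \<and> int (card {j \<in> indices N. ze j = w}) = zorder f w"
  if w: "w \<in> ball 0 1" "f w = 0" for w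
 proof -
  have "0 < zorder f w" using zorder_exist_zero[OF f open_ball connected_ball w(1)] f0 w(2) by (metis centre_in_ball zero_less_one zero_neq_one)
  have b: "bij_betw g {j \<in> indices N. ze j = w} ({w} \<times> {..<nat (zorder f w)})"
  proof (rule bij_betw_subset[OF g(1)])
   show "g ` {j \<in> indices N. ze j = w} = {w} \<times> {..<nat (zorder f w)}"
   proof
    show "g ` {j \<in> indices N. ze j = w} \<subseteq> {w} \<times> {..<nat (zorder f w)}" using gZ by (fastforce simp: ze_def zmult_def)
    show "{w} \<times> {..<nat (zorder f w)} \<subseteq> g ` {j \<in> indices N. ze j = w}"
    proof
     fix y assume y: "y \<in> {w} \<times> {..<nat (zorder f w)}"
     hence "y \<in> ?Z" using w by (auto simp: zmult_def)
     then obtain j where "j \<in> indices N" "y = g j" using g(1) by (auto simp: bij_betw_def)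
     thus "y \<in> g ` {j \<in> indices N. ze j = w}" using y by (auto simp: ze_def)
    qed
   qed
  qed auto
  have "finite {j \<in> indices N. ze j = w}" using bij_betw_finite[OF b] by simp
  moreover have "card {j \<in> indices N. ze j = w} = nat (zorder f w)" using bij_betw_same_card[OF b] by (simp add: card_cartesian_product)
  ultimately show ?thesis using \<open>0 < zorder f w\<close> by simp
 qed
 hence "zeros_in_disc f N ze"
 proof -
  have "ze j \<in> ball 0 1 \<and> f (ze j) = 0" if "j \<in> indices N" for j using gZ[OF that] by (cases "g j") (auto simp: ze_def zmult_def)
  with \<open>!!w. w \<in> ball 0 1 ==> f w = 0 ==> _\<close> show ?thesis unfolding zeros_in_disc_def by blast
 qed
 moreover have "(%j. 1 - cmod (ze j)) summable_on indices N"
 proof (rule nonneg_bdd_above_summable_on)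
  show "0 <= 1 - cmod (ze j)" if "j \<in> indices N" for j using gZ[OF that] by (auto simp: ze_def zmult_def)
  show "bdd_above (sum (%j. 1 - cmod (ze j)) ` {F. F \<subseteq> indices N \<and> finite F})"
  proof (rule bdd_aboveI2)
   fix F assume F: "F \<in> {F. F \<subseteq> indices N \<and> finite F}"
   have "inj_on g F" using g(1) F by (auto simp: bij_betw_def intro: inj_on_subset)
   hence "(\<Sum>j\<in>F. 1 - cmod (ze j)) = (\<Sum>x\<in>g ` F. 1 - cmod (fst x))" by (simp add: sum.reindex ze_def)
   also have "... <= ln M" by (rule blaschke_sum[OF f M f0]) (use F gZ in auto)
   finally show "(\<Sum>j\<in>F. 1 - cmod (ze j)) <= ln M" .
  qed
 qed
 ultimately show ?thesis using g(2) by (intro exI[of _ N] exI[of _ ze]) (auto simp: ze_def)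
qed

text \<open>Both sides have the same square, d^2/4 (1/z - z)^2. The sign is left open because only
  the modulus of the real part is estimated.\<close>

lemma varkappa_joukowski:
 assumes z: "z \<in> ball 0 1" "z ~= 0" and d: "0 < d"
 defines "u \<equiv> of_nat d/2*(1/z - z)" shows "varkappa d (joukowski d z) = u \<or> varkappa d (joukowski d z) = - u"
proof -
 have "(varkappa d (joukowski d z))^2 = (joukowski d z)^2 - (of_nat d)^2" by (rule varkappa_square[OF joukowski_in_Lam[OF z d]])
 also have "... = u^2" using z(2) by (simp add: joukowski_def u_def power2_eq_square field_simps)
 finally show ?thesis by (simp add: power2_eq_iff)
qed

text \<open>Im \<lambda> and Re \<open>varkappa\<close> are, up to sign, d/2 (1/|z|^2 - 1) times Im
  z and Re z. Both vanish to first order at the circle, and r keeps the estimate away from the pole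
  at 0.\<close>

lemma joukowski_boundary_estimate:
 assumes z: "z \<in> ball 0 1" and r: "0 < r" "r <= cmod z" and d: "0 < d"
 shows "\<bar>Im (joukowski d z)\<bar> + \<bar>Re (varkappa d (joukowski d z))\<bar> <= 2*real d/r*(1 - cmod z)"
proof -
 have z0: "z ~= 0" and m: "0 < cmod z" "cmod z < 1" using r z by auto
 let ?D = "1/(cmod z)^2 - 1"
 have D0: "0 <= ?D" using m by (simp add: field_simps power_le_one)
 have bnd: "cmod z*?D <= 2/r*(1 - cmod z)"
 proof -
  have "cmod z*?D = (1 + cmod z) / cmod z*(1 - cmod z)" using m by (simp add: field_simps power2_eq_square)
  also have "... <= 2/r*(1 - cmod z)" using m r by (intro mult_right_mono frac_le) auto
  finally show ?thesis .
 qed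
 have "\<bar>Im (joukowski d z)\<bar> = real d/2*(\<bar>Im z\<bar>*?D)" unfolding Im_joukowski[OF z0] abs_mult using D0 by simp
 also have "... <= real d/2*(cmod z*?D)" using D0 abs_Im_le_cmod[of z] by (intro mult_left_mono mult_right_mono) auto
 also have "... <= real d/2*(2/r*(1 - cmod z))" by (intro mult_left_mono bnd) auto
 also have "... = real d/r*(1 - cmod z)" unfolding mult.assoc[symmetric] by simp
 finally have 1: "\<bar>Im (joukowski d z)\<bar> <= real d/r*(1 - cmod z)" .
 have "Re (1/z) = Re z/(cmod z)^2" by (simp add: Re_divide cmod_power2)
 moreover have "of_nat d/2*(1/z - z) = of_real (real d/2)*(1/z - z)" by simp
 ultimately have R: "Re (of_nat d/2*(1/z - z)) = real d/2*(Re z*?D)"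
  by (simp only: times_complex.sel Re_complex_of_real Im_complex_of_real minus_complex.sel) (simp add: algebra_simps)
 have "\<bar>Re (varkappa d (joukowski d z))\<bar> = \<bar>Re (of_nat d/2*(1/z - z))\<bar>"
  using varkappa_joukowski[OF z z0 d] by (elim disjE) (simp_all only: uminus_complex.sel abs_minus_cancel)
 also have "... = \<bar>real d/2*(Re z*?D)\<bar>" by (simp only: R)
 also have "... = real d/2*(\<bar>Re z\<bar>*?D)" unfolding abs_mult using D0 by simp
 also have "... <= real d/2*(cmod z*?D)" using D0 abs_Re_le_cmod[of z] by (intro mult_left_mono mult_right_mono) auto
 also have "... <= real d/2*(2/r*(1 - cmod z))" by (intro mult_left_mono bnd) auto
 also have "... = real d/r*(1 - cmod z)" unfolding mult.assoc[symmetric] by simp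
 finally have 2: "\<bar>Re (varkappa d (joukowski d z))\<bar> <= real d/r*(1 - cmod z)" .
 have "2*real d/r*(1 - cmod z) = real d/r*(1 - cmod z) + real d/r*(1 - cmod z)" by simp
 thus ?thesis using 1 2 by linarith
qed

lemma zeros_with_estimates:
 assumes f: "f holomorphic_on ball 0 1" and M: "!!z. z \<in> ball 0 1 ==> cmod (f z) <= M" and f0: "f 0 = 1" and d: "0 < d"
 shows "\<exists>(N::enat) (ze::nat => complex) (r0::real).
   zeros_in_disc f N ze \<and> 0 < r0 \<and> (if N = 0 then r0 = 1 else r0 = (INF j\<in>indices N. cmod (ze j)) \<and> r0 = cmod (ze 1)) \<and>
   (\<forall>i\<in>indices N. \<forall>j\<in>indices N. i <= j --> cmod (ze i) <= cmod (ze j)) \<and>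
   (%j. (1 - cmod (ze j)) + \<bar>Im (joukowski d (ze j))\<bar> + \<bar>Re (varkappa d (joukowski d (ze j)))\<bar>) summable_on indices N \<and>
   r0 <= 1 \<and> (\<forall>z\<in>ball 0 r0. f z ~= 0)"
proof -
 obtain N :: enat and ze where Z: "zeros_in_disc f N ze" "!!i j. i \<in> indices N ==> j \<in> indices N ==> i <= j ==> cmod (ze i) <= cmod (ze j)"
  "(%j. 1 - cmod (ze j)) summable_on indices N" using zeros_enumeration[OF f M f0] by blast
 have in_ball: "ze j \<in> ball 0 1" "f (ze j) = 0" if "j \<in> indices N" for j using Z(1) that by (auto simp: zeros_in_disc_def)
 have hit: "\<exists>j\<in>indices N. ze j = w" if w: "w \<in> ball 0 1" "f w = 0" for w
 proof (rule ccontr)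
  assume "\<not> ?thesis"
  hence "card {j \<in> indices N. ze j = w} = 0" by (simp add: card_eq_0_iff)
  moreover have "int (card {j \<in> indices N. ze j = w}) = zorder f w" using Z(1) w unfolding zeros_in_disc_def by blast
  ultimately have "zorder f w = 0" by simp
  moreover have "0 < zorder f w" using zorder_exist_zero[OF f open_ball connected_ball w(1)] f0 w(2)
   by (metis centre_in_ball zero_less_one zero_neq_one)
  ultimately show False by simp
 qed
 show ?thesis
 proof (cases "N = 0")
  case True
  hence e: "indices N = {}" by (auto simp: indices_def zero_enat_def)
  hence "\<forall>z\<in>ball 0 1. f z ~= 0" using hit by auto
  thus ?thesis using Z True e by (intro exI[of _ N] exI[of _ ze] exI[of _ 1]) simp
 next
  case False
  hence "1 <= N" by (metis i0_less ileI1 one_eSuc)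
  hence one: "1 \<in> indices N" by (simp add: indices_def one_enat_def)
  define r0 where "r0 = cmod (ze 1)"
  have le: "r0 <= cmod (ze j)" if "j \<in> indices N" for j
   unfolding r0_def by (rule Z(2)[OF one that]) (use that in \<open>simp add: indices_def\<close>)
  have r0: "0 < r0" using in_ball(2)[OF one] f0 unfolding r0_def by auto
  have inf: "(INF j\<in>indices N. cmod (ze j)) = r0" by (rule cInf_eq_minimum) (use one le in \<open>auto simp: r0_def\<close>)
  have nz: "f z ~= 0" if z: "z \<in> ball 0 r0" for z
  proof
   assume "f z = 0"
   moreover have "z \<in> ball 0 1" using z in_ball(1)[OF one] by (simp add: r0_def)
   ultimately obtain j where "j \<in> indices N" "ze j = z" using hit by blast
   thus False using le[of j] z by simp
  qed
  have sm: "(%j. (1 - cmod (ze j)) + \<bar>Im (joukowski d (ze j))\<bar> + \<bar>Re (varkappa d (joukowski d (ze j)))\<bar>) summable_on indices N"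
  proof (rule summable_on_comparison_test)
   show "(%j. (1 + 2*real d/r0)*(1 - cmod (ze j))) summable_on indices N" by (rule summable_on_cmult_right[OF Z(3)])
   fix j assume j: "j \<in> indices N"
   show "(1 - cmod (ze j)) + \<bar>Im (joukowski d (ze j))\<bar> + \<bar>Re (varkappa d (joukowski d (ze j)))\<bar>
     <= (1 + 2*real d/r0)*(1 - cmod (ze j))" using joukowski_boundary_estimate[OF in_ball(1)[OF j] r0 le[OF j] d]
    by (simp only: distrib_right mult_1_left add.assoc add_le_cancel_left)
   show "0 <= (1 - cmod (ze j)) + \<bar>Im (joukowski d (ze j))\<bar> + \<bar>Re (varkappa d (joukowski d (ze j)))\<bar>"
    using in_ball(1)[OF j] by simp
  qed
  have "r0 <= 1" using in_ball(1)[OF one] by (simp add: r0_def)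
  thus ?thesis using Z(1,2) r0 inf sm nz False by (intro exI[of _ N] exI[of _ ze] exI[of _ r0]) (auto simp: r0_def)
 qed
qed

section \<open>Taylor coefficients of the logarithm\<close>

lemma exp_commute_algebra:
 fixes A X :: "'a::{real_normed_algebra_1, banach}"
 assumes "A*X = X*A" shows "A*exp X = exp X*A"
proof -
 have s: "summable (%n. X^n /\<^sub>R fact n)" by (rule summable_exp_generic)
 have "A*exp X = (\<Sum>n. A*(X^n /\<^sub>R fact n))" unfolding exp_def by (rule suminf_mult[OF s, symmetric])
 also have "... = (\<Sum>n. (X^n /\<^sub>R fact n)*A)" by (simp add: power_commuting_commutes[OF assms[symmetric]])
 also have "... = exp X*A" unfolding exp_def by (rule suminf_mult2[OF s, symmetric])
 finally show ?thesis .
qed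

text \<open>The scaling parameter s joins 1 at s = 0 to the factor exp (c A^k) at s = 1, so that the
  deviation of a product of such factors from 1 is controlled by its derivative in s.\<close>

definition Ek :: "'a::{real_normed_algebra_1, banach} => nat => real => real => 'a" where "Ek A k c s = exp ((c * s^k) *\<^sub>R A^k)"

lemma Ek_commute: "Ek A k c s*A = A*Ek A k c s" unfolding Ek_def by (rule exp_commute_algebra[symmetric]) (simp add: power_commutes)

lemma Ek_deriv: "(Ek A k c has_vector_derivative (c*(real k * s^(k - 1))) *\<^sub>R (A^k*Ek A k c s)) (at s)"
proof -
 have "((%s. c * s^k) has_vector_derivative c*(real k * s^(k - 1))) (at s)"
  unfolding has_real_derivative_iff_has_vector_derivative[symmetric] by (auto intro!: derivative_eq_intros)
 from vector_diff_chain_at[OF this exp_scaleR_has_vector_derivative_right[of "A^k"]]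
 have "((%s. exp ((c * s^k) *\<^sub>R A^k)) has_vector_derivative
  (c*(real k * s^(k - 1))) *\<^sub>R (exp ((c * s^k) *\<^sub>R A^k)*A^k)) (at s)" by (simp add: o_def)
 moreover have "exp ((c * s^k) *\<^sub>R A^k)*A^k = A^k*exp ((c * s^k) *\<^sub>R A^k)" by (rule exp_commute_algebra[symmetric]) simp
 ultimately show ?thesis unfolding Ek_def[abs_def] by simp
qed

lemma norm_Ek_le:
 assumes "norm A <= 1" "0 <= s" "s <= 1" "\<bar>c\<bar> <= 1" shows "norm (Ek A k c s) <= exp 1"
proof -
 have "\<bar>c * s^k\<bar>*norm (A^k) <= 1*1"
 proof (rule mult_mono)
  show "\<bar>c * s^k\<bar> <= 1" using assms by (simp add: abs_mult mult_le_one power_le_one)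
  show "norm (A^k) <= 1" using norm_power_ineq[of A k] power_le_one[OF norm_ge_zero assms(1), of k] by linarith
 qed auto
 hence "norm ((c * s^k) *\<^sub>R A^k) <= 1" by simp
 thus ?thesis unfolding Ek_def by (meson norm_exp exp_le_cancel_iff order_trans)
qed

text \<open>The derivative in \<open>s\<close> of the left-hand product is of fifth order in \<open>A\<close>, because
  \<open>(1 + sA) (-A + sA\<^sup>2 - s\<^sup>2A\<^sup>3 + s\<^sup>3A\<^sup>4) = -A + s\<^sup>4A\<^sup>5\<close>.\<close>

lemma norm_truncated_log_product:
 fixes A :: "'a::{real_normed_algebra_1, banach}"
 assumes A: "norm A <= 1" shows "norm ((1 + A)*Ek A 1 (-1) 1*Ek A 2 (1/2) 1*Ek A 3 (-(1/3)) 1*Ek A 4 (1/4) 1 - 1) <= exp 4*norm A^5"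
proof -
 let ?E1 = "Ek A 1 (-1)" and ?E2 = "Ek A 2 (1/2)" and ?E3 = "Ek A 3 (-(1/3))" and ?E4 = "Ek A 4 (1/4)"
 define Ph where "Ph = (%s::real. (1 + s *\<^sub>R A)*?E1 s*?E2 s*?E3 s*?E4 s)"
 have d0: "((%s::real. 1 + s *\<^sub>R A) has_vector_derivative A) (at s)" for s by (auto intro!: derivative_eq_intros)
 have D: "(Ph has_vector_derivative s^4 *\<^sub>R (A^5*(?E1 s*?E2 s*?E3 s*?E4 s))) (at s)" for s
 proof -
  have c: "Ek A k c s*A^m = A^m*Ek A k c s" for k c m by (rule power_commuting_commutes[OF Ek_commute[symmetric], symmetric])
  have c': "Ek A k c s*(A^m*X) = A^m*(Ek A k c s*X)" for k c m X by (metis c mult.assoc)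
  have c1: "Ek A k c s*(A*X) = A*(Ek A k c s*X)" for k c X using c'[of k c 1 X] by simp
  have pw: "A*(A^m*X) = A^Suc m*X" for m X by (simp add: mult.assoc)
  note Ds = Ek_deriv[of A 1 "-1" s] Ek_deriv[of A 2 "1/2" s] Ek_deriv[of A 3 "-(1/3)" s] Ek_deriv[of A 4 "1/4" s]
  note raw = has_vector_derivative_mult[OF has_vector_derivative_mult[OF has_vector_derivative_mult[OF has_vector_derivative_mult[OF
   d0[of s] Ds(1)] Ds(2)] Ds(3)] Ds(4)]
  show ?thesis unfolding Ph_def by (rule has_vector_derivative_eq_rhs[OF raw])
    (simp add: algebra_simps mult.assoc c' c1 pw scaleR_add_right[symmetric] power_numeral_reduce)
 qed
 let ?D = "%s::real. s^4 *\<^sub>R (A^5*(?E1 s*?E2 s*?E3 s*?E4 s))"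
 have "norm (Ph 1 - Ph 0 - (1 - 0) *\<^sub>R ?D 0) <= norm (1 - 0 :: real)*(norm A^5*exp 4)"
 proof (rule vector_differentiable_bound_linearization[where S = "{0..1}" and f' = ?D])
  fix s :: real assume s: "s \<in> {0..1}"
  show "(Ph has_vector_derivative s^4 *\<^sub>R (A^5*(?E1 s*?E2 s*?E3 s*?E4 s))) (at s within {0..1})" by (rule has_vector_derivative_at_within[OF D])
  have E: "norm (Ek A k c s) <= exp 1" if "\<bar>c\<bar> <= 1" for k c using norm_Ek_le[OF A] s that by auto
  have "norm (s^4 *\<^sub>R (A^5*(?E1 s*?E2 s*?E3 s*?E4 s))) = s^4*norm (A^5*(?E1 s*?E2 s*?E3 s*?E4 s))" using s by simp
  also have "... <= 1*(norm A^5*(exp 1*exp 1*exp 1*exp 1))"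
   using s by (intro mult_mono order_trans[OF norm_mult_ineq] norm_power_ineq E power_le_one) auto
  also have "(exp 1*exp 1*exp 1*exp 1 :: real) = exp 4" by (simp add: exp_add[symmetric])
  finally show "norm (?D s - ?D 0) <= norm A^5*exp 4" by simp
 qed (auto simp: closed_segment_eq_real_ivl)
 moreover have "Ph 0 = 1" by (simp add: Ph_def Ek_def)
 ultimately show ?thesis by (simp add: Ph_def mult.commute)
qed

definition trF :: "'a set => 'a opalg => complex" where "trF F A = (\<Sum>x\<in>F. ent A x x)"

lemma norm_detS_le:
 assumes "!!x y. cmod (M x y) <= b" "finite S" shows "cmod (detS S M) <= fact (card S)*b ^ card S"
proof -
 have "cmod (detS S M) <= (\<Sum>pe | pe permutes S. b ^ card S)" unfolding detS_def
 proof (rule order_trans[OF norm_sum sum_mono])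
  fix pe assume "pe \<in> {pe. pe permutes S}"
  have "cmod (of_int (sign pe)*(\<Prod>x\<in>S. M x (pe x))) = (\<Prod>x\<in>S. cmod (M x (pe x)))" by (simp add: norm_mult prod_norm sign_def)
  also have "... <= (\<Prod>x\<in>S. b)" by (intro prod_mono) (simp add: assms)
  finally show "cmod (of_int (sign pe)*(\<Prod>x\<in>S. M x (pe x))) <= b ^ card S" by simp
 qed
 thus ?thesis using assms(2) by (simp add: card_permutations)
qed

text \<open>Among the minors of X - 1 the empty one is 1, and every other has at least one factor
  bounded by the norm of X - 1.\<close>

lemma norm_dF_minus_one_le:
 assumes F: "finite F" shows "\<exists>K\<ge>0. \<forall>X. norm (X - 1) <= B --> cmod (dF F X - 1) <= K*norm (X - 1)"
proof -
 define B' where "B' = max B 1"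
 define K where "K = (\<Sum>S\<in>Pow F. fact (card S)*B' ^ card S)"
 have B': "1 <= B'" by (simp add: B'_def)
 have K0: "0 <= K" unfolding K_def using B' by (intro sum_nonneg) auto
 have "cmod (dF F X - 1) <= K*norm (X - 1)" if X: "norm (X - 1) <= B" for X
 proof -
  let ?m = "norm (X - 1)"
  have e: "dF F X - 1 = (\<Sum>S\<in>Pow F - {{}}. detS S (ent (X - 1)))"
   using F by (subst dF_one_plus) (auto simp: sum.remove[of "Pow F" "{}"] detS_def permutes_empty sign_id)
  have "cmod (dF F X - 1) <= (\<Sum>S\<in>Pow F - {{}}. fact (card S)*B' ^ card S*?m)" unfolding e
  proof (rule order_trans[OF norm_sum sum_mono])
   fix S assume S: "S \<in> Pow F - {{}}"
   hence fS: "finite S" using F finite_subset by auto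
   then obtain k where k: "card S = Suc k" using S by (metis Diff_iff card_eq_0_iff insertCI not0_implies_Suc)
   have "cmod (detS S (ent (X - 1))) <= fact (card S)*?m ^ card S" by (rule norm_detS_le[OF norm_ent_le fS])
   also have "... <= fact (card S)*(B' ^ card S*?m)"
   proof (intro mult_left_mono)
    have "?m^k <= B'^k" using X by (intro power_mono) (auto simp: B'_def)
    also have "... <= B'^Suc k" using B' by (intro power_increasing) auto
    finally show "?m ^ card S <= B' ^ card S*?m" unfolding k using mult_right_mono[of "?m^k" "B'^Suc k" ?m] by (simp add: mult.commute)
   qed simp
   finally show "cmod (detS S (ent (X - 1))) <= fact (card S)*B' ^ card S*?m" by (simp add: mult.assoc)
  qed
  also have "... <= (\<Sum>S\<in>Pow F. fact (card S)*B' ^ card S*?m)" using F B' by (intro sum_mono2) auto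
  finally show ?thesis by (simp add: K_def sum_distrib_right)
 qed
 thus ?thesis using K0 by blast
qed

text \<open>Multiplicativity of the compressed determinant and det exp = exp tr identify the
  left-hand product with the determinant of (1 + A) times the exponential of the truncated - log (1
  + A), which is within order 5 of the identity.\<close>

lemma det2_trace_expansion:
 assumes F: "finite (F :: 'a set)" shows "\<exists>K\<ge>0. \<forall>A :: 'a opalg. clin A --> supp_in F A --> norm A <= 1 -->
  cmod (det2 (rep A)*exp (trF F (A^2)/2 - trF F (A^3)/3 + trF F (A^4)/4) - 1) <= K*norm A^5"
proof -
 obtain K where K: "0 <= K" "!!X :: 'a opalg. norm (X - 1) <= exp 4 ==> cmod (dF F X - 1) <= K*norm (X - 1)"
  using norm_dF_minus_one_le[OF F, of "exp 4"] by blast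
 have "cmod (det2 (rep A)*exp (trF F (A^2)/2 - trF F (A^3)/3 + trF F (A^4)/4) - 1) <= K*exp 4*norm A^5"
  if A: "clin A" "supp_in F A" "norm A <= 1" for A :: "'a opalg"
 proof -
  let ?E = "%k c. Ek A k c 1"
  define X where "X = (1 + A)*?E 1 (-1)*?E 2 (1/2)*?E 3 (-(1/3))*?E 4 (1/4)"
  have eE: "?E k c = exp (c *\<^sub>R A^k)" for k c by (simp add: Ek_def)
  have cE: "clin (?E k c)" for k c unfolding eE by (intro clin_exp clin_closed A)
  have sE: "supp_in F (?E k c - 1)" if "0 < k" for k c unfolding eE by (intro supp_in_exp supp_in_closed supp_in_power A that)
  have dE: "dF F (?E k c) = exp (of_real c*trF F (A^k))" if "0 < k" for k c unfolding eE trF_def by (intro dF_exp F clin_closed supp_in_power A that)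
  have c1: "clin (1 + A)" by (intro clin_closed A)
  have "dF F X = dF F (1 + A)*dF F (?E 1 (-1))*dF F (?E 2 (1/2))*dF F (?E 3 (-(1/3)))*dF F (?E 4 (1/4))" unfolding X_def
   by (simp add: dF_mult[OF F] clin_closed(6) c1 cE sE)
  also have "... = dF F (1 + A)*exp (- trF F A)*(exp (trF F (A^2)/2)*exp (- (trF F (A^3)/3))*exp (trF F (A^4)/4))" by (simp add: dE mult.assoc)
  also have "dF F (1 + A)*exp (- trF F A) = det2 (rep A)"
  proof -
   have "ent (1 + A) = (%x y. (if x = y then 1 else 0) + ent A x y)" by (intro ext) (simp add: ent_simps)
   thus ?thesis unfolding det2_finite[OF F A(1,2)] det2S_def dF_def trF_def by simp
  qed
  also have "exp (trF F (A^2)/2)*exp (- (trF F (A^3)/3))*exp (trF F (A^4)/4) = exp (trF F (A^2)/2 - trF F (A^3)/3 + trF F (A^4)/4)"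
   by (simp add: exp_add[symmetric])
  finally have e: "dF F X = det2 (rep A)*exp (trF F (A^2)/2 - trF F (A^3)/3 + trF F (A^4)/4)" .
  have n: "norm (X - 1) <= exp 4*norm A^5" unfolding X_def by (rule norm_truncated_log_product[OF A(3)])
  also have "... <= exp 4*1" using A(3) by (intro mult_left_mono power_le_one) auto
  finally have "cmod (dF F X - 1) <= K*norm (X - 1)" using K(2)[of X] by simp
  also have "... <= K*(exp 4*norm A^5)" by (intro mult_left_mono n K)
  finally show ?thesis unfolding e by (simp add: mult.assoc)
 qed
 moreover have "0 <= K*exp 4" using K(1) by simp
 ultimately show ?thesis by blast
qed

section \<open>Traces of powers and their expansion in z\<close>

definition tr2 :: "'a set => ('a => 'a => complex) => complex" where "tr2 F k = (\<Sum>x\<in>F. \<Sum>y\<in>F. k x y*k y x)"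
definition tr3 :: "'a set => ('a => 'a => complex) => complex" where "tr3 F k = (\<Sum>x\<in>F. \<Sum>y\<in>F. \<Sum>u\<in>F. k x y*(k y u*k u x))"
definition tr4 :: "'a set => ('a => 'a => complex) => complex" where
 "tr4 F k = (\<Sum>x\<in>F. \<Sum>y\<in>F. \<Sum>u\<in>F. \<Sum>v\<in>F. k x y*(k y u*(k u v * k v x)))"

lemma trF_powers:
 assumes F: "finite F" and A: "clin A" "supp_in F A" shows "trF F (A^2) = tr2 F (ent A)" "trF F (A^3) = tr3 F (ent A)" "trF F (A^4) = tr4 F (ent A)"
proof -
 have p: "A^2 = A*A" "A^3 = A*(A*A)" "A^4 = A*(A*(A*A))" by (simp_all add: eval_nat_numeral mult.assoc)
 have s: "supp_in F (A*A)" "supp_in F (A*(A*A))" using A(2) by (auto intro: supp_in_closed)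
 show "trF F (A^2) = tr2 F (ent A)" "trF F (A^3) = tr3 F (ent A)" "trF F (A^4) = tr4 F (ent A)" unfolding trF_def tr2_def tr3_def tr4_def p
  by (simp_all add: ent_mult_supp[OF F A(1) A(2)] ent_mult_supp[OF F A(1) s(1)] ent_mult_supp[OF F A(1) s(2)] sum_distrib_left)
qed

text \<open>Minus the logarithm of the truncated determinant up to fourth order. The unsymmetrised
  kernel is used; it has the same traces and is polynomial in V.\<close>

definition QN :: "(int ^ 'n::finite => complex) => nat => complex => complex" where "QN V N z = (let k = (%x y. V x*rho z (x - y)) in
  tr2 (zbox N) k/2 - tr3 (zbox N) k/3 + tr4 (zbox N) k/4)"

text \<open>The norm of A is at most 4 M |z|, so an error of fifth order in A is of order z^5.
  Radius and constant depend on the box here; \<open>holomorphic_Oz_bound\<close> removes this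
  dependence later.\<close>

lemma DN_QN_bigo:
 fixes V :: "int ^ 'n::finite => complex"
 assumes d: "3 <= CARD('n)" and b: "!!x. cmod (V x) <= M" shows "(%z. DN V N z*exp (QN V N z) - 1) \<in> O[at 0](%z. z^5)"
proof -
 obtain K where K: "0 <= K" "!!A :: (int ^ 'n) opalg. clin A ==> supp_in (zbox N) A ==> norm A <= 1 ==>
  cmod (det2 (rep A)*exp (trF (zbox N) (A^2)/2 - trF (zbox N) (A^3)/3 + trF (zbox N) (A^4)/4) - 1) <= K*norm A^5"
  using det2_trace_expansion[OF finite_zbox, of N] by blast
 have M0: "0 <= M" using b norm_ge_zero order_trans by blast
 define de where "de = min (1/8) (1/(4*M + 1))"
 have de: "0 < de" using M0 by (simp add: de_def)
 have main: "cmod (DN V N z*exp (QN V N z) - 1) <= (K*(4*M)^5) * cmod (z^5)" if z: "z ~= 0" "cmod z < de" for z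
 proof -
  have z8: "cmod z <= 1/8" and zM: "cmod z <= 1/(4*M + 1)" using z by (auto simp: de_def)
  have zb: "z \<in> ball 0 1" using z8 by simp
  define R where "R = (Rs (joukowski CARD('n) z) :: (int ^ 'n) opalg)"
  define A where "A = opa (mult_op (%x. if x \<in> zbox N then V x else 0))*R"
  have bv: "bounded (range V)" by (rule bounded_of_le[OF b])
  note D = DN_eq_det2[OF d zb z(1) bv, folded R_def, of N, folded A_def]
  have "norm A <= norm (opa (mult_op (%x. if x \<in> zbox N then V x else 0)))*norm R" unfolding A_def by (rule norm_mult_ineq)
  also have "... <= M*(4 * cmod z)" unfolding R_def using b M0 by (intro mult_mono norm_mult_op_le norm_Rs_small[OF d z(1) z8]) auto
  finally have nA: "norm A <= 4*M * cmod z" by simp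
  have "4*M * cmod z <= 4*M*(1/(4*M + 1))" using M0 zM by (intro mult_left_mono) auto
  also have "... <= 1" using M0 by (simp add: field_simps)
  finally have nA1: "norm A <= 1" using nA by linarith
  have "tr2 (zbox N) (ent A) = tr2 (zbox N) (%x y. V x*rho z (x - y))" "tr3 (zbox N) (ent A) = tr3 (zbox N) (%x y. V x*rho z (x - y))"
   "tr4 (zbox N) (ent A) = tr4 (zbox N) (%x y. V x*rho z (x - y))" unfolding tr2_def tr3_def tr4_def by (intro sum.cong refl; simp add: D(4))+
  hence Q: "QN V N z = trF (zbox N) (A^2)/2 - trF (zbox N) (A^3)/3 + trF (zbox N) (A^4)/4"
   unfolding trF_powers[OF finite_zbox D(2,3)] by (simp add: QN_def Let_def)
  have "cmod (DN V N z*exp (QN V N z) - 1) <= K*norm A^5" unfolding Q D(1)[symmetric] by (rule K(2)[OF D(2,3) nA1])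
  also have "... <= K*(4*M * cmod z)^5" using K(1) by (intro mult_left_mono power_mono nA) auto
  finally show ?thesis by (simp add: power_mult_distrib norm_power mult.assoc)
 qed
 have "\<forall>\<^sub>F z in at 0. z \<in> ball (0::complex) de - {0}" by (rule eventually_at_in_open) (use de in auto)
 hence "\<forall>\<^sub>F z in at 0. cmod (DN V N z*exp (QN V N z) - 1) <= (K*(4*M)^5) * cmod (z^5)" by eventually_elim (use main in auto)
 thus ?thesis by (rule bigoI)
qed

abbreviation Oz :: "nat => (complex => complex) set" where "Oz k \<equiv> O[at 0](%z. z^k)"

lemma Oz_mult: "f \<in> Oz j ==> g \<in> Oz k ==> (%z. f z*g z) \<in> Oz (j + k)" unfolding power_add by (rule landau_o.big.mult)

lemma Oz_continuous:
 assumes "isCont f 0" shows "f \<in> Oz 0"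
proof -
 have "(f \<longlongrightarrow> f 0) (at 0)" using assms by (simp add: isCont_def)
 thus ?thesis by (intro bigoI_tendsto[where c = "f 0"]) simp_all
qed

lemma Oz_const: "(%_. c) \<in> Oz 0" by (rule Oz_continuous) simp

lemma Oz_power: "(%z. z^k) \<in> Oz k" by simp

lemma Oz_mono:
 assumes "f \<in> Oz j" "k <= j" shows "f \<in> Oz k"
proof -
 have "(%z :: complex. z^j) \<in> Oz (k + 0)"
 proof -
  have "(%z :: complex. z^k*z^(j - k)) \<in> Oz (k + 0)" by (intro Oz_mult Oz_power Oz_continuous) simp
  thus ?thesis using assms(2) by (simp add: power_add[symmetric])
 qed
 thus ?thesis using assms(1) landau_o.big_trans by (metis add_0_right)
qed

lemma Oz_cmult: "f \<in> Oz k ==> (%z. c*f z) \<in> Oz k" using Oz_mult[OF Oz_const] by simp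

lemma Oz_add: "f \<in> Oz k ==> g \<in> Oz k ==> (%z. f z + g z) \<in> Oz k" by (rule sum_in_bigo)

lemma Oz_mult': "f \<in> Oz j ==> g \<in> Oz k ==> m <= j + k ==> (%z. f z*g z) \<in> Oz m" by (rule Oz_mono[OF Oz_mult])

lemma Oz_approx: "(%z. f z - p z) \<in> Oz k ==> f \<in> Oz m ==> m <= k ==> p \<in> Oz m"
 using Oz_add[OF _ Oz_cmult[OF Oz_mono], of f m "%z. f z - p z" k "-1"] by simp

text \<open>f g - p q = (f - p) g + p (g - q): each error is multiplied by the order of the
  untouched factor.\<close>

lemma Oz_mult_diff:
 assumes "(%z. f z - p z) \<in> Oz j" "(%z. g z - q z) \<in> Oz k" "g \<in> Oz l" "p \<in> Oz m" "n <= j + l" "n <= m + k"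
 shows "(%z. f z*g z - p z*q z) \<in> Oz n"
proof -
 have "(%z. (f z - p z)*g z + p z*(g z - q z)) \<in> Oz n" by (intro Oz_add Oz_mult'[OF assms(1,3,5)] Oz_mult'[OF assms(4,2,6)])
 thus ?thesis by (simp add: algebra_simps)
qed

lemma Oz_sum: "(!!x. x \<in> F ==> f x \<in> Oz k) ==> (%z. \<Sum>x\<in>F. f x z) \<in> Oz k" by (rule big_sum_in_bigo)

definition hH :: "int ^ 'n::finite => complex" where "hH n = ent Hop n 0"
definition hHH :: "int ^ 'n::finite => complex" where "hHH n = ent (Hop*Hop) n 0"
definition kd :: "int ^ 'n::finite => complex" where "kd n = (if n = 0 then 1 else 0)"

lemma ent_Hop_mult: "ent (Hop*X) x (y :: int ^ 'n::finite) = 1/2*(\<Sum>v | lat_norm v = 1. ent X (x - v) y)"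
proof -
 interpret b: bounded_linear "%A. ent A x y" by (rule ent_bounded_linear)
 have "ent (Sh v * X) x y = ent X (x - v) y" for v by (simp add: ent_def rep_apply_simps coord_Sh)
 hence "ent ((1/2) *\<^sub>R (\<Sum>v | lat_norm v = 1. Sh v * X)) x y = (1/2) *\<^sub>R (\<Sum>v | lat_norm v = 1. ent X (x - v) y)"
  by (simp only: b.scaleR b.sum)
 moreover have "Hop*X = (1/2) *\<^sub>R (\<Sum>v | lat_norm v = 1. Sh v * X)" by (simp only: H0_eq_shifts mult_scaleR_left sum_distrib_right)
 ultimately show ?thesis by (simp add: scaleR_conv_of_real[where 'a = complex])
qed

lemma ent_Hop: "ent Hop x (y :: int ^ 'n::finite) = (if lat_norm (x - y) = 1 then 1/2 else 0)"
proof -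
 have "ent Hop x y = 1/2*(\<Sum>v | lat_norm v = 1. ent 1 (x - v) y)" using ent_Hop_mult[of 1 x y] by simp
 also have "(\<Sum>v | lat_norm v = 1. ent 1 (x - v) y) = (\<Sum>v | lat_norm v = 1. if v = x - y then 1 else 0)"
  by (intro sum.cong refl) (auto simp: ent_simps)
 also have "... = (if lat_norm (x - y) = 1 then 1 else 0)" by (subst sum.delta[OF finite_lat_sphere]) simp
 finally show ?thesis by (cases "lat_norm (x - y) = 1") simp_all
qed

lemma lat_norm_minus: "lat_norm (- v) = lat_norm v"
proof -
 have "(lat_norm (- v))^2 = (lat_norm v)^2" unfolding lat_norm_square by simp
 thus ?thesis by (rule power2_eq_imp_eq) (simp_all add: lat_norm_def)
qed

lemma lat_norm_zero: "lat_norm 0 = 0"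
proof -
 have "(lat_norm (0 :: int ^ 'a))^2 = 0" unfolding lat_norm_square by simp
 thus ?thesis by simp
qed

lemma hH_zero: "hH 0 = 0" by (simp add: hH_def ent_Hop lat_norm_zero)

lemma ent_Hop_square_diag: "ent (Hop*Hop) x (x :: int ^ 'n::finite) = of_nat CARD('n)/2"
proof -
 have "(\<Sum>v | lat_norm v = 1. ent Hop (x - v) x) = (\<Sum>v \<in> {v :: int ^ 'n. lat_norm v = 1}. 1/2)"
  by (intro sum.cong refl) (simp add: ent_Hop lat_norm_minus)
 also have "... = of_nat CARD('n)" unfolding sum_unit_sphere by simp
 finally show ?thesis unfolding ent_Hop_mult by simp
qed

lemma hHH_zero: "hHH (0 :: int ^ 'n::finite) = of_nat CARD('n)/2" unfolding hHH_def by (rule ent_Hop_square_diag)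

lemma nu_Oz: "nu d \<in> Oz 1"
proof -
 have "(%z. (2 / of_nat d)*(z^1*(1/(1 + z^2)))) \<in> Oz 1"
  by (rule Oz_cmult[OF Oz_mult'[OF Oz_power Oz_continuous]]) (auto intro!: continuous_intros)
 moreover have "nu d = (%z. (2 / of_nat d)*(z^1*(1/(1 + z^2))))" by (intro ext) (simp add: nu_def)
 ultimately show ?thesis by simp
qed

lemma nu_power_Oz: "(%z. nu d z^k) \<in> Oz k" using landau_o.big_power[OF nu_Oz, of d k] by simp

lemma nu_cpower_Oz: "m <= k ==> (%z. c*nu d z^k) \<in> Oz m" by (rule Oz_mono[OF Oz_cmult[OF nu_power_Oz]])

lemma eventually_near_zero: "\<forall>\<^sub>F z in at (0::complex). cmod z <= 1/8"
proof -
 have "\<forall>\<^sub>F z in at 0. z \<in> ball (0::complex) (1/8)" by (rule eventually_at_in_open') auto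
 thus ?thesis by eventually_elim simp
qed

text \<open>All follows from z/(1 + z^2) = z - z^3 + z^5/(1 + z^2). The term - 2 z^4 in the square
  is the origin of the summand - 2 c 2 in the fourth coefficient.\<close>

lemma nu_squares:
 defines "a \<equiv> %d. 2 / of_nat d :: complex" shows "(%z. nu d z^2 - a d^2*(z^2 - 2*z^4)) \<in> Oz 5"
  "(%z. nu d z^3 - a d^3*z^3) \<in> Oz 5" "(%z. nu d z^4 - a d^4*z^4) \<in> Oz 5"
proof -
 have nz: "1 + z^2 ~= 0" if "cmod z <= 1/8" for z :: complex
 proof
  assume "1 + z^2 = 0"
  hence "z^2 = -1" by (simp add: eq_neg_iff_add_eq_0 add.commute)
  hence "(cmod z)^2 = 1" by (metis norm_minus_cancel norm_one norm_power)
  moreover have "(cmod z)^2 <= (1/8)^2" using that by (intro power_mono) auto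
  ultimately show False by (simp add: power2_eq_square)
 qed
 have "\<forall>\<^sub>F z in at 0. a d*(z^5*(1/(1 + z^2))) = nu d z - a d*(z - z^3)" using eventually_near_zero
 proof eventually_elim
  case (elim z)
  have "z^5 = z - (z - z^3)*(1 + z^2)" by algebra
  hence "z^5*(1/(1 + z^2)) = z/(1 + z^2) - (z - z^3)" using nz[OF elim] by (simp add: field_simps)
  thus ?case by (simp add: nu_def a_def right_diff_distrib)
 qed
 moreover have "(%z. a d*(z^5*(1/(1 + z^2)))) \<in> Oz 5" by (rule Oz_cmult[OF Oz_mult'[OF Oz_power Oz_continuous]]) (auto intro!: continuous_intros)
 ultimately have 5: "(%z. nu d z - a d*(z - z^3)) \<in> Oz 5" using landau_o.big.in_cong by fast
 have 1: "(%z. a d*z) \<in> Oz 1" using Oz_cmult[OF Oz_power[of 1]] by simp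
 have "(%z. (nu d z - a d*(z - z^3)) + (- a d)*z^3) \<in> Oz 3" by (intro Oz_add Oz_cmult Oz_power Oz_mono[OF 5]) auto
 hence 3: "(%z. nu d z - a d*z) \<in> Oz 3" by (simp add: algebra_simps)
 have 4: "(%z. nu d z*nu d z - a d*z*(a d*z)) \<in> Oz 4" by (rule Oz_mult_diff[OF 3 3 nu_Oz 1]) auto
 have 2: "(%z. nu d z*nu d z) \<in> Oz 2" "(%z. a d*z*(a d*z)) \<in> Oz 2" by (rule Oz_mult'[OF nu_Oz nu_Oz] Oz_mult'[OF 1 1]; simp)+
 have "(nu d z*nu d z - a d*(z - z^3)*(a d*(z - z^3))) + a d^2*z^6 = nu d z^2 - a d^2*(z^2 - 2*z^4)" for z by algebra
 moreover have "(%z. (nu d z*nu d z - a d*(z - z^3)*(a d*(z - z^3))) + a d^2*z^6) \<in> Oz 5"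
  by (intro Oz_add Oz_mult_diff[OF 5 5 nu_Oz Oz_approx[OF 5 nu_Oz]] Oz_cmult Oz_mono[OF Oz_power]) auto
 ultimately show "(%z. nu d z^2 - a d^2*(z^2 - 2*z^4)) \<in> Oz 5" by (simp only:)
 show "(%z. nu d z^3 - a d^3*z^3) \<in> Oz 5" using Oz_mult_diff[OF 3 4 2(1) 1, of 5] by (simp add: power3_eq_cube mult_ac)
 show "(%z. nu d z^4 - a d^4*z^4) \<in> Oz 5" using Oz_mult_diff[OF 4 4 2, of 5] by (simp add: power4_eq_xxxx mult_ac)
qed

lemma rho_Oz:
 assumes d: "3 <= CARD('n::finite)"
 shows "(%z. rho z n + (nu CARD('n) z*kd (n :: int ^ 'n) + nu CARD('n) z^2*hH n + nu CARD('n) z^3*hHH n)) \<in> Oz 4"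
proof (rule bigoI)
 show "\<forall>\<^sub>F z in at 0. norm (rho z n + (nu CARD('n) z*kd n + nu CARD('n) z^2*hH n + nu CARD('n) z^3*hHH n))
  <= (4*real CARD('n)^3)*norm (z^4)" using eventually_near_zero
 proof eventually_elim
  case (elim z)
  thus ?case using rho_expansion[OF d elim, of n] by (simp add: kd_def hH_def hHH_def norm_power)
 qed
qed

lemma rho_Oz_lower:
 assumes d: "3 <= CARD('n::finite)" shows "(%z. rho z n + (nu CARD('n) z*kd (n :: int ^ 'n) + nu CARD('n) z^2*hH n)) \<in> Oz 3"
  "(%z. rho z n + nu CARD('n) z*kd n) \<in> Oz 2" "(%z. rho z n) \<in> Oz 1"
proof -
 let ?nv = "nu CARD('n)"

 have e: "(%z. (rho z n + (?nv z*kd n + ?nv z^2*hH n + ?nv z^3*hHH n)) + (- hHH n)*?nv z^3) \<in> Oz 3"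
  by (rule Oz_add[OF Oz_mono[OF rho_Oz[OF d]] nu_cpower_Oz]) auto
 thus 3: "(%z. rho z n + (?nv z*kd n + ?nv z^2*hH n)) \<in> Oz 3" by (simp add: algebra_simps)
 have "(%z. (rho z n + (?nv z*kd n + ?nv z^2*hH n)) + (- hH n)*?nv z^2) \<in> Oz 2" by (rule Oz_add[OF Oz_mono[OF 3] nu_cpower_Oz]) auto
 thus 2: "(%z. rho z n + ?nv z*kd n) \<in> Oz 2" by (simp add: algebra_simps)
 have "(%z. (rho z n + ?nv z*kd n) + (- kd n)*?nv z^1) \<in> Oz 1" by (rule Oz_add[OF Oz_mono[OF 2] nu_cpower_Oz]) auto
 thus "(%z. rho z n) \<in> Oz 1" by (simp add: algebra_simps)
qed

text \<open>The terms of order \<nu>^3 carry \<open>kd\<close> at one point and \<open>hH\<close> at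
  the other; since both points vanish together and \<open>hH 0 = 0\<close>, they disappear.\<close>

lemma rho_product2:
 fixes m m' :: "int ^ 'n::finite"
 assumes d: "3 <= CARD('n)" and m: "m = 0 \<longleftrightarrow> m' = 0" shows "(%z. rho z m*rho z m' - (nu CARD('n) z^2*(kd m*kd m')
  + nu CARD('n) z^4*(kd m*hHH m' + hHH m*kd m' + hH m*hH m'))) \<in> Oz 5"
proof -
 let ?nv = "nu CARD('n)"
 define p where "p = (%n z. - (?nv z*kd (n :: int ^ 'n) + ?nv z^2*hH n + ?nv z^3*hHH n))"
 have diff: "(%z. rho z n - p n z) \<in> Oz 4" for n using rho_Oz[OF d, of n] unfolding p_def diff_minus_eq_add .
 have r1: "(%z. rho z m) \<in> Oz 1" for m :: "int ^ 'n" using rho_Oz_lower(3)[OF d] .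
 have z: "kd m*hH m' = 0" "hH m*kd m' = 0" using m by (auto simp: kd_def hH_zero)
 have "p m z*p m' z = ?nv z^2*(kd m*kd m') + ?nv z^3*(kd m*hH m' + hH m*kd m') + ?nv z^4*(kd m*hHH m' + hHH m*kd m' + hH m*hH m')
  + ((hH m*hHH m' + hHH m*hH m')*?nv z^5 + (hHH m*hHH m')*?nv z^6)" for z unfolding p_def by algebra
 hence e: "(%z. (rho z m*rho z m' - p m z*p m' z) + ((hH m*hHH m' + hHH m*hH m')*?nv z^5 + (hHH m*hHH m')*?nv z^6))
  = (%z. rho z m*rho z m' - (?nv z^2*(kd m*kd m') + ?nv z^4*(kd m*hHH m' + hHH m*kd m' + hH m*hH m')))" unfolding z by (simp add: algebra_simps)
 have "(%z. (rho z m*rho z m' - p m z*p m' z) + ((hH m*hHH m' + hHH m*hH m')*?nv z^5 + (hHH m*hHH m')*?nv z^6)) \<in> Oz 5"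
  by (intro Oz_add Oz_mult_diff[OF diff diff r1 Oz_approx[OF diff r1]] nu_cpower_Oz) auto
 thus ?thesis unfolding e .
qed

text \<open>At order \<nu>^4 two of the points are 0, hence so is the third, where \<open>hH\<close>
  vanishes. Thus the third trace has no contribution at order 4.\<close>

lemma rho_product3:
 fixes m1 m2 m3 :: "int ^ 'n::finite"
 assumes d: "3 <= CARD('n)" and m: "m1 + m2 + m3 = 0" shows "(%z. rho z m1*(rho z m2*rho z m3) + nu CARD('n) z^3*(kd m1*(kd m2*kd m3))) \<in> Oz 5"
proof -
 let ?nv = "nu CARD('n)"
 define p where "p = (%n z. - (?nv z*kd (n :: int ^ 'n) + ?nv z^2*hH n))"
 have diff: "(%z. rho z n - p n z) \<in> Oz 3" for n using rho_Oz_lower(1)[OF d, of n] unfolding p_def diff_minus_eq_add .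
 note r1 = rho_Oz_lower(3)[OF d]
 have p1: "p n \<in> Oz 1" for n by (rule Oz_approx[OF diff r1]) simp
 have z: "hH m1*(kd m2*kd m3) = 0" "kd m1*(hH m2*kd m3) = 0" "kd m1*(kd m2*hH m3) = 0" using m by (auto simp: kd_def hH_zero)
 let ?c = "%z. - (hH m1*hH m2*kd m3 + hH m1*kd m2*hH m3 + kd m1*hH m2*hH m3)*?nv z^5 + - (hH m1*hH m2*hH m3)*?nv z^6"
 have "p m1 z*(p m2 z*p m3 z) = - (?nv z^3*(kd m1*(kd m2*kd m3)))
  - ?nv z^4*(hH m1*(kd m2*kd m3) + kd m1*(hH m2*kd m3) + kd m1*(kd m2*hH m3)) + ?c z" for z unfolding p_def by algebra
 hence e: "(%z. (rho z m1*(rho z m2*rho z m3) - p m1 z*(p m2 z*p m3 z)) + ?c z) = (%z. rho z m1*(rho z m2*rho z m3) + ?nv z^3*(kd m1*(kd m2*kd m3)))"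
  unfolding z by simp
 have "(%z. rho z m2*rho z m3 - p m2 z*p m3 z) \<in> Oz 4" by (rule Oz_mult_diff[OF diff diff r1 p1]) auto
 from Oz_mult_diff[OF diff this Oz_mult[OF r1 r1] p1]
 have "(%z. (rho z m1*(rho z m2*rho z m3) - p m1 z*(p m2 z*p m3 z)) + ?c z) \<in> Oz 5" by (intro Oz_add nu_cpower_Oz) auto
 thus ?thesis unfolding e .
qed

lemma rho_product4:
 fixes m1 m2 m3 m4 :: "int ^ 'n::finite"
 assumes d: "3 <= CARD('n)" shows "(%z. rho z m1*(rho z m2*(rho z m3*rho z m4)) - nu CARD('n) z^4*(kd m1*(kd m2*(kd m3*kd m4)))) \<in> Oz 5"
proof -
 let ?nv = "nu CARD('n)"
 define p where "p = (%n z. - (?nv z*kd (n :: int ^ 'n)))"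
 have diff: "(%z. rho z n - p n z) \<in> Oz 2" for n using rho_Oz_lower(2)[OF d, of n] unfolding p_def diff_minus_eq_add .
 note r1 = rho_Oz_lower(3)[OF d]
 have p1: "p n \<in> Oz 1" for n by (rule Oz_approx[OF diff r1]) simp
 have "(%z. rho z m3*rho z m4 - p m3 z*p m4 z) \<in> Oz 3" by (rule Oz_mult_diff[OF diff diff r1 p1]) auto
 hence "(%z. rho z m2*(rho z m3*rho z m4) - p m2 z*(p m3 z*p m4 z)) \<in> Oz 4" by (rule Oz_mult_diff[OF diff _ Oz_mult[OF r1 r1] p1]) auto
 hence "(%z. rho z m1*(rho z m2*(rho z m3*rho z m4)) - p m1 z*(p m2 z*(p m3 z*p m4 z))) \<in> Oz 5"
  by (rule Oz_mult_diff[OF diff _ Oz_mult[OF r1 Oz_mult[OF r1 r1]] p1]) auto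
 moreover have "p m1 z*(p m2 z*(p m3 z*p m4 z)) = ?nv z^4*(kd m1*(kd m2*(kd m3*kd m4)))" for z unfolding p_def by algebra
 ultimately show ?thesis by simp
qed

definition pwS :: "('a => complex) => 'a set => nat => complex" where "pwS V F k = (\<Sum>x\<in>F. V x^k)"

definition nbS :: "(int ^ 'n::finite => complex) => (int ^ 'n) set => complex" where
 "nbS V F = (\<Sum>x\<in>F. \<Sum>y\<in>F. V x*V y*(hH (x - y)*hH (y - x)))"

lemma tr2_Oz:
 fixes V :: "int ^ 'n::finite => complex"
 assumes d: "3 <= CARD('n)" and F: "finite F" shows "(%z. tr2 F (%x y. V x*rho z (x - y)) - (nu CARD('n) z^2*pwS V F 2
  + nu CARD('n) z^4*(of_nat CARD('n)*pwS V F 2 + nbS V F))) \<in> Oz 5"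
proof -
 let ?nv = "nu CARD('n)"
 let ?e = "%z m m'. ?nv z^2*(kd m*kd m') + ?nv z^4*(kd m*hHH m' + hHH m*kd m' + hH m*hH (m' :: int ^ 'n))"
 have "(%z. \<Sum>x\<in>F. \<Sum>y\<in>F. (V x*V y)*(rho z (x - y)*rho z (y - x) - ?e z (x - y) (y - x))) \<in> Oz 5"
  by (intro Oz_sum Oz_cmult rho_product2[OF d]) auto
 moreover have "(\<Sum>x\<in>F. \<Sum>y\<in>F. (V x*V y)*(rho z (x - y)*rho z (y - x) - ?e z (x - y) (y - x)))
  = tr2 F (%x y. V x*rho z (x - y)) - (?nv z^2*pwS V F 2 + ?nv z^4*(of_nat CARD('n)*pwS V F 2 + nbS V F))" for z
 proof -
  have t: "V x*V y*?e z (x - y) (y - x) = (if x = y then ?nv z^2*V x^2 + ?nv z^4*(of_nat CARD('n)*V x^2) else 0)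
   + ?nv z^4*(V x*V y*(hH (x - y)*hH (y - x)))" for x y by (simp add: kd_def hHH_zero power2_eq_square algebra_simps)
  have "(\<Sum>x\<in>F. \<Sum>y\<in>F. V x*V y*?e z (x - y) (y - x)) = ?nv z^2*pwS V F 2 + ?nv z^4*(of_nat CARD('n)*pwS V F 2 + nbS V F)"
   unfolding t sum.distrib using F by (simp add: pwS_def nbS_def sum.distrib sum_distrib_left distrib_left)
  thus ?thesis by (simp add: tr2_def right_diff_distrib sum_subtractf mult_ac)
 qed
 ultimately show ?thesis by simp
qed

lemma tr3_Oz:
 fixes V :: "int ^ 'n::finite => complex"
 assumes d: "3 <= CARD('n)" and F: "finite F" shows "(%z. tr3 F (%x y. V x*rho z (x - y)) + nu CARD('n) z^3*pwS V F 3) \<in> Oz 5"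
proof -
 let ?nv = "nu CARD('n)"
 have "(%z. \<Sum>x\<in>F. \<Sum>y\<in>F. \<Sum>u\<in>F. (V x*V y*V u)*(rho z (x - y)*(rho z (y - u)*rho z (u - x))
   + ?nv z^3*(kd (x - y)*(kd (y - u)*kd (u - x))))) \<in> Oz 5" by (intro Oz_sum Oz_cmult rho_product3[OF d]) auto
 moreover have "(\<Sum>x\<in>F. \<Sum>y\<in>F. \<Sum>u\<in>F. (V x*V y*V u)*(rho z (x - y)*(rho z (y - u)*rho z (u - x))
   + ?nv z^3*(kd (x - y)*(kd (y - u)*kd (u - x))))) = tr3 F (%x y. V x*rho z (x - y)) + ?nv z^3*pwS V F 3" for z
 proof -
  have t: "V x*V y*V u*(?nv z^3*(kd (x - y)*(kd (y - u)*kd (u - x)))) = (if y = u then if x = y then ?nv z^3*V x^3 else 0 else 0)" for x y u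
   by (auto simp: kd_def power3_eq_cube)
  have "(\<Sum>x\<in>F. \<Sum>y\<in>F. \<Sum>u\<in>F. V x*V y*V u*(?nv z^3*(kd (x - y)*(kd (y - u)*kd (u - x))))) = ?nv z^3*pwS V F 3"
   unfolding t using F by (simp add: pwS_def sum_distrib_left)
  thus ?thesis by (simp add: tr3_def distrib_left sum.distrib mult_ac)
 qed
 ultimately show ?thesis by simp
qed

lemma tr4_Oz:
 fixes V :: "int ^ 'n::finite => complex"
 assumes d: "3 <= CARD('n)" and F: "finite F" shows "(%z. tr4 F (%x y. V x*rho z (x - y)) - nu CARD('n) z^4*pwS V F 4) \<in> Oz 5"
proof -
 let ?nv = "nu CARD('n)"
 have "(%z. \<Sum>x\<in>F. \<Sum>y\<in>F. \<Sum>u\<in>F. \<Sum>v\<in>F. (V x*V y*V u*V v)*(rho z (x - y)*(rho z (y - u)*(rho z (u - v)*rho z (v - x)))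
   - ?nv z^4*(kd (x - y)*(kd (y - u)*(kd (u - v)*kd (v - x)))))) \<in> Oz 5" by (intro Oz_sum Oz_cmult rho_product4[OF d])
 moreover have "(\<Sum>x\<in>F. \<Sum>y\<in>F. \<Sum>u\<in>F. \<Sum>v\<in>F. (V x*V y*V u*V v)*(rho z (x - y)*(rho z (y - u)*(rho z (u - v)*rho z (v - x)))
   - ?nv z^4*(kd (x - y)*(kd (y - u)*(kd (u - v)*kd (v - x)))))) = tr4 F (%x y. V x*rho z (x - y)) - ?nv z^4*pwS V F 4" for z
 proof -
  have t: "V x*V y*V u*V v * (?nv z^4*(kd (x - y)*(kd (y - u)*(kd (u - v)*kd (v - x)))))
    = (if u = v then if y = u then if x = y then ?nv z^4*V x^4 else 0 else 0 else 0)" for x y u v by (auto simp: kd_def eval_nat_numeral)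
  have "(\<Sum>x\<in>F. \<Sum>y\<in>F. \<Sum>u\<in>F. \<Sum>v\<in>F. V x*V y*V u*V v * (?nv z^4*(kd (x - y)*(kd (y - u)*(kd (u - v)*kd (v - x)))))) = ?nv z^4*pwS V F 4"
   unfolding t using F by (simp add: pwS_def sum_distrib_left)
  thus ?thesis by (simp add: tr4_def right_diff_distrib sum_subtractf mult_ac)
 qed
 ultimately show ?thesis by simp
qed

definition c2c :: "nat => complex => complex" where "c2c d s2 = (2 / of_nat d)^2/2 * s2"
definition c3c :: "nat => complex => complex" where "c3c d s3 = (2 / of_nat d)^3/3 * s3"
text \<open>The order \<nu>^4 collects s4/4 from the fourth trace and (d s2 + b)/2 from the second;
  - 2 \<open>c2c\<close> is the z^4 term of \<nu>^2.\<close>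

definition c4c :: "nat => complex => complex => complex => complex" where
 "c4c d s2 s4 b = (2 / of_nat d)^4/4*(s4 + 2*b + 2 * of_nat d * s2) - 2 * c2c d s2"

lemma QN_Oz:
 fixes V :: "int ^ 'n::finite => complex"
 assumes d: "3 <= CARD('n)" shows "(%z. QN V N z - (c2c CARD('n) (pwS V (zbox N) 2)*z^2 + c3c CARD('n) (pwS V (zbox N) 3)*z^3
  + c4c CARD('n) (pwS V (zbox N) 2) (pwS V (zbox N) 4) (nbS V (zbox N))*z^4)) \<in> Oz 5"
proof -
 let ?nv = "nu CARD('n)" and ?F = "zbox N :: (int ^ 'n) set" and ?a = "2 / of_nat CARD('n) :: complex"
 let ?k = "%z x y. V x*rho z (x - y)"
 let ?S2 = "pwS V ?F 2" and ?S3 = "pwS V ?F 3" and ?S4 = "pwS V ?F 4" and ?B = "nbS V ?F" and ?d = "of_nat CARD('n) :: complex"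
 have "(%z. (1/2)*(tr2 ?F (?k z) - (?nv z^2*?S2 + ?nv z^4*(?d*?S2 + ?B)))
   + (- (1/3))*(tr3 ?F (?k z) + ?nv z^3*?S3) + (1/4)*(tr4 ?F (?k z) - ?nv z^4*?S4)
   + ((?S2/2)*(?nv z^2 - ?a^2*(z^2 - 2*z^4)) + (?S3/3)*(?nv z^3 - ?a^3*z^3) + (?S4/4 + (?d*?S2 + ?B)/2)*(?nv z^4 - ?a^4*z^4))) \<in> Oz 5"
  by (rule Oz_add[OF Oz_add[OF Oz_add[OF Oz_cmult[OF tr2_Oz[OF d finite_zbox]] Oz_cmult[OF tr3_Oz[OF d finite_zbox]]]
    Oz_cmult[OF tr4_Oz[OF d finite_zbox]]] Oz_add[OF Oz_add[OF Oz_cmult[OF nu_squares(1)] Oz_cmult[OF nu_squares(2)]] Oz_cmult[OF nu_squares(3)]]])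
 moreover have "(1/2)*(tr2 ?F (?k z) - (?nv z^2*?S2 + ?nv z^4*(?d*?S2 + ?B)))
   + (- (1/3))*(tr3 ?F (?k z) + ?nv z^3*?S3) + (1/4)*(tr4 ?F (?k z) - ?nv z^4*?S4)
   + ((?S2/2)*(?nv z^2 - ?a^2*(z^2 - 2*z^4)) + (?S3/3)*(?nv z^3 - ?a^3*z^3) + (?S4/4 + (?d*?S2 + ?B)/2)*(?nv z^4 - ?a^4*z^4))
   = QN V N z - (c2c CARD('n) ?S2*z^2 + c3c CARD('n) ?S3*z^3 + c4c CARD('n) ?S2 ?S4 ?B*z^4)" for z
 proof -
  have gen: "(1/2)*(T2 - (n2*S2 + n4*(D*S2 + B))) + (- (1/3))*(T3 + n3*S3) + (1/4)*(T4 - n4*S4)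
   + ((S2/2)*(n2 - a2*(z2 - 2*z4)) + (S3/3)*(n3 - a3*z3) + (S4/4 + (D*S2 + B)/2)*(n4 - a4*z4))
   = (T2/2 - T3/3 + T4/4) - (a2/2*S2*z2 + a3/3*S3*z3 + (a4/4*(S4 + 2*B + 2*D*S2) - 2*(a2/2*S2))*z4)"
   for T2 T3 T4 n2 n3 n4 S2 S3 S4 D B a2 a3 a4 z2 z3 z4 :: complex by (simp add: field_simps)
  show ?thesis unfolding QN_def Let_def c4c_def c2c_def c3c_def by (rule gen)
 qed
 ultimately show ?thesis by simp
qed

lemma Oz_exp_diff:
 assumes f: "f \<in> Oz 0" and g: "g \<in> Oz 0" and fg: "(%z. f z - g z) \<in> Oz k" shows "(%z. exp (f z) - exp (g z)) \<in> Oz k"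
proof -
 obtain c1 where c1: "\<forall>\<^sub>F z in at 0. cmod (f z) <= c1" using f by (auto elim!: landau_o.bigE)
 obtain c2 where c2: "\<forall>\<^sub>F z in at 0. cmod (g z) <= c2" using g by (auto elim!: landau_o.bigE)
 have "(%z. exp (f z) - exp (g z)) \<in> O[at 0](%z. f z - g z)"
 proof (rule bigoI)
  show "\<forall>\<^sub>F z in at 0. norm (exp (f z) - exp (g z)) <= exp (max c1 c2)*norm (f z - g z)"
   using c1 c2 by eventually_elim (rule norm_exp_diff_algebra_le, auto)
 qed
 thus ?thesis using fg by (rule landau_o.big_trans)
qed

lemma Oz_exp: "f \<in> Oz 0 ==> (%z. exp (f z)) \<in> Oz 0" using Oz_add[OF Oz_exp_diff[of f "%_. 0" 0] Oz_const[of 1]] Oz_const[of 0] by simp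

definition Ppol :: "complex => complex => complex => complex => complex" where "Ppol a b c z = a*z^2 + b*z^3 + c*z^4"

lemma Ppol_Oz: "Ppol a b c \<in> Oz 0" unfolding Ppol_def[abs_def] by (rule Oz_continuous) (auto intro!: continuous_intros)

lemma DN_Oz:
 fixes V :: "int ^ 'n::finite => complex"
 assumes d: "3 <= CARD('n)" and b: "!!x. cmod (V x) <= M"
 defines "P \<equiv> %N. Ppol (c2c CARD('n) (pwS V (zbox N) 2)) (c3c CARD('n) (pwS V (zbox N) 3))
  (c4c CARD('n) (pwS V (zbox N) 2) (pwS V (zbox N) 4) (nbS V (zbox N)))" shows "(%z. DN V N z - exp (- P N z)) \<in> Oz 5"
proof -
 have QP: "(%z. QN V N z - P N z) \<in> Oz 5" using QN_Oz[OF d, of V N] by (simp add: P_def Ppol_def)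
 have P0: "P N \<in> Oz 0" unfolding P_def by (rule Ppol_Oz)
 have "(%z. (QN V N z - P N z) + P N z) \<in> Oz 0" by (rule Oz_add[OF Oz_mono[OF QP] P0]) simp
 hence Q0: "QN V N \<in> Oz 0" by simp
 have m: "(%z. - f z) \<in> Oz k" if "f \<in> Oz k" for f k using Oz_cmult[OF that, of "-1"] by simp
 have "(%z. (- QN V N z) - (- P N z)) \<in> Oz 5" using m[OF QP] by (simp add: algebra_simps)
 hence e: "(%z. exp (- QN V N z) - exp (- P N z)) \<in> Oz 5" by (rule Oz_exp_diff[OF m[OF Q0] m[OF P0]])
 have "(%z. (DN V N z*exp (QN V N z) - 1)*exp (- QN V N z) + (exp (- QN V N z) - exp (- P N z))) \<in> Oz 5"
  by (rule Oz_add[OF Oz_mult'[OF DN_QN_bigo[OF d b] Oz_exp[OF m[OF Q0]]] e]) simp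
 moreover have "(DN V N z*exp (QN V N z) - 1)*exp (- QN V N z) + (exp (- QN V N z) - exp (- P N z)) = DN V N z - exp (- P N z)" for z
 proof -
  have "exp (QN V N z)*exp (- QN V N z) = 1" by (simp add: exp_add[symmetric])
  thus ?thesis by (simp add: left_diff_distrib mult.assoc)
 qed
 ultimately show ?thesis by simp
qed

text \<open>Schwarz's lemma, iterated through \<open>blf_divide\<close> with w = 0. A local order of
  vanishing with unspecified constant becomes a bound on the whole disc whose constant is the
  supremum bound, and so is uniform in the box.\<close>

lemma holomorphic_Oz_bound:
 assumes "g holomorphic_on ball 0 1" "!!z. z \<in> ball 0 1 ==> cmod (g z) <= M" "g \<in> Oz k" "z \<in> ball 0 1" shows "cmod (g z) <= M * cmod z^k"
 using assms
proof (induction k arbitrary: g)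
 case 0
 thus ?case by simp
next
 case (Suc k)
 have "isCont g 0" using holomorphic_on_imp_continuous_on[OF Suc.prems(1)] by (simp add: continuous_on_eq_continuous_at)
 hence 1: "(g \<longlongrightarrow> g 0) (at 0)" by (simp add: isCont_def)
 obtain c where c: "\<forall>\<^sub>F z in at 0. cmod (g z) <= c * cmod (z^Suc k)" using Suc.prems(3) by (auto elim!: landau_o.bigE)
 have "((%z :: complex. c * cmod (z^Suc k)) \<longlongrightarrow> 0) (at 0)" by (auto intro!: tendsto_eq_intros)
 hence "(g \<longlongrightarrow> 0) (at 0)" by (rule Lim_null_comparison[OF c])
 hence "g 0 = 0" using 1 LIM_unique by blast
 then obtain h where h: "h holomorphic_on ball 0 1" "!!z. z \<in> ball 0 1 ==> cmod (h z) <= M" "!!z. z \<in> ball 0 1 ==> g z = blf 0 z*h z"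
  using blf_divide[OF Suc.prems(1,2), of 0] by auto
 have "h \<in> Oz k"
 proof (rule bigoI)
  have "\<forall>\<^sub>F z in at 0. z \<in> ball (0::complex) 1 - {0}" by (rule eventually_at_in_open) auto
  with c show "\<forall>\<^sub>F z in at 0. norm (h z) <= c*norm (z^k)"
  proof eventually_elim
   case (elim z)
   hence "cmod z * cmod (h z) <= c*(cmod z * cmod (z^k))" using h(3)[of z] by (simp add: blf_def norm_mult)
   hence "cmod z * cmod (h z) <= cmod z*(c * cmod (z^k))" by (simp add: mult_ac)
   moreover have "0 < cmod z" using elim by simp
   ultimately show ?case by (rule mult_left_le_imp_le)
  qed
 qed
 hence "cmod (h z) <= M * cmod z^k" using Suc.IH[of h] h(1,2) Suc.prems(4) by blast
 hence "cmod z * cmod (h z) <= cmod z*(M * cmod z^k)" by (intro mult_left_mono) auto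
 thus ?case using h(3)[OF Suc.prems(4)] by (simp add: blf_def norm_mult mult_ac)
qed

lemma norm_exp_Ppol_le:
 assumes "z \<in> ball 0 1" shows "cmod (exp (- Ppol a b c z)) <= exp (cmod a + cmod b + cmod c)"
proof -
 have "cmod (Ppol a b c z) <= cmod a * cmod z^2 + cmod b * cmod z^3 + cmod c * cmod z^4"
  unfolding Ppol_def by (intro norm_triangle_le add_mono) (simp_all add: norm_mult norm_power)
 also have "... <= cmod a*1 + cmod b*1 + cmod c*1" using assms by (intro add_mono mult_left_mono power_le_one) auto
 finally have "cmod (- Ppol a b c z) <= cmod a + cmod b + cmod c" by simp
 thus ?thesis by (meson norm_exp exp_le_cancel_iff order_trans)
qed

text \<open>The constant M bounds determinants and exponentials for all boxes, so |DN - exp| <= M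
  |z|^5 survives the limit. Interchanging the limit with Taylor coefficients is thereby
  avoided.\<close>

lemma modD_Oz:
 fixes V :: "int ^ 'n::finite => complex"
 assumes d: "3 <= CARD('n)" and V: "in_lp p V" and p: "1 <= p" "p <= 2" and kb: "ker_bound p (kmaj :: int ^ 'n => real) C"
  and lim: "(%N. pwS V (zbox N) 2) \<longlonglongrightarrow> s2" "(%N. pwS V (zbox N) 3) \<longlonglongrightarrow> s3"
   "(%N. pwS V (zbox N) 4) \<longlonglongrightarrow> s4" "(%N. nbS V (zbox N)) \<longlonglongrightarrow> b"
 shows "(%z. modD V z - exp (- Ppol (c2c CARD('n) s2) (c3c CARD('n) s3) (c4c CARD('n) s2 s4 b) z)) \<in> Oz 5"
proof -
 define a1 where "a1 = (%N. c2c CARD('n) (pwS V (zbox N) 2))"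
 define a2 where "a2 = (%N. c3c CARD('n) (pwS V (zbox N) 3))"
 define a3 where "a3 = (%N. c4c CARD('n) (pwS V (zbox N) 2) (pwS V (zbox N) 4) (nbS V (zbox N)))"
 have l1: "a1 \<longlonglongrightarrow> c2c CARD('n) s2" unfolding a1_def c2c_def by (intro tendsto_intros lim)
 have l2: "a2 \<longlonglongrightarrow> c3c CARD('n) s3" unfolding a2_def c3c_def by (intro tendsto_intros lim)
 have l3: "a3 \<longlonglongrightarrow> c4c CARD('n) s2 s4 b" unfolding a3_def c4c_def c2c_def by (intro tendsto_intros lim)
 have "(%N. cmod (a1 N) + cmod (a2 N) + cmod (a3 N)) \<longlonglongrightarrow> cmod (c2c CARD('n) s2) + cmod (c3c CARD('n) s3) + cmod (c4c CARD('n) s2 s4 b)"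
  by (intro tendsto_intros l1 l2 l3)
 hence "Bseq (%N. cmod (a1 N) + cmod (a2 N) + cmod (a3 N))" by (intro convergent_imp_Bseq convergentI)
 then obtain B where B: "!!N. cmod (a1 N) + cmod (a2 N) + cmod (a3 N) <= B" by (auto simp: Bseq_def abs_le_iff)
 define M where "M = exp (C^2*(lp_norm p V)^2/2) + exp B"
 have b1: "cmod (DN V N z - exp (- Ppol (a1 N) (a2 N) (a3 N) z)) <= M * cmod z^5" if z: "z \<in> ball 0 1" for N z
 proof (rule holomorphic_Oz_bound[OF _ _ _ z])
  show "(%z. DN V N z - exp (- Ppol (a1 N) (a2 N) (a3 N) z)) holomorphic_on ball 0 1"
   unfolding Ppol_def by (intro holomorphic_intros DN_holomorphic d)
  show "cmod (DN V N z - exp (- Ppol (a1 N) (a2 N) (a3 N) z)) <= M" if z: "z \<in> ball 0 1" for z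
  proof -
   have "cmod (exp (- Ppol (a1 N) (a2 N) (a3 N) z)) <= exp B" using norm_exp_Ppol_le[OF z] B[of N] by (meson exp_le_cancel_iff order_trans)
   moreover have "cmod (DN V N z) <= exp (C^2*(lp_norm p V)^2/2)" by (rule norm_DN_le[OF d V p z kb])
   moreover have "cmod (DN V N z - exp (- Ppol (a1 N) (a2 N) (a3 N) z)) <= cmod (DN V N z) + cmod (exp (- Ppol (a1 N) (a2 N) (a3 N) z))"
    by (rule norm_triangle_ineq4)
   ultimately show ?thesis unfolding M_def by linarith
  qed
  show "(%z. DN V N z - exp (- Ppol (a1 N) (a2 N) (a3 N) z)) \<in> Oz 5"
   unfolding a1_def a2_def a3_def by (rule DN_Oz[OF d norm_le_lp_norm[OF V p(1)]])
 qed
 have b2: "cmod (modD V z - exp (- Ppol (c2c CARD('n) s2) (c3c CARD('n) s3) (c4c CARD('n) s2 s4 b) z)) <= M * cmod z^5"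
  if z: "z \<in> ball 0 1" for z
 proof (rule tendsto_upperbound)
  show "(%N. cmod (DN V N z - exp (- Ppol (a1 N) (a2 N) (a3 N) z)))
    \<longlonglongrightarrow> cmod (modD V z - exp (- Ppol (c2c CARD('n) s2) (c3c CARD('n) s3) (c4c CARD('n) s2 s4 b) z))"
   unfolding Ppol_def by (intro tendsto_intros DN_tendsto[OF d V p z] l1 l2 l3)
 qed (use b1[OF z] in auto)
 have "\<forall>\<^sub>F z in at 0. z \<in> ball (0::complex) 1" by (rule eventually_at_in_open') auto
 hence "\<forall>\<^sub>F z in at 0. cmod (modD V z - exp (- Ppol (c2c CARD('n) s2) (c3c CARD('n) s3) (c4c CARD('n) s2 s4 b) z)) <= M * cmod (z^5)"
  by eventually_elim (use b2 in \<open>simp add: norm_power\<close>)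
 thus ?thesis by (rule bigoI)
qed

section \<open>From sums over boxes to traces over the lattice\<close>

lemma filterlim_zbox: "filterlim (zbox :: nat => (int ^ 'n::finite) set) (finite_subsets_at_top UNIV) sequentially"
 unfolding filterlim_finite_subsets_at_top
proof (intro allI impI)
 fix X :: "(int ^ 'n) set" assume "finite X \<and> X \<subseteq> UNIV"
 then obtain N0 where "!!N. N0 <= N ==> X \<subseteq> zbox N" using zbox_exhausts[of X] by blast
 thus "\<forall>\<^sub>F y in sequentially. finite (zbox y :: (int ^ 'n) set) \<and> X \<subseteq> zbox y \<and> zbox y \<subseteq> UNIV"
  by (auto simp: eventually_sequentially finite_zbox)
qed

lemma sum_zbox_tendsto: "f summable_on UNIV ==> (%N. \<Sum>x\<in>zbox N. f x) \<longlonglongrightarrow> infsum f UNIV"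
 using filterlim_compose[OF _ filterlim_zbox] has_sum_infsum unfolding has_sum_def by blast

lemma summable_square_in_lp:
 assumes "in_lp p V" "1 <= p" "p <= 2" shows "(%x. (cmod (V x))^2) summable_on UNIV"
proof -
 obtain S where "!!F. finite F ==> (\<Sum>x\<in>F. (cmod (V x))^2) <= S" using in_lp_imp_square_sums[OF assms] by blast
 thus ?thesis by (intro nonneg_bdd_above_summable_on) (auto intro!: bdd_aboveI[of _ S])
qed

lemma summable_power_in_lp:
 assumes V: "in_lp p V" "1 <= p" "p <= 2" and k: "2 <= k" shows "(%x. V x^k) summable_on UNIV"
proof (rule abs_summable_summable, rule summable_on_comparison_test)
 show "(%x. lp_norm p V^(k - 2)*(cmod (V x))^2) summable_on UNIV" by (rule summable_on_cmult_right[OF summable_square_in_lp[OF V]])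
 fix x
 have "norm (V x^k) = cmod (V x)^(k - 2)*(cmod (V x))^2" unfolding power_add[symmetric] norm_power le_add_diff_inverse2[OF k] ..
 also have "... <= lp_norm p V^(k - 2)*(cmod (V x))^2" by (intro mult_right_mono power_mono norm_le_lp_norm V) auto
 finally show "norm (V x^k) <= lp_norm p V^(k - 2)*(cmod (V x))^2" .
qed simp

text \<open>The diagonal entry of V H V H at x; the factor 1/4 comes from the two factors 1/2 in the
  Laplacian.\<close>

definition nbE :: "(int ^ 'n::finite => complex) => int ^ 'n => complex" where "nbE V x = 1/4*(V x*(\<Sum>v | lat_norm v = 1. V (x - v)))"

text \<open>A summable majorant for V x V (x - v), from a b <= a^2 + b^2, that also covers
  potentials truncated to a box.\<close>

definition nbM :: "(int ^ 'n::finite => complex) => int ^ 'n => real" where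
 "nbM V x = (\<Sum>v | lat_norm v = 1. ((cmod (V x))^2 + (cmod (V (x - v)))^2))"

lemma nbM_summable:
 fixes V :: "int ^ 'n::finite => complex"
 assumes V: "in_lp p V" "1 <= p" "p <= 2" shows "nbM V summable_on UNIV"
proof -
 note s = summable_square_in_lp[OF V]
 have "(%x. (cmod (V (x - v)))^2) summable_on UNIV" for v
 proof -
  have "bij_betw (%n. n - v) UNIV UNIV" by (rule bij_betwI[where g = "%n. n + v"]) auto
  from summable_on_reindex_bij_betw[OF this, of "%x. (cmod (V x))^2"] s show ?thesis by simp
 qed
 hence "((%x. \<Sum>v | lat_norm v = 1. ((cmod (V x))^2 + (cmod (V (x - v)))^2)) has_sum
  (\<Sum>v | lat_norm (v :: int ^ 'n) = 1. infsum (%x. (cmod (V x))^2 + (cmod (V (x - v)))^2) UNIV)) UNIV"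
  using s by (intro has_sum_finite_sum finite_lat_sphere has_sum_infsum summable_on_add) auto
 thus ?thesis unfolding nbM_def[abs_def] by (auto simp: summable_on_def)
qed

lemma nb_term_bound:
 fixes V :: "int ^ 'n::finite => complex"
 assumes "!!y. cmod (W y) <= cmod (V y)" shows "cmod (1/4*(V x*(\<Sum>v | lat_norm (v :: int ^ 'n) = 1. W (x - v)))) <= nbM V x"
proof -
 have "cmod (1/4*(V x*(\<Sum>v | lat_norm (v :: int ^ 'n) = 1. W (x - v)))) = cmod (\<Sum>v | lat_norm (v :: int ^ 'n) = 1. 1/4*(V x*W (x - v)))"
  by (simp add: sum_distrib_left)
 also have "... <= nbM V x" unfolding nbM_def
 proof (rule order_trans[OF norm_sum sum_mono])
  fix v :: "int ^ 'n"
  have "cmod (V x) * cmod (W (x - v)) <= cmod (V x) * cmod (V (x - v))" using assms by (intro mult_left_mono) auto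
  thus "cmod (1/4*(V x*W (x - v))) <= (cmod (V x))^2 + (cmod (V (x - v)))^2"
  proof -
   have "cmod (1/4*(V x*W (x - v))) = cmod (V x) * cmod (W (x - v))/4" by (simp add: norm_mult)
   moreover note \<open>cmod (V x) * cmod (W (x - v)) <= cmod (V x) * cmod (V (x - v))\<close>
   moreover have "2*(cmod (V x) * cmod (V (x - v))) <= (cmod (V x))^2 + (cmod (V (x - v)))^2"
    using sum_squares_bound[of "cmod (V x)" "cmod (V (x - v))"] by (simp only: mult.assoc)
   moreover have "0 <= (cmod (V x))^2 + (cmod (V (x - v)))^2" by simp
   ultimately show ?thesis by linarith
  qed
 qed
 finally show ?thesis .
qed

lemma nbE_summable:
 fixes V :: "int ^ 'n::finite => complex"
 assumes V: "in_lp p V" "1 <= p" "p <= 2" shows "nbE V summable_on UNIV"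
proof (rule abs_summable_summable, rule summable_on_comparison_test[OF nbM_summable[OF V]])
 show "norm (nbE V x) <= nbM V x" for x unfolding nbE_def by (rule nb_term_bound) simp
qed simp

lemma nbS_eq: "finite F ==> nbS V F = (\<Sum>x\<in>F. 1/4*(V x*(\<Sum>v | lat_norm v = 1. if x - v \<in> F then V (x - v) else 0)))"
 for V :: "int ^ 'n::finite => complex"
proof -
 assume F: "finite F"
 have "(\<Sum>y\<in>F. V x*V y*(hH (x - y)*hH (y - x))) = 1/4*(V x*(\<Sum>v | lat_norm v = 1. if x - v \<in> F then V (x - v) else 0))" for x
 proof -
  have h: "hH (x - y)*hH (y - x) = (if lat_norm (x - y) = 1 then 1/4 else 0)" for y using lat_norm_minus[of "x - y"] by (simp add: hH_def ent_Hop)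
  have "(\<Sum>y\<in>F. V x*V y*(hH (x - y)*hH (y - x))) = (\<Sum>y\<in>{y \<in> F. lat_norm (x - y) = 1}. 1/4*(V x*V y))"
   unfolding h using F by (simp add: sum.inter_filter[symmetric] if_distrib cong: if_cong)
  also have "... = (\<Sum>v\<in>{v. lat_norm v = 1 \<and> x - v \<in> F}. 1/4*(V x*V (x - v)))"
   by (rule sum.reindex_bij_witness[where i = "%v. x - v" and j = "%y. x - y"]) auto
  also have "... = (\<Sum>v | lat_norm v = 1. if x - v \<in> F then 1/4*(V x*V (x - v)) else 0)"
   using sum.inter_filter[OF finite_lat_sphere, of "%v. 1/4*(V x*V (x - v))" "%v. x - v \<in> F"] by simp
  also have "... = 1/4*(V x*(\<Sum>v | lat_norm v = 1. if x - v \<in> F then V (x - v) else 0))" unfolding sum_distrib_left by (intro sum.cong) auto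
  finally show ?thesis .
 qed
 thus ?thesis unfolding nbS_def by (simp only:)
qed

lemma nbS_tendsto:
 fixes V :: "int ^ 'n::finite => complex"
 assumes V: "in_lp p V" "1 <= p" "p <= 2" shows "(%N. nbS V (zbox N)) \<longlonglongrightarrow> infsum (nbE V) UNIV"
proof -
 define a where "a = (%N x. if x \<in> zbox N then 1/4*(V x*(\<Sum>v | lat_norm v = 1. if x - v \<in> zbox N then V (x - v) else 0)) else 0)"
 have "(%N. infsum (a N) UNIV) \<longlonglongrightarrow> infsum (nbE V) UNIV"
 proof (rule infsum_dominated_limit[OF nbM_summable[OF V]])
  show "cmod (a N x) <= nbM V x" for N x
  proof (cases "x \<in> zbox N")
   case True
   have "cmod (1/4*(V x*(\<Sum>v | lat_norm v = 1. (%y. if y \<in> zbox N then V y else 0) (x - v)))) <= nbM V x" by (rule nb_term_bound) auto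
   thus ?thesis using True by (simp add: a_def)
  qed (simp add: a_def nbM_def sum_nonneg)
  show "(%N. a N x) \<longlonglongrightarrow> nbE V x" for x
  proof (rule tendsto_eventually)
   have "finite (insert x ((%v. x - v) ` {v :: int ^ 'n. lat_norm v = 1}))" by (intro finite.insertI finite_imageI finite_lat_sphere)
   then obtain N0 where N0: "!!N. N0 <= N ==> insert x ((%v. x - v) ` {v :: int ^ 'n. lat_norm v = 1}) \<subseteq> zbox N"
    using zbox_exhausts by blast
   have "a N x = nbE V x" if "N0 <= N" for N
   proof -
    have "(\<Sum>v | lat_norm v = 1. if x - v \<in> zbox N then V (x - v) else 0) = (\<Sum>v | lat_norm v = 1. V (x - v))"
     using N0[OF that] by (intro sum.cong) auto
    thus ?thesis using N0[OF that] by (simp add: a_def nbE_def)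
   qed
   thus "\<forall>\<^sub>F N in sequentially. a N x = nbE V x" by (auto simp: eventually_sequentially)
  qed
 qed
 moreover have "infsum (a N) UNIV = nbS V (zbox N)" for N
 proof -
  have "infsum (a N) UNIV = infsum (a N) (zbox N)" by (rule infsum_cong_neutral) (auto simp: a_def)
  also have "... = nbS V (zbox N)" by (simp add: finite_zbox nbS_eq a_def)
  finally show ?thesis .
 qed
 ultimately show ?thesis by simp
qed

lemma op_trace_rep: "op_trace (rep A) = infsum (%x. ent A x x) UNIV" by (simp add: op_trace_def entry_rep)

lemma ent_mult_op_power:
 assumes b: "bounded (range V)" shows "ent (opa (mult_op V)^k*X) x y = V x^k*ent X x y"
 by (induction k) (simp_all add: mult.assoc ent_mult_op_mult[OF b])

lemma op_trace_mult_op_power: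
 assumes b: "bounded (range V)" shows "op_trace (op_pow (mult_op V) k) = infsum (%x. V x^k) UNIV"
proof -
 have "op_pow (mult_op V) k = rep (opa (mult_op V)^k)" by (simp add: rep_power)
 moreover have "ent (opa (mult_op V)^k) x x = V x^k" for x using ent_mult_op_power[OF b, of k 1 x x] by (simp add: ent_simps)
 ultimately show ?thesis by (simp add: op_trace_rep)
qed

lemma op_trace_fourth:
 fixes V :: "int ^ 'n::finite => complex"
 assumes V: "in_lp p V" "1 <= p" "p <= 2"
 defines "W \<equiv> mult_op V" and "L \<equiv> H0 :: (int ^ 'n) ell2_op"
 shows "op_trace (op_pow W 4 + 2 *\<^sub>R (W o\<^sub>L L o\<^sub>L W o\<^sub>L L) + 4 *\<^sub>R (op_pow W 2 o\<^sub>L op_pow L 2))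
  = infsum (%x. V x^4) UNIV + 2*infsum (nbE V) UNIV + 2 * of_nat CARD('n)*infsum (%x. V x^2) UNIV"
proof -
 have b: "bounded (range V)" using norm_le_lp_norm[OF V(1,2)] by (rule bounded_of_le)
 let ?W = "opa (mult_op V)"
 have r: "op_pow W 4 + 2 *\<^sub>R (W o\<^sub>L L o\<^sub>L W o\<^sub>L L) + 4 *\<^sub>R (op_pow W 2 o\<^sub>L op_pow L 2)
  = rep (?W^4*1 + 2 *\<^sub>R (?W*Hop*?W*Hop) + 4 *\<^sub>R (?W^2*(Hop^2)))" by (simp add: W_def L_def rep_simps rep_power)
 have e1: "ent (?W*Hop*?W*Hop) x x = nbE V x" for x
 proof -
  have "ent (?W*Hop*?W*Hop) x x = V x*(1/2*(\<Sum>v | lat_norm v = 1. V (x - v)*ent Hop (x - v) x))"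
   by (simp add: mult.assoc ent_mult_op_mult[OF b] ent_Hop_mult)
  also have "(\<Sum>v | lat_norm v = 1. V (x - v)*ent Hop (x - v) x) = (\<Sum>v | lat_norm v = 1. 1/2*V (x - v))"
   by (intro sum.cong refl) (simp add: ent_Hop lat_norm_minus)
  finally show ?thesis by (simp add: nbE_def sum_distrib_left)
 qed
 have e2: "ent (?W^2*(Hop^2)) x x = V x^2*(of_nat CARD('n)/2)" for x
  unfolding ent_mult_op_power[OF b] by (simp add: power2_eq_square[of Hop] ent_Hop_square_diag)
 have e3: "ent (?W^4*1) x x = V x^4" for x unfolding ent_mult_op_power[OF b] by (simp add: ent_simps)
 have "op_trace (rep (?W^4*1 + 2 *\<^sub>R (?W*Hop*?W*Hop) + 4 *\<^sub>R (?W^2*(Hop^2))))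
  = infsum (%x. V x^4 + 2*nbE V x + 2 * of_nat CARD('n)*V x^2) UNIV" unfolding op_trace_rep ent_simps(3,6) e1 e2 e3 by (simp add: mult_ac)
 also have "... = infsum (%x. V x^4) UNIV + 2*infsum (nbE V) UNIV + 2 * of_nat CARD('n)*infsum (%x. V x^2) UNIV"
 proof (rule infsumI)
  show "((%x. V x^4 + 2*nbE V x + 2 * of_nat CARD('n)*V x^2) has_sum
   infsum (%x. V x^4) UNIV + 2*infsum (nbE V) UNIV + 2 * of_nat CARD('n)*infsum (%x. V x^2) UNIV) UNIV"
   by (intro has_sum_add has_sum_cmult_right has_sum_infsum summable_power_in_lp[OF V] nbE_summable[OF V]) auto
 qed
 finally show ?thesis unfolding r .
qed

text \<open>Smallness of exp (et) - 1 determines \<open>et\<close> only modulo 2 pi i; the limit 0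
  selects the branch, near which exp w - 1 is comparable to w.\<close>

lemma Oz_log:
 assumes et: "(et \<longlongrightarrow> 0) (at 0)" and e: "(%z. exp (et z) - 1) \<in> Oz k" shows "et \<in> Oz k"
proof -
 have "((%w :: complex. (exp w - exp 0)/(w - 0)) \<longlongrightarrow> exp 0) (at 0)"
  using DERIV_exp[of "0 :: complex"] by (simp only: has_field_derivative_iff)
 hence "((%w :: complex. cmod ((exp w - 1)/w)) \<longlongrightarrow> 1) (at 0)" using tendsto_norm by fastforce
 hence "\<forall>\<^sub>F w in at (0::complex). 1/2 < cmod ((exp w - 1)/w)" by (rule order_tendstoD) simp
 then obtain de where de: "0 < de" "!!w :: complex. w ~= 0 ==> cmod w < de ==> 1/2 < cmod ((exp w - 1)/w)" by (auto simp: eventually_at dist_norm)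
 have le: "cmod w <= 2 * cmod (exp w - 1)" if "cmod w < de" for w :: complex
 proof (cases "w = 0")
  case False
  thus ?thesis using de(2)[OF False that] by (simp add: norm_divide field_simps)
 qed simp
 have "\<forall>\<^sub>F z in at 0. cmod (et z) < de" using tendstoD[OF et de(1)] by (simp add: dist_norm)
 hence "\<forall>\<^sub>F z in at 0. norm (et z) <= 2*norm (exp (et z) - 1)" by eventually_elim (rule le)
 hence "et \<in> O[at 0](%z. exp (et z) - 1)" by (rule bigoI)
 thus ?thesis using e by (rule landau_o.big_trans)
qed

text \<open>Cauchy's inequality on circles of radius s bounds the derivative by a multiple of s^(m -
  k), and s tends to 0.\<close>

lemma Oz_higher_deriv_zero:
 assumes h: "h holomorphic_on ball 0 r" and r: "0 < r" and O: "h \<in> Oz m" and h0: "h 0 = 0" and k: "k < m" shows "(deriv ^^ k) h 0 = 0"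
proof -
 obtain c where c: "\<forall>\<^sub>F z in at 0. cmod (h z) <= c * cmod (z^m)" "0 < c" using O by (auto elim!: landau_o.bigE)
 then obtain de where de: "0 < de" "!!z. z ~= 0 ==> cmod z < de ==> cmod (h z) <= c * cmod z^m" by (auto simp: eventually_at dist_norm norm_power)
 let ?D = "(deriv ^^ k) h 0"
 have le: "cmod ?D <= fact k * c * s^(m - k)" if s: "0 < s" "s < min r de" for s
 proof -
  have sub: "cball 0 s \<subseteq> ball (0::complex) r" using s by auto
  have "cmod ?D <= fact k*(c * s^m) / s^k"
  proof (rule Cauchy_inequality)
   show "h holomorphic_on ball 0 s" using holomorphic_on_subset[OF h] sub ball_subset_cball by blast
   show "continuous_on (cball 0 s) h" using holomorphic_on_imp_continuous_on[OF holomorphic_on_subset[OF h sub]] .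
   show "cmod (h x) <= c * s^m" if "cmod (0 - x) = s" for x using de(2)[of x] that s by auto
  qed (use s in auto)
  also have "... = fact k * c * s^(m - k)" using s k by (simp add: power_diff)
  finally show ?thesis .
 qed
 have "((%s. fact k * c * s^(m - k)) \<longlongrightarrow> fact k * c*0^(m - k)) (at_right 0)" by (intro tendsto_intros)
 moreover have "\<forall>\<^sub>F s in at_right 0. cmod ?D <= fact k * c * s^(m - k)"
  unfolding eventually_at_right_field using le r de(1) by (intro exI[of _ "min r de"]) auto
 ultimately have "cmod ?D <= fact k * c*0^(m - k)" by (rule tendsto_lowerbound) simp
 thus ?thesis using k by (simp add: zero_power)
qed

text \<open>A logarithm \<open>ps\<close> exists on the disc free of zeros. Then \<open>ps\<close> +
  P is of order z^5, so the coefficients of \<open>ps\<close> of order 2, 3, 4 are those of - P and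
  the lower ones vanish.\<close>

lemma log_taylor_series:
 assumes f: "f holomorphic_on ball 0 1" and r: "0 < r" "r <= 1" and nz: "!!z. z \<in> ball 0 r ==> f z ~= 0"
  and f0: "f 0 = 1" and O: "(%z. f z - exp (- Ppol a b c z)) \<in> Oz 5"
 shows "\<exists>ps cc. ps analytic_on ball 0 r \<and> ps 0 = 0 \<and> (\<forall>z\<in>ball 0 r. exp (ps z) = f z) \<and>
  (\<forall>z\<in>ball 0 r. (%k. - cc (k + 2)*z^(k + 2)) sums ps z) \<and> cc (2::nat) = a \<and> cc 3 = b \<and> cc 4 = c"
proof -
 have fr: "f holomorphic_on ball 0 r" by (rule holomorphic_on_subset[OF f]) (use r in auto)
 obtain g where g: "g holomorphic_on ball 0 r" "!!z. z \<in> ball 0 r ==> exp (g z) = f z"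
  by (rule holomorphic_logarithm_exists[OF convex_ball open_ball fr nz, of 0]) (use r in auto)
 define ps where "ps = (%z. g z - g 0)"
 have ps: "ps holomorphic_on ball 0 r" unfolding ps_def by (intro holomorphic_intros g)
 have "exp (g 0) = 1" using g(2)[of 0] r f0 by simp
 hence eps: "exp (ps z) = f z" if "z \<in> ball 0 r" for z using g(2)[OF that] by (simp add: ps_def exp_diff)
 have ps0: "ps 0 = 0" by (simp add: ps_def)
 define P where "P = Ppol a b c"
 define et where "et = (%z. ps z + P z)"
 have eth: "et holomorphic_on ball 0 r" unfolding et_def P_def Ppol_def by (intro holomorphic_intros ps)
 have et0: "et 0 = 0" by (simp add: et_def P_def Ppol_def ps0)
 have "isCont et 0" using holomorphic_on_imp_continuous_on[OF eth] r by (simp add: continuous_on_eq_continuous_at)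
 hence etl: "(et \<longlongrightarrow> 0) (at 0)" by (simp add: isCont_def et0)
 have "(%z. (f z - exp (- P z))*exp (P z)) \<in> Oz 5" unfolding P_def by (rule Oz_mult'[OF O Oz_exp[OF Ppol_Oz]]) simp
 moreover have "\<forall>\<^sub>F z in at 0. (f z - exp (- P z))*exp (P z) = exp (et z) - 1"
 proof -
  have "\<forall>\<^sub>F z in at 0. z \<in> ball (0::complex) r" by (rule eventually_at_in_open') (use r in auto)
  thus ?thesis
  proof eventually_elim
   case (elim z)
   have "exp (- P z)*exp (P z) = 1" by (simp add: exp_add[symmetric])
   thus ?case using eps[OF elim] by (simp add: et_def exp_add left_diff_distrib)
  qed
 qed
 ultimately have "(%z. exp (et z) - 1) \<in> Oz 5" using landau_o.big.in_cong by fast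
 hence etO: "et \<in> Oz 5" by (rule Oz_log[OF etl])
 define bb where "bb = (%k. (deriv ^^ k) et 0/fact k)"
 have bb0: "bb k = 0" if "k < 5" for k unfolding bb_def using Oz_higher_deriv_zero[OF eth r(1) etO et0 that] by simp
 define pp where "pp = (%k::nat. if k = 2 then a else if k = 3 then b else if k = 4 then c else 0)"
 have "(%k. - (pp (k + 2) - bb (k + 2))*z^(k + 2)) sums ps z" if z: "z \<in> ball 0 r" for z
 proof -
  have 1: "(%k. bb k*z^k) sums et z" using holomorphic_power_series[OF eth z] by (simp add: bb_def)
  have "(%k. pp k*z^k) sums (\<Sum>k\<in>{2, 3, 4}. pp k*z^k)" by (rule sums_finite) (auto simp: pp_def)
  hence "(%k. pp k*z^k) sums P z" by (simp add: pp_def P_def Ppol_def add.assoc)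
  from sums_diff[OF 1 this] have "(%k. - (pp k - bb k)*z^k) sums ps z" by (simp add: et_def algebra_simps)
  moreover have "(\<Sum>k<2. - (pp k - bb k)*z^k) = 0" using bb0[of 0] bb0[of 1] by (simp add: pp_def eval_nat_numeral)
  ultimately show ?thesis using sums_iff_shift[of "%k. - (pp k - bb k)*z^k" 2 "ps z"] by simp
 qed
 moreover have "pp 2 - bb 2 = a" "pp 3 - bb 3 = b" "pp 4 - bb 4 = c" using bb0 by (auto simp: pp_def)
 moreover have "ps analytic_on ball 0 r" using ps by (simp add: analytic_on_open)
 ultimately show ?thesis using ps0 eps by (intro exI[of _ ps] exI[of _ "%k. pp k - bb k"]) auto
qed

theorem theorem1p1:
  fixes V :: "int ^ 'n::finite \<Rightarrow> complex" and p :: real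
  assumes "CARD('n) \<ge> 3"
    and "1 \<le> p"
    and "CARD('n) = 3 \<Longrightarrow> p < 6/5"
    and "CARD('n) \<ge> 4 \<Longrightarrow> p < 4/3"
    and "in_lp p V"
  shows "modD V analytic_on ball 0 1 \<and>
    holder_up_to_boundary (modD V) \<and>
    Hinf_norm (modD V) \<le> ereal (exp ((Cstar p CARD('n))\<^sup>2 * (lp_norm p V)\<^sup>2 / 2)) \<and>
    (\<exists>(N::enat) (\<zeta>::nat \<Rightarrow> complex) (r0::real).
      zeros_in_disc (modD V) N \<zeta> \<and>
      0 < r0 \<and>
      (if N = 0 then r0 = 1 else r0 = (INF j\<in>indices N. cmod (\<zeta> j)) \<and> r0 = cmod (\<zeta> 1)) \<and>
      (\<forall>i\<in>indices N. \<forall>j\<in>indices N. i \<le> j \<longrightarrow> cmod (\<zeta> i) \<le> cmod (\<zeta> j)) \<and>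
      (\<lambda>j. (1 - cmod (\<zeta> j)) + \<bar>Im (joukowski CARD('n) (\<zeta> j))\<bar>
           + \<bar>Re (varkappa CARD('n) (joukowski CARD('n) (\<zeta> j)))\<bar>) summable_on indices N \<and>
      (\<exists>(\<psi>::complex \<Rightarrow> complex) (c::nat \<Rightarrow> complex).
        let a = 2 / complex_of_nat CARD('n); W = mult_op V; L = (H0 :: (int ^ 'n) ell2_op) in
        \<psi> analytic_on ball 0 r0 \<and> \<psi> 0 = 0 \<and> (\<forall>z\<in>ball 0 r0. exp (\<psi> z) = modD V z) \<and>
        (\<forall>z\<in>ball 0 r0. (\<lambda>k. - c (k + 2) * z ^ (k + 2)) sums \<psi> z) \<and>
        c 2 = a ^ 2 / 2 * op_trace (op_pow W 2) \<and>
        c 3 = a ^ 3 / 3 * op_trace (op_pow W 3) \<and>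
        c 4 = a ^ 4 / 4 * op_trace (op_pow W 4 + 2 *\<^sub>R (W o\<^sub>L L o\<^sub>L W o\<^sub>L L)
                                    + 4 *\<^sub>R (op_pow W 2 o\<^sub>L op_pow L 2))
              - 2 * c 2))"
proof -
 note d = assms(1) and p1 = assms(2) and V = assms(5)
 \<comment> \<open>The common requirement of Young's inequality and of the inclusion of l^p in
   l^2.\<close>
 have p2: "p <= 2" using assms(1,3,4) by (cases "CARD('n) = 3") auto
 note kb = ker_bound_kmaj[OF assms(1-4)]
 note hol = modD_holomorphic[OF d V p1 p2 kb]
 note bd = norm_modD_le[OF d V p1 p2 _ kb]
 have m0: "modD V 0 = 1" by (simp add: modD_def)
 have ho: "holder_up_to_boundary (modD V)"
 proof -
  obtain al c where al: "0 < al" "al <= 1" "0 <= c" "!!z w. z \<in> ball 0 1 ==> w \<in> ball 0 1 ==>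
    ker_bound p (%n :: int ^ 'n. cmod (rho z n - rho w n)) (c * cmod (z - w) powr al)"
   using ker_bound_rho_diff[OF d p1 kmaj_smaller_exponent[OF d _ assms(3,4)]] by blast
  show ?thesis by (rule holder_up_to_boundaryI[OF modD_hoelder_interior[OF d V p1 p2 kb al(4)] al(1,2)])
 qed
 have H: "Hinf_norm (modD V) <= ereal (exp ((Cstar p CARD('n))^2*(lp_norm p V)^2/2))" unfolding Hinf_norm_def by (rule SUP_least) (simp add: bd)
 have an: "modD V analytic_on ball 0 1" using hol by (simp add: analytic_on_open)
 obtain N :: enat and ze r0 where Z: "zeros_in_disc (modD V) N ze" "0 < r0"
   "if N = 0 then r0 = 1 else r0 = (INF j\<in>indices N. cmod (ze j)) \<and> r0 = cmod (ze 1)"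
   "\<forall>i\<in>indices N. \<forall>j\<in>indices N. i <= j --> cmod (ze i) <= cmod (ze j)"
   "(%j. (1 - cmod (ze j)) + \<bar>Im (joukowski CARD('n) (ze j))\<bar>
     + \<bar>Re (varkappa CARD('n) (joukowski CARD('n) (ze j)))\<bar>) summable_on indices N" "r0 <= 1" "\<forall>z\<in>ball 0 r0. modD V z ~= 0"
  using zeros_with_estimates[OF hol bd m0, of "CARD('n)"] by auto
 let ?S = "%k. infsum (%x. V x^k) UNIV" and ?B = "infsum (nbE V) UNIV"
 have pw: "(%N. pwS V (zbox N) k) \<longlonglongrightarrow> ?S k" if "2 <= k" for k
  unfolding pwS_def by (rule sum_zbox_tendsto[OF summable_power_in_lp[OF V p1 p2 that]])
 have O: "(%z. modD V z - exp (- Ppol (c2c CARD('n) (?S 2)) (c3c CARD('n) (?S 3)) (c4c CARD('n) (?S 2) (?S 4) ?B) z)) \<in> Oz 5"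
  by (rule modD_Oz[OF d V p1 p2 kb pw pw pw nbS_tendsto[OF V p1 p2]]) auto
 obtain ps cc where ps: "ps analytic_on ball 0 r0" "ps 0 = 0" "\<forall>z\<in>ball 0 r0. exp (ps z) = modD V z"
  "\<forall>z\<in>ball 0 r0. (%k. - cc (k + 2)*z^(k + 2)) sums ps z"
  "cc (2::nat) = c2c CARD('n) (?S 2)" "cc 3 = c3c CARD('n) (?S 3)" "cc 4 = c4c CARD('n) (?S 2) (?S 4) ?B"
  using log_taylor_series[OF hol Z(2,6) _ m0 O] Z(7) by blast
 have b: "bounded (range V)" using norm_le_lp_norm[OF V p1] by (rule bounded_of_le)
 show ?thesis unfolding Let_def op_trace_fourth[OF V p1 p2] op_trace_mult_op_power[OF b]
 proof (intro conjI an ho H, rule exI[of _ N], rule exI[of _ ze], rule exI[of _ r0], intro conjI Z(1-5),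
   rule exI[of _ ps], rule exI[of _ cc], intro conjI ps(1-4))
  show "cc 2 = (2 / complex_of_nat CARD('n))^2/2*?S 2" by (simp only: ps(5) c2c_def)
  show "cc 3 = (2 / complex_of_nat CARD('n))^3/3*?S 3" by (simp only: ps(6) c3c_def)
  show "cc 4 = (2 / complex_of_nat CARD('n))^4/4*(?S 4 + 2*?B + 2 * complex_of_nat CARD('n)*?S 2) - 2 * cc 2" by (simp only: ps(5,7) c4c_def)
 qed
qed

end
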